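(* Let $\widetilde{M}$ be a complete, $n$-dimensional ($n\geq 2$), simply connected, nonpositively curved visibility manifold whose Ricci curvature satisfies $\mathrm{Ric}\geq -(n-1)$. Let $\Gamma_{0}$ be a finitely generated group acting freely and properly discontinuously by isometries on $\widetilde{M}$. Assume that there exists a point $\eta \in \widetilde{M}(\infty)$ such that $\mathrm{Fix}(\varphi)=\{\eta\}$ for every $\varphi \in \Gamma_{0} \setminus \{e\}$. Then the algebraic entropy of $\Gamma_{0}$ vanishes.
   Context: Nonpositively curved means sectional curvature $\le 0$. The geometric boundary $\widetilde M(\infty)$ is the set of geodesic rays in $\widetilde M$ (parametrized by arc length) modulo the relation $\gamma_1\sim\gamma_2$ iff $d(\gamma_1(t),\gamma_2(t))$ is bounded for $t\ge0$; isometries of $\widetilde M$ act on $\widetilde M(\infty)$. $\widetilde M$ is a visibility manifold if for any two distinct $\xi,\eta\in\widetilde M(\infty)$ there is a geodesic line $\gamma:\mathbb{R}\to\widetilde M$ with $\gamma(-\infty)=\xi$ and $\gamma(\infty)=\eta$. For an isometry $\varphi$, $\mathrm{Fix}(\varphi)=\{\zeta\in\widetilde M(\infty):\varphi(\zeta)=\zeta\}$. For a group $\Gamma$ with finite symmetric generating set $S$ (closed under inverses), $|\varphi|_w$ is the length of a shortest word over $S$ representing $\varphi$, $B_w(k)=\{\varphi\in\Gamma:|\varphi|_w\le k\}$, and the algebraic entropy with respect to $S$ is $h(\Gamma,S)=\lim_{k\to\infty}\frac{\log(\#B_w(k))}{k}$. If $h(\Gamma,S)=0$ for one finite symmetric generating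 set then this holds for every one; in this case one says the algebraic entropy of $\Gamma$ vanishes, $h(\Gamma)=0$. *)

theory Defs
  imports
    "HOL-Analysis.Analysis"
    "HOL-Algebra.Group_Action"
    "HOL-Algebra.Generated_Groups"
begin

section \<open>Smooth manifolds modelled on \<open>real ^ 'n\<close>\<close>

definition partial_deriv ::
  "'n \<Rightarrow> (real ^ 'n \<Rightarrow> 'b::real_normed_vector) \<Rightarrow> real ^ 'n::finite \<Rightarrow> 'b"
  where "partial_deriv i f x = frechet_derivative f (at x) (axis i 1)"

text \<open>Only meaningful for open \<open>S\<close>, which is the only way it is used below.\<close>

primrec Ck_on ::
  "nat \<Rightarrow> (real ^ 'n) set \<Rightarrow> (real ^ 'n::finite \<Rightarrow> 'b::real_normed_vector) \<Rightarrow> bool"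
  where
    "Ck_on 0 S f \<longleftrightarrow> continuous_on S f"
  | "Ck_on (Suc k) S f \<longleftrightarrow> f differentiable_on S \<and> (\<forall>i. Ck_on k S (partial_deriv i f))"

definition smooth_on ::
  "(real ^ 'n) set \<Rightarrow> (real ^ 'n::finite \<Rightarrow> 'b::real_normed_vector) \<Rightarrow> bool"
  where "smooth_on S f \<longleftrightarrow> (\<forall>k. Ck_on k S f)"

text \<open>A chart is a pair of its domain \<open>U\<close> and its coordinate map; values of the coordinate
  map outside \<open>U\<close> are irrelevant.\<close>

type_synonym ('m, 'n) chart = "'m set \<times> ('m \<Rightarrow> real ^ 'n)"

definition coord_rep ::
  "('m, 'n) chart \<Rightarrow> ('m, 'n) chart \<Rightarrow> ('m \<Rightarrow> 'm) \<Rightarrow> real ^ 'n \<Rightarrow> real ^ 'n"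
  where "coord_rep c d f = snd d \<circ> f \<circ> inv_into (fst c) (snd c)"

definition smooth_map ::
  "('m::topological_space, 'n::finite) chart set \<Rightarrow> ('m \<Rightarrow> 'm) \<Rightarrow> bool"
  where "smooth_map A f \<longleftrightarrow> continuous_on UNIV f \<and>
    (\<forall>c\<in>A. \<forall>d\<in>A. smooth_on (snd c ` (fst c \<inter> f -` fst d)) (coord_rep c d f))"

text \<open>The manifold is the whole type \<open>'m\<close> (Hausdorff and second countable by its type class).
  Smoothness of the identity map is smoothness of all transition maps.  The atlas need not be
  maximal.\<close>

definition smooth_atlas ::
  "('m::{t2_space,second_countable_topology}, 'n::finite) chart set \<Rightarrow> bool"
  where "smooth_atlas A \<longleftrightarrow>
    (\<forall>c\<in>A. open (fst c) \<and> open (snd c ` fst c) \<and>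
       homeomorphism (fst c) (snd c ` fst c) (snd c) (inv_into (fst c) (snd c))) \<and>
    (\<Union>c\<in>A. fst c) = UNIV \<and>
    smooth_map A id"

section \<open>Riemannian metrics\<close>

text \<open>A metric tensor is given by its coefficient matrices: \<open>g c x\<close> is the matrix \<open>(g\<^sub>i\<^sub>j)\<close> in the
  chart \<open>c\<close> at the point with coordinates \<open>x\<close>.\<close>

type_synonym ('m, 'n) metric_coeffs = "('m, 'n) chart \<Rightarrow> real ^ 'n \<Rightarrow> real ^ 'n ^ 'n"

definition preserves_metric ::
  "('m, 'n::finite) chart set \<Rightarrow> ('m, 'n) metric_coeffs \<Rightarrow> ('m \<Rightarrow> 'm) \<Rightarrow> bool"
  where "preserves_metric A g f \<longleftrightarrow>
    (\<forall>c\<in>A. \<forall>d\<in>A. \<forall>p. p \<in> fst c \<and> f p \<in> fst d \<longrightarrow>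
      (\<forall>u v. let J = frechet_derivative (coord_rep c d f) (at (snd c p)) in
         u \<bullet> (g c (snd c p) *v v) = J u \<bullet> (g d (snd d (f p)) *v J v)))"

text \<open>For the identity map, the condition \<^const>\<open>preserves_metric\<close> is the transformation law of a
  covariant 2-tensor under change of charts.\<close>

definition riemannian_metric ::
  "('m, 'n::finite) chart set \<Rightarrow> ('m, 'n) metric_coeffs \<Rightarrow> bool"
  where "riemannian_metric A g \<longleftrightarrow>
    (\<forall>c\<in>A. smooth_on (snd c ` fst c) (g c) \<and>
       (\<forall>x \<in> snd c ` fst c. transpose (g c x) = g c x \<and> (\<forall>v. v \<noteq> 0 \<longrightarrow> v \<bullet> (g c x *v v) > 0))) \<and>
    preserves_metric A g id"

definition riemannian_isometry ::
  "('m::topological_space, 'n::finite) chart set \<Rightarrow> ('m, 'n) metric_coeffs \<Rightarrow> ('m \<Rightarrow> 'm) \<Rightarrow> bool"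
  where "riemannian_isometry A g f \<longleftrightarrow>
    bij f \<and> smooth_map A f \<and> smooth_map A (inv_into UNIV f) \<and> preserves_metric A g f"

section \<open>Riemannian distance\<close>

definition C1_curve_on ::
  "('m::topological_space, 'n::finite) chart set \<Rightarrow> real set \<Rightarrow> (real \<Rightarrow> 'm) \<Rightarrow> bool"
  where "C1_curve_on A I \<gamma> \<longleftrightarrow> continuous_on I \<gamma> \<and>
    (\<forall>c\<in>A. \<exists>v. continuous_on {t \<in> I. \<gamma> t \<in> fst c} v \<and>
       (\<forall>t\<in>I. \<gamma> t \<in> fst c \<longrightarrow> ((snd c \<circ> \<gamma>) has_vector_derivative v t) (at t within I)))"

text \<open>Being \<open>C\<^sup>1\<close> on the closed pieces (one-sided derivatives at the break points included)
  keeps the speed bounded, so that the integral in \<open>curve_length\<close> below is never the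
  default value of a non-integrable function.\<close>

definition piecewise_C1_curve ::
  "('m::topological_space, 'n::finite) chart set \<Rightarrow> (real \<Rightarrow> 'm) \<Rightarrow> bool"
  where "piecewise_C1_curve A \<gamma> \<longleftrightarrow> path \<gamma> \<and>
    (\<exists>P. finite P \<and>
       (\<forall>a b. 0 \<le> a \<and> a < b \<and> b \<le> 1 \<and> {a<..<b} \<inter> P = {} \<longrightarrow> C1_curve_on A {a..b} \<gamma>))"

text \<open>The speed is computed in an arbitrarily chosen chart around the point; it does not depend
  on the choice.\<close>

definition speed ::
  "('m, 'n::finite) chart set \<Rightarrow> ('m, 'n) metric_coeffs \<Rightarrow> (real \<Rightarrow> 'm) \<Rightarrow> real \<Rightarrow> real"
  where "speed A g \<gamma> t =
    (let c = (SOME c. c \<in> A \<and> \<gamma> t \<in> fst c);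
         v = vector_derivative (snd c \<circ> \<gamma>) (at t)
     in sqrt (v \<bullet> (g c (snd c (\<gamma> t)) *v v)))"

definition curve_length ::
  "('m, 'n::finite) chart set \<Rightarrow> ('m, 'n) metric_coeffs \<Rightarrow> (real \<Rightarrow> 'm) \<Rightarrow> real"
  where "curve_length A g \<gamma> = integral {0..1} (speed A g \<gamma>)"

definition rdist ::
  "('m::topological_space, 'n::finite) chart set \<Rightarrow> ('m, 'n) metric_coeffs \<Rightarrow> 'm \<Rightarrow> 'm \<Rightarrow> real"
  where "rdist A g p q =
    Inf {curve_length A g \<gamma> | \<gamma>. piecewise_C1_curve A \<gamma> \<and> pathstart \<gamma> = p \<and> pathfinish \<gamma> = q}"

definition complete_riemannian ::
  "('m::topological_space, 'n::finite) chart set \<Rightarrow> ('m, 'n) metric_coeffs \<Rightarrow> bool"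
  where "complete_riemannian A g \<longleftrightarrow> Metric_space.mcomplete UNIV (rdist A g)"

section \<open>Curvature\<close>

text \<open>In this section \<open>G\<close> is the metric in one chart, as a function of the coordinates.
  \<open>christoffel G k i j x\<close> is \<open>\<Gamma>\<^sup>k\<^sub>i\<^sub>j(x)\<close>.\<close>

definition christoffel ::
  "(real ^ 'n \<Rightarrow> real ^ 'n ^ 'n) \<Rightarrow> 'n \<Rightarrow> 'n \<Rightarrow> 'n \<Rightarrow> real ^ 'n::finite \<Rightarrow> real"
  where "christoffel G k i j x =
    (1 / 2) * (\<Sum>l\<in>UNIV. matrix_inv (G x) $ k $ l *
      (partial_deriv i (\<lambda>y. G y $ j $ l) x + partial_deriv j (\<lambda>y. G y $ i $ l) x
        - partial_deriv l (\<lambda>y. G y $ i $ j) x))"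

text \<open>\<open>riem_coeff G l i j k x\<close> is the \<open>l\<close>-th coordinate of \<open>R(\<partial>\<^sub>i, \<partial>\<^sub>j) \<partial>\<^sub>k\<close>, with the sign convention
  \<open>R(X, Y) Z = \<nabla>\<^sub>X \<nabla>\<^sub>Y Z - \<nabla>\<^sub>Y \<nabla>\<^sub>X Z - \<nabla>\<^bsub>[X,Y]\<^esub> Z\<close>.\<close>

definition riem_coeff ::
  "(real ^ 'n \<Rightarrow> real ^ 'n ^ 'n) \<Rightarrow> 'n \<Rightarrow> 'n \<Rightarrow> 'n \<Rightarrow> 'n \<Rightarrow> real ^ 'n::finite \<Rightarrow> real"
  where "riem_coeff G l i j k x =
    partial_deriv i (christoffel G l j k) x - partial_deriv j (christoffel G l i k) x
    + (\<Sum>m\<in>UNIV. christoffel G m j k x * christoffel G l i m x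
                - christoffel G m i k x * christoffel G l j m x)"

definition curvature ::
  "(real ^ 'n \<Rightarrow> real ^ 'n ^ 'n) \<Rightarrow> real ^ 'n \<Rightarrow> real ^ 'n \<Rightarrow> real ^ 'n \<Rightarrow> real ^ 'n \<Rightarrow> real ^ 'n::finite"
  where "curvature G x u v w =
    (\<chi> l. \<Sum>i\<in>UNIV. \<Sum>j\<in>UNIV. \<Sum>k\<in>UNIV. riem_coeff G l i j k x * u $ i * v $ j * w $ k)"

definition sectional_curvature ::
  "(real ^ 'n \<Rightarrow> real ^ 'n ^ 'n) \<Rightarrow> real ^ 'n \<Rightarrow> real ^ 'n \<Rightarrow> real ^ 'n::finite \<Rightarrow> real"
  where "sectional_curvature G x u v =
    (curvature G x u v v \<bullet> (G x *v u)) /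
    ((u \<bullet> (G x *v u)) * (v \<bullet> (G x *v v)) - (u \<bullet> (G x *v v))\<^sup>2)"

text \<open>The trace of \<open>u \<mapsto> R(u, v) w\<close>.\<close>

definition ricci ::
  "(real ^ 'n \<Rightarrow> real ^ 'n ^ 'n) \<Rightarrow> real ^ 'n \<Rightarrow> real ^ 'n \<Rightarrow> real ^ 'n::finite \<Rightarrow> real"
  where "ricci G x v w = (\<Sum>i\<in>UNIV. curvature G x (axis i 1) v w $ i)"

definition nonpositively_curved ::
  "('m, 'n::finite) chart set \<Rightarrow> ('m, 'n) metric_coeffs \<Rightarrow> bool"
  where "nonpositively_curved A g \<longleftrightarrow>
    (\<forall>c\<in>A. \<forall>x \<in> snd c ` fst c. \<forall>u v. u \<noteq> v \<and> independent {u, v} \<longrightarrow>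
       sectional_curvature (g c) x u v \<le> 0)"

definition ricci_bounded_below ::
  "('m, 'n::finite) chart set \<Rightarrow> ('m, 'n) metric_coeffs \<Rightarrow> real \<Rightarrow> bool"
  where "ricci_bounded_below A g \<kappa> \<longleftrightarrow>
    (\<forall>c\<in>A. \<forall>x \<in> snd c ` fst c. \<forall>v. ricci (g c) x v v \<ge> \<kappa> * (v \<bullet> (g c x *v v)))"

section \<open>Geodesics and the geometric boundary\<close>

text \<open>Unit speed solutions of the geodesic equation on \<open>I\<close>; \<open>v\<close> is the velocity in the chart \<open>c\<close>.\<close>

definition unit_geodesic_on ::
  "('m::topological_space, 'n::finite) chart set \<Rightarrow> ('m, 'n) metric_coeffs \<Rightarrow> real set
    \<Rightarrow> (real \<Rightarrow> 'm) \<Rightarrow> bool"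
  where "unit_geodesic_on A g I \<gamma> \<longleftrightarrow> continuous_on I \<gamma> \<and>
    (\<forall>c\<in>A. \<exists>v. \<forall>t\<in>I. \<gamma> t \<in> fst c \<longrightarrow>
       ((snd c \<circ> \<gamma>) has_vector_derivative v t) (at t within I) \<and>
       (v has_vector_derivative
          (\<chi> k. - (\<Sum>i\<in>UNIV. \<Sum>j\<in>UNIV. christoffel (g c) k i j (snd c (\<gamma> t)) * v t $ i * v t $ j)))
         (at t within I) \<and>
       v t \<bullet> (g c (snd c (\<gamma> t)) *v v t) = 1)"

abbreviation geodesic_ray where
  "geodesic_ray A g \<equiv> unit_geodesic_on A g {0..}"

abbreviation geodesic_line where
  "geodesic_line A g \<equiv> unit_geodesic_on A g UNIV"

text \<open>A ray is a function on all of \<open>real\<close> of which only the restriction to \<open>{0..}\<close> matters: rays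
  agreeing there are identified by this relation.\<close>

definition asymptotic ::
  "('m::topological_space, 'n::finite) chart set \<Rightarrow> ('m, 'n) metric_coeffs
    \<Rightarrow> ((real \<Rightarrow> 'm) \<times> (real \<Rightarrow> 'm)) set"
  where "asymptotic A g =
    {(\<gamma>\<^sub>1, \<gamma>\<^sub>2). geodesic_ray A g \<gamma>\<^sub>1 \<and> geodesic_ray A g \<gamma>\<^sub>2 \<and>
       (\<exists>C. \<forall>t\<ge>0. rdist A g (\<gamma>\<^sub>1 t) (\<gamma>\<^sub>2 t) \<le> C)}"

definition boundary_at_infinity ::
  "('m::topological_space, 'n::finite) chart set \<Rightarrow> ('m, 'n) metric_coeffs
    \<Rightarrow> (real \<Rightarrow> 'm) set set"
  where "boundary_at_infinity A g = {\<gamma>. geodesic_ray A g \<gamma>} // asymptotic A g"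

definition end_point ::
  "('m::topological_space, 'n::finite) chart set \<Rightarrow> ('m, 'n) metric_coeffs
    \<Rightarrow> (real \<Rightarrow> 'm) \<Rightarrow> (real \<Rightarrow> 'm) set"
  where "end_point A g \<gamma> = asymptotic A g `` {\<gamma>}"

definition visibility_manifold ::
  "('m::topological_space, 'n::finite) chart set \<Rightarrow> ('m, 'n) metric_coeffs \<Rightarrow> bool"
  where "visibility_manifold A g \<longleftrightarrow>
    (\<forall>\<xi> \<in> boundary_at_infinity A g. \<forall>\<eta> \<in> boundary_at_infinity A g. \<xi> \<noteq> \<eta> \<longrightarrow>
       (\<exists>\<gamma>. geodesic_line A g \<gamma> \<and>
            end_point A g (\<lambda>t. \<gamma> (- t)) = \<xi> \<and> end_point A g \<gamma> = \<eta>))"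

definition boundary_map ::
  "('m::topological_space, 'n::finite) chart set \<Rightarrow> ('m, 'n) metric_coeffs \<Rightarrow> ('m \<Rightarrow> 'm)
    \<Rightarrow> (real \<Rightarrow> 'm) set \<Rightarrow> (real \<Rightarrow> 'm) set"
  where "boundary_map A g f \<xi> = asymptotic A g `` ((\<lambda>\<gamma>. f \<circ> \<gamma>) ` \<xi>)"

definition Fix ::
  "('m::topological_space, 'n::finite) chart set \<Rightarrow> ('m, 'n) metric_coeffs \<Rightarrow> ('m \<Rightarrow> 'm)
    \<Rightarrow> (real \<Rightarrow> 'm) set set"
  where "Fix A g f = {\<zeta> \<in> boundary_at_infinity A g. boundary_map A g f \<zeta> = \<zeta>}"

section \<open>Group actions\<close>

definition isometric_action ::
  "('m::topological_space, 'n::finite) chart set \<Rightarrow> ('m, 'n) metric_coeffs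
    \<Rightarrow> ('g, 'r) monoid_scheme \<Rightarrow> ('g \<Rightarrow> 'm \<Rightarrow> 'm) \<Rightarrow> bool"
  where "isometric_action A g \<Gamma> \<phi> \<longleftrightarrow>
    group_action \<Gamma> UNIV \<phi> \<and> (\<forall>a \<in> carrier \<Gamma>. riemannian_isometry A g (\<phi> a))"

definition free_action :: "('g, 'r) monoid_scheme \<Rightarrow> ('g \<Rightarrow> 'm \<Rightarrow> 'm) \<Rightarrow> bool"
  where "free_action \<Gamma> \<phi> \<longleftrightarrow> (\<forall>p. stabilizer \<Gamma> \<phi> p = {\<one>\<^bsub>\<Gamma>\<^esub>})"

definition properly_discontinuous_action ::
  "('g, 'r) monoid_scheme \<Rightarrow> ('g \<Rightarrow> 'm::topological_space \<Rightarrow> 'm) \<Rightarrow> bool"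
  where "properly_discontinuous_action \<Gamma> \<phi> \<longleftrightarrow>
    (\<forall>K. compact K \<longrightarrow> finite {a \<in> carrier \<Gamma>. \<phi> a ` K \<inter> K \<noteq> {}})"

section \<open>Algebraic entropy\<close>

definition finitely_generated :: "('g, 'r) monoid_scheme \<Rightarrow> bool"
  where "finitely_generated \<Gamma> \<longleftrightarrow>
    (\<exists>S. finite S \<and> S \<subseteq> carrier \<Gamma> \<and> generate \<Gamma> S = carrier \<Gamma>)"

definition finite_symmetric_generating_set :: "('g, 'r) monoid_scheme \<Rightarrow> 'g set \<Rightarrow> bool"
  where "finite_symmetric_generating_set \<Gamma> S \<longleftrightarrow>
    finite S \<and> S \<subseteq> carrier \<Gamma> \<and> (\<forall>s\<in>S. inv\<^bsub>\<Gamma>\<^esub> s \<in> S) \<and> generate \<Gamma> S = carrier \<Gamma>"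

definition word_length :: "('g, 'r) monoid_scheme \<Rightarrow> 'g set \<Rightarrow> 'g \<Rightarrow> nat"
  where "word_length \<Gamma> S a =
    (LEAST k. \<exists>ws. set ws \<subseteq> S \<and> length ws = k \<and> foldr (\<otimes>\<^bsub>\<Gamma>\<^esub>) ws \<one>\<^bsub>\<Gamma>\<^esub> = a)"

definition word_ball :: "('g, 'r) monoid_scheme \<Rightarrow> 'g set \<Rightarrow> nat \<Rightarrow> 'g set"
  where "word_ball \<Gamma> S k = {a \<in> carrier \<Gamma>. word_length \<Gamma> S a \<le> k}"

definition has_algebraic_entropy :: "('g, 'r) monoid_scheme \<Rightarrow> 'g set \<Rightarrow> real \<Rightarrow> bool"
  where "has_algebraic_entropy \<Gamma> S h \<longleftrightarrow>
    (\<lambda>k. ln (real (card (word_ball \<Gamma> S k))) / real k) \<longlonglongrightarrow> h"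

text \<open>Vanishing for one finite symmetric generating set is equivalent to vanishing for all of
  them; the definition asks for both.\<close>

definition algebraic_entropy_vanishes :: "('g, 'r) monoid_scheme \<Rightarrow> bool"
  where "algebraic_entropy_vanishes \<Gamma> \<longleftrightarrow>
    (\<exists>S. finite_symmetric_generating_set \<Gamma> S) \<and>
    (\<forall>S. finite_symmetric_generating_set \<Gamma> S \<longrightarrow> has_algebraic_entropy \<Gamma> S 0)"

end

theory Submission
  imports Defs
begin

text \<open>Nonpositive curvature makes the norm of Jacobi fields convex, so that the exponential map at each
  point does not shrink tangent vectors; completeness and simple connectivity turn it into a global
  diffeomorphism, and the distance function becomes convex. Conversely, the lower curvature bound
  controls the growth of Jacobi fields: on balls of radius \<open>R\<close> the exponential map is
  Lipschitz with a constant exponential in \<open>R\<close>. As orbit points are uniformly separated, a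
  volume count in the tangent space bounds the number of elements of word length at most \<open>k\<close>
  by an exponential in their maximal displacement \<open>D(k)\<close>, and it remains to see that
  \<open>D(k) = o(k)\<close>.

  Otherwise \<open>D\<close> has infinitely many jumps of a fixed size; the elements realizing them have a limit
  direction \<open>v\<close> whose Busemann function is negative at \<open>s p\<close> for some generator \<open>s\<close>. For the
  powers of a single element the limit direction is fixed by the element, hence is \<open>\<eta>\<close>;
  applied to \<open>s\<close> and to its inverse this contradicts the equivariance of the Busemann function of
  \<open>\<eta>\<close>, which therefore vanishes on the orbit. In general \<open>v \<noteq> \<eta>\<close> then follows, and by convexity
  the Busemann function of \<open>\<eta>\<close> is bounded above on the ray towards \<open>v\<close>, which
  is impossible in a visibility manifold.\<close>

section \<open>Calculus on open sets\<close>

text \<open>Ricci curvature is only a trace. Since the curvature has a sign, the operator R(.,u)u is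
  semidefinite, and then its trace bounds its norm; this turns the Ricci bound into the growth bound
  for Jacobi fields, with \<kappa> = n - 1. At a jump of D the new maximizer is a = s b with b among
  the earlier elements, so s p is nearer to a p than p is, by the size of the jump; hence the
  negative Busemann value. A power a of s commutes with s, so s moves a p exactly as far as p;
  convexity spreads this bound to the limit ray, whose class s therefore fixes. The Busemann
  function of \<eta> is additive along the powers of s, and their displacement is sublinear, so its
  value at s p is 0. Two devices shape the geometric part. Changes of charts and isometries are one
  notion, a smooth map preserving the metric coefficients, with f = id for changes of charts.
  Differentiability of the exponential map is carried along a geodesic chart by chart, as strict
  differentiability: this notion composes, follows from Gronwall estimates, and gives local
  injectivity without continuity of the derivative.\<close>

lemma frechet_derivative_cong_open:
  assumes "open S" "x \<in> S" "\<And>y. y \<in> S ==> f y = g y"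
  shows "frechet_derivative f (at x) = frechet_derivative g (at x)"
proof -
  have "(f has_derivative D) (at x) \<longleftrightarrow> (g has_derivative D) (at x)" for D
    using assms has_derivative_transform_within_open by metis
  then show ?thesis by (simp add: frechet_derivative_def)
qed

lemma differentiable_cong_open:
  assumes "open S" "x \<in> S" "\<And>y. y \<in> S ==> f y = g y"
  shows "f differentiable (at x) \<longleftrightarrow> g differentiable (at x)"
  using assms has_derivative_transform_within_open unfolding differentiable_def by metis

lemma partial_deriv_cong_open:
  assumes "open S" "x \<in> S" "\<And>y. y \<in> S ==> f y = g y"
  shows "partial_deriv i f x = partial_deriv i g x"
  using frechet_derivative_cong_open[OF assms] by (simp add: partial_deriv_def)

lemma Ck_on_cong:
  assumes "open S" "\<And>y. y \<in> S ==> f y = g y"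
  shows "Ck_on k S f \<longleftrightarrow> Ck_on k S g"
  using assms
proof (induction k arbitrary: f g)
  case 0
  then show ?case by (auto intro: continuous_on_cong)
next
  case (Suc k)
  have "f differentiable_on S \<longleftrightarrow> g differentiable_on S"
    using differentiable_cong_open[OF Suc.prems(1), of _ f g] Suc.prems(2)
    unfolding differentiable_on_eq_differentiable_at[OF Suc.prems(1)] by blast
  moreover have "Ck_on k S (partial_deriv i f) \<longleftrightarrow> Ck_on k S (partial_deriv i g)" for i
    by (rule Suc.IH[OF Suc.prems(1)]) (use Suc.prems partial_deriv_cong_open in blast)
  ultimately show ?case by simp
qed

lemma Ck_on_SucD: "Ck_on (Suc k) S f ==> Ck_on k S f"
  by (induction k arbitrary: f) (auto intro: differentiable_imp_continuous_on)

lemma Ck_on_const: "Ck_on k S (\<lambda>x. c)"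
proof (induction k arbitrary: c)
  case (Suc k)
  have "partial_deriv i (\<lambda>x::real^'a. c) = (\<lambda>x. 0)" for i
    by (auto simp: partial_deriv_def fun_eq_iff)
  then show ?case using Suc by (simp add: differentiable_on_const)
qed simp

lemma Ck_on_differentiable:
  assumes "open S" "Ck_on (Suc k) S f" "x \<in> S"
  shows "f differentiable (at x)"
  using assms by (simp add: differentiable_on_eq_differentiable_at)

lemma has_derivative_partial:
  fixes f :: "real ^ 'n => 'b::real_normed_vector"
  assumes "f differentiable (at x)"
  shows "(f has_derivative (\<lambda>h. \<Sum>i\<in>UNIV. h $ i *\<^sub>R partial_deriv i f x)) (at x)"
proof -
  let ?D = "frechet_derivative f (at x)"
  have D: "(f has_derivative ?D) (at x)" using assms frechet_derivative_works by blast
  interpret D: bounded_linear ?D using D has_derivative_bounded_linear by blast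
  have "?D h = (\<Sum>i\<in>UNIV. h $ i *\<^sub>R partial_deriv i f x)" for h
  proof -
    have "h = (\<Sum>i\<in>UNIV. h $ i *\<^sub>R axis i 1)"
      using basis_expansion[of h] by (simp add: scalar_mult_eq_scaleR)
    then have "?D h = ?D (\<Sum>i\<in>UNIV. h $ i *\<^sub>R axis i 1)" by simp
    then show ?thesis by (simp add: D.sum D.scaleR partial_deriv_def)
  qed
  then have "?D = (\<lambda>h. \<Sum>i\<in>UNIV. h $ i *\<^sub>R partial_deriv i f x)" by auto
  with D show ?thesis by simp
qed

lemma partial_deriv_eqI:
  "(f has_derivative D) (at x) ==> partial_deriv i f x = D (axis i 1)"
  unfolding partial_deriv_def using frechet_derivative_at by metis

lemma partial_deriv_axis:
  "(\<Sum>i\<in>UNIV. axis j (1::real) $ i *\<^sub>R (f i :: 'b::real_normed_vector)) = f (j::'n::finite)"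
  by (simp add: axis_def if_distrib[where f="\<lambda>r. r *\<^sub>R _"] cong: if_cong)

text \<open>The recursion in \<open>Ck_on\<close> runs through \<open>partial_deriv\<close>, a
  chosen derivative. This rule accepts any explicit derivative, so the closure rules below follow
  from the usual differentiation rules by induction on k.\<close>

lemma Ck_on_SucI:
  assumes S: "open S" and f: "\<And>x. x \<in> S ==> (f has_derivative f' x) (at x)"
    and k: "\<And>i. Ck_on k S (\<lambda>x. f' x (axis i 1))"
  shows "Ck_on (Suc k) S f"
proof -
  have "Ck_on k S (partial_deriv i f)" for i
    using k Ck_on_cong[OF S, of "partial_deriv i f"] partial_deriv_eqI[OF f] by metis
  moreover have "f differentiable_on S"
    using f unfolding differentiable_on_eq_differentiable_at[OF S] differentiable_def by blast
  ultimately show ?thesis by simp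
qed

lemma Ck_on_derivative:
  assumes "open S" "Ck_on (Suc k) S f" "x \<in> S"
  shows "(f has_derivative (\<lambda>h. \<Sum>i\<in>UNIV. h $ i *\<^sub>R partial_deriv i f x)) (at x)"
  by (rule has_derivative_partial[OF Ck_on_differentiable[OF assms]])

lemma Ck_on_bounded_linear:
  assumes L: "bounded_linear L" and S: "open S"
  shows "Ck_on k S f ==> Ck_on k S (\<lambda>x. L (f x))"
proof (induction k arbitrary: f)
  case 0
  then show ?case using bounded_linear.continuous_on[OF L] by auto
next
  case (Suc k)
  then show ?case
    by (intro Ck_on_SucI[OF S bounded_linear.has_derivative[OF L Ck_on_derivative[OF S Suc.prems]]])
      (simp_all add: partial_deriv_axis)
qed

lemma Ck_on_add:
  assumes S: "open S"
  shows "Ck_on k S f ==> Ck_on k S g ==> Ck_on k S (\<lambda>x. f x + g x)"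
proof (induction k arbitrary: f g)
  case 0
  then show ?case by (auto intro: continuous_intros)
next
  case (Suc k)
  then show ?case
    by (intro Ck_on_SucI[OF S has_derivative_add[OF Ck_on_derivative[OF S Suc.prems(1)] Ck_on_derivative[OF S Suc.prems(2)]]])
      (simp_all add: partial_deriv_axis)
qed

lemma Ck_on_mult:
  fixes f g :: "real ^ 'n => real"
  assumes S: "open S"
  shows "Ck_on k S f ==> Ck_on k S g ==> Ck_on k S (\<lambda>x. f x * g x)"
proof (induction k arbitrary: f g)
  case 0
  then show ?case by (auto intro: continuous_intros)
next
  case (Suc k)
  have "Ck_on k S (\<lambda>x. f x * partial_deriv i g x + partial_deriv i f x * g x)" for i
    using Suc.prems Ck_on_SucD[OF Suc.prems(1)] Ck_on_SucD[OF Suc.prems(2)]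
    by (intro Ck_on_add[OF S] Suc.IH) auto
  then show ?case
    by (intro Ck_on_SucI[OF S has_derivative_mult[OF Ck_on_derivative[OF S Suc.prems(1)] Ck_on_derivative[OF S Suc.prems(2)]]])
      (simp_all add: partial_deriv_axis del: real_scaleR_def)
qed

lemma Ck_on_inverse:
  fixes f :: "real ^ 'n => real"
  assumes S: "open S" and nz: "\<And>x. x \<in> S ==> f x \<noteq> 0"
  shows "Ck_on k S f ==> Ck_on k S (\<lambda>x. inverse (f x))"
proof (induction k)
  case 0
  then show ?case using nz by (auto intro: continuous_intros)
next
  case (Suc k)
  have "Ck_on k S (\<lambda>x. (- 1) * (inverse (f x) * partial_deriv i f x * inverse (f x)))" for i
    using Suc.prems Suc.IH[OF Ck_on_SucD[OF Suc.prems]]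
    by (intro Ck_on_mult[OF S] Ck_on_const) auto
  then show ?case
    by (intro Ck_on_SucI[OF S Deriv.has_derivative_inverse[OF nz Ck_on_derivative[OF S Suc.prems]]])
      (simp_all add: partial_deriv_axis del: real_scaleR_def)
qed

lemma Ck_on_sum:
  assumes "open S" "\<And>i. i \<in> I ==> Ck_on k S (f i)"
  shows "Ck_on k S (\<lambda>x. \<Sum>i\<in>I. f i x)"
  using assms(2) by (induction I rule: infinite_finite_induct)
    (simp_all add: Ck_on_const Ck_on_add[OF assms(1)] del: Ck_on.simps)

lemma Ck_on_prod:
  fixes f :: "'i => real ^ 'n => real"
  assumes "open S" "\<And>i. i \<in> I ==> Ck_on k S (f i)"
  shows "Ck_on k S (\<lambda>x. \<Prod>i\<in>I. f i x)"
  using assms(2) by (induction I rule: infinite_finite_induct)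
    (simp_all add: Ck_on_const Ck_on_mult[OF assms(1)] del: Ck_on.simps)

lemma Ck_on_det:
  fixes M :: "real ^ 'n => real ^ 'm ^ 'm"
  assumes "open S" "\<And>i j. Ck_on k S (\<lambda>x. M x $ i $ j)"
  shows "Ck_on k S (\<lambda>x. det (M x))"
  unfolding det_def
  by (intro Ck_on_sum Ck_on_mult Ck_on_prod Ck_on_const assms)

lemma matrix_inv_mult:
  fixes M :: "real ^ 'n ^ 'n"
  assumes "invertible M"
  shows "M ** matrix_inv M = mat 1" "matrix_inv M ** M = mat 1"
  using someI_ex[OF assms[unfolded invertible_def]] by (auto simp: matrix_inv_def)

text \<open>Cramer's rule. Entries of the inverse become quotients of determinants, which reduces
  smoothness of the Christoffel symbols to sums, products and inverses of functions.\<close>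

lemma matrix_inv_entry:
  fixes M :: "real ^ 'n ^ 'n"
  assumes "det M \<noteq> 0"
  shows "matrix_inv M $ k $ l = det (\<chi> i j. if j = k then axis l 1 $ i else M $ i $ j) / det M"
proof -
  have "M ** matrix_inv M = mat 1"
    using assms by (simp add: invertible_det_nz matrix_inv_mult)
  then have "M *v (matrix_inv M *v axis l 1) = axis l 1"
    by (simp add: matrix_vector_mul_assoc)
  then have "matrix_inv M *v axis l 1 = (\<chi> k. det (\<chi> i j. if j = k then axis l 1 $ i else M $ i $ j) / det M)"
    using cramer[OF assms] by blast
  then have "(matrix_inv M *v axis l 1) $ k = det (\<chi> i j. if j = k then axis l 1 $ i else M $ i $ j) / det M"
    by simp
  then show ?thesis by (simp add: matrix_vector_mul_component inner_axis)
qed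

lemma Ck_on_matrix_inv:
  fixes M :: "real ^ 'n => real ^ 'm ^ 'm"
  assumes S: "open S" and M: "\<And>i j. Ck_on k S (\<lambda>x. M x $ i $ j)" and nz: "\<And>x. x \<in> S ==> det (M x) \<noteq> 0"
  shows "Ck_on k S (\<lambda>x. matrix_inv (M x) $ p $ q)"
proof -
  have "Ck_on k S (\<lambda>x. (\<chi> i j. if j = p then axis q 1 $ i else M x $ i $ j) $ i $ j)" for i j
    using M[of i j] Ck_on_const[of k S "axis q 1 $ i :: real"] by (cases "j = p") simp_all
  then have "Ck_on k S (\<lambda>x. det (\<chi> i j. if j = p then axis q 1 $ i else M x $ i $ j) * inverse (det (M x)))"
    by (intro Ck_on_mult[OF S] Ck_on_inverse[OF S nz] Ck_on_det[OF S] M)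
  then show ?thesis
    using Ck_on_cong[OF S, of "\<lambda>x. matrix_inv (M x) $ p $ q"
        "\<lambda>x. det (\<chi> i j. if j = p then axis q 1 $ i else M x $ i $ j) * inverse (det (M x))"]
      matrix_inv_entry[OF nz] by (simp add: divide_inverse)
qed

section \<open>Symmetry of second derivatives\<close>

text \<open>The mean value theorem for the increment s -> f(x + s h + t k) - f(x + s h) reduces the
  second difference to the linearization of y -> f' y h at x.\<close>

lemma second_difference:
  fixes f :: "'a::real_normed_vector => real"
  assumes S: "open S" "x \<in> S" and f: "\<And>y. y \<in> S ==> (f has_derivative f' y) (at y)"
    and A: "((\<lambda>y. f' y h) has_derivative A) (at x)" and e: "e > 0"
  obtains d where "d > 0" "\<And>t. 0 < t ==> t < d ==>
    \<bar>f (x + t *\<^sub>R h + t *\<^sub>R k) - f (x + t *\<^sub>R h) - f (x + t *\<^sub>R k) + f x - t\<^sup>2 * A k\<bar> \<le> e * t\<^sup>2"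
proof -
  interpret A: bounded_linear A using A has_derivative_bounded_linear by blast
  \<comment> \<open>\<open>c\<close> exceeds |h| + |k|, so both displacements from x stay below t c;
    the linearization error is taken as e / (2 c) because it is incurred at two points.\<close>
  define c where "c = norm h + norm k + 1"
  have c: "c > 0" by (simp add: c_def add_nonneg_pos)
  obtain r where r: "r > 0" "ball x r \<subseteq> S" using S open_contains_ball by blast
  have "e / (2 * c) > 0" using e c by simp
  then obtain d where d: "d > 0" "\<And>y. norm (y - x) < d ==>
      norm (f' y h - f' x h - A (y - x)) \<le> e / (2 * c) * norm (y - x)"
    using A unfolding has_derivative_within_alt by (metis UNIV_I)
  show ?thesis
  proof (rule that[of "min d r / c"])
    show "min d r / c > 0" using d r c by simp
    fix t :: real assume t: "0 < t" "t < min d r / c"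
    then have tc: "t * c < d" "t * c < r" using c by (auto simp: field_simps min_less_iff_conj)
    define \<phi> where "\<phi> s = f (x + s *\<^sub>R h + t *\<^sub>R k) - f (x + s *\<^sub>R h)" for s
    define \<phi>' where "\<phi>' s = f' (x + s *\<^sub>R h + t *\<^sub>R k) h - f' (x + s *\<^sub>R h) h" for s
    have n1: "norm (s *\<^sub>R h + t *\<^sub>R k) \<le> t * c" "norm (s *\<^sub>R h) \<le> t * c" if "0 \<le> s" "s \<le> t" for s
    proof -
      have "norm (s *\<^sub>R h) \<le> t * norm h" using that by (simp add: mult_right_mono)
      moreover have "norm (t *\<^sub>R k) = t * norm k" using t by simp
      moreover have "0 \<le> t * norm k" "t * c = t * norm h + t * norm k + t"
        using t by (auto simp: c_def algebra_simps)
      ultimately show "norm (s *\<^sub>R h + t *\<^sub>R k) \<le> t * c" "norm (s *\<^sub>R h) \<le> t * c"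
        using norm_triangle_ineq[of "s *\<^sub>R h" "t *\<^sub>R k"] t by linarith+
    qed
    have in0: "x + w \<in> S" if "norm w \<le> t * c" for w
      using that tc r(2) by (auto simp: dist_norm intro!: subsetD[OF r(2)])
    have in1: "x + s *\<^sub>R h + t *\<^sub>R k \<in> S" "x + s *\<^sub>R h \<in> S" if "0 \<le> s" "s \<le> t" for s
      using in0[OF n1(1)[OF that]] in0[OF n1(2)[OF that]] by (simp_all add: add.assoc)
    have g: "((\<lambda>s. x + s *\<^sub>R h + w) has_derivative (\<lambda>r. r *\<^sub>R h)) (at s)" for s w
      by (auto intro!: derivative_eq_intros)
    have "(\<phi> has_derivative (\<lambda>r. r * \<phi>' s)) (at s within {0..t})" if "0 \<le> s" "s \<le> t" for s
    proof -
      have "((\<lambda>s. f (x + s *\<^sub>R h + w)) has_derivative (\<lambda>r. r * f' (x + s *\<^sub>R h + w) h)) (at s)"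
        if "x + s *\<^sub>R h + w \<in> S" for w
      proof -
        have "((\<lambda>s. f (x + s *\<^sub>R h + w)) has_derivative (\<lambda>r. f' (x + s *\<^sub>R h + w) (r *\<^sub>R h))) (at s)"
          by (rule has_derivative_compose[OF g f[OF that]])
        moreover have "bounded_linear (f' (x + s *\<^sub>R h + w))"
          using f[OF that] has_derivative_bounded_linear by blast
        ultimately show ?thesis by (simp add: linear_simps)
      qed
      from has_derivative_diff[OF this this, of "t *\<^sub>R k" 0] in1[OF that]
      have "((\<lambda>s. f (x + s *\<^sub>R h + t *\<^sub>R k) - f (x + s *\<^sub>R h + 0)) has_derivative
        (\<lambda>r. r * f' (x + s *\<^sub>R h + t *\<^sub>R k) h - r * f' (x + s *\<^sub>R h + 0) h)) (at s)" by simp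
      then show ?thesis unfolding \<phi>_def \<phi>'_def add_0_right right_diff_distrib
        by (rule has_derivative_at_withinI)
    qed
    from mvt_simple[OF t(1) this]
    obtain s where s: "s \<in> {0<..<t}" "\<phi> t - \<phi> 0 = t * \<phi>' s" by auto
    then have s': "0 \<le> s" "s \<le> t" by auto
    have le: "\<bar>f' (x + w) h - f' x h - A w\<bar> \<le> e / 2 * t" if "norm w \<le> t * c" for w
    proof -
      have "\<bar>f' (x + w) h - f' x h - A w\<bar> \<le> e / (2 * c) * norm w"
        using d(2)[of "x + w"] that tc by simp
      also have "\<dots> \<le> e / (2 * c) * (t * c)"
        using that e c by (intro mult_left_mono) auto
      finally show ?thesis using c by (simp add: field_simps)
    qed
    have "A (s *\<^sub>R h + t *\<^sub>R k) - A (s *\<^sub>R h) = t * A k"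
      by (simp add: A.add A.scaleR)
    moreover have "\<phi>' s = f' (x + (s *\<^sub>R h + t *\<^sub>R k)) h - f' (x + s *\<^sub>R h) h"
      by (simp add: \<phi>'_def add.assoc)
    ultimately have "\<bar>\<phi>' s - t * A k\<bar> \<le> e * t"
      using le[OF n1(1)[OF s']] le[OF n1(2)[OF s']] by (simp only: abs_le_iff) linarith
    moreover have "\<phi> t - \<phi> 0 - t\<^sup>2 * A k = t * (\<phi>' s - t * A k)"
      using s by (simp add: algebra_simps power2_eq_square)
    ultimately have "\<bar>\<phi> t - \<phi> 0 - t\<^sup>2 * A k\<bar> \<le> t * (e * t)"
      using t by (simp add: abs_mult)
    then show "\<bar>f (x + t *\<^sub>R h + t *\<^sub>R k) - f (x + t *\<^sub>R h) - f (x + t *\<^sub>R k) + f x - t\<^sup>2 * A k\<bar> \<le> e * t\<^sup>2"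
      by (simp add: \<phi>_def algebra_simps power2_eq_square)
  qed
qed

text \<open>The second difference is symmetric in h and k, and divided by t^2 it tends to either of
  the two mixed derivatives.\<close>

lemma symmetric_second_derivative:
  fixes f :: "'a::real_normed_vector => real"
  assumes S: "open S" "x \<in> S" and f: "\<And>y. y \<in> S ==> (f has_derivative f' y) (at y)"
    and A: "((\<lambda>y. f' y h) has_derivative A) (at x)" and B: "((\<lambda>y. f' y k) has_derivative B) (at x)"
  shows "A k = B h"
proof (rule ccontr)
  assume ne: "A k \<noteq> B h"
  define e where "e = \<bar>A k - B h\<bar> / 4"
  have e: "e > 0" using ne by (simp add: e_def)
  obtain d1 where d1: "d1 > 0" "\<And>t. 0 < t ==> t < d1 ==>
    \<bar>f (x + t *\<^sub>R h + t *\<^sub>R k) - f (x + t *\<^sub>R h) - f (x + t *\<^sub>R k) + f x - t\<^sup>2 * A k\<bar> \<le> e * t\<^sup>2"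
    using second_difference[OF S f A e] by blast
  obtain d2 where d2: "d2 > 0" "\<And>t. 0 < t ==> t < d2 ==>
    \<bar>f (x + t *\<^sub>R k + t *\<^sub>R h) - f (x + t *\<^sub>R k) - f (x + t *\<^sub>R h) + f x - t\<^sup>2 * B h\<bar> \<le> e * t\<^sup>2"
    using second_difference[OF S f B e] by blast
  define t where "t = min d1 d2 / 2"
  have t: "0 < t" "t < d1" "t < d2" using d1(1) d2(1) by (auto simp: t_def)
  have "x + t *\<^sub>R k + t *\<^sub>R h = x + t *\<^sub>R h + t *\<^sub>R k" by simp
  then have "\<bar>t\<^sup>2 * A k - t\<^sup>2 * B h\<bar> \<le> 2 * (e * t\<^sup>2)"
    using d1(2)[OF t(1,2)] d2(2)[OF t(1,3)] by (simp only: abs_le_iff) linarith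
  also have "\<bar>t\<^sup>2 * A k - t\<^sup>2 * B h\<bar> = t\<^sup>2 * \<bar>A k - B h\<bar>"
    by (metis abs_mult abs_power2 right_diff_distrib)
  finally have "t\<^sup>2 * \<bar>A k - B h\<bar> \<le> t\<^sup>2 * (\<bar>A k - B h\<bar> / 2)" by (simp add: e_def)
  then show False using t ne by (simp add: mult_le_cancel_left_pos)
qed

section \<open>Linear algebra of a positive definite matrix\<close>

lemma inner_symmetric_matrix:
  fixes S :: "real ^ 'n ^ 'n"
  assumes "transpose S = S"
  shows "a \<bullet> (S *v b) = b \<bullet> (S *v a)"
  using dot_lmul_matrix[of a S b] assms
  by (metis inner_commute transpose_matrix_vector)

text \<open>Gram-Schmidt by a dimension count: as long as an index is free, the vectors S f_j
  already chosen span a proper subspace, so some y \<noteq> 0 is Euclidean orthogonal to all of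
  them, that is, S-orthogonal to the f_j. Normalizing y extends the family.\<close>

lemma orthonormal_family_exists:
  fixes S :: "real ^ 'n ^ 'n"
  assumes sym: "transpose S = S" and pos: "\<And>v. v \<noteq> 0 ==> v \<bullet> (S *v v) > 0"
    and a: "a \<bullet> (S *v a) = 1" and "finite I" and "(k::'n) \<notin> I"
  shows "\<exists>f. f k = a \<and> (\<forall>i\<in>insert k I. \<forall>j\<in>insert k I. f i \<bullet> (S *v f j) = (if i = j then 1 else 0))"
  using \<open>finite I\<close> \<open>k \<notin> I\<close>
proof (induction I rule: finite_induct)
  case empty
  show ?case by (rule exI[of _ "\<lambda>_. a"]) (use a in auto)
next
  case (insert i I)
  then obtain f where f: "f k = a"
    "\<And>i j. i\<in>insert k I ==> j\<in>insert k I ==> f i \<bullet> (S *v f j) = (if i = j then 1 else 0)"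
    by fastforce
  let ?T = "(\<lambda>j. S *v f j) ` insert k I"
  have "dim ?T \<le> card ?T" using insert by (intro dim_le_card span_superset) auto
  also have "\<dots> \<le> card (insert k I)" using insert by (intro card_image_le) auto
  also have "\<dots> < CARD('n)"
  proof -
    have "insert k I \<subset> UNIV" using \<open>i \<notin> I\<close> \<open>k \<notin> insert i I\<close> by auto
    then show ?thesis by (intro psubset_card_mono) auto
  qed
  finally have "dim ?T < DIM(real ^ 'n)" by simp
  then obtain y where y: "y \<noteq> 0" "\<And>z. z \<in> span ?T ==> orthogonal y z"
    using orthogonal_to_subspace_exists by blast
  define c where "c = sqrt (y \<bullet> (S *v y))"
  have c: "c > 0" "c * c = y \<bullet> (S *v y)" using pos[OF y(1)] by (auto simp: c_def)
  define u where "u = (1 / c) *\<^sub>R y"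
  have u: "u \<bullet> (S *v f j) = 0" if "j \<in> insert k I" for j
    using y(2)[OF span_base, of "S *v f j"] that by (auto simp: u_def orthogonal_def)
  have u': "f j \<bullet> (S *v u) = 0" if "j \<in> insert k I" for j
    using u[OF that] inner_symmetric_matrix[OF sym] by metis
  have uu: "u \<bullet> (S *v u) = 1"
    using c by (simp add: u_def matrix_vector_mult_scaleR field_simps flip: c(2))
  show ?case
    by (rule exI[of _ "f(i := u)"]) (use f u u' uu insert in auto)
qed

lemma orthonormal_frame_exists:
  fixes S :: "real ^ 'n ^ 'n"
  assumes sym: "transpose S = S" and pos: "\<And>v. v \<noteq> 0 ==> v \<bullet> (S *v v) > 0"
    and a: "a \<bullet> (S *v a) = 1"
  obtains f where "f (k::'n) = a" "\<And>i j. f i \<bullet> (S *v f j) = (if i = j then 1 else 0)"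
proof -
  have "insert k (UNIV - {k}) = UNIV" by auto
  moreover have "finite (UNIV - {k})" by simp
  ultimately have "\<exists>f. f k = a \<and> (\<forall>i j. f i \<bullet> (S *v f j) = (if i = j then 1 else 0))"
    using orthonormal_family_exists[OF assms, of "UNIV - {k}" k] by simp
  then show ?thesis using that by blast
qed

lemma frame_matrix:
  fixes S :: "real ^ 'n ^ 'n"
  assumes "\<And>i j. f i \<bullet> (S *v f j) = (if i = j then 1 else 0)"
  shows "transpose (\<chi> i j. f j $ i) ** S ** (\<chi> i j. f j $ i) = mat 1"
proof -
  have "(\<Sum>l\<in>UNIV. (\<Sum>m\<in>UNIV. f i $ m * S $ m $ l) * f j $ l) = f i \<bullet> (S *v f j)" for i j
    unfolding inner_vec_def matrix_vector_mult_def
    by (simp add: sum_distrib_left sum_distrib_right mult.assoc) (rule sum.swap)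
  then show ?thesis
    using assms by (simp add: vec_eq_iff matrix_matrix_mult_def transpose_def mat_def)
qed

text \<open>In an S-orthonormal frame containing a, the trace is the sum of the terms <f_i, Q f_i>;
  all are nonnegative, so the one belonging to a is at most the sum.\<close>

lemma trace_bound_unit:
  fixes S Q :: "real ^ 'n ^ 'n"
  assumes sym: "transpose S = S" and pos: "\<And>v. v \<noteq> 0 ==> v \<bullet> (S *v v) > 0"
    and Q: "\<And>v. v \<bullet> (S *v (Q *v v)) \<ge> 0" and a: "a \<bullet> (S *v a) = 1"
  shows "a \<bullet> (S *v (Q *v a)) \<le> trace Q"
proof -
  fix k :: 'n
  obtain f where f: "f k = a" "\<And>i j. f i \<bullet> (S *v f j) = (if i = j then 1 else 0)"
    using orthonormal_frame_exists[OF sym pos a, of k] by metis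
  define B where "B = (\<chi> i j. f j $ i)"
  have "transpose B ** S ** B = mat 1" unfolding B_def by (rule frame_matrix[OF f(2)])
  \<comment> \<open>A one-sided inverse of a square matrix is two-sided. Inserting this product next
    to Q and using cyclicity of the trace passes to the frame.\<close>
  then have "B ** (transpose B ** S) = mat 1" using matrix_left_right_inverse by blast
  then have "trace Q = trace ((Q ** B) ** (transpose B ** S))"
    by (metis matrix_mul_assoc matrix_mul_rid)
  also have "\<dots> = trace ((transpose B ** S) ** (Q ** B))" by (rule trace_mul_sym)
  also have "\<dots> = (\<Sum>i\<in>UNIV. f i \<bullet> (S *v (Q *v f i)))"
  proof -
    have "((transpose B ** S) ** (Q ** B)) $ i $ i = f i \<bullet> (S *v (Q *v f i))" for i
    proof -
      have Bi: "B *v axis i 1 = f i"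
        by (simp add: B_def vec_eq_iff matrix_vector_mul_component inner_axis)
      have "((transpose B ** S) ** (Q ** B)) $ i $ i = axis i 1 \<bullet> (((transpose B ** S) ** (Q ** B)) *v axis i 1)"
        by (simp add: inner_axis matrix_vector_mul_component inner_commute[of "axis i 1"])
      also have "\<dots> = axis i 1 \<bullet> (transpose B *v (S *v (Q *v f i)))"
        by (simp add: Bi flip: matrix_vector_mul_assoc)
      also have "\<dots> = (B *v axis i 1) \<bullet> (S *v (Q *v f i))"
        by (metis dot_lmul_matrix inner_commute transpose_matrix_vector transpose_transpose)
      finally show ?thesis by (simp add: Bi)
    qed
    then show ?thesis by (simp add: trace_def)
  qed
  finally have "trace Q = (\<Sum>i\<in>UNIV. f i \<bullet> (S *v (Q *v f i)))" .
  moreover have "f k \<bullet> (S *v (Q *v f k)) \<le> (\<Sum>i\<in>UNIV. f i \<bullet> (S *v (Q *v f i)))"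
    using Q by (intro member_le_sum) auto
  ultimately show ?thesis using f(1) by simp
qed

lemma trace_bound:
  fixes S Q :: "real ^ 'n ^ 'n"
  assumes sym: "transpose S = S" and pos: "\<And>v. v \<noteq> 0 ==> v \<bullet> (S *v v) > 0"
    and Q: "\<And>v. v \<bullet> (S *v (Q *v v)) \<ge> 0"
  shows "a \<bullet> (S *v (Q *v a)) \<le> trace Q * (a \<bullet> (S *v a))"
proof (cases "a = 0")
  case False
  define c where "c = sqrt (a \<bullet> (S *v a))"
  have c: "c > 0" "c * c = a \<bullet> (S *v a)" using pos[OF False] by (auto simp: c_def)
  have "(inverse c *\<^sub>R a) \<bullet> (S *v (inverse c *\<^sub>R a)) = 1"
    using c by (simp add: matrix_vector_mult_scaleR field_simps flip: c(2))
  from trace_bound_unit[OF sym pos Q this]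
  have "inverse c * (inverse c * (a \<bullet> (S *v (Q *v a)))) \<le> trace Q"
    by (simp add: matrix_vector_mult_scaleR)
  then have "(a \<bullet> (S *v (Q *v a))) / (c * c) \<le> trace Q"
    by (simp add: divide_inverse mult_ac)
  then show ?thesis using c(1) unfolding c(2)[symmetric] by (simp add: pos_divide_le_eq)
qed simp

lemma nonneg_quadratic_discriminant:
  fixes a b c :: real
  assumes "\<And>t. a + 2 * t * b + t\<^sup>2 * c \<ge> 0" "c \<ge> 0"
  shows "b\<^sup>2 \<le> a * c"
proof (cases "c = 0")
  case True
  show ?thesis
  proof (cases "b = 0")
    case False
    \<comment> \<open>For c = 0 and b \<noteq> 0 the expression is affine in t; this t gives it the
      value -1.\<close>
    then have "2 * (- (a + 1) / (2 * b)) * b = - (a + 1)" by simp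
    then show ?thesis using assms(1)[of "- (a + 1) / (2 * b)"] True by simp
  qed (use True in simp)
next
  case False
  have "a + 2 * (- b / c) * b + (- b / c)\<^sup>2 * c = a - b\<^sup>2 / c"
    using False by (simp add: power2_eq_square)
  then have "b\<^sup>2 / c \<le> a" using assms(1)[of "- b / c"] by linarith
  then show ?thesis using False assms(2) by (simp add: pos_divide_le_eq)
qed

text \<open>Cauchy-Schwarz for the semidefinite form <., Q .> applied to a and Q a gives |Q a|^4
  \<le> <a, Q a> <Q a, Q Q a>; \<open>trace_bound\<close> bounds both factors, and |Q a|^2 cancels.
  No eigenvalues are involved.\<close>

lemma psd_operator_bound:
  fixes S Q :: "real ^ 'n ^ 'n"
  assumes sym: "transpose S = S" and pos: "\<And>v. v \<noteq> 0 ==> v \<bullet> (S *v v) > 0"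
    and Q: "\<And>v. v \<bullet> (S *v (Q *v v)) \<ge> 0"
    and Qsym: "\<And>u v. u \<bullet> (S *v (Q *v v)) = v \<bullet> (S *v (Q *v u))"
  shows "(Q *v a) \<bullet> (S *v (Q *v a)) \<le> (trace Q)\<^sup>2 * (a \<bullet> (S *v a))"
proof -
  define N where "N = Q *v a"
  define m where "m = N \<bullet> (S *v N)"
  have m0: "m \<ge> 0" unfolding m_def using pos[of N] by (cases "N = 0") auto
  have aa: "a \<bullet> (S *v a) \<ge> 0" using pos[of a] by (cases "a = 0") auto
  have "a \<bullet> (S *v (Q *v a)) + 2 * t * m + t\<^sup>2 * (N \<bullet> (S *v (Q *v N))) \<ge> 0" for t
  proof -
    have "N \<bullet> (S *v (Q *v a)) = m" "a \<bullet> (S *v (Q *v N)) = m"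
      using Qsym[of a N] by (simp_all add: m_def N_def)
    then have "(a + t *\<^sub>R N) \<bullet> (S *v (Q *v (a + t *\<^sub>R N)))
      = a \<bullet> (S *v (Q *v a)) + t * m + t * (m + t * (N \<bullet> (S *v (Q *v N))))"
      by (simp only: matrix_vector_right_distrib matrix_vector_mult_scaleR inner_add_left
          inner_add_right inner_scaleR_left inner_scaleR_right)
    also have "\<dots> = a \<bullet> (S *v (Q *v a)) + 2 * t * m + t\<^sup>2 * (N \<bullet> (S *v (Q *v N)))"
      by (simp add: power2_eq_square distrib_left)
    finally have "(a + t *\<^sub>R N) \<bullet> (S *v (Q *v (a + t *\<^sub>R N)))
      = a \<bullet> (S *v (Q *v a)) + 2 * t * m + t\<^sup>2 * (N \<bullet> (S *v (Q *v N)))" .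
    then show ?thesis using Q[of "a + t *\<^sub>R N"] by simp
  qed
  then have "m\<^sup>2 \<le> (a \<bullet> (S *v (Q *v a))) * (N \<bullet> (S *v (Q *v N)))"
    by (rule nonneg_quadratic_discriminant) (rule Q)
  also have "\<dots> \<le> (trace Q * (a \<bullet> (S *v a))) * (trace Q * m)"
    unfolding m_def using trace_bound[OF sym pos Q] order_trans[OF Q trace_bound[OF sym pos Q]]
    by (intro mult_mono Q) auto
  finally have "m * m \<le> ((trace Q)\<^sup>2 * (a \<bullet> (S *v a))) * m"
    by (simp add: power2_eq_square algebra_simps)
  then show ?thesis
    using m0 aa unfolding m_def[symmetric] N_def[symmetric]
    by (cases "m = 0") (auto simp: mult_le_cancel_right)
qed

section \<open>Ordinary differential equations\<close>

text \<open>Continuation principle: a property that passes between any two nearby parameters holds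
  on a connected set once it holds somewhere. It drives uniqueness of solutions, constancy of speed,
  smooth dependence along geodesics and the lifting of paths.\<close>

lemma interval_induction:
  fixes I :: "real set"
  assumes "connected I" "a \<in> I" "b \<in> I" "P a"
    and step: "\<And>r. r \<in> I ==> \<exists>e>0. \<forall>x\<in>I \<inter> ball r e. \<forall>y\<in>I \<inter> ball r e. P x \<longrightarrow> P y"
  shows "P b"
proof (rule connected_induction_simple[of I a b P, OF assms(1-4)])
  fix r assume r: "r \<in> I"
  then obtain e where "e > 0" "\<forall>x\<in>I \<inter> ball r e. \<forall>y\<in>I \<inter> ball r e. P x \<longrightarrow> P y" using step by blast
  then show "\<exists>T. openin (top_of_set I) T \<and> r \<in> T \<and> (\<forall>x\<in>T. \<forall>y\<in>T. P x \<longrightarrow> P y)"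
    using r by (intro exI[of _ "I \<inter> ball r e"] conjI) (simp_all add: openin_open_Int)
qed

lemma nearby:
  fixes f :: "'a::metric_space => 'b::topological_space"
  assumes "continuous_on T f" "t \<in> T" "open V" "f t \<in> V"
  obtains e where "e > 0" "\<And>s. s \<in> T ==> dist s t < e ==> f s \<in> V"
proof -
  have "\<forall>\<^sub>F s in at t within T. f s \<in> V" using assms unfolding continuous_on_def tendsto_def by blast
  then obtain e where e: "e > 0" "\<And>s. s \<in> T ==> s \<noteq> t ==> dist s t < e ==> f s \<in> V"
    unfolding eventually_at by blast
  have "f s \<in> V" if "s \<in> T" "dist s t < e" for s using e(2)[OF that(1) _ that(2)] assms(4) by (cases "s = t") auto
  then show thesis using that e(1) by blast
qed

lemma gronwall_sq:
  fixes z :: "real => 'a::real_inner"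
  assumes z: "\<And>t. t \<in> {a..b} ==> (z has_vector_derivative z' t) (at t within {a..b})"
    and bnd: "\<And>t. t \<in> {a..b} ==> norm (z' t) \<le> L * norm (z t) + e"
    and ab: "a \<le> b" and L: "L \<ge> 0"
  shows "(norm (z b))\<^sup>2 \<le> ((norm (z a))\<^sup>2 + e\<^sup>2 * (b - a)) * exp ((2 * L + 1) * (b - a))"
proof -
  \<comment> \<open>The summand 1 absorbs the mixed term 2 |z| e \<le> |z|^2 + e^2. Working with
    |z|^2 avoids differentiating the norm at zeros of z.\<close>
  define K where "K = 2 * L + 1"
  define h where "h s = (z s \<bullet> z s) * exp (- K * (s - a)) - e\<^sup>2 * (s - a)" for s
  have "h b \<le> h a"
  proof (rule DERIV_nonpos_imp_decreasing_open[OF ab])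
    have "continuous_on {a..b} z"
      using z has_vector_derivative_continuous continuous_on_eq_continuous_within by blast
    then show "continuous_on {a..b} h"
      unfolding h_def by (intro continuous_intros)
    fix s assume s: "a < s" "s < b"
    then have "(z has_vector_derivative z' s) (at s)"
      using z[of s] by (simp add: at_within_Icc_at)
    then have d: "((\<lambda>s. z s \<bullet> z s) has_real_derivative (2 * (z s \<bullet> z' s))) (at s)"
      unfolding has_vector_derivative_def has_field_derivative_def
      by (auto intro!: derivative_eq_intros simp: inner_commute algebra_simps)
    have "(h has_real_derivative ((2 * (z s \<bullet> z' s)) * exp (- K * (s - a))
        + (z s \<bullet> z s) * (exp (- K * (s - a)) * (- K)) - e\<^sup>2)) (at s)"
      unfolding h_def by (auto intro!: derivative_eq_intros d)
    moreover have "(2 * (z s \<bullet> z' s)) * exp (- K * (s - a))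
        + (z s \<bullet> z s) * (exp (- K * (s - a)) * (- K)) - e\<^sup>2 \<le> 0"
    proof -
      have "z s \<bullet> z' s \<le> norm (z s) * (L * norm (z s) + e)"
        using norm_cauchy_schwarz[of "z s" "z' s"] bnd[of s] s
        by (smt (verit) atLeastAtMost_iff mult_left_mono norm_ge_zero)
      moreover have "2 * (norm (z s) * e) \<le> (norm (z s))\<^sup>2 + e\<^sup>2"
        using sum_squares_bound[of "norm (z s)" e] by simp
      ultimately have "2 * (z s \<bullet> z' s) \<le> K * (z s \<bullet> z s) + e\<^sup>2"
        by (simp add: K_def power2_norm_eq_inner[symmetric] power2_eq_square algebra_simps)
      then have "2 * (z s \<bullet> z' s) - K * (z s \<bullet> z s) \<le> e\<^sup>2" by simp
      then have "(2 * (z s \<bullet> z' s) - K * (z s \<bullet> z s)) * exp (- K * (s - a)) \<le> e\<^sup>2 * exp (- K * (s - a))"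
        by (intro mult_right_mono) auto
      also have "\<dots> \<le> e\<^sup>2 * 1"
      proof (rule mult_left_mono)
        have "K * (s - a) \<ge> 0" using s L by (intro mult_nonneg_nonneg) (auto simp: K_def)
        then show "exp (- K * (s - a)) \<le> 1" by simp
      qed simp
      finally show ?thesis by (simp add: algebra_simps)
    qed
    ultimately show "\<exists>y. (h has_real_derivative y) (at s) \<and> y \<le> 0" by blast
  qed
  then have "(norm (z b))\<^sup>2 * exp (- K * (b - a)) \<le> (norm (z a))\<^sup>2 + e\<^sup>2 * (b - a)"
    by (simp add: h_def power2_norm_eq_inner)
  from mult_right_mono[OF this, of "exp (K * (b - a))"]
  have "(norm (z b))\<^sup>2 * (exp (- K * (b - a)) * exp (K * (b - a)))
      \<le> ((norm (z a))\<^sup>2 + e\<^sup>2 * (b - a)) * exp (K * (b - a))" by simp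
  moreover have "exp (- K * (b - a)) * exp (K * (b - a)) = 1" by (simp flip: exp_add)
  ultimately show ?thesis unfolding K_def by (simp only: mult_1_right)
qed

lemma gronwall_forward:
  fixes z :: "real => 'a::real_inner"
  assumes z: "\<And>t. t \<in> {a..b} ==> (z has_vector_derivative z' t) (at t within {a..b})"
    and bnd: "\<And>t. t \<in> {a..b} ==> norm (z' t) \<le> L * norm (z t) + e"
    and ab: "a \<le> b" "b - a \<le> 1" and L: "L \<ge> 0" "e \<ge> 0"
  shows "norm (z b) \<le> (norm (z a) + e) * exp (L + 1)"
proof -
  have "(norm (z b))\<^sup>2 \<le> ((norm (z a))\<^sup>2 + e\<^sup>2 * (b - a)) * exp ((2 * L + 1) * (b - a))"
    by (rule gronwall_sq[OF z bnd ab(1) L(1)])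
  also have "\<dots> \<le> (norm (z a) + e)\<^sup>2 * exp (2 * (L + 1))"
  proof (rule mult_mono)
    have "e\<^sup>2 * (b - a) \<le> e\<^sup>2 * 1" using ab by (intro mult_left_mono) auto
    moreover have "2 * norm (z a) * e \<ge> 0" using L by simp
    ultimately show "(norm (z a))\<^sup>2 + e\<^sup>2 * (b - a) \<le> (norm (z a) + e)\<^sup>2"
      unfolding power2_sum by linarith
    have "(2 * L + 1) * (b - a) \<le> (2 * L + 1) * 1" using ab L by (intro mult_left_mono) auto
    then show "exp ((2 * L + 1) * (b - a)) \<le> exp (2 * (L + 1))" by simp
  qed auto
  also have "\<dots> = ((norm (z a) + e) * exp (L + 1))\<^sup>2"
    by (simp only: power_mult_distrib exp_double)
  finally show ?thesis by (rule power2_le_imp_le) (use L in auto)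
qed

text \<open>Holds in both time directions; the backward case is the forward one for r -> z (-
  r).\<close>

lemma gronwall:
  fixes z :: "real => 'a::real_inner"
  assumes z: "\<And>t. t \<in> I ==> (z has_vector_derivative z' t) (at t within I)"
    and bnd: "\<And>t. t \<in> I ==> norm (z' t) \<le> L * norm (z t) + e"
    and I: "convex I" "s \<in> I" "t \<in> I" "\<bar>t - s\<bar> \<le> 1" and L: "L \<ge> 0" "e \<ge> 0"
  shows "norm (z t) \<le> (norm (z s) + e) * exp (L + 1)"
proof (cases "s \<le> t")
  case True
  have sub: "{s..t} \<subseteq> I" using I True closed_segment_subset[of s I t] by (simp add: closed_segment_eq_real_ivl)
  show ?thesis
    by (rule gronwall_forward[of s t z z' L e])
      (use sub bnd True I L in \<open>auto intro!: has_vector_derivative_within_subset[OF z sub]\<close>)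
next
  case False
  then have sub: "{t..s} \<subseteq> I" using I closed_segment_subset[of t I s] by (simp add: closed_segment_eq_real_ivl)
  have "((\<lambda>r. z (- r)) has_vector_derivative - z' (- r)) (at r within {- s..- t})" if "r \<in> {- s..- t}" for r
  proof -
    have "(z has_vector_derivative z' (- r)) (at (- r) within uminus ` {- s..- t})"
    proof -
      have "- r \<in> I" "uminus ` {- s..- t} \<subseteq> I" using sub that by auto
      then show ?thesis using z has_vector_derivative_within_subset by blast
    qed
    moreover have "(uminus has_vector_derivative (- 1)) (at r within {- s..- t})"
      by (auto intro!: derivative_eq_intros)
    ultimately show ?thesis
      using vector_diff_chain_within[of uminus "- 1" r "{- s..- t}" z "z' (- r)"] by (simp add: o_def)
  qed
  from gronwall_forward[OF this, of L e] show ?thesis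
    using sub bnd I L False by (auto simp: subset_eq)
qed

lemma C1_lipschitz:
  fixes X :: "'a::real_normed_vector => 'b::real_normed_vector"
  assumes "convex K" "\<And>y. y \<in> K ==> (X has_derivative blinfun_apply (DX y)) (at y)"
    and "\<And>y. y \<in> K ==> norm (DX y) \<le> L" "x \<in> K" "y \<in> K"
  shows "norm (X x - X y) \<le> L * norm (x - y)"
  by (rule differentiable_bound[OF assms(1) _ _ assms(4,5), where f' = "\<lambda>y. blinfun_apply (DX y)"])
    (use assms(2,3) in \<open>auto intro: has_derivative_at_withinI simp: norm_blinfun.rep_eq[symmetric]\<close>)

lemma ode_unique:
  fixes X :: "'a::euclidean_space => 'a"
  assumes U: "open U" and X: "\<And>y. y \<in> U ==> (X has_derivative blinfun_apply (DX y)) (at y)"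
    and DX: "continuous_on U DX" and I: "convex I" "s \<in> I" "t \<in> I"
    and x: "\<And>r. r \<in> I ==> x r \<in> U \<and> (x has_vector_derivative X (x r)) (at r within I)"
    and y: "\<And>r. r \<in> I ==> y r \<in> U \<and> (y has_vector_derivative X (y r)) (at r within I)"
    and eq: "x s = y s"
  shows "x t = y t"
proof (rule interval_induction[of I s t "\<lambda>r. x r = y r"])
  show "connected I" using I convex_connected by blast
  fix r assume r: "r \<in> I"
  have cx: "continuous_on I x" "continuous_on I y"
    using x y has_vector_derivative_continuous continuous_on_eq_continuous_within by blast+
  obtain e where e: "e > 0" "cball (x r) e \<subseteq> U" using x[OF r] U open_contains_cball by blast
  have "compact (DX ` cball (x r) e)"
    by (intro compact_continuous_image continuous_on_subset[OF DX e(2)] compact_cball)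
  then obtain L where L: "\<And>q. q \<in> cball (x r) e ==> norm (DX q) \<le> L" "L \<ge> 0"
    using compact_imp_bounded bounded_pos by (metis imageI less_imp_le)
  have lip: "norm (X p - X q) \<le> L * norm (p - q)" if "p \<in> cball (x r) e" "q \<in> cball (x r) e" for p q
    by (rule C1_lipschitz[of "cball (x r) e" X DX]) (use e X L that in auto)
  \<comment> \<open>One radius for two cases. If x r = y r, both solutions stay near r in a ball on
    which X is Lipschitz. Otherwise half of their distance keeps them apart near r, so that equality
    at a nearby parameter is impossible.\<close>
  define \<mu> where "\<mu> = (if x r = y r then e else dist (x r) (y r) / 2)"
  have \<mu>: "\<mu> > 0" using e(1) by (simp add: \<mu>_def)
  obtain d1 where d1: "d1 > 0" "\<And>q. q \<in> I ==> dist q r < d1 ==> dist (x q) (x r) < \<mu>"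
    using cx(1) r \<mu> unfolding continuous_on_iff by metis
  obtain d2 where d2: "d2 > 0" "\<And>q. q \<in> I ==> dist q r < d2 ==> dist (y q) (y r) < \<mu>"
    using cx(2) r \<mu> unfolding continuous_on_iff by metis
  define d where "d = min (1/2) (min d1 d2)"
  have d: "d > 0" using d1 d2 by (simp add: d_def)
  let ?T = "I \<inter> ball r d"
  have near: "dist (x q) (x r) < \<mu>" "dist (y q) (y r) < \<mu>" if "q \<in> ?T" for q
    using d1(2)[of q] d2(2)[of q] that by (auto simp: d_def dist_commute)
  have "x b = y b" if ab: "a \<in> ?T" "b \<in> ?T" "x a = y a" for a b
  proof -
    have xy: "x r = y r"
    proof (rule ccontr)
      assume ne: "x r \<noteq> y r"
      then show False
        using near[OF ab(1)] ab(3) dist_triangle2[of "x r" "y r" "x a"] by (simp add: \<mu>_def dist_commute)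
    qed
    have inb: "x q \<in> cball (x r) e" "y q \<in> cball (x r) e" if "q \<in> ?T" for q
      using near[OF that] xy by (auto simp: \<mu>_def dist_commute less_imp_le)
    have "norm (x b - y b) \<le> (norm (x a - y a) + 0) * exp (L + 1)"
    proof (rule gronwall[of ?T "\<lambda>q. x q - y q" "\<lambda>q. X (x q) - X (y q)" L 0 a b])
      fix q assume q: "q \<in> ?T"
      then have "(x has_vector_derivative X (x q)) (at q within ?T)" "(y has_vector_derivative X (y q)) (at q within ?T)"
        using x y has_vector_derivative_within_subset by blast+
      then show "((\<lambda>q. x q - y q) has_vector_derivative X (x q) - X (y q)) (at q within ?T)"
        by (intro derivative_intros)
      show "norm (X (x q) - X (y q)) \<le> L * norm (x q - y q) + 0" using lip inb q by simp
    next
      show "convex ?T" using I convex_ball convex_Int by blast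
      have "dist r a < 1/2" "dist r b < 1/2" using ab by (auto simp: d_def)
      then show "\<bar>b - a\<bar> \<le> 1" unfolding dist_real_def by linarith
    qed (use ab L in auto)
    then show ?thesis using ab by simp
  qed
  then show "\<exists>e>0. \<forall>a\<in>I \<inter> ball r e. \<forall>b\<in>I \<inter> ball r e. x a = y a \<longrightarrow> x b = y b" using d by blast
qed (use I eq in auto)

text \<open>Banach's fixed point theorem for the integral operator on bounded continuous functions.
  These live on all of \<open>real\<close>, so the values outside [-T, T] are frozen by the clamp
  \<open>cl\<close>.\<close>

lemma picard:
  fixes f :: "real => 'a::banach => 'a"
  assumes T: "T > 0" and r: "r \<ge> 0" and L: "L \<ge> 0"
    and cont: "continuous_on ({-T..T} \<times> cball z0 r) (\<lambda>p. f (fst p) (snd p))"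
    and lip: "\<And>t z w. t \<in> {-T..T} ==> z \<in> cball z0 r ==> w \<in> cball z0 r ==> norm (f t z - f t w) \<le> L * norm (z - w)"
    and bnd: "\<And>t z. t \<in> {-T..T} ==> z \<in> cball z0 r ==> norm (f t z) \<le> B"
    and small: "B * T \<le> r" "L * T < 1"
  shows "\<exists>z. z 0 = z0 \<and> (\<forall>t\<in>{-T..T}. z t \<in> cball z0 r \<and>
           (z has_vector_derivative f t (z t)) (at t within {-T..T}))"
proof -
  define cl where "cl t = max (- T) (min T t)" for t :: real
  have cl: "cl t \<in> {-T..T}" "t \<in> {-T..T} ==> cl t = t" for t using T by (auto simp: cl_def)
  have ccl: "continuous_on S cl" for S unfolding cl_def by (intro continuous_intros)
  \<comment> \<open>Subtracting the integral up to 0 anchors the solution at 0, while all integrals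
    start at -T; one formula covers both signs of u.\<close>
  define I where "I x u = z0 + (integral {-T..u} (\<lambda>s. f s (apply_bcontfun x s)) - integral {-T..0} (\<lambda>s. f s (apply_bcontfun x s)))" for x u
  define S where "S = {x :: real \<Rightarrow>\<^sub>C 'a. \<forall>t. apply_bcontfun x t \<in> cball z0 r}"
  have fx: "continuous_on {-T..T} (\<lambda>s. f s (apply_bcontfun x s))" if "x \<in> S" for x
  proof -
    have "continuous_on {-T..T} ((\<lambda>p. f (fst p) (snd p)) \<circ> (\<lambda>s. (s, apply_bcontfun x s)))"
      by (rule continuous_on_compose) (auto intro!: continuous_intros continuous_on_subset[OF cont] simp: that[unfolded S_def, simplified])
    then show ?thesis by (simp add: o_def)
  qed
  have dI: "(I x has_vector_derivative f t (apply_bcontfun x t)) (at t within {-T..T})" if "x \<in> S" "t \<in> {-T..T}" for x t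
  proof -
    have "((\<lambda>u. integral {-T..u} (\<lambda>s. f s (apply_bcontfun x s))) has_vector_derivative f t (apply_bcontfun x t)) (at t within {-T..T})"
      by (rule integral_has_vector_derivative[OF fx[OF that(1)] that(2)])
    from has_vector_derivative_diff[OF this has_vector_derivative_const] 
    have "((\<lambda>u. (integral {-T..u} (\<lambda>s. f s (apply_bcontfun x s)) - integral {-T..0} (\<lambda>s. f s (apply_bcontfun x s)))) has_vector_derivative f t (apply_bcontfun x t)) (at t within {-T..T})"
      by simp
    from has_vector_derivative_add[OF has_vector_derivative_const this]
    show ?thesis unfolding I_def by simp
  qed
  have I0: "I x 0 = z0" for x by (simp add: I_def)
  have mv: "norm (g t - g 0) \<le> M * T" if dg: "\<And>t. t \<in> {-T..T} ==> (g has_vector_derivative g' t) (at t within {-T..T})"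
    and bd: "\<And>t. t \<in> {-T..T} ==> norm (g' t) \<le> M" and tT: "t \<in> {-T..T}" for g g' :: "real => 'a" and M t
  proof -
    have "norm (g t - g 0) \<le> M * norm (t - 0)"
    proof (rule differentiable_bound[of "{-T..T}" g "\<lambda>t h. h *\<^sub>R g' t"])
      show "onorm (\<lambda>h. h *\<^sub>R g' s) \<le> M" if "s \<in> {-T..T}" for s
        by (rule onorm_le) (use bd[OF that] in \<open>simp add: mult.commute[of M] mult_left_mono\<close>)
    qed (use dg tT T in \<open>auto simp: has_vector_derivative_def\<close>)
    also have "\<dots> \<le> M * T"
      using tT order_trans[OF norm_ge_zero bd[OF tT]] by (intro mult_left_mono) auto
    finally show ?thesis .
  qed
  have Ir: "I x (cl t) \<in> cball z0 r" if "x \<in> S" for x t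
  proof -
    have "norm (I x (cl t) - I x 0) \<le> B * T"
      by (rule mv[OF dI[OF that] _ cl(1)]) (use bnd that in \<open>auto simp: S_def\<close>)
    then show ?thesis using small by (simp add: I0 dist_norm norm_minus_commute)
  qed
  have Ic: "continuous_on UNIV (\<lambda>t. I x (cl t))" if "x \<in> S" for x
  proof (rule continuous_on_compose2[OF _ ccl])
    show "continuous_on {-T..T} (I x)"
      using dI[OF that] has_vector_derivative_continuous continuous_on_eq_continuous_within by blast
  qed (use cl in auto)
  define \<Phi> where "\<Phi> x = Bcontfun (\<lambda>t. I x (cl t))" for x
  have \<Phi>: "apply_bcontfun (\<Phi> x) t = I x (cl t)" if "x \<in> S" for x t
  proof -
    have "norm (I x (cl t)) \<le> norm z0 + r" for t
      using Ir[OF that, of t] norm_triangle_sub[of "I x (cl t)" z0] by (simp add: dist_norm norm_minus_commute)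
    then have "(\<lambda>t. I x (cl t)) \<in> bcontfun" using Ic[OF that] by (intro bcontfun_normI) auto
    then show ?thesis by (simp add: \<Phi>_def Bcontfun_inverse)
  qed
  have "\<exists>!x. x \<in> S \<and> \<Phi> x = x"
  proof (rule Banach_fix[of S "L * T"])
    have "S = PiC UNIV (\<lambda>_. cball z0 r)" by (simp add: S_def set_eq_iff mem_PiC_iff Pi_iff del: mem_cball)
    then show "complete S" using closed_PiC[of UNIV "\<lambda>_. cball z0 r"] complete_eq_closed by auto
    have "const_bcontfun z0 \<in> S" using r by (simp add: S_def)
    then show "S \<noteq> {}" by blast
    show "0 \<le> L * T" "L * T < 1" using T L small by auto
    show "\<Phi> ` S \<subseteq> S" using \<Phi> Ir by (auto simp: S_def simp del: mem_cball)
    show "dist (\<Phi> x) (\<Phi> y) \<le> L * T * dist x y" if xy: "x \<in> S" "y \<in> S" for x y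
    proof (rule dist_bound)
      fix t
      have "norm ((\<lambda>u. I x u - I y u) (cl t) - (\<lambda>u. I x u - I y u) 0) \<le> (L * dist x y) * T"
      proof (rule mv[OF _ _ cl(1)])
        show "((\<lambda>u. I x u - I y u) has_vector_derivative f t (apply_bcontfun x t) - f t (apply_bcontfun y t)) (at t within {-T..T})"
          if "t \<in> {-T..T}" for t
          by (intro has_vector_derivative_diff dI xy that)
        show "norm (f t (apply_bcontfun x t) - f t (apply_bcontfun y t)) \<le> L * dist x y" if "t \<in> {-T..T}" for t
        proof -
          have "norm (f t (apply_bcontfun x t) - f t (apply_bcontfun y t)) \<le> L * norm (apply_bcontfun x t - apply_bcontfun y t)"
            using xy by (intro lip that) (auto simp: S_def)
          also have "\<dots> \<le> L * dist x y"
            using L dist_bounded[of x t y] by (intro mult_left_mono) (auto simp: dist_norm)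
          finally show ?thesis .
        qed
      qed
      then show "dist (apply_bcontfun (\<Phi> x) t) (apply_bcontfun (\<Phi> y) t) \<le> L * T * dist x y"
        by (simp add: \<Phi> xy I0 dist_norm mult_ac)
    qed
  qed
  then obtain x where x: "x \<in> S" "\<Phi> x = x" by blast
  have xI: "apply_bcontfun x t = I x t" if "t \<in> {-T..T}" for t
    using \<Phi>[OF x(1), of t] cl(2)[OF that] x(2) by simp
  show ?thesis
  proof (intro exI[of _ "apply_bcontfun x"] conjI ballI)
    show "apply_bcontfun x 0 = z0" using xI[of 0] T I0 by simp
    fix t assume t: "t \<in> {-T..T}"
    show "apply_bcontfun x t \<in> cball z0 r" using x(1) by (simp add: S_def)
    show "(apply_bcontfun x has_vector_derivative f t (apply_bcontfun x t)) (at t within {-T..T})"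
      by (rule has_vector_derivative_transform[OF t xI dI[OF x(1) t]])
  qed
qed

section \<open>Strict differentiability and local flows\<close>

text \<open>Strict differentiability: increments between any two points near x are controlled, not
  only increments from x. The notion is closed under composition, makes f injective near x when f'
  is bounded below, and for flows it comes straight out of a Gronwall estimate.\<close>

definition strict_deriv :: "('a::real_normed_vector => 'b::real_normed_vector) => ('a => 'b) => 'a => bool"
  where "strict_deriv f f' x \<longleftrightarrow> bounded_linear f' \<and>
    (\<forall>e>0. \<exists>d>0. \<forall>y\<in>ball x d. \<forall>z\<in>ball x d. norm (f y - f z - f' (y - z)) \<le> e * norm (y - z))"

lemma strict_derivD:
  assumes "strict_deriv f f' x" "e > 0"
  obtains d where "d > 0" "\<And>y z. y \<in> ball x d ==> z \<in> ball x d ==>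
    norm (f y - f z - f' (y - z)) \<le> e * norm (y - z)"
  using assms unfolding strict_deriv_def by metis

lemma strict_deriv_bounded_linear: "strict_deriv f f' x ==> bounded_linear f'"
  by (simp add: strict_deriv_def)

lemma strict_deriv_has_derivative:
  assumes "strict_deriv f f' x"
  shows "(f has_derivative f') (at x)"
  unfolding has_derivative_within_alt
proof (intro conjI allI impI)
  show "bounded_linear f'" using assms by (simp add: strict_deriv_def)
  fix e :: real assume "e > 0"
  from strict_derivD[OF assms this] obtain d where
    d: "d > 0" "\<And>y z. y \<in> ball x d ==> z \<in> ball x d ==> norm (f y - f z - f' (y - z)) \<le> e * norm (y - z)" by blast
  then show "\<exists>d>0. \<forall>y\<in>UNIV. norm (y - x) < d \<longrightarrow> norm (f y - f x - f' (y - x)) \<le> e * norm (y - x)"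
    by (intro exI[of _ d]) (auto simp: dist_norm norm_minus_commute)
qed

lemma strict_deriv_linear: "bounded_linear f ==> strict_deriv f f x"
  unfolding strict_deriv_def by (auto simp: linear_simps intro: exI[of _ 1])

lemma strict_deriv_const: "strict_deriv (\<lambda>x. c) (\<lambda>h. 0) x"
  unfolding strict_deriv_def by (auto intro: exI[of _ 1])

lemma strict_deriv_Pair:
  assumes "strict_deriv f f' x" "strict_deriv g g' x"
  shows "strict_deriv (\<lambda>x. (f x, g x)) (\<lambda>h. (f' h, g' h)) x"
  unfolding strict_deriv_def
proof (intro conjI allI impI)
  show "bounded_linear (\<lambda>h. (f' h, g' h))"
    using assms by (intro bounded_linear_Pair) (auto simp: strict_deriv_def)
  fix e :: real assume "e > 0"
  then have e: "e / 2 > 0" by simp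
  obtain d1 where d1: "d1 > 0" "\<And>y z. y \<in> ball x d1 ==> z \<in> ball x d1 ==> norm (f y - f z - f' (y - z)) \<le> e / 2 * norm (y - z)"
    using strict_derivD[OF assms(1) e] by blast
  obtain d2 where d2: "d2 > 0" "\<And>y z. y \<in> ball x d2 ==> z \<in> ball x d2 ==> norm (g y - g z - g' (y - z)) \<le> e / 2 * norm (y - z)"
    using strict_derivD[OF assms(2) e] by blast
  show "\<exists>d>0. \<forall>y\<in>ball x d. \<forall>z\<in>ball x d. norm ((f y, g y) - (f z, g z) - (f' (y - z), g' (y - z))) \<le> e * norm (y - z)"
  proof (intro exI[of _ "min d1 d2"] conjI ballI)
    fix y z assume "y \<in> ball x (min d1 d2)" "z \<in> ball x (min d1 d2)"
    then have "norm (f y - f z - f' (y - z)) + norm (g y - g z - g' (y - z)) \<le> e / 2 * norm (y - z) + e / 2 * norm (y - z)"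
      by (intro add_mono d1(2) d2(2)) auto
    also have "\<dots> = e * norm (y - z)" by simp
    finally show "norm ((f y, g y) - (f z, g z) - (f' (y - z), g' (y - z))) \<le> e * norm (y - z)"
      using norm_Pair_le[of "f y - f z - f' (y - z)" "g y - g z - g' (y - z)"] by simp
  qed (use d1 d2 in auto)
qed

lemma strict_deriv_compose:
  assumes f: "strict_deriv f f' x" and g: "strict_deriv g g' (f x)"
  shows "strict_deriv (\<lambda>x. g (f x)) (\<lambda>h. g' (f' h)) x"
  unfolding strict_deriv_def
proof (intro conjI allI impI)
  have bl: "bounded_linear f'" "bounded_linear g'" using f g by (auto simp: strict_deriv_def)
  then show "bounded_linear (\<lambda>h. g' (f' h))" using bounded_linear_compose by blast
  fix e :: real assume e: "e > 0"
  obtain F where F: "F > 0" "\<And>h. norm (f' h) \<le> norm h * F" using bounded_linear.pos_bounded[OF bl(1)] by blast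
  obtain G where G: "G > 0" "\<And>h. norm (g' h) \<le> norm h * G" using bounded_linear.pos_bounded[OF bl(2)] by blast
  \<comment> \<open>The bound 1 makes f (F + 1)-Lipschitz near x; the bound e / (2 G) makes the
    error of f, pushed through g', cost e / 2. The other e / 2 is the error of g, through
    \<open>e2\<close>.\<close>
  define e1 where "e1 = min 1 (e / (2 * G))"
  define e2 where "e2 = e / (2 * (F + 1))"
  have e12: "e1 > 0" "e2 > 0" using e F G by (auto simp: e1_def e2_def)
  obtain d1 where d1: "d1 > 0" "\<And>y z. y \<in> ball x d1 ==> z \<in> ball x d1 ==> norm (f y - f z - f' (y - z)) \<le> e1 * norm (y - z)"
    using strict_derivD[OF f e12(1)] by blast
  obtain d2 where d2: "d2 > 0" "\<And>y z. y \<in> ball (f x) d2 ==> z \<in> ball (f x) d2 ==> norm (g y - g z - g' (y - z)) \<le> e2 * norm (y - z)"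
    using strict_derivD[OF g e12(2)] by blast
  have lip: "norm (f y - f z) \<le> (F + 1) * norm (y - z)" if "y \<in> ball x d1" "z \<in> ball x d1" for y z
  proof -
    have "norm (f y - f z) \<le> norm (f y - f z - f' (y - z)) + norm (f' (y - z))" by norm
    also have "\<dots> \<le> e1 * norm (y - z) + norm (y - z) * F" by (intro add_mono d1(2) F that)
    also have "\<dots> \<le> 1 * norm (y - z) + norm (y - z) * F" using F(1) by (intro add_mono mult_right_mono) (auto simp: e1_def)
    finally show ?thesis by (simp add: algebra_simps)
  qed
  define d where "d = min d1 (d2 / (F + 1))"
  show "\<exists>d>0. \<forall>y\<in>ball x d. \<forall>z\<in>ball x d. norm (g (f y) - g (f z) - g' (f' (y - z))) \<le> e * norm (y - z)"
  proof (intro exI[of _ d] conjI ballI)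
    show "d > 0" using d1 d2 F by (simp add: d_def)
    have inb: "f y \<in> ball (f x) d2" if "y \<in> ball x d" for y
    proof -
      have "norm (f y - f x) \<le> (F + 1) * norm (y - x)" using that d1 by (intro lip) (auto simp: d_def)
      also have "\<dots> < (F + 1) * (d2 / (F + 1))" using that F by (intro mult_strict_left_mono) (auto simp: d_def dist_norm norm_minus_commute)
      finally show ?thesis using F by (simp add: dist_norm norm_minus_commute)
    qed
    fix y z assume yz: "y \<in> ball x d" "z \<in> ball x d"
    then have yz1: "y \<in> ball x d1" "z \<in> ball x d1" by (auto simp: d_def)
    have "norm (g (f y) - g (f z) - g' (f' (y - z))) \<le> norm (g (f y) - g (f z) - g' (f y - f z)) + norm (g' (f y - f z - f' (y - z)))"
      using bl(2) by (simp add: linear_simps) norm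
    also have "\<dots> \<le> e2 * norm (f y - f z) + norm (f y - f z - f' (y - z)) * G"
      by (intro add_mono d2(2) inb yz G(2))
    also have "\<dots> \<le> e2 * ((F + 1) * norm (y - z)) + (e / (2 * G) * norm (y - z)) * G"
    proof (intro add_mono mult_left_mono mult_right_mono lip yz1)
      have "norm (f y - f z - f' (y - z)) \<le> e1 * norm (y - z)" by (rule d1(2)[OF yz1])
      also have "\<dots> \<le> e / (2 * G) * norm (y - z)" by (intro mult_right_mono) (auto simp: e1_def)
      finally show "norm (f y - f z - f' (y - z)) \<le> e / (2 * G) * norm (y - z)" .
    qed (use e12 G in auto)
    also have "\<dots> = e * norm (y - z)" using F G by (simp add: e2_def field_simps)
    finally show "norm (g (f y) - g (f z) - g' (f' (y - z))) \<le> e * norm (y - z)" .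
  qed
qed

lemma strict_deriv_cong:
  assumes "strict_deriv f f' x" "open S" "x \<in> S" "\<And>y. y \<in> S ==> f y = g y"
  shows "strict_deriv g f' x"
  unfolding strict_deriv_def
proof (intro conjI allI impI)
  show "bounded_linear f'" using assms by (simp add: strict_deriv_def)
  fix e :: real assume "e > 0"
  from strict_derivD[OF assms(1) this] obtain d where
    d: "d > 0" "\<And>y z. y \<in> ball x d ==> z \<in> ball x d ==> norm (f y - f z - f' (y - z)) \<le> e * norm (y - z)" by blast
  obtain r where r: "r > 0" "ball x r \<subseteq> S" using assms(2,3) open_contains_ball by blast
  show "\<exists>d>0. \<forall>y\<in>ball x d. \<forall>z\<in>ball x d. norm (g y - g z - f' (y - z)) \<le> e * norm (y - z)"
  proof (intro exI[of _ "min d r"] conjI ballI)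
    fix y z assume "y \<in> ball x (min d r)" "z \<in> ball x (min d r)"
    then have "y \<in> ball x d" "z \<in> ball x d" "y \<in> S" "z \<in> S" using r(2) by auto
    then show "norm (g y - g z - f' (y - z)) \<le> e * norm (y - z)" using d(2) assms(4) by metis
  qed (use d r in auto)
qed

lemma strict_deriv_continuous:
  "strict_deriv f f' x ==> isCont f x"
  using strict_deriv_has_derivative has_derivative_continuous by blast

lemma strict_deriv_C1:
  assumes U: "open U" "x \<in> U" and f: "\<And>y. y \<in> U ==> (f has_derivative f' y) (at y)"
    and c: "\<And>e. e > 0 ==> \<exists>d>0. \<forall>y\<in>ball x d. y \<in> U \<longrightarrow> (\<forall>h. norm (f' y h - f' x h) \<le> e * norm h)"
  shows "strict_deriv f (f' x) x"
  unfolding strict_deriv_def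
proof (intro conjI allI impI)
  show bl: "bounded_linear (f' x)" using f[OF U(2)] has_derivative_bounded_linear by blast
  fix e :: real assume e: "e > 0"
  obtain d where d: "d > 0" "\<And>y h. y \<in> ball x d ==> y \<in> U ==> norm (f' y h - f' x h) \<le> e * norm h"
    using c[OF e] by blast
  obtain r where r: "r > 0" "ball x r \<subseteq> U" using U open_contains_ball by blast
  show "\<exists>d>0. \<forall>y\<in>ball x d. \<forall>z\<in>ball x d. norm (f y - f z - f' x (y - z)) \<le> e * norm (y - z)"
  proof (intro exI[of _ "min d r"] conjI ballI)
    fix y z assume yz: "y \<in> ball x (min d r)" "z \<in> ball x (min d r)"
    have "norm ((\<lambda>y. f y - f' x y) y - (\<lambda>y. f y - f' x y) z) \<le> e * norm (y - z)"
    proof (rule differentiable_bound[OF convex_ball _ _ yz])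
      fix w assume w: "w \<in> ball x (min d r)"
      then have "w \<in> U" using r by auto
      then show "((\<lambda>y. f y - f' x y) has_derivative (\<lambda>h. f' w h - f' x h)) (at w within ball x (min d r))"
        by (intro has_derivative_diff has_derivative_at_withinI[OF f] bounded_linear_imp_has_derivative bl)
      have "norm (f' w h - f' x h) \<le> e * norm h" for h using d(2) w \<open>w \<in> U\<close> by simp
      then show "onorm (\<lambda>h. f' w h - f' x h) \<le> e" using e by (intro onorm_bound) auto
    qed
    then show "norm (f y - f z - f' x (y - z)) \<le> e * norm (y - z)"
      using bl by (simp add: linear_simps algebra_simps)
  qed (use d r in auto)
qed

text \<open>Radius and error are explicit, so that one modulus of continuity of \<open>DX\<close> on
  a compact set serves all points p of a trajectory at once; the flow needs this uniformity in
  time.\<close>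

lemma strict_deriv_uniform:
  fixes X :: "'a::real_normed_vector => 'b::real_normed_vector"
  assumes K: "convex K" "\<And>y. y \<in> K ==> (X has_derivative blinfun_apply (DX y)) (at y)"
    and c: "\<And>y. y \<in> K \<inter> ball p \<rho> ==> norm (DX y - DX p) \<le> \<eta>"
    and ab: "a \<in> K \<inter> ball p \<rho>" "b \<in> K \<inter> ball p \<rho>"
  shows "norm (X a - X b - blinfun_apply (DX p) (a - b)) \<le> \<eta> * norm (a - b)"
proof -
  have "norm ((\<lambda>y. X y - blinfun_apply (DX p) y) a - (\<lambda>y. X y - blinfun_apply (DX p) y) b) \<le> \<eta> * norm (a - b)"
  proof (rule differentiable_bound[OF convex_Int[OF K(1) convex_ball] _ _ ab])
    fix w assume w: "w \<in> K \<inter> ball p \<rho>"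
    show "((\<lambda>y. X y - blinfun_apply (DX p) y) has_derivative blinfun_apply (DX w - DX p)) (at w within K \<inter> ball p \<rho>)"
      using w by (auto intro!: derivative_eq_intros has_derivative_at_withinI[OF K(2)] bounded_linear_imp_has_derivative
          blinfun.bounded_linear_right simp: blinfun.diff_left)
    show "onorm (blinfun_apply (DX w - DX p)) \<le> \<eta>"
      using c[OF w] by (simp add: norm_blinfun.rep_eq)
  qed
  then show ?thesis by (simp add: blinfun.diff_right algebra_simps)
qed

text \<open>\<open>W\<close> solves the variational equation. The difference \<Phi> y1 - \<Phi> y2 -
  W (y1 - y2) starts at 0 and obeys a linear differential inequality whose forcing term is a small
  multiple of |y1 - y2|; Gronwall turns this into strict differentiability in the initial
  value.\<close>

theorem local_flow:
  fixes X :: "'a::euclidean_space => 'a" and DX :: "'a => 'a \<Rightarrow>\<^sub>L 'a"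
  assumes U: "open U" "y0 \<in> U" and X: "\<And>y. y \<in> U ==> (X has_derivative blinfun_apply (DX y)) (at y)"
    and DX: "continuous_on U DX"
  obtains \<delta> \<epsilon> :: real and \<Phi> :: "'a => real => 'a" and W :: "'a => real => 'a => 'a"
  where "\<delta> > 0" "\<epsilon> > 0" "\<And>y. y \<in> ball y0 \<delta> ==> \<Phi> y 0 = y"
    "\<And>y t. y \<in> ball y0 \<delta> ==> \<bar>t\<bar> < \<epsilon> ==> \<Phi> y t \<in> U \<and> (\<Phi> y has_vector_derivative X (\<Phi> y t)) (at t)"
    "\<And>y h. y \<in> ball y0 \<delta> ==> W y 0 h = h"
    "\<And>y t h. y \<in> ball y0 \<delta> ==> \<bar>t\<bar> < \<epsilon> ==>
       ((\<lambda>t. W y t h) has_vector_derivative blinfun_apply (DX (\<Phi> y t)) (W y t h)) (at t)"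
    "\<And>y t. y \<in> ball y0 \<delta> ==> \<bar>t\<bar> < \<epsilon> ==> strict_deriv (\<lambda>y. \<Phi> y t) (W y t) y"
proof -
  obtain r2 where r2: "r2 > 0" "cball y0 r2 \<subseteq> U" using U open_contains_cball by blast
  \<comment> \<open>Half of the radius leaves room: initial values in the ball of radius r move by
    at most r and remain in \<open>K\<close>.\<close>
  define r where "r = r2 / 2"
  define K where "K = cball y0 r2"
  have r: "r > 0" using r2 by (simp add: r_def)
  have K: "compact K" "convex K" "K \<subseteq> U" using r2 by (auto simp: K_def)
  have cb: "cball y r \<subseteq> K" if "y \<in> cball y0 r" for y
  proof
    fix x assume "x \<in> cball y r"
    then show "x \<in> K" using that dist_triangle[of y0 x y] by (simp add: K_def r_def)
  qed
  have "continuous_on K X"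
    using X K(3) has_derivative_continuous by (meson continuous_at_imp_continuous_on subsetD)
  then have "bounded (X ` K)" using K(1) compact_continuous_image compact_imp_bounded by blast
  then obtain B where B: "B > 0" "\<And>y. y \<in> K ==> norm (X y) \<le> B"
    unfolding bounded_pos by auto
  have cDX: "continuous_on K DX" using continuous_on_subset[OF DX K(3)] .
  then have "bounded (DX ` K)" using K(1) compact_continuous_image compact_imp_bounded by blast
  then obtain L where L: "L > 0" "\<And>y. y \<in> K ==> norm (DX y) \<le> L"
    unfolding bounded_pos by auto
  have lip: "norm (X p - X q) \<le> L * norm (p - q)" if "p \<in> K" "q \<in> K" for p q
    by (rule C1_lipschitz[of K X DX]) (use K X L that in auto)
  \<comment> \<open>B T \<le> r keeps solutions in their ball and L T < 1 gives the contraction. 2 L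
    T \<le> 1 does the first for \<open>W\<close>, which stays within distance 1 of the identity,
    where norms are at most 2. T \<le> 1/2 stays within the unit time of
    \<open>gronwall\<close>.\<close>
  define T where "T = min (1/2) (min (r / B) (1 / (4 * L)))"
  have T: "T > 0" "T \<le> 1/2" "B * T \<le> r" "2 * L * T \<le> 1" "L * T < 1"
  proof -
    show "T > 0" using r B L by (auto simp: T_def)
    show "T \<le> 1/2" by (simp only: T_def min.cobounded1)
    have "T \<le> r / B" "T \<le> 1 / (4 * L)" by (auto simp: T_def)
    then show "B * T \<le> r" "2 * L * T \<le> 1" "L * T < 1" using B L by (auto simp: field_simps)
  qed
  have "\<forall>y\<in>cball y0 r. \<exists>z. z 0 = y \<and> (\<forall>t\<in>{-T..T}. z t \<in> cball y r \<and> (z has_vector_derivative X (z t)) (at t within {-T..T}))"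
  proof
    fix y assume y: "y \<in> cball y0 r"
    have "continuous_on ({-T..T} \<times> cball y r) (X \<circ> snd)"
      by (rule continuous_on_compose) (auto intro!: continuous_intros continuous_on_subset[OF \<open>continuous_on K X\<close>] subsetD[OF cb[OF y]])
    then show "\<exists>z. z 0 = y \<and> (\<forall>t\<in>{-T..T}. z t \<in> cball y r \<and> (z has_vector_derivative X (z t)) (at t within {-T..T}))"
      using picard[of T r L y "\<lambda>t. X" B] T r L B(2) lip cb[OF y] by (auto simp: o_def subset_eq simp del: mem_cball)
  qed
  then obtain \<Phi> where \<Phi>0: "\<And>y. y \<in> cball y0 r ==> \<Phi> y 0 = y"
    and \<Phi>: "\<And>y t. y \<in> cball y0 r ==> t \<in> {-T..T} ==> \<Phi> y t \<in> cball y r"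
    and d\<Phi>: "\<And>y t. y \<in> cball y0 r ==> t \<in> {-T..T} ==> (\<Phi> y has_vector_derivative X (\<Phi> y t)) (at t within {-T..T})"
    by (subst (asm) bchoice_iff) blast
  have \<Phi>K: "\<Phi> y t \<in> K" if "y \<in> cball y0 r" "t \<in> {-T..T}" for y t using \<Phi>[OF that] cb[OF that(1)] by blast
  have "\<forall>y\<in>cball y0 r. \<exists>w. w 0 = id_blinfun \<and> (\<forall>t\<in>{-T..T}. w t \<in> cball id_blinfun 1 \<and>
      (w has_vector_derivative (DX (\<Phi> y t) o\<^sub>L w t)) (at t within {-T..T}))"
  proof
    fix y assume y: "y \<in> cball y0 r"
    have c\<Phi>: "continuous_on {-T..T} (\<Phi> y)"
      using d\<Phi>[OF y] has_vector_derivative_continuous continuous_on_eq_continuous_within by blast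
    have "continuous_on {-T..T} (\<lambda>t. DX (\<Phi> y t))"
      by (rule continuous_on_compose2[OF cDX c\<Phi>]) (use \<Phi>K[OF y] in auto)
    then have c: "continuous_on ({-T..T} \<times> cball id_blinfun 1) (\<lambda>p. DX (\<Phi> y (fst p)) o\<^sub>L snd p)"
      by (intro bounded_bilinear.continuous_on[OF bounded_bilinear_blinfun_compose] continuous_intros)
        (rule continuous_on_compose2, auto intro: continuous_intros)
    have l: "norm (DX (\<Phi> y t) o\<^sub>L z) \<le> L * norm z" if "t \<in> {-T..T}" for t z
      using norm_blinfun_compose[of "DX (\<Phi> y t)" z] L(2)[OF \<Phi>K[OF y that]]
      by (meson mult_right_mono norm_ge_zero order_trans)
    have n2: "norm z \<le> 2" if "z \<in> cball (id_blinfun :: 'a \<Rightarrow>\<^sub>L 'a) 1" for z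
      using that norm_blinfun_id_le[where 'a='a] norm_triangle_sub[of z id_blinfun] by (simp add: dist_norm norm_minus_commute)
    show "\<exists>w. w 0 = id_blinfun \<and> (\<forall>t\<in>{-T..T}. w t \<in> cball id_blinfun 1 \<and>
      (w has_vector_derivative (DX (\<Phi> y t) o\<^sub>L w t)) (at t within {-T..T}))"
    proof (rule picard[where L = L and B = "L * 2"])
      show "norm ((DX (\<Phi> y t) o\<^sub>L z) - (DX (\<Phi> y t) o\<^sub>L w)) \<le> L * norm (z - w)" if "t \<in> {-T..T}" for t z w
        using l[OF that, of "z - w"] by (simp add: bounded_bilinear.diff_right[OF bounded_bilinear_blinfun_compose])
      show "norm (DX (\<Phi> y t) o\<^sub>L z) \<le> L * 2" if "t \<in> {-T..T}" "z \<in> cball id_blinfun 1" for t z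
        by (rule order_trans[OF l[OF that(1)] mult_left_mono[OF n2[OF that(2)]]]) (use L in simp)
      show "L * 2 * T \<le> 1" using T(4) by (simp add: mult_ac)
      show "continuous_on ({-T..T} \<times> cball id_blinfun 1) (\<lambda>p. DX (\<Phi> y (fst p)) o\<^sub>L snd p)" by (rule c)
    qed (use T L in simp_all)
  qed
  then obtain W where W0: "\<And>y. y \<in> cball y0 r ==> W y 0 = id_blinfun"
    and dW: "\<And>y t. y \<in> cball y0 r ==> t \<in> {-T..T} ==> (W y has_vector_derivative (DX (\<Phi> y t) o\<^sub>L W y t)) (at t within {-T..T})"
    by (subst (asm) bchoice_iff) blast
  have dWh: "((\<lambda>t. blinfun_apply (W y t) h) has_vector_derivative blinfun_apply (DX (\<Phi> y t)) (blinfun_apply (W y t) h)) (at t within {-T..T})"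
    if "y \<in> cball y0 r" "t \<in> {-T..T}" for y t h
    using bounded_linear.has_vector_derivative[OF blinfun.bounded_linear_left dW[OF that], of h] by simp
  define C where "C = exp (L + 1)"
  have C: "C > 0" by (simp add: C_def)
  have gr: "norm (z t) \<le> (norm (z 0) + e) * C"
    if "\<And>t. t \<in> {-T..T} ==> (z has_vector_derivative z' t) (at t within {-T..T})"
      "\<And>t. t \<in> {-T..T} ==> norm (z' t) \<le> L * norm (z t) + e" "t \<in> {-T..T}" "e \<ge> 0" for z z' :: "real => 'a" and t e
    unfolding C_def by (rule gronwall[OF that(1,2)]) (use that T L in auto)
  have lipP: "norm (\<Phi> y t - \<Phi> y' t) \<le> C * norm (y - y')" if "y \<in> cball y0 r" "y' \<in> cball y0 r" "t \<in> {-T..T}" for y y' t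
  proof -
    have "norm (\<Phi> y t - \<Phi> y' t) \<le> (norm (\<Phi> y 0 - \<Phi> y' 0) + 0) * C"
      by (rule gr[OF has_vector_derivative_diff[OF d\<Phi> d\<Phi>]]) (use that lip \<Phi>K in auto)
    then show ?thesis using that \<Phi>0 by (simp add: mult.commute)
  qed
  have sd: "strict_deriv (\<lambda>y. \<Phi> y t) (blinfun_apply (W y t)) y" if y: "y \<in> ball y0 r" and t: "t \<in> {-T..T}" for y t
    unfolding strict_deriv_def
  proof (intro conjI allI impI)
    show "bounded_linear (blinfun_apply (W y t))" by (rule blinfun.bounded_linear_right)
    fix e :: real assume e: "e > 0"
    \<comment> \<open>One factor C is the Lipschitz constant of the flow, the other the Gronwall
      constant.\<close>
    define \<eta> where "\<eta> = e / (C * C)"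
    have \<eta>: "\<eta> > 0" using e C by (simp add: \<eta>_def)
    have "uniformly_continuous_on K DX" using compact_uniformly_continuous[OF cDX K(1)] .
    then obtain \<rho> where \<rho>: "\<rho> > 0" "\<And>p q. p \<in> K ==> q \<in> K ==> dist q p < \<rho> ==> dist (DX q) (DX p) < \<eta>"
      using \<eta> unfolding uniformly_continuous_on_def by metis
    obtain d1 where d1: "d1 > 0" "ball y d1 \<subseteq> ball y0 r" using y open_contains_ball by (metis open_ball)
    define d where "d = min d1 (\<rho> / C)"
    show "\<exists>d>0. \<forall>y1\<in>ball y d. \<forall>y2\<in>ball y d. norm (\<Phi> y1 t - \<Phi> y2 t - blinfun_apply (W y t) (y1 - y2)) \<le> e * norm (y1 - y2)"
    proof (intro exI[of _ d] conjI ballI)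
      show "d > 0" using d1 \<rho> C by (simp add: d_def)
      fix y1 y2 assume y12: "y1 \<in> ball y d" "y2 \<in> ball y d"
      have yc: "y \<in> cball y0 r" "y1 \<in> cball y0 r" "y2 \<in> cball y0 r"
        using y y12 d1(2) by (auto simp: d_def subset_eq less_imp_le)
      have near: "\<Phi> y' s \<in> K \<inter> ball (\<Phi> y s) \<rho>" if "y' \<in> ball y d" "y' \<in> cball y0 r" "s \<in> {-T..T}" for y' s
      proof -
        have "norm (\<Phi> y' s - \<Phi> y s) \<le> C * norm (y' - y)" by (rule lipP) (use that yc in auto)
        also have "\<dots> < C * (\<rho> / C)" using that C by (intro mult_strict_left_mono) (auto simp: d_def dist_norm norm_minus_commute)
        finally show ?thesis using C \<Phi>K[OF that(2,3)] by (simp add: dist_norm norm_minus_commute)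
      qed
      have "norm ((\<lambda>t. \<Phi> y1 t - \<Phi> y2 t - blinfun_apply (W y t) (y1 - y2)) t)
         \<le> (norm ((\<lambda>t. \<Phi> y1 t - \<Phi> y2 t - blinfun_apply (W y t) (y1 - y2)) 0) + \<eta> * (C * norm (y1 - y2))) * C"
      proof (rule gr)
        fix s assume s: "s \<in> {-T..T}"
        show "((\<lambda>t. \<Phi> y1 t - \<Phi> y2 t - blinfun_apply (W y t) (y1 - y2)) has_vector_derivative
           X (\<Phi> y1 s) - X (\<Phi> y2 s) - blinfun_apply (DX (\<Phi> y s)) (blinfun_apply (W y s) (y1 - y2))) (at s within {-T..T})"
          by (intro has_vector_derivative_diff d\<Phi> dWh yc s)
        define z where "z = \<Phi> y1 s - \<Phi> y2 s - blinfun_apply (W y s) (y1 - y2)"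
        have "norm (X (\<Phi> y1 s) - X (\<Phi> y2 s) - blinfun_apply (DX (\<Phi> y s)) (\<Phi> y1 s - \<Phi> y2 s)) \<le> \<eta> * norm (\<Phi> y1 s - \<Phi> y2 s)"
        proof (rule strict_deriv_uniform[of K])
          show "norm (DX p - DX (\<Phi> y s)) \<le> \<eta>" if "p \<in> K \<inter> ball (\<Phi> y s) \<rho>" for p
            using \<rho>(2)[of "\<Phi> y s" p] that \<Phi>K[OF yc(1) s] by (simp add: dist_norm norm_minus_commute less_imp_le)
        qed (use K X near y12 yc s in auto)
        also have "\<dots> \<le> \<eta> * (C * norm (y1 - y2))" using \<eta> lipP[OF yc(2,3) s] by (intro mult_left_mono) auto
        finally have 1: "norm (X (\<Phi> y1 s) - X (\<Phi> y2 s) - blinfun_apply (DX (\<Phi> y s)) (\<Phi> y1 s - \<Phi> y2 s)) \<le> \<eta> * (C * norm (y1 - y2))" .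
        have 2: "norm (blinfun_apply (DX (\<Phi> y s)) z) \<le> L * norm z"
          using norm_blinfun[of "DX (\<Phi> y s)" z] L(2)[OF \<Phi>K[OF yc(1) s]] by (meson mult_right_mono norm_ge_zero order_trans)
        have eq: "X (\<Phi> y1 s) - X (\<Phi> y2 s) - blinfun_apply (DX (\<Phi> y s)) (blinfun_apply (W y s) (y1 - y2))
          = (X (\<Phi> y1 s) - X (\<Phi> y2 s) - blinfun_apply (DX (\<Phi> y s)) (\<Phi> y1 s - \<Phi> y2 s)) + blinfun_apply (DX (\<Phi> y s)) z"
          by (simp add: z_def blinfun.diff_right)
        show "norm (X (\<Phi> y1 s) - X (\<Phi> y2 s) - blinfun_apply (DX (\<Phi> y s)) (blinfun_apply (W y s) (y1 - y2)))
          \<le> L * norm (\<Phi> y1 s - \<Phi> y2 s - blinfun_apply (W y s) (y1 - y2)) + \<eta> * (C * norm (y1 - y2))"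
          unfolding eq z_def[symmetric]
          using 1 2 norm_triangle_ineq[of "X (\<Phi> y1 s) - X (\<Phi> y2 s) - blinfun_apply (DX (\<Phi> y s)) (\<Phi> y1 s - \<Phi> y2 s)" "blinfun_apply (DX (\<Phi> y s)) z"]
          by linarith
      qed (use t \<eta> C in auto)
      then show "norm (\<Phi> y1 t - \<Phi> y2 t - blinfun_apply (W y t) (y1 - y2)) \<le> e * norm (y1 - y2)"
        using \<Phi>0 W0 yc C by (simp add: \<eta>_def)
    qed
  qed
  show thesis
  proof (rule that[of r T \<Phi> "\<lambda>y t. blinfun_apply (W y t)"])
    show "r > 0" "T > 0" by fact+
    show "\<Phi> y 0 = y" if "y \<in> ball y0 r" for y using \<Phi>0 that by simp
    show "blinfun_apply (W y 0) h = h" if "y \<in> ball y0 r" for y h using W0 that by simp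
    show "\<Phi> y t \<in> U \<and> (\<Phi> y has_vector_derivative X (\<Phi> y t)) (at t)" if "y \<in> ball y0 r" "\<bar>t\<bar> < T" for y t
      using \<Phi>K[of y t] d\<Phi>[of y t] K that by (auto simp: at_within_Icc_at abs_less_iff)
    show "((\<lambda>t. blinfun_apply (W y t) h) has_vector_derivative blinfun_apply (DX (\<Phi> y t)) (blinfun_apply (W y t) h)) (at t)"
      if "y \<in> ball y0 r" "\<bar>t\<bar> < T" for y t h
      using dWh[of y t h] that by (auto simp: at_within_Icc_at abs_less_iff)
    show "strict_deriv (\<lambda>y. \<Phi> y t) (blinfun_apply (W y t)) y" if "y \<in> ball y0 r" "\<bar>t\<bar> < T" for y t
      using sd[OF that(1), of t] that(2) by (simp add: abs_less_iff)
  qed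
qed

section \<open>Riemannian metric in one chart\<close>

lemma bounded_bilinear_matrix_vector:
  "bounded_bilinear ((*v) :: real ^ 'n ^ 'm => real ^ 'n => real ^ 'm)"
proof -
  have "bilinear ((*v) :: real ^ 'n ^ 'm => real ^ 'n => real ^ 'm)"
    unfolding bilinear_def
    by (intro conjI allI linearI)
      (simp_all add: matrix_vector_right_distrib matrix_vector_mult_add_rdistrib matrix_vector_mult_scaleR
        scaleR_matrix_vector_assoc)
  then show ?thesis by (simp add: bilinear_conv_bounded_bilinear)
qed

lemma has_derivative_vecI:
  fixes f :: "'a::real_normed_vector => 'i::finite => real"
  assumes "\<And>i. ((\<lambda>x. f x i) has_derivative (\<lambda>h. f' h i)) (at x within S)"
  shows "((\<lambda>x. \<chi> i. f x i) has_derivative (\<lambda>h. \<chi> i. f' h i)) (at x within S)"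
  unfolding has_derivative_componentwise_within[of "\<lambda>x. \<chi> i. f x i"]
  using assms by (auto simp: Basis_vec_def inner_axis)

lemma sum3_swap:
  "(\<Sum>i\<in>I. \<Sum>j\<in>J. \<Sum>m\<in>K. f i j m) = (\<Sum>m\<in>K. \<Sum>i\<in>I. \<Sum>j\<in>J. f i j m)"
proof -
  have "(\<Sum>i\<in>I. \<Sum>j\<in>J. \<Sum>m\<in>K. f i j m) = (\<Sum>i\<in>I. \<Sum>m\<in>K. \<Sum>j\<in>J. f i j m)"
    by (rule sum.cong[OF refl], rule sum.swap)
  also have "\<dots> = (\<Sum>m\<in>K. \<Sum>i\<in>I. \<Sum>j\<in>J. f i j m)" by (rule sum.swap)
  finally show ?thesis .
qed

definition ip :: "(real ^ 'n => real ^ 'n ^ 'n) => real ^ 'n => real ^ 'n => real ^ 'n::finite => real"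
  where "ip G x a b = a \<bullet> (G x *v b)"

definition Gam :: "(real ^ 'n => real ^ 'n ^ 'n) => real ^ 'n => real ^ 'n => real ^ 'n => real ^ 'n::finite"
  where "Gam G x a b = (\<chi> k. \<Sum>i\<in>UNIV. \<Sum>j\<in>UNIV. christoffel G k i j x * a $ i * b $ j)"

text \<open>Derivative of the coefficients of \<open>Gam\<close> in direction h with a and b held
  fixed; when base point and vectors all move, two \<open>Gam\<close> terms are added.
  \<open>dmet\<close> plays the same role for the metric.\<close>

definition dGam :: "(real ^ 'n => real ^ 'n ^ 'n) => real ^ 'n => real ^ 'n => real ^ 'n => real ^ 'n => real ^ 'n::finite"
  where "dGam G x h a b = (\<chi> k. \<Sum>i\<in>UNIV. \<Sum>j\<in>UNIV.
     (\<Sum>l\<in>UNIV. h $ l * partial_deriv l (christoffel G k i j) x) * a $ i * b $ j)"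

definition dmet :: "(real ^ 'n => real ^ 'n ^ 'n) => real ^ 'n => real ^ 'n => real ^ 'n => real ^ 'n::finite => real"
  where "dmet G x h a b = a \<bullet> ((\<Sum>l\<in>UNIV. h $ l *\<^sub>R partial_deriv l G x) *v b)"

lemma ip_lin:
  "ip G x (a + a') b = ip G x a b + ip G x a' b" "ip G x a (b + b') = ip G x a b + ip G x a b'"
  "ip G x (a - a') b = ip G x a b - ip G x a' b" "ip G x a (b - b') = ip G x a b - ip G x a b'"
  "ip G x (r *\<^sub>R a) b = r * ip G x a b" "ip G x a (r *\<^sub>R b) = r * ip G x a b"
  "ip G x (- a) b = - ip G x a b" "ip G x a (- b) = - ip G x a b"
  "ip G x 0 b = 0" "ip G x a 0 = 0"
  by (simp_all add: ip_def inner_simps matrix_vector_right_distrib matrix_vector_mult_scaleR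
      matrix_vector_mult_diff_distrib linear_neg[OF matrix_vector_mul_linear])

lemma Gam_lin:
  "Gam G x (a + a') b = Gam G x a b + Gam G x a' b" "Gam G x a (b + b') = Gam G x a b + Gam G x a b'"
  "Gam G x (r *\<^sub>R a) b = r *\<^sub>R Gam G x a b" "Gam G x a (r *\<^sub>R b) = r *\<^sub>R Gam G x a b"
  by (simp_all add: Gam_def vec_eq_iff algebra_simps sum.distrib sum_distrib_left)

lemma Gam_bilinear: "bilinear (Gam G x)"
  unfolding bilinear_def by (intro conjI allI linearI) (simp_all add: Gam_lin)

lemma Gam_lin':
  "Gam G x (a - a') b = Gam G x a b - Gam G x a' b" "Gam G x a (b - b') = Gam G x a b - Gam G x a b'"
  "Gam G x (- a) b = - Gam G x a b" "Gam G x a (- b) = - Gam G x a b"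
  "Gam G x 0 b = 0" "Gam G x a 0 = 0"
  by (rule bilinear_lsub[OF Gam_bilinear], rule bilinear_rsub[OF Gam_bilinear], rule bilinear_lneg[OF Gam_bilinear],
    rule bilinear_rneg[OF Gam_bilinear], rule bilinear_lzero[OF Gam_bilinear], rule bilinear_rzero[OF Gam_bilinear])

lemma dGam_lin:
  "dGam G x (h + h') a b = dGam G x h a b + dGam G x h' a b"
  "dGam G x h (a + a') b = dGam G x h a b + dGam G x h a' b" "dGam G x h a (b + b') = dGam G x h a b + dGam G x h a b'"
  "dGam G x (r *\<^sub>R h) a b = r *\<^sub>R dGam G x h a b"
  "dGam G x h (r *\<^sub>R a) b = r *\<^sub>R dGam G x h a b" "dGam G x h a (r *\<^sub>R b) = r *\<^sub>R dGam G x h a b"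
  by (simp_all add: dGam_def vec_eq_iff algebra_simps sum.distrib sum_distrib_left)

lemma dGam_zero: "dGam G x 0 a b = 0" "dGam G x h 0 b = 0" "dGam G x h a 0 = 0"
  by (simp_all add: dGam_def vec_eq_iff)

lemma Gam_axis: "Gam G x (axis i 1) (axis j 1) $ k = christoffel G k i j x"
  by (simp add: Gam_def axis_def if_distrib[of "\<lambda>r. r * _"] if_distrib[of "\<lambda>r. _ * r"] cong: if_cong)

text \<open>The index sums are converted once into bilinear notation; all later work with the
  curvature is algebra with \<open>Gam\<close> and \<open>dGam\<close>.\<close>

lemma curvature_Gam:
  fixes x :: "real ^ 'n"
  shows "curvature G x u v w = dGam G x u v w - dGam G x v u w + Gam G x u (Gam G x v w) - Gam G x v (Gam G x u w)"
proof -
  have d: "(\<Sum>i\<in>UNIV. \<Sum>j\<in>UNIV. \<Sum>k\<in>UNIV. partial_deriv i (christoffel G l j k) x * u $ i * v $ j * w $ k)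
      = dGam G x u v w $ l" for u v w :: "real ^ 'n" and l
  proof -
    have "dGam G x u v w $ l = (\<Sum>j\<in>UNIV. \<Sum>k\<in>UNIV. \<Sum>i\<in>UNIV. partial_deriv i (christoffel G l j k) x * u $ i * v $ j * w $ k)"
      by (simp only: dGam_def vec_lambda_beta sum_distrib_right) (intro sum.cong refl, simp only: mult_ac)
    also have "\<dots> = (\<Sum>i\<in>UNIV. \<Sum>j\<in>UNIV. \<Sum>k\<in>UNIV. partial_deriv i (christoffel G l j k) x * u $ i * v $ j * w $ k)"
      by (rule sum3_swap)
    finally show ?thesis by simp
  qed
  have g: "(\<Sum>i\<in>UNIV. \<Sum>j\<in>UNIV. \<Sum>k\<in>UNIV. (\<Sum>m\<in>UNIV. christoffel G m j k x * christoffel G l i m x) * u $ i * v $ j * w $ k)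
      = Gam G x u (Gam G x v w) $ l" for u v w :: "real ^ 'n" and l
  proof -
    have "Gam G x u (Gam G x v w) $ l = (\<Sum>i\<in>UNIV. \<Sum>m\<in>UNIV. \<Sum>j\<in>UNIV. \<Sum>k\<in>UNIV.
        christoffel G m j k x * christoffel G l i m x * u $ i * v $ j * w $ k)"
      by (simp add: Gam_def sum_distrib_left mult_ac)
    also have "\<dots> = (\<Sum>i\<in>UNIV. \<Sum>j\<in>UNIV. \<Sum>k\<in>UNIV. \<Sum>m\<in>UNIV.
        christoffel G m j k x * christoffel G l i m x * u $ i * v $ j * w $ k)"
      by (rule sum.cong[OF refl], rule sum3_swap[symmetric])
    finally show ?thesis by (simp add: sum_distrib_right)
  qed
  have sw: "(\<Sum>i\<in>UNIV. \<Sum>j\<in>UNIV. \<Sum>k\<in>UNIV. f i j k * u $ i * v $ j * w $ k)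
      = (\<Sum>i\<in>UNIV. \<Sum>j\<in>UNIV. \<Sum>k\<in>UNIV. f j i k * v $ i * u $ j * w $ k)" for f :: "'n => 'n => 'n => real"
    by (subst sum.swap) (simp add: mult_ac)
  have "curvature G x u v w $ l = (dGam G x u v w - dGam G x v u w + Gam G x u (Gam G x v w) - Gam G x v (Gam G x u w)) $ l" for l
  proof -
    have "curvature G x u v w $ l =
      (\<Sum>i\<in>UNIV. \<Sum>j\<in>UNIV. \<Sum>k\<in>UNIV. partial_deriv i (christoffel G l j k) x * u $ i * v $ j * w $ k)
      - (\<Sum>i\<in>UNIV. \<Sum>j\<in>UNIV. \<Sum>k\<in>UNIV. partial_deriv j (christoffel G l i k) x * u $ i * v $ j * w $ k)
      + (\<Sum>i\<in>UNIV. \<Sum>j\<in>UNIV. \<Sum>k\<in>UNIV. (\<Sum>m\<in>UNIV. christoffel G m j k x * christoffel G l i m x) * u $ i * v $ j * w $ k)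
      - (\<Sum>i\<in>UNIV. \<Sum>j\<in>UNIV. \<Sum>k\<in>UNIV. (\<Sum>m\<in>UNIV. christoffel G m i k x * christoffel G l j m x) * u $ i * v $ j * w $ k)"
      by (simp add: curvature_def riem_coeff_def sum_subtractf algebra_simps flip: sum.distrib)
    also have "(\<Sum>i\<in>UNIV. \<Sum>j\<in>UNIV. \<Sum>k\<in>UNIV. partial_deriv j (christoffel G l i k) x * u $ i * v $ j * w $ k) = dGam G x v u w $ l"
      using sw[of "\<lambda>i j k. partial_deriv j (christoffel G l i k) x"] d[where u=v and v=u] by simp
    also have "(\<Sum>i\<in>UNIV. \<Sum>j\<in>UNIV. \<Sum>k\<in>UNIV. (\<Sum>m\<in>UNIV. christoffel G m i k x * christoffel G l j m x) * u $ i * v $ j * w $ k) = Gam G x v (Gam G x u w) $ l"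
      using sw[of "\<lambda>i j k. \<Sum>m\<in>UNIV. christoffel G m i k x * christoffel G l j m x"] g[where u=v and v=u] by simp
    finally show ?thesis by (simp add: d g)
  qed
  then show ?thesis unfolding vec_eq_iff by blast
qed

text \<open>A metric on a single coordinate domain. All local tensor computations take place here
  and are instantiated with the image of a chart c and \<open>g c\<close>.\<close>

locale chart_metric =
  fixes D :: "(real ^ 'n::finite) set" and G :: "real ^ 'n => real ^ 'n ^ 'n"
  assumes D: "open D" and G_smooth: "smooth_on D G"
    and G_sym: "\<And>x. x \<in> D ==> transpose (G x) = G x"
    and G_pos: "\<And>x v. x \<in> D ==> v \<noteq> 0 ==> v \<bullet> (G x *v v) > 0"
begin

lemma ip_sym: "x \<in> D ==> ip G x a b = ip G x b a"
  unfolding ip_def using inner_symmetric_matrix[OF G_sym] .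

lemma ip_pos: "x \<in> D ==> v \<noteq> 0 ==> ip G x v v > 0"
  unfolding ip_def by (rule G_pos)

lemma ip_nonneg: "x \<in> D ==> ip G x v v \<ge> 0"
  using ip_pos[of x v] by (cases "v = 0") (auto simp: ip_lin)

lemma ip_eqI:
  assumes "x \<in> D" "\<And>e. ip G x a e = ip G x b e"
  shows "a = b"
  using ip_pos[OF assms(1), of "a - b"] assms(2) by (auto simp: ip_lin)

lemma Ck_G: "Ck_on k D G"
  using G_smooth by (simp add: smooth_on_def)

lemma Ck_G_entry: "Ck_on k D (\<lambda>x. G x $ i $ j)"
  by (rule Ck_on_bounded_linear[OF _ D Ck_G])
    (rule bounded_linear_compose[OF bounded_linear_vec_nth bounded_linear_vec_nth])

lemma det_G: "x \<in> D ==> det (G x) \<noteq> 0"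
proof -
  assume x: "x \<in> D"
  have "G x *v v = 0 ==> v = 0" for v using G_pos[OF x, of v] by auto
  then have "invertible (G x)" by (simp add: invertible_left_inverse matrix_left_invertible_ker)
  then show ?thesis by (simp add: invertible_det_nz)
qed

lemma Ck_christoffel: "Ck_on k D (christoffel G p i j)"
proof -
  have e: "Ck_on k D (partial_deriv l (\<lambda>y. G y $ i $ j))" for l i j
    using Ck_G_entry[of "Suc k" i j] by simp
  have eq: "christoffel G p i j = (\<lambda>x. (1 / 2) * (\<Sum>l\<in>UNIV. matrix_inv (G x) $ p $ l *
      (partial_deriv i (\<lambda>y. G y $ j $ l) x + partial_deriv j (\<lambda>y. G y $ i $ l) x
        + (- 1) * partial_deriv l (\<lambda>y. G y $ i $ j) x)))"
    by (simp add: christoffel_def fun_eq_iff)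
  show ?thesis unfolding eq
    by (intro Ck_on_mult[OF D] Ck_on_sum[OF D] Ck_on_add[OF D] Ck_on_const Ck_on_matrix_inv[OF D]
        Ck_G_entry det_G e)
qed

lemma has_derivative_christoffel:
  assumes "x \<in> D"
  shows "(christoffel G p i j has_derivative (\<lambda>h. \<Sum>l\<in>UNIV. h $ l * partial_deriv l (christoffel G p i j) x)) (at x)"
  using has_derivative_partial[OF Ck_on_differentiable[OF D Ck_christoffel[of "Suc 0"] assms]] by simp

lemma continuous_partial_christoffel: "continuous_on D (partial_deriv l (christoffel G p i j))"
  using Ck_christoffel[of "Suc 0" p i j] by simp

lemma continuous_christoffel: "continuous_on D (christoffel G p i j)"
  using Ck_christoffel[of 0 p i j] by simp

lemma has_derivative_G:
  assumes "x \<in> D"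
  shows "(G has_derivative (\<lambda>h. \<Sum>l\<in>UNIV. h $ l *\<^sub>R partial_deriv l G x)) (at x)"
  by (rule has_derivative_partial[OF Ck_on_differentiable[OF D Ck_G[of "Suc 0"] assms]])

lemma has_derivative_ip:
  assumes x: "(x has_derivative x') (at s within S)" "x s \<in> D"
    and a: "(a has_derivative a') (at s within S)" and b: "(b has_derivative b') (at s within S)"
  shows "((\<lambda>s. ip G (x s) (a s) (b s)) has_derivative
     (\<lambda>h. dmet G (x s) (x' h) (a s) (b s) + ip G (x s) (a' h) (b s) + ip G (x s) (a s) (b' h))) (at s within S)"
proof -
  have "((\<lambda>s. G (x s)) has_derivative (\<lambda>h. \<Sum>l\<in>UNIV. x' h $ l *\<^sub>R partial_deriv l G (x s))) (at s within S)"
    by (rule has_derivative_compose[OF x(1) has_derivative_G[OF x(2)]])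
  from bounded_bilinear.FDERIV[OF bounded_bilinear_inner a bounded_bilinear.FDERIV[OF bounded_bilinear_matrix_vector this b]]
  show ?thesis by (simp add: ip_def dmet_def inner_add_right algebra_simps)
qed

lemma has_derivative_Gam:
  assumes x: "(x has_derivative x') (at s within S)" "x s \<in> D"
    and a: "(a has_derivative a') (at s within S)" and b: "(b has_derivative b') (at s within S)"
  shows "((\<lambda>s. Gam G (x s) (a s) (b s)) has_derivative
     (\<lambda>h. dGam G (x s) (x' h) (a s) (b s) + Gam G (x s) (a' h) (b s) + Gam G (x s) (a s) (b' h))) (at s within S)"
proof -
  have ab: "((\<lambda>s. a s $ i) has_derivative (\<lambda>h. a' h $ i)) (at s within S)" "((\<lambda>s. b s $ i) has_derivative (\<lambda>h. b' h $ i)) (at s within S)" for i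
    using bounded_linear.has_derivative[OF bounded_linear_vec_nth a] bounded_linear.has_derivative[OF bounded_linear_vec_nth b] by auto
  have "((\<lambda>s. \<Sum>i\<in>UNIV. \<Sum>j\<in>UNIV. christoffel G k i j (x s) * a s $ i * b s $ j) has_derivative
    (\<lambda>h. \<Sum>i\<in>UNIV. \<Sum>j\<in>UNIV. christoffel G k i j (x s) * a s $ i * b' h $ j
       + (christoffel G k i j (x s) * a' h $ i + (\<Sum>l\<in>UNIV. x' h $ l * partial_deriv l (christoffel G k i j) (x s)) * a s $ i) * b s $ j)) (at s within S)" for k
    by (intro has_derivative_sum has_derivative_mult ab has_derivative_compose[OF x(1) has_derivative_christoffel[OF x(2)]])
  then have "((\<lambda>s. \<chi> k. \<Sum>i\<in>UNIV. \<Sum>j\<in>UNIV. christoffel G k i j (x s) * a s $ i * b s $ j) has_derivative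
    (\<lambda>h. \<chi> k. \<Sum>i\<in>UNIV. \<Sum>j\<in>UNIV. christoffel G k i j (x s) * a s $ i * b' h $ j
       + (christoffel G k i j (x s) * a' h $ i + (\<Sum>l\<in>UNIV. x' h $ l * partial_deriv l (christoffel G k i j) (x s)) * a s $ i) * b s $ j)) (at s within S)"
    by (rule has_derivative_vecI)
  moreover have "(\<chi> k. \<Sum>i\<in>UNIV. \<Sum>j\<in>UNIV. christoffel G k i j (x s) * a s $ i * b' h $ j
       + (christoffel G k i j (x s) * a' h $ i + (\<Sum>l\<in>UNIV. x' h $ l * partial_deriv l (christoffel G k i j) (x s)) * a s $ i) * b s $ j)
     = dGam G (x s) (x' h) (a s) (b s) + Gam G (x s) (a' h) (b s) + Gam G (x s) (a s) (b' h)" for h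
    unfolding vec_eq_iff vec_lambda_beta vector_add_component dGam_def Gam_def
    by (simp only: distrib_right sum.distrib) simp
  ultimately show ?thesis unfolding Gam_def[symmetric] by simp
qed

lemma has_vector_derivative_ip:
  assumes "(x has_vector_derivative x') (at s within S)" "x s \<in> D"
    "(a has_vector_derivative a') (at s within S)" "(b has_vector_derivative b') (at s within S)"
  shows "((\<lambda>s. ip G (x s) (a s) (b s)) has_vector_derivative
     dmet G (x s) x' (a s) (b s) + ip G (x s) a' (b s) + ip G (x s) (a s) b') (at s within S)"
proof -
  have "dmet G (x s) (r *\<^sub>R h) u v = r * dmet G (x s) h u v" for r h u v
    by (simp add: dmet_def flip: scaleR_scaleR scaleR_sum_right scaleR_matrix_vector_assoc)
  then show ?thesis
    using has_derivative_ip[OF assms(1)[unfolded has_vector_derivative_def] assms(2)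
        assms(3)[unfolded has_vector_derivative_def] assms(4)[unfolded has_vector_derivative_def]]
    unfolding has_vector_derivative_def by (simp add: ip_lin algebra_simps)
qed

lemma has_vector_derivative_Gam:
  assumes "(x has_vector_derivative x') (at s within S)" "x s \<in> D"
    "(a has_vector_derivative a') (at s within S)" "(b has_vector_derivative b') (at s within S)"
  shows "((\<lambda>s. Gam G (x s) (a s) (b s)) has_vector_derivative
     dGam G (x s) x' (a s) (b s) + Gam G (x s) a' (b s) + Gam G (x s) (a s) b') (at s within S)"
  using has_derivative_Gam[OF assms(1)[unfolded has_vector_derivative_def] assms(2)
      assms(3)[unfolded has_vector_derivative_def] assms(4)[unfolded has_vector_derivative_def]]
  unfolding has_vector_derivative_def by (simp add: Gam_lin dGam_lin algebra_simps)

lemma partial_deriv_G_entry: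
  assumes "x \<in> D"
  shows "partial_deriv l (\<lambda>y. G y $ i $ j) x = partial_deriv l G x $ i $ j"
proof -
  have "bounded_linear (\<lambda>M :: real ^ 'n ^ 'n. M $ i $ j)"
    by (rule bounded_linear_compose[OF bounded_linear_vec_nth bounded_linear_vec_nth])
  from partial_deriv_eqI[OF bounded_linear.has_derivative[OF this has_derivative_G[OF assms]], of l]
  show ?thesis by (simp only: partial_deriv_axis)
qed

lemma partial_deriv_G_sym:
  assumes "x \<in> D"
  shows "partial_deriv l G x $ i $ j = partial_deriv l G x $ j $ i"
proof -
  have "G y $ i $ j = G y $ j $ i" if "y \<in> D" for y
    using G_sym[OF that] by (metis transpose_def vec_lambda_beta)
  then have "partial_deriv l (\<lambda>y. G y $ i $ j) x = partial_deriv l (\<lambda>y. G y $ j $ i) x"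
    by (rule partial_deriv_cong_open[OF D assms])
  then show ?thesis using partial_deriv_G_entry[OF assms] by simp
qed

lemma dmet_expand:
  "dmet G x h a b = (\<Sum>i\<in>UNIV. \<Sum>j\<in>UNIV. \<Sum>l\<in>UNIV. h $ l * a $ i * b $ j * partial_deriv l G x $ i $ j)"
  by (simp add: dmet_def inner_vec_def matrix_vector_mult_def sum_component sum_distrib_left sum_distrib_right mult_ac)

lemma dmet_sym: "x \<in> D ==> dmet G x h a b = dmet G x h b a"
  unfolding dmet_expand by (subst sum.swap) (simp add: partial_deriv_G_sym mult_ac)

text \<open>Koszul formula for constant vector fields: pairing with G undoes the inverse matrix in
  \<open>christoffel\<close>. It determines \<open>Gam\<close> by first derivatives of the metric,
  whence its symmetry and its behaviour under isometries.\<close>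

lemma ip_Gam:
  assumes x: "x \<in> D"
  shows "ip G x (Gam G x a b) e = (1 / 2) * (dmet G x a b e + dmet G x b a e - dmet G x e a b)"
proof -
  let ?P = "\<lambda>l i j. partial_deriv l G x $ i $ j"
  define w :: "real ^ 'n" where "w = (\<chi> l. \<Sum>i\<in>UNIV. \<Sum>j\<in>UNIV. a $ i * b $ j * (?P i j l + ?P j i l - ?P l i j))"
  have "Gam G x a b = (1 / 2) *\<^sub>R (matrix_inv (G x) *v w)"
  proof -
    have "Gam G x a b $ k = (1 / 2) * (\<Sum>l\<in>UNIV. matrix_inv (G x) $ k $ l * w $ l)" for k
    proof -
      have "(\<Sum>i\<in>UNIV. \<Sum>j\<in>UNIV. \<Sum>l\<in>UNIV. matrix_inv (G x) $ k $ l * (a $ i * b $ j * (?P i j l + ?P j i l - ?P l i j)))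
        = (\<Sum>l\<in>UNIV. \<Sum>i\<in>UNIV. \<Sum>j\<in>UNIV. matrix_inv (G x) $ k $ l * (a $ i * b $ j * (?P i j l + ?P j i l - ?P l i j)))"
        by (rule sum3_swap)
      then have "(\<Sum>i\<in>UNIV. \<Sum>j\<in>UNIV. \<Sum>l\<in>UNIV. matrix_inv (G x) $ k $ l * (?P i j l + ?P j i l - ?P l i j) * a $ i * b $ j)
        = (\<Sum>l\<in>UNIV. matrix_inv (G x) $ k $ l * w $ l)"
        by (simp add: w_def sum_distrib_left mult_ac)
      then show ?thesis
        by (simp add: Gam_def christoffel_def partial_deriv_G_entry[OF x] sum_distrib_right sum_divide_distrib[symmetric])
    qed
    then show ?thesis by (simp add: vec_eq_iff matrix_vector_mult_def)
  qed
  moreover have "ip G x (matrix_inv (G x) *v w) e = w \<bullet> e"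
  proof -
    have "ip G x (matrix_inv (G x) *v w) e = e \<bullet> (G x *v (matrix_inv (G x) *v w))"
      using ip_sym[OF x] by (simp add: ip_def)
    also have "\<dots> = e \<bullet> w"
      using matrix_inv_mult(1)[of "G x"] det_G[OF x]
      by (simp add: invertible_det_nz matrix_vector_mul_assoc)
    finally show ?thesis by (simp add: inner_commute)
  qed
  moreover have "w \<bullet> e = dmet G x a b e + dmet G x b a e - dmet G x e a b"
  proof -
    have "w \<bullet> e = (\<Sum>l\<in>UNIV. \<Sum>i\<in>UNIV. \<Sum>j\<in>UNIV. a $ i * b $ j * e $ l * ?P i j l
       + a $ i * b $ j * e $ l * ?P j i l - a $ i * b $ j * e $ l * ?P l i j)"
      by (simp only: w_def inner_vec_def inner_real_def vec_lambda_beta sum_distrib_right)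
        (intro sum.cong refl, simp only: ring_distribs mult_ac)
    then have w: "w \<bullet> e = (\<Sum>l\<in>UNIV. \<Sum>i\<in>UNIV. \<Sum>j\<in>UNIV. a $ i * b $ j * e $ l * ?P i j l)
       + (\<Sum>l\<in>UNIV. \<Sum>i\<in>UNIV. \<Sum>j\<in>UNIV. a $ i * b $ j * e $ l * ?P j i l)
       - (\<Sum>l\<in>UNIV. \<Sum>i\<in>UNIV. \<Sum>j\<in>UNIV. a $ i * b $ j * e $ l * ?P l i j)"
      by (simp only: sum.distrib sum_subtractf)
    have 1: "dmet G x a b e = (\<Sum>l\<in>UNIV. \<Sum>i\<in>UNIV. \<Sum>j\<in>UNIV. a $ i * b $ j * e $ l * ?P i j l)"
    proof -
      have "dmet G x a b e = (\<Sum>j\<in>UNIV. \<Sum>l\<in>UNIV. \<Sum>i\<in>UNIV. a $ i * b $ j * e $ l * ?P i j l)"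
        by (simp add: dmet_expand mult_ac)
      also have "\<dots> = (\<Sum>l\<in>UNIV. \<Sum>j\<in>UNIV. \<Sum>i\<in>UNIV. a $ i * b $ j * e $ l * ?P i j l)" by (rule sum.swap)
      also have "\<dots> = (\<Sum>l\<in>UNIV. \<Sum>i\<in>UNIV. \<Sum>j\<in>UNIV. a $ i * b $ j * e $ l * ?P i j l)"
        by (rule sum.cong[OF refl], rule sum.swap)
      finally show ?thesis .
    qed
    have 2: "dmet G x b a e = (\<Sum>l\<in>UNIV. \<Sum>i\<in>UNIV. \<Sum>j\<in>UNIV. a $ i * b $ j * e $ l * ?P j i l)"
    proof -
      have "dmet G x b a e = (\<Sum>i\<in>UNIV. \<Sum>l\<in>UNIV. \<Sum>j\<in>UNIV. a $ i * b $ j * e $ l * ?P j i l)"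
        by (simp add: dmet_expand mult_ac)
      also have "\<dots> = (\<Sum>l\<in>UNIV. \<Sum>i\<in>UNIV. \<Sum>j\<in>UNIV. a $ i * b $ j * e $ l * ?P j i l)" by (rule sum.swap)
      finally show ?thesis .
    qed
    have 3: "dmet G x e a b = (\<Sum>l\<in>UNIV. \<Sum>i\<in>UNIV. \<Sum>j\<in>UNIV. a $ i * b $ j * e $ l * ?P l i j)"
    proof -
      have "dmet G x e a b = (\<Sum>i\<in>UNIV. \<Sum>j\<in>UNIV. \<Sum>l\<in>UNIV. a $ i * b $ j * e $ l * ?P l i j)"
        by (simp add: dmet_expand mult_ac)
      also have "\<dots> = (\<Sum>l\<in>UNIV. \<Sum>i\<in>UNIV. \<Sum>j\<in>UNIV. a $ i * b $ j * e $ l * ?P l i j)" by (rule sum3_swap)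
      finally show ?thesis .
    qed
    show ?thesis unfolding w 1 2 3 ..
  qed
  ultimately show ?thesis by (simp add: ip_lin)
qed

lemma Gam_sym: "x \<in> D ==> Gam G x a b = Gam G x b a"
  by (rule ip_eqI, assumption) (simp add: ip_Gam dmet_sym[of x _ a b])

text \<open>Metric compatibility of the connection: in the sum of two Koszul formulas the
  derivatives along a and b cancel.\<close>

lemma dmet_Gam:
  assumes "x \<in> D"
  shows "dmet G x h a b = ip G x (Gam G x h a) b + ip G x a (Gam G x h b)"
proof -
  have "ip G x a (Gam G x h b) = (1 / 2) * (dmet G x h a b + dmet G x b h a - dmet G x a h b)"
    unfolding ip_sym[OF assms, of a] ip_Gam[OF assms] dmet_sym[OF assms, of h b a] ..
  moreover have "ip G x (Gam G x h a) b = (1 / 2) * (dmet G x h a b + dmet G x a h b - dmet G x b h a)"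
    by (rule ip_Gam[OF assms])
  ultimately show ?thesis by simp
qed

lemma dGam_sym:
  assumes "x \<in> D"
  shows "dGam G x h a b = dGam G x h b a"
proof -
  have "christoffel G k i j y = christoffel G k j i y" if "y \<in> D" for k i j y
    using Gam_sym[OF that, of "axis i 1" "axis j 1"] Gam_axis by metis
  then have p: "partial_deriv l (christoffel G k i j) x = partial_deriv l (christoffel G k j i) x" for l k i j
    by (rule partial_deriv_cong_open[OF D assms])
  show ?thesis unfolding dGam_def vec_eq_iff vec_lambda_beta
    by (intro allI, subst sum.swap, subst p) (simp add: mult_ac)
qed

section \<open>Symmetries and bounds of the curvature tensor\<close>

abbreviation (input) R where "R x a b e \<equiv> curvature G x a b e"

text \<open>For constant a and b the function y -> <a, b> at y has symmetric second derivatives.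
  Written with \<open>Gam\<close> and \<open>dGam\<close>, their antisymmetrization in h and k is
  the left-hand side.\<close>

lemma R_skew_metric:
  assumes x: "x \<in> D"
  shows "ip G x (curvature G x k h a) b + ip G x a (curvature G x k h b) = 0"
proof -
  define f' where "f' y h = ip G y (Gam G y h a) b + ip G y a (Gam G y h b)" for y h
  have id: "((\<lambda>y. y) has_derivative (\<lambda>h. h)) (at y)" for y :: "real ^ 'n" by simp
  have c: "((\<lambda>y. u) has_derivative (\<lambda>h. 0)) (at y)" for y u :: "real ^ 'n" by simp
  have f: "((\<lambda>y. ip G y a b) has_derivative f' y) (at y)" if "y \<in> D" for y
    using has_derivative_ip[OF id that c c, of a b] by (simp add: f'_def[abs_def] dmet_Gam[OF that] ip_lin)
  have A: "((\<lambda>y. f' y h) has_derivative (\<lambda>k.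
        (dmet G x k (Gam G x h a) b + ip G x (dGam G x k h a) b)
      + (dmet G x k a (Gam G x h b) + ip G x a (dGam G x k h b)))) (at x)" for h
    unfolding f'_def
    using has_derivative_add[OF has_derivative_ip[OF id x has_derivative_Gam[OF id x c c] c]
        has_derivative_ip[OF id x c has_derivative_Gam[OF id x c c]], of h a b a h b]
    by (simp add: ip_lin Gam_lin')
  from symmetric_second_derivative[OF D x f A A, of k h]
  show ?thesis
    by (simp add: dmet_Gam[OF x] curvature_Gam ip_lin)
qed

lemma R_antisym: "curvature G x a b e = - curvature G x b a e"
  by (simp add: curvature_Gam)

lemma R_bianchi:
  assumes "x \<in> D"
  shows "curvature G x a b e + curvature G x b e a + curvature G x e a b = 0"
proof -
  have "dGam G x a b e = dGam G x a e b" "dGam G x b e a = dGam G x b a e" "dGam G x e a b = dGam G x e b a"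
    "Gam G x b e = Gam G x e b" "Gam G x a e = Gam G x e a" "Gam G x a b = Gam G x b a"
    using dGam_sym[OF assms] Gam_sym[OF assms] by blast+
  then show ?thesis by (simp add: curvature_Gam)
qed

text \<open>Octahedron argument: four instances of the Bianchi identity, with terms identified by
  the two skew symmetries, combine linearly to the claim.\<close>

lemma R_pair_sym:
  assumes x: "x \<in> D"
  shows "ip G x (curvature G x a b e) f = ip G x (curvature G x e f a) b"
proof -
  define T where "T a b e f = ip G x (curvature G x a b e) f" for a b e f
  have s1: "T a b e f = - T b a e f" for a b e f
    unfolding T_def by (subst R_antisym) (simp add: ip_lin)
  have s2: "T a b e f = - T a b f e" for a b e f
    using R_skew_metric[OF x, of a b e f] ip_sym[OF x] unfolding T_def by simp
  have B: "T a b e f + T b e a f + T e a b f = 0" for a b e f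
    unfolding T_def using R_bianchi[OF x, of a b e] by (metis ip_lin(1) ip_lin(9))
  have "T a b e f = T e f a b"
    using B[of a b e f] B[of b e f a] B[of e f a b] B[of f a b e]
      s1[of e a b f] s2[of e a f b] s1[of a e f b] s2[of b e a f] s1[of f b e a] s2[of b f e a] s1[of b f a e]
      s2[of a b e f] s1[of e f b a] s2[of e f b a] s1[of f a e b] s2[of f a b e] s1[of b f e a] s2[of f b e a]
    by linarith
  then show ?thesis by (simp add: T_def)
qed

lemma R_self_sym:
  assumes x: "x \<in> D"
  shows "ip G x (curvature G x a u u) b = ip G x (curvature G x b u u) a"
proof -
  have "ip G x (curvature G x a u u) b = ip G x (curvature G x u b a) u" by (rule R_pair_sym[OF x])
  also have "\<dots> = - ip G x (curvature G x b u a) u" by (subst R_antisym) (simp add: ip_lin)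
  also have "\<dots> = ip G x (curvature G x b u u) a"
    using R_skew_metric[OF x, of b u a u] ip_sym[OF x] by simp
  finally show ?thesis .
qed

lemma R_lin:
  "curvature G x (a + a') b e = curvature G x a b e + curvature G x a' b e"
  "curvature G x (r *\<^sub>R a) b e = r *\<^sub>R curvature G x a b e"
  by (simp_all add: curvature_Gam Gam_lin dGam_lin algebra_simps)

text \<open>The curvature hypothesis speaks of independent pairs, with u \<noteq> v stated because
  {u, u} is a singleton. In the remaining cases u = 0 or a is a multiple of u, and the term
  vanishes.\<close>

lemma R_nonpos:
  assumes x: "x \<in> D"
    and K: "\<And>u v. u \<noteq> v ==> independent {u, v} ==> sectional_curvature G x u v \<le> 0"
  shows "ip G x (curvature G x a u u) a \<le> 0"
proof (cases "a \<noteq> u \<and> independent {a, u}")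
  case True
  then have u0: "u \<noteq> 0" using dependent_zero[of "{a, u}"] by auto
  \<comment> \<open>Removing the component along u: the Gram determinant of a and u equals <w, w>
    <u, u> > 0, so the sign of the sectional curvature is that of its numerator.\<close>
  define c where "c = ip G x a u / ip G x u u"
  define w where "w = a - c *\<^sub>R u"
  have uu: "ip G x u u > 0" using ip_pos[OF x u0] .
  have "w \<noteq> 0"
  proof
    assume "w = 0"
    then have "a \<in> span {u}" by (auto simp: w_def span_singleton)
    then show False using True by (auto simp: independent_insert split: if_splits)
  qed
  then have "ip G x w w > 0" using ip_pos[OF x] by blast
  moreover have "ip G x w w * ip G x u u = ip G x a a * ip G x u u - (ip G x a u)\<^sup>2"
    using uu ip_sym[OF x, of u a] by (simp add: w_def ip_lin c_def field_simps power2_eq_square)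
  ultimately have den: "ip G x a a * ip G x u u - (ip G x a u)\<^sup>2 > 0"
    using uu mult_pos_pos by metis
  have "sectional_curvature G x a u \<le> 0" using K True by blast
  then show ?thesis
    using den unfolding sectional_curvature_def ip_def[symmetric] by (simp add: divide_le_0_iff)
next
  case False
  show ?thesis
  proof (cases "u = 0")
    case True
    then show ?thesis by (simp add: curvature_Gam Gam_lin' dGam_zero ip_lin)
  next
    case u: False
    have "a \<in> span {u}"
      using False u by (auto simp: independent_insert dependent_single span_base split: if_splits)
    then obtain c where "a = c *\<^sub>R u" by (auto simp: span_singleton)
    moreover have "curvature G x u u u = 0" by (simp add: curvature_Gam)
    ultimately show ?thesis by (simp add: R_lin ip_lin)
  qed
qed

text \<open>The operator a -> - R(a,u)u is self-adjoint, positive semidefinite by nonpositive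
  curvature, and has trace - Ric(u,u) \<le> \<kappa> |u|^2. Hence the Ricci bound controls the whole
  curvature term of the Jacobi equation.\<close>

lemma R_bound:
  assumes x: "x \<in> D"
    and K: "\<And>u v. u \<noteq> v ==> independent {u, v} ==> sectional_curvature G x u v \<le> 0"
    and Ric: "ricci G x u u \<ge> - \<kappa> * ip G x u u"
  shows "ip G x (curvature G x a u u) (curvature G x a u u) \<le> (\<kappa> * ip G x u u)\<^sup>2 * ip G x a a"
proof -
  define Q where "Q = matrix (\<lambda>a. - curvature G x a u u)"
  have "linear (\<lambda>a. - curvature G x a u u)" by (rule linearI) (simp_all add: R_lin)
  then have Q: "Q *v a = - curvature G x a u u" for a unfolding Q_def using matrix_works[of "\<lambda>a. - curvature G x a u u"] by (simp add: linear_def)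
  have Qp: "v \<bullet> (G x *v (Q *v v)) \<ge> 0" for v
    using R_nonpos[OF x K, of v u] ip_sym[OF x] by (simp add: Q ip_def[symmetric] ip_lin)
  have tr: "trace Q \<le> \<kappa> * ip G x u u"
  proof -
    have "trace Q = - ricci G x u u"
      by (simp add: trace_def Q_def matrix_def ricci_def sum_negf)
    then show ?thesis using Ric by simp
  qed
  \<comment> \<open>Squaring the trace bound requires a nonnegative trace; testing the trace
    inequality on one nonzero vector provides it.\<close>
  have tr0: "trace Q \<ge> 0"
  proof (rule ccontr)
    assume n: "\<not> trace Q \<ge> 0"
    have "axis k (1::real) \<noteq> 0" for k :: 'n by (simp add: axis_eq_0_iff)
    then have "ip G x (axis k 1) (axis k 1) > 0" for k by (intro ip_pos[OF x])
    then show False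
      using order_trans[OF Qp trace_bound[OF G_sym[OF x] G_pos[OF x] Qp]] n
      by (metis ip_def mult_neg_pos not_le)
  qed
  have "ip G x (Q *v a) (Q *v a) \<le> (trace Q)\<^sup>2 * ip G x a a"
    unfolding ip_def
    by (rule psd_operator_bound[OF G_sym[OF x] G_pos[OF x] Qp])
      (use R_self_sym[OF x] ip_sym[OF x] in \<open>auto simp: Q ip_def[symmetric] ip_lin\<close>)
  also have "\<dots> \<le> (\<kappa> * ip G x u u)\<^sup>2 * ip G x a a"
    using tr tr0 ip_nonneg[OF x] by (intro mult_right_mono power_mono) auto
  finally show ?thesis by (simp add: Q ip_lin)
qed

section \<open>The geodesic equation as a first-order system\<close>

definition geo_field :: "(real ^ 'n) \<times> (real ^ 'n) => (real ^ 'n) \<times> (real ^ 'n)"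
  where "geo_field p = (snd p, - Gam G (fst p) (snd p) (snd p))"

definition geo_field_deriv :: "(real ^ 'n) \<times> (real ^ 'n) => ((real ^ 'n) \<times> (real ^ 'n)) \<Rightarrow>\<^sub>L ((real ^ 'n) \<times> (real ^ 'n))"
  where "geo_field_deriv p = Blinfun (\<lambda>h. (snd h,
     - (dGam G (fst p) (fst h) (snd p) (snd p) + Gam G (fst p) (snd h) (snd p) + Gam G (fst p) (snd p) (snd h))))"

lemma has_derivative_geo_field':
  assumes "fst p \<in> D"
  shows "(geo_field has_derivative (\<lambda>h. (snd h,
     - (dGam G (fst p) (fst h) (snd p) (snd p) + Gam G (fst p) (snd h) (snd p) + Gam G (fst p) (snd p) (snd h))))) (at p)"
  unfolding geo_field_def[abs_def]
  by (intro has_derivative_Pair has_derivative_minus has_derivative_Gam assms)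
    (auto intro!: derivative_eq_intros)

lemma geo_field_deriv_apply:
  assumes "fst p \<in> D"
  shows "blinfun_apply (geo_field_deriv p) h = (snd h,
     - (dGam G (fst p) (fst h) (snd p) (snd p) + Gam G (fst p) (snd h) (snd p) + Gam G (fst p) (snd p) (snd h)))"
  unfolding geo_field_deriv_def
  using bounded_linear_Blinfun_apply[OF has_derivative_bounded_linear[OF has_derivative_geo_field'[OF assms]]] by metis

lemma has_derivative_geo_field:
  assumes "p \<in> D \<times> UNIV"
  shows "(geo_field has_derivative blinfun_apply (geo_field_deriv p)) (at p)"
proof -
  have p: "fst p \<in> D" using assms by auto
  have "blinfun_apply (geo_field_deriv p) = (\<lambda>h. (snd h,
     - (dGam G (fst p) (fst h) (snd p) (snd p) + Gam G (fst p) (snd h) (snd p) + Gam G (fst p) (snd p) (snd h))))"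
    using geo_field_deriv_apply[OF p] by (rule ext)
  then show ?thesis using has_derivative_geo_field'[OF p] by metis
qed

lemma continuous_geo_field_deriv: "continuous_on (D \<times> UNIV) geo_field_deriv"
proof (rule continuous_on_blinfun_componentwise)
  fix h :: "(real ^ 'n) \<times> (real ^ 'n)"
  have c: "continuous_on (D \<times> UNIV) (\<lambda>p. christoffel G k i j (fst p))"
    "continuous_on (D \<times> UNIV) (\<lambda>p. partial_deriv l (christoffel G k i j) (fst p))" for k i j l
    by (rule continuous_on_compose2[OF continuous_christoffel], auto intro!: continuous_intros)
      (rule continuous_on_compose2[OF continuous_partial_christoffel], auto intro!: continuous_intros)
  have "continuous_on (D \<times> UNIV) (\<lambda>p. (snd h,
     - (dGam G (fst p) (fst h) (snd p) (snd p) + Gam G (fst p) (snd h) (snd p) + Gam G (fst p) (snd p) (snd h))))"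
    unfolding dGam_def Gam_def by (intro continuous_intros c)
  moreover have "continuous_on (D \<times> UNIV) (\<lambda>p. (snd h,
     - (dGam G (fst p) (fst h) (snd p) (snd p) + Gam G (fst p) (snd h) (snd p) + Gam G (fst p) (snd p) (snd h))))
     = continuous_on (D \<times> UNIV) (\<lambda>p. blinfun_apply (geo_field_deriv p) h)"
    by (rule continuous_on_cong) (auto simp: geo_field_deriv_apply)
  ultimately show "continuous_on (D \<times> UNIV) (\<lambda>p. blinfun_apply (geo_field_deriv p) h)" by simp
qed

end

section \<open>Transition maps, local isometries and geodesics\<close>

definition cim :: "('m, 'n) chart => (real ^ 'n) set" where "cim c = snd c ` fst c"
definition cinv :: "('m, 'n) chart => real ^ 'n => 'm" where "cinv c = inv_into (fst c) (snd c)"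
text \<open>The part of the coordinate image of c that f carries into the domain of d. For f = id,
  \<open>coord_rep c d f\<close> is the change of charts, so the lemmas on f cover isometries and
  changes of charts alike.\<close>

definition tdom :: "('m, 'n) chart => ('m, 'n) chart => ('m => 'm) => (real ^ 'n) set"
  where "tdom c d f = snd c ` (fst c \<inter> f -` fst d)"
definition dtr :: "('m, 'n::finite) chart => ('m, 'n) chart => ('m => 'm) => real ^ 'n => real ^ 'n => real ^ 'n"
  where "dtr c d f x h = (\<Sum>i\<in>UNIV. h $ i *\<^sub>R partial_deriv i (coord_rep c d f) x)"
definition d2tr :: "('m, 'n::finite) chart => ('m, 'n) chart => ('m => 'm) => real ^ 'n => real ^ 'n => real ^ 'n => real ^ 'n"
  where "d2tr c d f x k h = (\<Sum>i\<in>UNIV. h $ i *\<^sub>R (\<Sum>j\<in>UNIV. k $ j *\<^sub>R partial_deriv j (partial_deriv i (coord_rep c d f)) x))"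

text \<open>The derivative within I is one-sided at end points. \<open>nontriv I\<close> below
  excludes isolated parameters, at which it would be arbitrary.\<close>

definition vel :: "('m, 'n::finite) chart => real set => (real => 'm) => real => real ^ 'n"
  where "vel c I cu t = vector_derivative (snd c \<circ> cu) (at t within I)"

definition nontriv :: "real set => bool"
  where "nontriv I \<longleftrightarrow> (\<forall>t\<in>I. at t within I \<noteq> bot)"

lemma nontriv_open: "open I ==> nontriv I"
  unfolding nontriv_def using at_within_open at_neq_bot by metis

lemma nontriv_UNIV: "nontriv UNIV"
  by (simp add: nontriv_def)

lemma nontriv_ray: "nontriv {a..}"
proof -
  have "at t within {a..} \<noteq> bot" if "t \<ge> a" for t
  proof
    assume "at t within {a..} = bot"
    moreover have "at_right t \<le> at t within {a..}" using that by (intro at_le) auto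
    ultimately show False using trivial_limit_at_right_real[of t] by (simp add: bot_unique)
  qed
  then show ?thesis by (simp add: nontriv_def)
qed

lemma dtr_lin:
  "dtr c d f x (h + h') = dtr c d f x h + dtr c d f x h'" "dtr c d f x (r *\<^sub>R h) = r *\<^sub>R dtr c d f x h"
  by (simp_all add: dtr_def scaleR_add_left sum.distrib scaleR_sum_right)

lemma dtr_linear: "linear (dtr c d f x)"
  by (rule linearI) (simp_all add: dtr_lin)

lemma has_vector_derivative_compose_linear:
  assumes "(F has_derivative F') (at (f t))" "(f has_vector_derivative v) (at t within I)"
  shows "((\<lambda>s. F (f s)) has_vector_derivative F' v) (at t within I)"
proof -
  have "linear F'" using assms(1) has_derivative_linear by blast
  then show ?thesis
    using has_derivative_compose[OF assms(2)[unfolded has_vector_derivative_def] assms(1)]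
    by (simp add: has_vector_derivative_def linear_cmul)
qed

lemma has_vector_derivative_transform_eventually:
  assumes "(f has_vector_derivative v) (at t within I)" "\<forall>\<^sub>F s in at t within I. f s = h s" "f t = h t" "t \<in> I"
  shows "(h has_vector_derivative v) (at t within I)"
  using has_derivative_transform_eventually[OF assms(1)[unfolded has_vector_derivative_def] assms(2-4)]
  by (simp add: has_vector_derivative_def)

locale riem_mfd =
  fixes A :: "('m::{t2_space,second_countable_topology}, 'n::finite) chart set"
    and g :: "('m, 'n) metric_coeffs"
  assumes atlas: "smooth_atlas A" and metric: "riemannian_metric A g"
begin

lemma open_dom: "c \<in> A ==> open (fst c)"
  and open_cim: "c \<in> A ==> open (cim c)"
  and homeo: "c \<in> A ==> homeomorphism (fst c) (cim c) (snd c) (cinv c)"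
  using atlas by (auto simp: smooth_atlas_def cim_def cinv_def)

lemma chart_at: obtains c where "c \<in> A" "p \<in> fst c"
  using atlas unfolding smooth_atlas_def by blast

lemma cinv_left [simp]: "c \<in> A ==> p \<in> fst c ==> cinv c (snd c p) = p"
  using homeo homeomorphism_apply1 by blast

lemma cinv_right [simp]: "c \<in> A ==> x \<in> cim c ==> snd c (cinv c x) = x"
  using homeo homeomorphism_apply2 by blast

lemma cinv_in [simp]: "c \<in> A ==> x \<in> cim c ==> cinv c x \<in> fst c"
  using homeo unfolding homeomorphism_def by blast

lemma in_cim [simp]: "p \<in> fst c ==> snd c p \<in> cim c"
  by (simp add: cim_def)

lemma cont_chart: "c \<in> A ==> p \<in> fst c ==> isCont (snd c) p"
  using homeomorphism_cont1[OF homeo] open_dom continuous_on_eq_continuous_at by blast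

lemma cont_cinv: "c \<in> A ==> x \<in> cim c ==> isCont (cinv c) x"
  using homeomorphism_cont2[OF homeo] open_cim continuous_on_eq_continuous_at by blast

lemma chart_metric: "c \<in> A ==> chart_metric (cim c) (g c)"
  using metric open_cim unfolding riemannian_metric_def chart_metric_def by (auto simp: cim_def)

definition local_isom :: "('m => 'm) => bool"
  where "local_isom f \<longleftrightarrow> smooth_map A f \<and> preserves_metric A g f"

lemma local_isom_id: "local_isom id"
  using atlas metric by (simp add: local_isom_def smooth_atlas_def riemannian_metric_def)

lemma local_isom_cont: "local_isom f ==> continuous_on UNIV f"
  by (simp add: local_isom_def smooth_map_def)

context
  fixes c d f
  assumes c: "c \<in> A" and d: "d \<in> A" and f: "local_isom f"
begin

lemma open_tdom: "open (tdom c d f)"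
proof -
  have "open (f -` fst d)"
    using local_isom_cont[OF f] open_dom[OF d] continuous_on_open_vimage[of UNIV f] by simp
  then have "open (fst c \<inter> f -` fst d)" using open_dom[OF c] by blast
  moreover have "tdom c d f = cim c \<inter> cinv c -` (fst c \<inter> f -` fst d)"
    unfolding tdom_def using c by (auto simp: cim_def)
  ultimately show ?thesis
    using homeomorphism_cont2[OF homeo[OF c]] open_cim[OF c] continuous_on_open_vimage by (metis Int_commute)
qed

lemma tdom_iff: "x \<in> tdom c d f \<longleftrightarrow> x \<in> cim c \<and> f (cinv c x) \<in> fst d"
  unfolding tdom_def using c by (auto simp: cim_def image_iff)

lemma tdom_chart: "p \<in> fst c ==> f p \<in> fst d ==> snd c p \<in> tdom c d f"
  unfolding tdom_def by auto

lemma tr_chart: "p \<in> fst c ==> coord_rep c d f (snd c p) = snd d (f p)"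
  using c cinv_left[of c p] by (simp add: coord_rep_def cinv_def)

lemma tr_in: "x \<in> tdom c d f ==> coord_rep c d f x \<in> cim d"
  unfolding tdom_def using tr_chart by (auto simp: cim_def)

lemma smooth_tr: "Ck_on k (tdom c d f) (coord_rep c d f)"
  using f c d by (simp add: local_isom_def smooth_map_def smooth_on_def tdom_def)

lemma has_derivative_tr:
  assumes "x \<in> tdom c d f"
  shows "(coord_rep c d f has_derivative dtr c d f x) (at x)"
  unfolding dtr_def[abs_def]
  by (rule has_derivative_partial[OF Ck_on_differentiable[OF open_tdom smooth_tr[of "Suc 0"] assms]])

lemma has_derivative_partial_tr:
  assumes "x \<in> tdom c d f"
  shows "(partial_deriv i (coord_rep c d f) has_derivative
    (\<lambda>k. \<Sum>j\<in>UNIV. k $ j *\<^sub>R partial_deriv j (partial_deriv i (coord_rep c d f)) x)) (at x)"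
proof -
  have "Ck_on (Suc 0) (tdom c d f) (partial_deriv i (coord_rep c d f))"
    using smooth_tr[of "Suc (Suc 0)"] by simp
  from has_derivative_partial[OF Ck_on_differentiable[OF open_tdom this assms]] show ?thesis .
qed

lemma continuous_partial_tr: "continuous_on (tdom c d f) (partial_deriv i (coord_rep c d f))"
  "continuous_on (tdom c d f) (partial_deriv j (partial_deriv i (coord_rep c d f)))"
  using smooth_tr[of "Suc 0"] smooth_tr[of "Suc (Suc 0)"] by auto

lemma has_derivative_dtr:
  assumes x: "(x has_derivative x') (at s within S)" "x s \<in> tdom c d f"
    and a: "(a has_derivative a') (at s within S)"
  shows "((\<lambda>s. dtr c d f (x s) (a s)) has_derivative
     (\<lambda>h. d2tr c d f (x s) (x' h) (a s) + dtr c d f (x s) (a' h))) (at s within S)"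
proof -
  have "((\<lambda>s. \<Sum>i\<in>UNIV. a s $ i *\<^sub>R partial_deriv i (coord_rep c d f) (x s)) has_derivative
    (\<lambda>h. \<Sum>i\<in>UNIV. a s $ i *\<^sub>R (\<Sum>j\<in>UNIV. x' h $ j *\<^sub>R partial_deriv j (partial_deriv i (coord_rep c d f)) (x s))
      + a' h $ i *\<^sub>R partial_deriv i (coord_rep c d f) (x s))) (at s within S)"
    by (intro has_derivative_sum has_derivative_scaleR bounded_linear.has_derivative[OF bounded_linear_vec_nth a]
        has_derivative_compose[OF x(1) has_derivative_partial_tr[OF x(2)]])
  then show ?thesis by (simp add: dtr_def[abs_def] d2tr_def sum.distrib)
qed

lemma d2tr_sym:
  assumes x: "x \<in> tdom c d f"
  shows "d2tr c d f x h k = d2tr c d f x k h"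
proof -
  have "d2tr c d f x h k \<bullet> b = d2tr c d f x k h \<bullet> b" for b
  proof -
    have 1: "((\<lambda>y. coord_rep c d f y \<bullet> b) has_derivative (\<lambda>h. dtr c d f y h \<bullet> b)) (at y)" if "y \<in> tdom c d f" for y
      by (rule has_derivative_inner_left[OF has_derivative_tr[OF that]])
    have 2: "((\<lambda>y. dtr c d f y h \<bullet> b) has_derivative (\<lambda>k. d2tr c d f x k h \<bullet> b)) (at x)" for h
      using has_derivative_inner_left[OF has_derivative_dtr[of "\<lambda>y. y" "\<lambda>h. h" x UNIV "\<lambda>y. h" "\<lambda>h. 0"], of b] x
      by (simp add: dtr_def)
    show ?thesis using symmetric_second_derivative[OF open_tdom x 1 2 2, of h k] by simp
  qed
  then show ?thesis by (metis vector_eq_rdot)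
qed

lemma tr_metric:
  assumes x: "x \<in> tdom c d f"
  shows "ip (g c) x u v = ip (g d) (coord_rep c d f x) (dtr c d f x u) (dtr c d f x v)"
proof -
  have "frechet_derivative (coord_rep c d f) (at x) = dtr c d f x"
    using frechet_derivative_at[OF has_derivative_tr[OF x]] by simp
  moreover have "preserves_metric A g f" using f by (simp add: local_isom_def)
  moreover obtain p where p: "p \<in> fst c" "f p \<in> fst d" "x = snd c p" using x unfolding tdom_def by auto
  ultimately show ?thesis
    using c d tr_chart[OF p(1)] unfolding preserves_metric_def ip_def by (metis (no_types, lifting))
qed

lemma dtr_inj:
  assumes x: "x \<in> tdom c d f" "dtr c d f x u = 0"
  shows "u = 0"
proof (rule ccontr)
  interpret C: chart_metric "cim c" "g c" by (rule chart_metric[OF c])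
  assume "u \<noteq> 0"
  then have "ip (g c) x u u > 0" using x C.ip_pos tdom_iff by blast
  then show False using tr_metric[OF x(1), of u u] x(2) by (simp add: ip_lin)
qed

lemma dtr_surj:
  assumes "x \<in> tdom c d f"
  obtains u where "dtr c d f x u = w"
proof -
  have "inj (dtr c d f x)" using dtr_inj[OF assms] linear_injective_0[OF dtr_linear] by blast
  then have "surj (dtr c d f x)" by (rule linear_injective_imp_surjective[OF dtr_linear]) simp
  then show ?thesis using that by (metis surjD)
qed

text \<open>Both sides are compared by the Koszul formula. Differentiating \<open>tr_metric\<close>
  relates the two \<open>dmet\<close> up to terms with second derivatives of the transition map; in
  the Koszul combination these cancel except for the inhomogeneous term \<open>d2tr\<close>.\<close>

lemma tr_Gam:
  assumes x: "x \<in> tdom c d f"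
  shows "dtr c d f x (Gam (g c) x a b) = d2tr c d f x a b + Gam (g d) (coord_rep c d f x) (dtr c d f x a) (dtr c d f x b)"
proof -
  interpret C: chart_metric "cim c" "g c" by (rule chart_metric[OF c])
  interpret E: chart_metric "cim d" "g d" by (rule chart_metric[OF d])
  let ?y = "coord_rep c d f x" and ?J = "dtr c d f x" and ?H = "d2tr c d f x"
  have xc: "x \<in> cim c" and yd: "?y \<in> cim d" using x tdom_iff tr_in by auto
  have D: "dmet (g c) x h u v = dmet (g d) ?y (?J h) (?J u) (?J v) + ip (g d) ?y (?H h u) (?J v) + ip (g d) ?y (?J u) (?H h v)" for h u v
  proof -
    have 1: "((\<lambda>y. ip (g c) y u v) has_derivative (\<lambda>h. dmet (g c) x h u v)) (at x)"
      using C.has_derivative_ip[of "\<lambda>y. y" "\<lambda>h. h" x UNIV "\<lambda>y. u" "\<lambda>h. 0" "\<lambda>y. v" "\<lambda>h. 0"] xc by (simp add: ip_lin)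
    have dt: "((\<lambda>y. dtr c d f y u) has_derivative (\<lambda>h. ?H h u)) (at x)" for u
      using has_derivative_dtr[of "\<lambda>y. y" "\<lambda>h. h" x UNIV "\<lambda>y. u" "\<lambda>h. 0"] x by (simp add: dtr_def)
    have "((\<lambda>y. ip (g d) (coord_rep c d f y) (dtr c d f y u) (dtr c d f y v)) has_derivative
      (\<lambda>h. dmet (g d) ?y (?J h) (?J u) (?J v) + ip (g d) ?y (?H h u) (?J v) + ip (g d) ?y (?J u) (?H h v))) (at x)"
      by (rule E.has_derivative_ip[OF has_derivative_tr[OF x] yd dt dt])
    then have "((\<lambda>y. ip (g c) y u v) has_derivative
      (\<lambda>h. dmet (g d) ?y (?J h) (?J u) (?J v) + ip (g d) ?y (?H h u) (?J v) + ip (g d) ?y (?J u) (?H h v))) (at x)"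
      by (rule has_derivative_transform_within_open[OF _ open_tdom x]) (simp add: tr_metric)
    from has_derivative_unique[OF 1 this] show ?thesis by metis
  qed
  show ?thesis
  proof (rule E.ip_eqI[OF yd])
    fix w
    obtain e where e: "w = ?J e" using dtr_surj[OF x] by metis
    have "ip (g d) ?y (?J (Gam (g c) x a b)) (?J e) = ip (g c) x (Gam (g c) x a b) e"
      by (rule tr_metric[OF x, symmetric])
    also have "\<dots> = (1 / 2) * (dmet (g c) x a b e + dmet (g c) x b a e - dmet (g c) x e a b)"
      by (rule C.ip_Gam[OF xc])
    also have "\<dots> = (1 / 2) * (dmet (g d) ?y (?J a) (?J b) (?J e) + dmet (g d) ?y (?J b) (?J a) (?J e) - dmet (g d) ?y (?J e) (?J a) (?J b))
       + ip (g d) ?y (?H a b) (?J e)"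
      unfolding D using d2tr_sym[OF x, of b a] d2tr_sym[OF x, of e a] d2tr_sym[OF x, of e b]
        E.ip_sym[OF yd, of "?J b" "?H a e"] E.ip_sym[OF yd, of "?J a" "?H b e"] by (simp add: field_simps)
    also have "\<dots> = ip (g d) ?y (Gam (g d) ?y (?J a) (?J b)) (?J e) + ip (g d) ?y (?H a b) (?J e)"
      by (simp add: E.ip_Gam[OF yd])
    finally show "ip (g d) ?y (?J (Gam (g c) x a b)) w = ip (g d) ?y (?H a b + Gam (g d) ?y (?J a) (?J b)) w"
      unfolding e by (simp add: ip_lin)
  qed
qed

lemma curve_tr:
  assumes t: "t \<in> I" "continuous (at t within I) cu" "cu t \<in> fst c" "f (cu t) \<in> fst d"
    and v: "((snd c \<circ> cu) has_vector_derivative v) (at t within I)"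
  shows "((snd d \<circ> (f \<circ> cu)) has_vector_derivative dtr c d f (snd c (cu t)) v) (at t within I)"
proof -
  have x: "snd c (cu t) \<in> tdom c d f" using t tdom_chart by blast
  have "((\<lambda>s. coord_rep c d f ((snd c \<circ> cu) s)) has_vector_derivative dtr c d f (snd c (cu t)) v) (at t within I)"
    by (rule has_vector_derivative_compose_linear[OF _ v]) (use has_derivative_tr[OF x] in simp)
  then show ?thesis
  proof (rule has_vector_derivative_transform_eventually[OF _ _ _ t(1)])
    have "\<forall>\<^sub>F s in at t within I. cu s \<in> fst c"
      by (rule topological_tendstoD[OF t(2)[unfolded continuous_within] open_dom[OF c] t(3)])
    then show "\<forall>\<^sub>F s in at t within I. coord_rep c d f ((snd c \<circ> cu) s) = (snd d \<circ> (f \<circ> cu)) s"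
      by eventually_elim (simp add: tr_chart)
    show "coord_rep c d f ((snd c \<circ> cu) t) = (snd d \<circ> (f \<circ> cu)) t" using t by (simp add: tr_chart)
  qed
qed

end

definition geo_on :: "real set => (real => 'm) => bool"
  where "geo_on I cu \<longleftrightarrow> continuous_on I cu \<and> (\<forall>c\<in>A. \<forall>t\<in>I. cu t \<in> fst c \<longrightarrow>
     ((snd c \<circ> cu) has_vector_derivative vel c I cu t) (at t within I) \<and>
     (vel c I cu has_vector_derivative - Gam (g c) (snd c (cu t)) (vel c I cu t) (vel c I cu t)) (at t within I))"

text \<open>The equation in one chart and near one parameter, as an ODE solution provides it;
  \<open>geoOn\<close>-type statements in all charts are recovered by
  \<open>geo_onI\<close>.\<close>

definition geo_at :: "real set => (real => 'm) => real => bool"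
  where "geo_at I cu t \<longleftrightarrow> (\<exists>c\<in>A. \<exists>v. \<exists>e>0. \<forall>s\<in>I \<inter> ball t e. cu s \<in> fst c \<and>
     ((snd c \<circ> cu) has_vector_derivative v s) (at s within I) \<and>
     (v has_vector_derivative - Gam (g c) (snd c (cu s)) (v s) (v s)) (at s within I))"

lemma geo_onD:
  assumes "geo_on I cu" "c \<in> A" "t \<in> I" "cu t \<in> fst c"
  shows "((snd c \<circ> cu) has_vector_derivative vel c I cu t) (at t within I)"
    "(vel c I cu has_vector_derivative - Gam (g c) (snd c (cu t)) (vel c I cu t) (vel c I cu t)) (at t within I)"
  using assms unfolding geo_on_def by auto

lemma geo_on_cont: "geo_on I cu ==> continuous_on I cu"
  by (simp add: geo_on_def)

lemma chart_nbhd: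
  assumes "continuous_on I cu" "t \<in> I" "cu t \<in> S" "open S"
  obtains e where "e > 0" "\<And>s. s \<in> I \<inter> ball t e ==> cu s \<in> S"
proof (rule nearby[OF assms(1,2,4,3)])
  fix e assume "e > 0" "\<And>s. s \<in> I ==> dist s t < e ==> cu s \<in> S"
  then show thesis by (intro that[of e]) (auto simp: dist_commute)
qed

lemma geo_on_geo_at:
  assumes "geo_on I cu" "t \<in> I"
  shows "geo_at I cu t"
proof -
  obtain c where c: "c \<in> A" "cu t \<in> fst c" using chart_at by blast
  obtain e where "e > 0" "\<And>s. s \<in> I \<inter> ball t e ==> cu s \<in> fst c"
    using chart_nbhd[OF geo_on_cont[OF assms(1)] assms(2) c(2) open_dom[OF c(1)]] by blast
  then show ?thesis using geo_onD[OF assms(1) c(1)] c(1) unfolding geo_at_def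
    by (intro bexI[of _ c] exI[of _ "vel c I cu"] exI[of _ e]) auto
qed

lemma geo_at_continuous:
  assumes "geo_at I cu t" "t \<in> I"
  shows "continuous (at t within I) cu"
proof -
  obtain c v e where c: "c \<in> A" "e > 0" and h: "\<And>s. s \<in> I \<inter> ball t e ==> cu s \<in> fst c \<and>
     ((snd c \<circ> cu) has_vector_derivative v s) (at s within I)"
    using assms(1) unfolding geo_at_def by blast
  have t: "cu t \<in> fst c" "continuous (at t within I) (snd c \<circ> cu)"
    using h[of t] assms(2) c has_vector_derivative_continuous by auto
  then have "continuous (at t within I) (cinv c \<circ> (snd c \<circ> cu))"
    using continuous_within_compose3[where g = "cinv c" and x = t and f = "snd c \<circ> cu" and s = I] cont_cinv[OF c(1) in_cim[OF t(1)]] by (simp add: o_def)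
  moreover have "\<forall>\<^sub>F s in at t within I. (cinv c \<circ> (snd c \<circ> cu)) s = cu s"
    unfolding eventually_at using c h by (auto intro!: exI[of _ e] simp: dist_commute)
  ultimately show ?thesis
    using t c unfolding continuous_within by (auto elim: Lim_transform_eventually simp: o_def)
qed

text \<open>The second derivative produced by the chain rule is exactly the inhomogeneous term of
  \<open>tr_Gam\<close>, so the equation is invariant. The case f = id passes from one chart to all
  of them.\<close>

lemma geo_on_isom:
  assumes I: "nontriv I" and cu: "\<And>t. t \<in> I ==> geo_at I cu t" and f: "local_isom f"
  shows "geo_on I (f \<circ> cu)"
  unfolding geo_on_def
proof (intro conjI ballI impI)
  have ccu: "continuous_on I cu" using geo_at_continuous[OF cu] continuous_on_eq_continuous_within by blast
  then show cf: "continuous_on I (f \<circ> cu)"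
    using local_isom_cont[OF f] continuous_on_compose continuous_on_subset by blast
  fix d t assume d: "d \<in> A" and t: "t \<in> I" and td: "(f \<circ> cu) t \<in> fst d"
  obtain c v e where c: "c \<in> A" "e > 0" and h: "\<And>s. s \<in> I \<inter> ball t e ==> cu s \<in> fst c \<and>
     ((snd c \<circ> cu) has_vector_derivative v s) (at s within I) \<and>
     (v has_vector_derivative - Gam (g c) (snd c (cu s)) (v s) (v s)) (at s within I)"
    using cu[OF t] unfolding geo_at_def by blast
  obtain e' where e': "e' > 0" "\<And>s. s \<in> I \<inter> ball t e' ==> (f \<circ> cu) s \<in> fst d"
    using chart_nbhd[OF cf t td open_dom[OF d]] by blast
  define w where "w s = dtr c d f (snd c (cu s)) (v s)" for s
  have 1: "((snd d \<circ> (f \<circ> cu)) has_vector_derivative w s) (at s within I)" if "s \<in> I \<inter> ball t (min e e')" for s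
  proof -
    have "s \<in> I" "continuous (at s within I) cu" "cu s \<in> fst c" "f (cu s) \<in> fst d" "((snd c \<circ> cu) has_vector_derivative v s) (at s within I)"
      using that h[of s] e'(2)[of s] ccu continuous_on_eq_continuous_within by auto
    then show ?thesis unfolding w_def by (rule curve_tr[OF c(1) d f])
  qed
  have 2: "vel d I (f \<circ> cu) s = w s" if "s \<in> I \<inter> ball t (min e e')" for s
    unfolding vel_def using 1[OF that] I that by (intro vector_derivative_within) (auto simp: nontriv_def)
  have t': "t \<in> I \<inter> ball t (min e e')" using t c e' by simp
  show "((snd d \<circ> (f \<circ> cu)) has_vector_derivative vel d I (f \<circ> cu) t) (at t within I)"
    using 1[OF t'] 2[OF t'] by simp
  have x: "snd c (cu t) \<in> tdom c d f" using tdom_chart[OF c(1) d f] h[of t] t' td by auto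
  let ?x = "snd c (cu t)"
  have "(w has_vector_derivative d2tr c d f ?x (v t) (v t) + dtr c d f ?x (- Gam (g c) ?x (v t) (v t))) (at t within I)"
  proof -
    have "((snd c \<circ> cu) has_derivative (\<lambda>r. r *\<^sub>R v t)) (at t within I)" "(v has_derivative (\<lambda>r. r *\<^sub>R - Gam (g c) ?x (v t) (v t))) (at t within I)"
      using h[of t] t' unfolding has_vector_derivative_def by auto
    from has_derivative_dtr[OF c(1) d f this(1) _ this(2)] x
    have "(w has_derivative (\<lambda>h. d2tr c d f ?x (h *\<^sub>R v t) (v t) + dtr c d f ?x (h *\<^sub>R - Gam (g c) ?x (v t) (v t)))) (at t within I)"
      by (simp add: w_def[abs_def])
    moreover have "d2tr c d f ?x (h *\<^sub>R v t) (v t) = h *\<^sub>R d2tr c d f ?x (v t) (v t)" for h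
      by (simp add: d2tr_def scaleR_sum_right mult_ac)
    ultimately show ?thesis
      unfolding has_vector_derivative_def by (simp only: dtr_lin scaleR_add_right)
  qed
  moreover have "d2tr c d f ?x (v t) (v t) + dtr c d f ?x (- Gam (g c) ?x (v t) (v t))
     = - Gam (g d) (coord_rep c d f ?x) (w t) (w t)"
    using tr_Gam[OF c(1) d f x, of "v t" "v t"] by (simp add: w_def linear_neg[OF dtr_linear])
  moreover have "coord_rep c d f ?x = snd d ((f \<circ> cu) t)"
    using tr_chart[OF c(1) d f] h[of t] t' by simp
  ultimately have "(w has_vector_derivative - Gam (g d) (snd d ((f \<circ> cu) t)) (vel d I (f \<circ> cu) t) (vel d I (f \<circ> cu) t)) (at t within I)"
    using 2[OF t'] by simp
  then show "(vel d I (f \<circ> cu) has_vector_derivative - Gam (g d) (snd d ((f \<circ> cu) t)) (vel d I (f \<circ> cu) t) (vel d I (f \<circ> cu) t)) (at t within I)"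
  proof (rule has_vector_derivative_transform_eventually[OF _ _ _ t])
    show "\<forall>\<^sub>F s in at t within I. w s = vel d I (f \<circ> cu) s"
      unfolding eventually_at using 2 c e' by (intro exI[of _ "min e e'"]) (auto simp: dist_commute)
    show "w t = vel d I (f \<circ> cu) t" using 2[OF t'] by simp
  qed
qed

lemma geo_onI:
  assumes "nontriv I" "\<And>t. t \<in> I ==> geo_at I cu t"
  shows "geo_on I cu"
  using geo_on_isom[OF assms local_isom_id] by simp

lemma vel_tr:
  assumes "nontriv I" "geo_on I cu" "c \<in> A" "d \<in> A" "local_isom f" "t \<in> I" "cu t \<in> fst c" "f (cu t) \<in> fst d"
  shows "vel d I (f \<circ> cu) t = dtr c d f (snd c (cu t)) (vel c I cu t)"
proof -
  have "((snd d \<circ> (f \<circ> cu)) has_vector_derivative dtr c d f (snd c (cu t)) (vel c I cu t)) (at t within I)"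
    by (rule curve_tr[OF assms(3,4,5,6) _ assms(7,8) geo_onD(1)[OF assms(2,3,6,7)]])
      (use geo_on_cont[OF assms(2)] assms(6) continuous_on_eq_continuous_within in blast)
  then show ?thesis unfolding vel_def using assms(1,6) by (intro vector_derivative_within) (auto simp: nontriv_def)
qed

text \<open>Within a chart this is uniqueness for the first-order system of position and velocity.
  \<open>?P\<close> compares velocities in all charts at once, so that it can be checked in any one
  of them and propagated along I.\<close>

lemma geo_unique:
  assumes I: "convex I" "nontriv I" and cu: "geo_on I cu" and \<delta>: "geo_on I \<delta>"
    and s: "s \<in> I" "cu s = \<delta> s" "c \<in> A" "cu s \<in> fst c" "vel c I cu s = vel c I \<delta> s"
    and t: "t \<in> I"
  shows "cu t = \<delta> t"
proof -
  let ?P = "\<lambda>t. cu t = \<delta> t \<and> (\<forall>d\<in>A. cu t \<in> fst d \<longrightarrow> vel d I cu t = vel d I \<delta> t)"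
  have tr: "?P t" if "t \<in> I" "cu t = \<delta> t" "c \<in> A" "cu t \<in> fst c" "vel c I cu t = vel c I \<delta> t" for t c
  proof (intro conjI ballI impI)
    fix d assume d: "d \<in> A" "cu t \<in> fst d"
    show "vel d I cu t = vel d I \<delta> t"
      using vel_tr[OF I(2) cu that(3) d(1) local_isom_id that(1,4)] vel_tr[OF I(2) \<delta> that(3) d(1) local_isom_id that(1)] that d by simp
  qed (use that in simp)
  have "?P t"
  proof (rule interval_induction[of I s t ?P])
    show "connected I" using I convex_connected by blast
    show "?P s" by (rule tr[OF s])
    fix r assume r: "r \<in> I"
    show "\<exists>e>0. \<forall>x\<in>I \<inter> ball r e. \<forall>y\<in>I \<inter> ball r e. ?P x \<longrightarrow> ?P y"
    proof (cases "cu r = \<delta> r")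
      case False
      \<comment> \<open>If the curves differ at r, disjoint neighbourhoods make \<open>?P\<close>
        false near r, and the step is vacuous.\<close>
      then obtain V W where VW: "open V" "open W" "cu r \<in> V" "\<delta> r \<in> W" "V \<inter> W = {}" using hausdorff by metis
      obtain e1 where e1: "e1 > 0" "\<And>s. s \<in> I \<inter> ball r e1 ==> cu s \<in> V" using chart_nbhd[OF geo_on_cont[OF cu] r VW(3,1)] by blast
      obtain e2 where e2: "e2 > 0" "\<And>s. s \<in> I \<inter> ball r e2 ==> \<delta> s \<in> W" using chart_nbhd[OF geo_on_cont[OF \<delta>] r VW(4,2)] by blast
      have "cu x \<noteq> \<delta> x" if "x \<in> I \<inter> ball r (min e1 e2)" for x
        using e1(2)[of x] e2(2)[of x] that VW(5) by auto
      then show ?thesis using e1(1) e2(1) by (intro exI[of _ "min e1 e2"]) simp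
    next
      case True
      obtain c where c: "c \<in> A" "cu r \<in> fst c" using chart_at by blast
      obtain e1 where e1: "e1 > 0" "\<And>s. s \<in> I \<inter> ball r e1 ==> cu s \<in> fst c"
        using chart_nbhd[OF geo_on_cont[OF cu] r c(2) open_dom[OF c(1)]] by blast
      obtain e2 where e2: "e2 > 0" "\<And>s. s \<in> I \<inter> ball r e2 ==> \<delta> s \<in> fst c"
        using chart_nbhd[OF geo_on_cont[OF \<delta>] r _ open_dom[OF c(1)]] True c(2) by metis
      let ?T = "I \<inter> ball r (min e1 e2)"
      interpret C: chart_metric "cim c" "g c" by (rule chart_metric[OF c(1)])
      have "?P y" if xy: "x \<in> ?T" "y \<in> ?T" "?P x" for x y
      proof -
        have st: "((\<lambda>s. (snd c (\<eta> s), vel c I \<eta> s)) has_vector_derivative C.geo_field (snd c (\<eta> s), vel c I \<eta> s)) (at s within ?T)"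
          if "geo_on I \<eta>" "s \<in> ?T" "\<eta> s \<in> fst c" for \<eta> s
        proof -
          have "((snd c \<circ> \<eta>) has_vector_derivative vel c I \<eta> s) (at s within ?T)"
            "(vel c I \<eta> has_vector_derivative - Gam (g c) (snd c (\<eta> s)) (vel c I \<eta> s) (vel c I \<eta> s)) (at s within ?T)"
            using geo_onD[OF that(1) c(1) _ that(3)] that(2) has_vector_derivative_within_subset by (blast, blast)
          from has_vector_derivative_Pair[OF this] show ?thesis by (simp add: C.geo_field_def o_def)
        qed
        have "(\<lambda>s. (snd c (cu s), vel c I cu s)) y = (\<lambda>s. (snd c (\<delta> s), vel c I \<delta> s)) y"
        proof (rule ode_unique[of "cim c \<times> UNIV" C.geo_field C.geo_field_deriv ?T x y])
          show "open (cim c \<times> (UNIV :: (real ^ 'n) set))" by (intro open_Times C.D open_UNIV)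
          show "convex ?T" using I convex_ball convex_Int by blast
        qed (use C.has_derivative_geo_field C.continuous_geo_field_deriv st cu \<delta> e1 e2 xy c in auto)
        then have "snd c (cu y) = snd c (\<delta> y)" "vel c I cu y = vel c I \<delta> y" by auto
        moreover have "cu y \<in> fst c" "\<delta> y \<in> fst c" using e1 e2 xy by auto
        moreover have "cu y = \<delta> y" using calculation c(1) cinv_left by metis
        ultimately show ?thesis using xy c(1) by (intro tr[of y c]) auto
      qed
      then have "\<forall>x\<in>?T. \<forall>y\<in>?T. ?P x \<longrightarrow> ?P y" by blast
      moreover have "min e1 e2 > 0" using e1(1) e2(1) by simp
      ultimately show ?thesis by (intro exI[of _ "min e1 e2"] conjI)
    qed
  qed (use s t in auto)
  then show ?thesis by blast
qed

lemma speed_const: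
  assumes I: "convex I" "nontriv I" and cu: "geo_on I cu"
    and s: "s \<in> I" "c \<in> A" "cu s \<in> fst c" and t: "t \<in> I" "d \<in> A" "cu t \<in> fst d"
  shows "ip (g d) (snd d (cu t)) (vel d I cu t) (vel d I cu t) = ip (g c) (snd c (cu s)) (vel c I cu s) (vel c I cu s)"
proof -
  let ?E = "\<lambda>c t. ip (g c) (snd c (cu t)) (vel c I cu t) (vel c I cu t)"
  define k where "k = ?E c s"
  let ?P = "\<lambda>t. \<forall>d\<in>A. cu t \<in> fst d \<longrightarrow> ?E d t = k"
  have tr: "?E d t = ?E c t" if "t \<in> I" "c \<in> A" "d \<in> A" "cu t \<in> fst c" "cu t \<in> fst d" for t c d
    using vel_tr[OF I(2) cu that(2,3) local_isom_id that(1,4)] that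
      tr_metric[OF that(2,3) local_isom_id tdom_chart[OF that(2,3) local_isom_id], of "cu t"] tr_chart[OF that(2,3) local_isom_id that(4)] by simp
  have "?P t"
  proof (rule interval_induction[of I s t ?P])
    show "connected I" using I convex_connected by blast
    show "?P s" unfolding k_def by (intro ballI impI) (rule tr[OF s(1,2) _ s(3)])
    fix r assume r: "r \<in> I"
    obtain c where c: "c \<in> A" "cu r \<in> fst c" using chart_at by blast
    obtain e where e: "e > 0" "\<And>s. s \<in> I \<inter> ball r e ==> cu s \<in> fst c"
      using chart_nbhd[OF geo_on_cont[OF cu] r c(2) open_dom[OF c(1)]] by blast
    let ?T = "I \<inter> ball r e"
    interpret C: chart_metric "cim c" "g c" by (rule chart_metric[OF c(1)])
    have "\<exists>k. \<forall>s\<in>?T. ?E c s = k"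
    proof (rule has_derivative_zero_constant)
      show "convex ?T" using I convex_ball convex_Int by blast
      fix s assume s: "s \<in> ?T"
      then have s': "s \<in> I" "cu s \<in> fst c" using e by auto
      let ?x = "snd c (cu s)" and ?v = "vel c I cu s"
      have x: "?x \<in> cim c" using s' by simp
      have "((\<lambda>s. ip (g c) ((snd c \<circ> cu) s) (vel c I cu s) (vel c I cu s)) has_vector_derivative
        dmet (g c) ((snd c \<circ> cu) s) ?v ?v ?v + ip (g c) ((snd c \<circ> cu) s) (- Gam (g c) ?x ?v ?v) ?v
          + ip (g c) ((snd c \<circ> cu) s) ?v (- Gam (g c) ?x ?v ?v)) (at s within I)"
        by (rule C.has_vector_derivative_ip[OF geo_onD(1)[OF cu c(1) s'] _ geo_onD(2)[OF cu c(1) s'] geo_onD(2)[OF cu c(1) s']])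
          (use x in simp)
      moreover have "dmet (g c) ?x ?v ?v ?v + ip (g c) ?x (- Gam (g c) ?x ?v ?v) ?v + ip (g c) ?x ?v (- Gam (g c) ?x ?v ?v) = 0"
        using C.dmet_Gam[OF x] by (simp add: ip_lin)
      ultimately have "((\<lambda>s. ?E c s) has_vector_derivative 0) (at s within I)" by simp
      then show "((\<lambda>s. ?E c s) has_derivative (\<lambda>h. 0)) (at s within ?T)"
        unfolding has_vector_derivative_def using has_derivative_subset by fastforce
    qed
    then obtain k' where k': "\<And>s. s \<in> ?T ==> ?E c s = k'" by blast
    have "?P y" if "x \<in> ?T" "y \<in> ?T" "?P x" for x y
    proof (intro ballI impI)
      fix d assume "d \<in> A" "cu y \<in> fst d"
      then have "?E d y = ?E c y" using that e by (intro tr[OF _ c(1)]) auto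
      also have "\<dots> = ?E c x" using k' that by metis
      also have "\<dots> = k" using that c e by auto
      finally show "?E d y = k" .
    qed
    then show "\<exists>e>0. \<forall>x\<in>I \<inter> ball r e. \<forall>y\<in>I \<inter> ball r e. ?P x \<longrightarrow> ?P y" using e(1) by blast
  qed (use s t in auto)
  then show ?thesis using t by (simp add: k_def)
qed

end

section \<open>Curves and the Riemannian distance\<close>

lemma at_within_Int_ball:
  assumes "e > 0"
  shows "at t within (I \<inter> ball t e) = at (t::real) within I"
  by (rule at_within_nhd[of t "ball t e"]) (use assms in auto)

lemma piecewise_integrable:
  fixes f :: "real => real"
  assumes "finite P" "\<And>a b. lo \<le> a ==> a \<le> b ==> b \<le> hi ==> {a<..<b} \<inter> P = {} ==> f integrable_on {a..b}" "lo \<le> hi"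
  shows "f integrable_on {lo..hi}"
  using assms
proof (induction P arbitrary: lo hi rule: finite_induct)
  case empty
  then show ?case by simp
next
  case (insert p P)
  show ?case
  proof (cases "lo < p \<and> p < hi")
    case True
    have l: "f integrable_on {lo..p}"
      by (rule insert.IH) (use insert.prems(1) True in auto)
    have r: "f integrable_on {p..hi}"
      by (rule insert.IH) (use insert.prems(1) True in auto)
    show ?thesis using Henstock_Kurzweil_Integration.integrable_combine[OF _ _ l r] True by simp
  next
    case False
    show ?thesis
      by (rule insert.IH) (use insert.prems False in auto)
  qed
qed

context riem_mfd
begin

text \<open>Agrees with \<open>C1_curve_on\<close> on nontrivial I, but names the velocity by
  \<open>vel\<close> instead of an existential quantifier, so that it can be computed with.\<close>

definition C1c :: "real set => (real => 'm) => bool"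
  where "C1c I cu \<longleftrightarrow> continuous_on I cu \<and> (\<forall>c\<in>A. \<forall>t\<in>I. cu t \<in> fst c \<longrightarrow>
     ((snd c \<circ> cu) has_vector_derivative vel c I cu t) (at t within I) \<and> continuous (at t within I) (vel c I cu))"

lemma C1cD:
  assumes "C1c I cu" "c \<in> A" "t \<in> I" "cu t \<in> fst c"
  shows "((snd c \<circ> cu) has_vector_derivative vel c I cu t) (at t within I)" "continuous (at t within I) (vel c I cu)"
  using assms unfolding C1c_def by auto

lemma vel_eqI:
  "nontriv I ==> t \<in> I ==> ((snd c \<circ> cu) has_vector_derivative v) (at t within I) ==> vel c I cu t = v"
  unfolding vel_def nontriv_def by (intro vector_derivative_within) auto

lemma C1_curve_iff:
  assumes I: "nontriv I"
  shows "C1_curve_on A I cu \<longleftrightarrow> C1c I cu"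
proof
  assume C: "C1_curve_on A I cu"
  then have cont: "continuous_on I cu" by (simp add: C1_curve_on_def)
  show "C1c I cu" unfolding C1c_def
  proof (intro conjI ballI impI cont)
    fix c t assume c: "c \<in> A" and t: "t \<in> I" "cu t \<in> fst c"
    obtain v where v: "continuous_on {t \<in> I. cu t \<in> fst c} v"
      "\<And>t. t \<in> I ==> cu t \<in> fst c ==> ((snd c \<circ> cu) has_vector_derivative v t) (at t within I)"
      using C c unfolding C1_curve_on_def by blast
    have eq: "vel c I cu s = v s" if "s \<in> I" "cu s \<in> fst c" for s
      using v(2)[OF that] I that by (intro vel_eqI)
    then show "((snd c \<circ> cu) has_vector_derivative vel c I cu t) (at t within I)" using v(2)[OF t] t by simp
    obtain e where e: "e > 0" "\<And>s. s \<in> I \<inter> ball t e ==> cu s \<in> fst c"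
      using chart_nbhd[OF cont t open_dom[OF c]] by blast
    have "continuous_on (I \<inter> ball t e) v"
      by (rule continuous_on_subset[OF v(1)]) (use e in auto)
    moreover have "continuous_on (I \<inter> ball t e) v \<longleftrightarrow> continuous_on (I \<inter> ball t e) (vel c I cu)"
      by (rule continuous_on_cong) (use eq e in auto)
    ultimately have "continuous (at t within (I \<inter> ball t e)) (vel c I cu)"
      using t e unfolding continuous_on_eq_continuous_within by auto
    then show "continuous (at t within I) (vel c I cu)" by (simp add: at_within_Int_ball[OF e(1)])
  qed
next
  assume C: "C1c I cu"
  have "continuous_on {t \<in> I. cu t \<in> fst c} (vel c I cu)" if "c \<in> A" for c
    unfolding continuous_on_eq_continuous_within
    using C1cD(2)[OF C that] by (auto intro: continuous_within_subset[of _ I])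
  then show "C1_curve_on A I cu"
    using C unfolding C1_curve_on_def C1c_def by blast
qed

definition C1_at :: "real set => (real => 'm) => real => bool"
  where "C1_at I cu t \<longleftrightarrow> (\<exists>c\<in>A. \<exists>v. \<exists>e>0. \<forall>s\<in>I \<inter> ball t e. cu s \<in> fst c \<and>
     ((snd c \<circ> cu) has_vector_derivative v s) (at s within I) \<and> continuous (at s within I) v)"

lemma continuous_chart:
  assumes c: "c \<in> A" "e > 0" and h: "\<And>s. s \<in> I \<inter> ball t e ==> cu s \<in> fst c" "t \<in> I"
    and cont: "continuous (at t within I) (snd c \<circ> cu)"
  shows "continuous (at t within I) cu"
proof -
  have t: "cu t \<in> fst c" using h c by simp
  then have "continuous (at t within I) (cinv c \<circ> (snd c \<circ> cu))"
    using continuous_within_compose3[where g = "cinv c" and x = t and f = "snd c \<circ> cu" and s = I]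
      cont_cinv[OF c(1) in_cim[OF t]] cont by (simp add: o_def)
  moreover have "\<forall>\<^sub>F s in at t within I. (cinv c \<circ> (snd c \<circ> cu)) s = cu s"
    unfolding eventually_at using c h by (auto intro!: exI[of _ e] simp: dist_commute)
  ultimately show ?thesis
    using t c unfolding continuous_within by (auto elim: Lim_transform_eventually simp: o_def)
qed

lemma C1c_C1_at:
  assumes "C1c I cu" "t \<in> I"
  shows "C1_at I cu t"
proof -
  obtain c where c: "c \<in> A" "cu t \<in> fst c" using chart_at by blast
  obtain e where "e > 0" "\<And>s. s \<in> I \<inter> ball t e ==> cu s \<in> fst c"
    using chart_nbhd[of I cu t "fst c"] assms c open_dom[OF c(1)] unfolding C1c_def by blast
  then show ?thesis using C1cD[OF assms(1) c(1)] c(1) unfolding C1_at_def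
    by (intro bexI[of _ c] exI[of _ "vel c I cu"] exI[of _ e]) auto
qed

lemma C1c_isom:
  assumes I: "nontriv I" and cu: "\<And>t. t \<in> I ==> C1_at I cu t" and f: "local_isom f"
  shows "C1c I (f \<circ> cu)"
  unfolding C1c_def
proof (intro conjI ballI impI)
  have "continuous (at t within I) cu" if t: "t \<in> I" for t
  proof -
    obtain c v e where "c \<in> A" "e > 0" and h: "\<And>s. s \<in> I \<inter> ball t e ==> cu s \<in> fst c \<and>
       ((snd c \<circ> cu) has_vector_derivative v s) (at s within I)"
      using cu[OF t] unfolding C1_at_def by blast
    moreover have "continuous (at t within I) (snd c \<circ> cu)"
      using h[of t] t \<open>e > 0\<close> has_vector_derivative_continuous by auto
    ultimately show ?thesis using t by (intro continuous_chart[of c e I t]) auto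
  qed
  then have ccu: "continuous_on I cu" using continuous_on_eq_continuous_within by blast
  then show cf: "continuous_on I (f \<circ> cu)"
    using local_isom_cont[OF f] continuous_on_compose continuous_on_subset by blast
  fix d t assume d: "d \<in> A" and t: "t \<in> I" and td: "(f \<circ> cu) t \<in> fst d"
  obtain c v e where c: "c \<in> A" "e > 0" and h: "\<And>s. s \<in> I \<inter> ball t e ==> cu s \<in> fst c \<and>
     ((snd c \<circ> cu) has_vector_derivative v s) (at s within I) \<and> continuous (at s within I) v"
    using cu[OF t] unfolding C1_at_def by blast
  obtain e' where e': "e' > 0" "\<And>s. s \<in> I \<inter> ball t e' ==> (f \<circ> cu) s \<in> fst d"
    using chart_nbhd[OF cf t td open_dom[OF d]] by blast
  define w where "w s = dtr c d f (snd c (cu s)) (v s)" for s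
  have 1: "((snd d \<circ> (f \<circ> cu)) has_vector_derivative w s) (at s within I)" if "s \<in> I \<inter> ball t (min e e')" for s
  proof -
    have "s \<in> I" "continuous (at s within I) cu" "cu s \<in> fst c" "f (cu s) \<in> fst d" "((snd c \<circ> cu) has_vector_derivative v s) (at s within I)"
      using that h[of s] e'(2)[of s] ccu continuous_on_eq_continuous_within by auto
    then show ?thesis unfolding w_def by (rule curve_tr[OF c(1) d f])
  qed
  have 2: "vel d I (f \<circ> cu) s = w s" if "s \<in> I \<inter> ball t (min e e')" for s
    using 1[OF that] that by (intro vel_eqI[OF I]) auto
  have t': "t \<in> I \<inter> ball t (min e e')" using t c e' by simp
  show "((snd d \<circ> (f \<circ> cu)) has_vector_derivative vel d I (f \<circ> cu) t) (at t within I)"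
    using 1[OF t'] 2[OF t'] by simp
  have x: "snd c (cu t) \<in> tdom c d f" using tdom_chart[OF c(1) d f] h[of t] t' td by auto
  have cx: "continuous (at t within I) (\<lambda>s. snd c (cu s))"
    using h[of t] t' has_vector_derivative_continuous[of "snd c \<circ> cu"] by (auto simp: o_def)
  have "isCont (partial_deriv i (coord_rep c d f)) (snd c (cu t))" for i
    using continuous_partial_tr(1)[OF c(1) d f] open_tdom[OF c(1) d f] x continuous_on_eq_continuous_at by blast
  then have cp: "continuous (at t within I) (\<lambda>s. partial_deriv i (coord_rep c d f) (snd c (cu s)))" for i
    by (rule continuous_within_compose3[OF _ cx])
  have cv: "continuous (at t within I) (\<lambda>s. v s $ i)" for i
    using h[of t] t' by (intro continuous_component) auto
  have "continuous (at t within I) w"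
    unfolding w_def dtr_def by (intro continuous_sum continuous_scaleR cp cv)
  moreover have "\<forall>\<^sub>F s in at t within I. w s = vel d I (f \<circ> cu) s"
    unfolding eventually_at using 2 c e' by (intro exI[of _ "min e e'"]) (auto simp: dist_commute)
  ultimately show "continuous (at t within I) (vel d I (f \<circ> cu))"
    using 2[OF t'] unfolding continuous_within by (auto elim: Lim_transform_eventually)
qed

lemma C1cI: "nontriv I ==> (\<And>t. t \<in> I ==> C1_at I cu t) ==> C1c I cu"
  using C1c_isom[OF _ _ local_isom_id] by simp

lemma C1c_cont: "C1c I cu ==> continuous_on I cu"
  by (simp add: C1c_def)

lemma vel_tr_C1:
  assumes "nontriv I" "C1c I cu" "c \<in> A" "d \<in> A" "local_isom f" "t \<in> I" "cu t \<in> fst c" "f (cu t) \<in> fst d"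
  shows "vel d I (f \<circ> cu) t = dtr c d f (snd c (cu t)) (vel c I cu t)"
  by (rule vel_eqI[OF assms(1,6) curve_tr[OF assms(3,4,5,6) _ assms(7,8) C1cD(1)[OF assms(2,3,6,7)]]])
    (use C1c_cont[OF assms(2)] assms(6) continuous_on_eq_continuous_within in blast)

text \<open>Uses the derivative within I: it equals \<open>speed\<close> in the interior of an
  interval and is continuous up to the end points, where \<open>speed\<close> may see a break of the
  curve.\<close>

definition spd :: "real set => (real => 'm) => real => real"
  where "spd I cu t = (let c = (SOME c. c \<in> A \<and> cu t \<in> fst c) in sqrt (ip (g c) (snd c (cu t)) (vel c I cu t) (vel c I cu t)))"

lemma some_chart: "(SOME c. c \<in> A \<and> p \<in> fst c) \<in> A" "p \<in> fst (SOME c. c \<in> A \<and> p \<in> fst c)"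
  using someI_ex[of "\<lambda>c. c \<in> A \<and> p \<in> fst c"] chart_at[of p] by metis+

lemma spd_isom:
  assumes I: "nontriv I" and cu: "C1c I cu" and f: "local_isom f" and t: "t \<in> I" and c: "c \<in> A" "cu t \<in> fst c"
  shows "spd I (f \<circ> cu) t = sqrt (ip (g c) (snd c (cu t)) (vel c I cu t) (vel c I cu t))"
proof -
  define d where "d = (SOME c. c \<in> A \<and> f (cu t) \<in> fst c)"
  have d: "d \<in> A" "f (cu t) \<in> fst d" using some_chart[of "f (cu t)"] by (auto simp: d_def)
  have x: "snd c (cu t) \<in> tdom c d f" by (rule tdom_chart[OF c(1) d(1) f c(2) d(2)])
  show ?thesis
    using vel_tr_C1[OF I cu c(1) d(1) f t c(2) d(2)] tr_metric[OF c(1) d(1) f x] tr_chart[OF c(1) d(1) f c(2)]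
    by (simp add: spd_def d_def[symmetric] Let_def)
qed

lemma spd_chart:
  assumes "nontriv I" "C1c I cu" "t \<in> I" "c \<in> A" "cu t \<in> fst c"
  shows "spd I cu t = sqrt (ip (g c) (snd c (cu t)) (vel c I cu t) (vel c I cu t))"
  using spd_isom[OF assms(1,2) local_isom_id assms(3-5)] by simp

lemma spd_nonneg: "C1c I cu ==> nontriv I ==> t \<in> I ==> spd I cu t \<ge> 0"
proof -
  assume h: "C1c I cu" "nontriv I" "t \<in> I"
  obtain c where c: "c \<in> A" "cu t \<in> fst c" using chart_at by blast
  interpret C: chart_metric "cim c" "g c" by (rule chart_metric[OF c(1)])
  show ?thesis using spd_chart[OF h(2,1,3) c] C.ip_nonneg c by simp
qed

lemma spd_cont:
  assumes I: "nontriv I" and cu: "C1c I cu"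
  shows "continuous_on I (spd I cu)"
  unfolding continuous_on_eq_continuous_within
proof
  fix t assume t: "t \<in> I"
  obtain c where c: "c \<in> A" "cu t \<in> fst c" using chart_at by blast
  interpret C: chart_metric "cim c" "g c" by (rule chart_metric[OF c(1)])
  obtain e where e: "e > 0" "\<And>s. s \<in> I \<inter> ball t e ==> cu s \<in> fst c"
    using chart_nbhd[OF C1c_cont[OF cu] t c(2) open_dom[OF c(1)]] by blast
  have cx: "continuous (at t within I) (\<lambda>s. snd c (cu s))"
    using C1cD(1)[OF cu c(1) t c(2)] has_vector_derivative_continuous[of "snd c \<circ> cu"] by (auto simp: o_def)
  have v: "continuous (at t within I) (\<lambda>s. vel c I cu s $ i)" for i
    by (intro continuous_component C1cD(2)[OF cu c(1) t c(2)])
  have "isCont (\<lambda>x. g c x $ i $ j) (snd c (cu t))" for i j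
    using C.Ck_G_entry[of 0 i j] in_cim[OF c(2)] continuous_on_eq_continuous_at[OF C.D] unfolding Ck_on.simps(1) by blast
  then have G: "continuous (at t within I) (\<lambda>s. g c (snd c (cu s)) $ i $ j)" for i j
    by (rule continuous_within_compose3[OF _ cx])
  have "continuous (at t within I) (\<lambda>s. sqrt (\<Sum>i\<in>UNIV. vel c I cu s $ i * (\<Sum>j\<in>UNIV. g c (snd c (cu s)) $ i $ j * vel c I cu s $ j)))"
    by (intro continuous_intros v G)
  then have "continuous (at t within I) (\<lambda>s. sqrt (ip (g c) (snd c (cu s)) (vel c I cu s) (vel c I cu s)))"
    by (simp add: ip_def inner_vec_def matrix_vector_mult_def)
  moreover have "\<forall>\<^sub>F s in at t within I. sqrt (ip (g c) (snd c (cu s)) (vel c I cu s) (vel c I cu s)) = spd I cu s"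
    unfolding eventually_at using spd_chart[OF I cu _ c(1)] e by (intro exI[of _ e]) (auto simp: dist_commute)
  ultimately show "continuous (at t within I) (spd I cu)"
    using spd_chart[OF I cu t c] unfolding continuous_within by (auto elim: Lim_transform_eventually)
qed

lemma speed_eq_spd:
  assumes "a < t" "t < b"
  shows "speed A g cu t = spd {a..b} cu t"
  using assms by (simp add: speed_def spd_def vel_def ip_def at_within_Icc_at Let_def)

lemma nontriv_Icc: "a < b ==> nontriv {a..b}"
  by (auto simp: nontriv_def trivial_limit_within islimpt_Icc)

lemma C1c_integrable:
  assumes "C1c {a..b} cu" "a < b"
  shows "speed A g cu integrable_on {a..b}" "integral {a..b} (speed A g cu) = integral {a..b} (spd {a..b} cu)"
proof -
  have 1: "spd {a..b} cu integrable_on {a..b}"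
    by (intro integrable_continuous_interval spd_cont nontriv_Icc assms)
  have 2: "speed A g cu t = spd {a..b} cu t" if "t \<in> {a..b} - {a, b}" for t
    using speed_eq_spd[of a t b cu] that by auto
  show "speed A g cu integrable_on {a..b}" 
    by (rule integrable_spike_finite[of "{a, b}", OF _ 2 1]) auto
  show "integral {a..b} (speed A g cu) = integral {a..b} (spd {a..b} cu)"
    by (rule integral_spike[of "{a, b}"]) (use 2 in auto)
qed

lemma C1c_subset:
  assumes "C1c I cu" "J \<subseteq> I" "nontriv J"
  shows "C1c J cu"
proof (rule C1cI[OF assms(3)])
  fix t assume "t \<in> J"
  then have "C1_at I cu t" using C1c_C1_at assms by blast
  then obtain c v e where "c \<in> A" "e > 0" and h: "\<And>s. s \<in> I \<inter> ball t e ==> cu s \<in> fst c \<and>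
     ((snd c \<circ> cu) has_vector_derivative v s) (at s within I) \<and> continuous (at s within I) v"
    unfolding C1_at_def by blast
  moreover have "((snd c \<circ> cu) has_vector_derivative v s) (at s within J)" "continuous (at s within J) v"
    if "s \<in> J \<inter> ball t e" for s
    using h[of s] that assms(2) has_vector_derivative_within_subset[of _ _ s I J] continuous_within_subset[of s I v J] by auto
  ultimately show "C1_at J cu t" unfolding C1_at_def
    using assms(2) by (intro bexI[of _ c] exI[of _ v] exI[of _ e]) auto
qed

lemma C1c_cong:
  assumes "C1c I cu" "nontriv I" "\<And>t. t \<in> I ==> cu t = \<delta> t"
  shows "C1c I \<delta>"
proof (rule C1cI[OF assms(2)])
  fix t assume "t \<in> I"
  then have "C1_at I cu t" using C1c_C1_at assms by blast
  then obtain c v e where c: "c \<in> A" "e > 0" and h: "\<And>s. s \<in> I \<inter> ball t e ==> cu s \<in> fst c \<and>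
     ((snd c \<circ> cu) has_vector_derivative v s) (at s within I) \<and> continuous (at s within I) v"
    unfolding C1_at_def by blast
  have "\<delta> s \<in> fst c \<and> ((snd c \<circ> \<delta>) has_vector_derivative v s) (at s within I) \<and> continuous (at s within I) v"
    if "s \<in> I \<inter> ball t e" for s
    using h[OF that] assms(3) that by (auto intro: has_vector_derivative_transform[of s I "snd c \<circ> \<delta>" "snd c \<circ> cu"])
  then show "C1_at I \<delta> t" unfolding C1_at_def using c by blast
qed

lemma C1c_affine:
  assumes cu: "C1c I cu" and J: "nontriv J" "\<And>t. t \<in> J ==> m * t + k \<in> I" and I: "nontriv I"
  shows "C1c J (\<lambda>t. cu (m * t + k))" "t \<in> J ==> spd J (\<lambda>t. cu (m * t + k)) t = \<bar>m\<bar> * spd I cu (m * t + k)"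
proof -
  let ?\<phi> = "\<lambda>t. m * t + k"
  have \<phi>: "continuous (at t within J) ?\<phi>" for t by (intro continuous_intros)
  have d: "((snd c \<circ> (\<lambda>t. cu (?\<phi> t))) has_vector_derivative m *\<^sub>R vel c I cu (?\<phi> t)) (at t within J)"
    if "t \<in> J" "c \<in> A" "cu (?\<phi> t) \<in> fst c" for t c
  proof -
    have "(?\<phi> has_vector_derivative m) (at t within J)" by (auto intro!: derivative_eq_intros)
    moreover have "((snd c \<circ> cu) has_vector_derivative vel c I cu (?\<phi> t)) (at (?\<phi> t) within ?\<phi> ` J)"
      by (rule has_vector_derivative_within_subset[OF C1cD(1)[OF cu that(2) J(2)[OF that(1)] that(3)]]) (use J in auto)
    ultimately show ?thesis using vector_diff_chain_within[of ?\<phi> m t J "snd c \<circ> cu"] by (simp add: o_def)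
  qed
  have cv: "continuous (at t within J) (\<lambda>t. m *\<^sub>R vel c I cu (?\<phi> t))" if "t \<in> J" "c \<in> A" "cu (?\<phi> t) \<in> fst c" for t c
  proof -
    have "continuous (at (?\<phi> t) within ?\<phi> ` J) (vel c I cu)"
      by (rule continuous_within_subset[OF C1cD(2)[OF cu that(2) J(2)[OF that(1)] that(3)]]) (use J in auto)
    from continuous_within_compose2[OF \<phi> this] show ?thesis by (intro continuous_intros)
  qed
  have cont: "continuous_on J (\<lambda>t. cu (?\<phi> t))"
    by (rule continuous_on_compose2[OF C1c_cont[OF cu]]) (auto intro!: continuous_intros J)
  show C: "C1c J (\<lambda>t. cu (?\<phi> t))"
  proof (rule C1cI[OF J(1)])
    fix t assume t: "t \<in> J"
    obtain c where c: "c \<in> A" "cu (?\<phi> t) \<in> fst c" using chart_at by blast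
    obtain e where e: "e > 0" "\<And>s. s \<in> J \<inter> ball t e ==> cu (?\<phi> s) \<in> fst c"
      using chart_nbhd[OF cont t c(2) open_dom[OF c(1)]] by blast
    show "C1_at J (\<lambda>t. cu (?\<phi> t)) t" unfolding C1_at_def
      by (rule bexI[OF _ c(1)], rule exI[of _ "\<lambda>t. m *\<^sub>R vel c I cu (?\<phi> t)"], rule exI[of _ e])
        (use e d cv c in auto)
  qed
  assume t: "t \<in> J"
  obtain c where c: "c \<in> A" "cu (?\<phi> t) \<in> fst c" using chart_at by blast
  have "vel c J (\<lambda>t. cu (?\<phi> t)) t = m *\<^sub>R vel c I cu (?\<phi> t)"
    by (rule vel_eqI[OF J(1) t d[OF t c]])
  then show "spd J (\<lambda>t. cu (?\<phi> t)) t = \<bar>m\<bar> * spd I cu (?\<phi> t)"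
    using spd_chart[OF J(1) C t c] spd_chart[OF I cu J(2)[OF t] c]
    by (simp add: ip_lin real_sqrt_mult mult.assoc[symmetric])
qed

lemma segment_C1:
  assumes c: "c \<in> A" and I: "nontriv I" and seg: "\<And>t. t \<in> I ==> x + t *\<^sub>R w \<in> cim c"
  shows "C1c I (\<lambda>t. cinv c (x + t *\<^sub>R w))" "t \<in> I ==> vel c I (\<lambda>t. cinv c (x + t *\<^sub>R w)) t = w"
proof -
  have d: "((snd c \<circ> (\<lambda>t. cinv c (x + t *\<^sub>R w))) has_vector_derivative w) (at t within I)" if "t \<in> I" for t
  proof (rule has_vector_derivative_transform[OF that])
    show "((\<lambda>t. x + t *\<^sub>R w) has_vector_derivative w) (at t within I)"
      by (auto intro!: derivative_eq_intros)
  qed (use seg c in simp)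
  show "C1c I (\<lambda>t. cinv c (x + t *\<^sub>R w))"
    by (rule C1cI[OF I], unfold C1_at_def, rule bexI[OF _ c], rule exI[of _ "\<lambda>_. w"], rule exI[of _ 1])
      (use d seg c in auto)
  show "t \<in> I ==> vel c I (\<lambda>t. cinv c (x + t *\<^sub>R w)) t = w"
    by (rule vel_eqI[OF I _ d])
qed

subsection \<open>Length of piecewise smooth curves\<close>

lemma piecewiseE:
  assumes "piecewise_C1_curve A cu"
  obtains P where "finite P" "\<And>a b. 0 \<le> a ==> a < b ==> b \<le> 1 ==> {a<..<b} \<inter> P = {} ==> C1c {a..b} cu"
  using assms C1_curve_iff[OF nontriv_Icc] unfolding piecewise_C1_curve_def by metis

lemma piecewiseI:
  assumes "path cu" "finite P" "\<And>a b. 0 \<le> a ==> a < b ==> b \<le> 1 ==> {a<..<b} \<inter> P = {} ==> C1c {a..b} cu"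
  shows "piecewise_C1_curve A cu"
  using assms C1_curve_iff[OF nontriv_Icc] unfolding piecewise_C1_curve_def by metis

lemma piecewise_at:
  assumes "piecewise_C1_curve A cu"
  obtains P where "finite P" "\<And>t. t \<in> {0<..<1} - P ==> \<exists>a b. 0 \<le> a \<and> a < t \<and> t < b \<and> b \<le> 1 \<and> C1c {a..b} cu"
proof -
  obtain P where P: "finite P" "\<And>a b. 0 \<le> a ==> a < b ==> b \<le> 1 ==> {a<..<b} \<inter> P = {} ==> C1c {a..b} cu"
    using piecewiseE[OF assms] by blast
  have "\<exists>a b. 0 \<le> a \<and> a < t \<and> t < b \<and> b \<le> 1 \<and> C1c {a..b} cu" if t: "t \<in> {0<..<1} - P" for t
  proof -
    have "open ({0<..<1} - P)" using P(1) by (simp add: open_Diff finite_imp_closed)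
    then obtain e where e: "e > 0" "ball t e \<subseteq> {0<..<1} - P" using t open_contains_ball by blast
    have sub: "s \<in> {0<..<1} - P" if "t - e/2 \<le> s" "s \<le> t + e/2" for s
    proof -
      have "dist t s < e" using e(1) that by (simp add: dist_real_def abs_if)
      then show ?thesis using e(2) by auto
    qed
    have "0 \<le> t - e/2" "t + e/2 \<le> 1" using sub[of "t - e/2"] sub[of "t + e/2"] e(1) by auto
    moreover have "{t - e/2<..<t + e/2} \<inter> P = {}"
      using sub by (meson DiffD2 disjoint_iff greaterThanLessThan_iff less_imp_le)
    ultimately show ?thesis using P(2)[of "t - e/2" "t + e/2"] e(1)
      by (intro exI[of _ "t - e/2"] exI[of _ "t + e/2"]) auto
  qed
  then show ?thesis using that P(1) by blast
qed

lemma speed_nonneg: "speed A g cu t \<ge> 0"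
proof -
  define c where "c = (SOME c. c \<in> A \<and> cu t \<in> fst c)"
  have c: "c \<in> A" "cu t \<in> fst c" using some_chart by (auto simp: c_def)
  interpret C: chart_metric "cim c" "g c" by (rule chart_metric[OF c(1)])
  show ?thesis using C.ip_nonneg[of "snd c (cu t)"] c
    by (simp add: speed_def c_def[symmetric] Let_def ip_def)
qed

lemma speed_integrable:
  assumes "piecewise_C1_curve A cu" "0 \<le> a" "a \<le> b" "b \<le> 1"
  shows "speed A g cu integrable_on {a..b}"
proof -
  obtain P where P: "finite P" "\<And>a b. 0 \<le> a ==> a < b ==> b \<le> 1 ==> {a<..<b} \<inter> P = {} ==> C1c {a..b} cu"
    using piecewiseE[OF assms(1)] by blast
  show ?thesis
  proof (rule piecewise_integrable[OF P(1) _ assms(3)])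
    fix a' b' assume "a \<le> a'" "a' \<le> b'" "b' \<le> b" "{a'<..<b'} \<inter> P = {}"
    then show "speed A g cu integrable_on {a'..b'}"
      using C1c_integrable(1)[OF P(2)[of a' b']] assms integrable_on_refl[of "speed A g cu" b'] by (cases "a' = b'") auto
  qed
qed

lemma curve_length_nonneg: "curve_length A g cu \<ge> 0"
  unfolding curve_length_def
  by (cases "speed A g cu integrable_on {0..1}") (auto intro: integral_nonneg speed_nonneg simp: not_integrable_integral)

text \<open>All lower bounds for lengths come from this lemma, applied to a coordinate \<open>h\<close> of the curve.\<close>

lemma length_lower_bound:
  assumes cu: "piecewise_C1_curve A cu" and ab: "0 \<le> a" "a \<le> b" "b \<le> 1"
    and h: "continuous_on {a..b} h" and K: "K \<ge> 0"
    and d: "\<And>t a' b'. t \<in> {a<..<b} ==> 0 \<le> a' ==> a' < t ==> t < b' ==> b' \<le> 1 ==> C1c {a'..b'} cu ==>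
      \<exists>h'. (h has_real_derivative h') (at t) \<and> h' \<le> K * spd {a'..b'} cu t"
  shows "h b - h a \<le> K * curve_length A g cu"
proof -
  obtain P where P: "finite P" "\<And>t. t \<in> {0<..<1} - P ==> \<exists>a b. 0 \<le> a \<and> a < t \<and> t < b \<and> b \<le> 1 \<and> C1c {a..b} cu"
    using piecewise_at[OF cu] by blast
  have "\<exists>h'. (h has_real_derivative h') (at t) \<and> h' \<le> K * speed A g cu t" if t: "t \<in> {a<..<b} - P" for t
  proof -
    obtain a' b' where a': "0 \<le> a'" "a' < t" "t < b'" "b' \<le> 1" "C1c {a'..b'} cu"
      using P(2)[of t] t ab by auto
    then show ?thesis using d[of t a' b'] t speed_eq_spd[of a' t b' cu] by auto
  qed
  then obtain h' where h': "\<And>t. t \<in> {a<..<b} - P ==> (h has_real_derivative h' t) (at t) \<and> h' t \<le> K * speed A g cu t"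
    by metis
  have int: "(h' has_integral (h b - h a)) {a..b}"
    by (rule fundamental_theorem_of_calculus_interior_strong[OF P(1) ab(2) _ h])
      (use h' in \<open>auto simp: has_real_derivative_iff_has_vector_derivative\<close>)
  have sp: "speed A g cu integrable_on {a..b}" by (rule speed_integrable[OF cu ab])
  then have "((\<lambda>t. K * speed A g cu t) has_integral K * integral {a..b} (speed A g cu)) {a..b}"
    by (intro has_integral_mult_right integrable_integral)
  \<comment> \<open>At finitely many points the integrand is raised to at least h', so that the
    comparison of integrals is pointwise on the whole interval.\<close>
  then have int2: "((\<lambda>t. if t \<in> insert a (insert b P) then max (h' t) (K * speed A g cu t) else K * speed A g cu t)
      has_integral K * integral {a..b} (speed A g cu)) {a..b}"
    by (rule has_integral_spike_finite[of "insert a (insert b P)", rotated 2]) (use P in auto)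
  have "h b - h a \<le> K * integral {a..b} (speed A g cu)"
    by (rule has_integral_le[OF int int2]) (use h' in auto)
  also have "\<dots> \<le> K * integral {0..1} (speed A g cu)"
    by (intro mult_left_mono K integral_subset_le sp speed_integrable[OF cu]) (use ab speed_nonneg in auto)
  finally show ?thesis by (simp add: curve_length_def)
qed

lemma C1c_piecewise:
  assumes "C1c {0..1} cu"
  shows "piecewise_C1_curve A cu" "curve_length A g cu = integral {0..1} (spd {0..1} cu)"
proof -
  show "piecewise_C1_curve A cu"
    by (rule piecewiseI[of _ "{}"])
      (use assms C1c_cont C1c_subset[OF assms _ nontriv_Icc] in \<open>auto simp: path_def\<close>)
  show "curve_length A g cu = integral {0..1} (spd {0..1} cu)"
    unfolding curve_length_def using C1c_integrable(2)[OF assms] by simp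
qed

lemma rdist_bdd: "bdd_below {curve_length A g cu | cu. piecewise_C1_curve A cu \<and> pathstart cu = p \<and> pathfinish cu = q}"
  using curve_length_nonneg by (auto intro!: bdd_belowI[of _ 0])

lemma rdist_le_length:
  assumes "piecewise_C1_curve A cu" "pathstart cu = p" "pathfinish cu = q"
  shows "rdist A g p q \<le> curve_length A g cu"
  unfolding rdist_def by (rule cInf_lower[OF _ rdist_bdd]) (use assms in auto)

lemma rdist_le_C1:
  assumes cu: "C1c {a..b} cu" and ab: "a < b" and K: "\<And>t. t \<in> {a..b} ==> spd {a..b} cu t \<le> K"
  shows "rdist A g (cu a) (cu b) \<le> K * (b - a)"
proof -
  let ?\<delta> = "\<lambda>t. cu ((b - a) * t + a)"
  have in1: "(b - a) * t + a \<in> {a..b}" if "t \<in> {0..1}" for t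
    using that ab mult_left_mono[of t 1 "b - a"] mult_nonneg_nonneg[of "b - a" t] by (simp add: algebra_simps)
  have C: "C1c {0..1} ?\<delta>" and s: "\<And>t. t \<in> {0..1} ==> spd {0..1} ?\<delta> t = \<bar>b - a\<bar> * spd {a..b} cu ((b - a) * t + a)"
    using C1c_affine[OF cu nontriv_Icc in1 nontriv_Icc[OF ab]] by auto
  have "rdist A g (?\<delta> 0) (?\<delta> 1) \<le> curve_length A g ?\<delta>"
    by (rule rdist_le_length[OF C1c_piecewise(1)[OF C]]) (simp_all add: pathstart_def pathfinish_def)
  also have "\<dots> = integral {0..1} (spd {0..1} ?\<delta>)" by (rule C1c_piecewise(2)[OF C])
  also have "\<dots> \<le> integral {0..1} (\<lambda>t::real. K * (b - a))"
  proof (rule integral_le)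
    show "spd {0..1} ?\<delta> integrable_on {0..1}"
      by (intro integrable_continuous_interval spd_cont nontriv_Icc C) simp
    show "spd {0..1} ?\<delta> t \<le> K * (b - a)" if "t \<in> {0..1}" for t
      using s[OF that] K[OF in1[OF that]] ab by (simp add: mult.commute mult_right_mono)
  qed auto
  finally show ?thesis by simp
qed

lemma rdist_nonneg_ex:
  assumes "\<exists>cu. piecewise_C1_curve A cu \<and> pathstart cu = p \<and> pathfinish cu = q"
  shows "rdist A g p q \<ge> 0"
  unfolding rdist_def by (rule cInf_greatest) (use assms curve_length_nonneg in auto)

end

context riem_mfd
begin

lemma vel_cong:
  assumes "\<And>s. s \<in> J ==> cu s = \<delta> s" "t \<in> J"
  shows "vel c J cu t = vel c J \<delta> t"
proof -
  have "((snd c \<circ> cu) has_vector_derivative D) (at t within J) \<longleftrightarrow> ((snd c \<circ> \<delta>) has_vector_derivative D) (at t within J)" for D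
    using assms has_vector_derivative_transform[of t J "snd c \<circ> cu" "snd c \<circ> \<delta>" D]
      has_vector_derivative_transform[of t J "snd c \<circ> \<delta>" "snd c \<circ> cu" D] by auto
  then show ?thesis by (simp add: vel_def vector_derivative_def)
qed

lemma speed_reparam:
  assumes cu: "C1c {a..b} cu" and t: "a < m * t + k" "m * t + k < b"
    and eq: "\<eta> > 0" "\<And>s. \<bar>s - t\<bar> < \<eta> ==> \<delta> s = cu (m * s + k)"
  shows "speed A g \<delta> t = \<bar>m\<bar> * speed A g cu (m * t + k)"
proof -
  let ?u = "m * t + k"
  define c where "c = (SOME c. c \<in> A \<and> cu ?u \<in> fst c)"
  define v where "v = vel c {a..b} cu ?u"
  have \<delta>t: "\<delta> t = cu ?u" using eq by simp
  have d: "((snd c \<circ> cu) has_vector_derivative v) (at ?u)"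
    using C1cD(1)[OF cu some_chart(1)[of "cu ?u", folded c_def] _ some_chart(2)[of "cu ?u", folded c_def]] t
    by (simp add: v_def at_within_Icc_at)
  have "((\<lambda>s. m * s + k) has_vector_derivative m) (at t)" by (auto intro!: derivative_eq_intros)
  from vector_diff_chain_at[OF this d] have "((\<lambda>s. snd c (cu (m * s + k))) has_vector_derivative m *\<^sub>R v) (at t)"
    by (simp add: o_def)
  then have d': "((snd c \<circ> \<delta>) has_vector_derivative m *\<^sub>R v) (at t)"
    by (rule has_vector_derivative_transform_within_open[of _ _ _ "ball t \<eta>"])
      (use eq in \<open>auto simp: dist_real_def abs_minus_commute\<close>)
  show ?thesis
    unfolding speed_def \<delta>t c_def[symmetric] Let_def vector_derivative_at[OF d] vector_derivative_at[OF d']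
    by (simp add: matrix_vector_mult_scaleR real_sqrt_mult power2_eq_square[symmetric] mult.assoc[symmetric])
qed

text \<open>The interval {p..q} is the preimage of {0..1} under x -> m x + k. The value m = -1
  serves reversal, m = 2 the two halves of a join; break points and end points form a finite, hence
  negligible, set.\<close>

lemma length_reparam:
  assumes cu: "piecewise_C1_curve A cu" and m: "m \<noteq> 0" and pq: "p < q"
    and eq: "\<And>s. s \<in> {p<..<q} ==> \<delta> s = cu (m * s + k)" and im: "(\<lambda>x. (1 / m) * x - k / m) ` {0..1} = {p..q}"
  shows "(speed A g \<delta> has_integral curve_length A g cu) {p..q}"
proof -
  obtain P where P: "finite P" "\<And>t. t \<in> {0<..<1} - P ==> \<exists>a b. 0 \<le> a \<and> a < t \<and> t < b \<and> b \<le> 1 \<and> C1c {a..b} cu"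
    using piecewise_at[OF cu] by blast
  have "(speed A g cu has_integral curve_length A g cu) (cbox 0 1)"
    using speed_integrable[OF cu, of 0 1] by (auto simp: curve_length_def intro: integrable_integral)
  from has_integral_affinity[OF this m, of k]
  have "((\<lambda>x. speed A g cu (m * x + k)) has_integral (1 / \<bar>m\<bar>) * curve_length A g cu) {p..q}"
    using im by (simp add: cbox_interval)
  from has_integral_mult_right[OF this, of "\<bar>m\<bar>"]
  have I: "((\<lambda>x. \<bar>m\<bar> * speed A g cu (m * x + k)) has_integral curve_length A g cu) {p..q}"
    using m by simp
  let ?S = "(\<lambda>x. (1 / m) * x - k / m) ` (insert 0 (insert 1 P)) \<union> {p, q}"
  show ?thesis
  proof (rule has_integral_spike_finite[OF _ _ I])
    show "finite ?S" using P by simp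
    fix t assume t: "t \<in> {p..q} - ?S"
    define u where "u = m * t + k"
    have tu: "t = (1 / m) * u - k / m" using m by (simp add: u_def field_simps)
    have "u \<notin> insert 0 (insert 1 P)" using t tu by blast
    moreover have "u \<in> {0..1}"
    proof -
      obtain x where "x \<in> {0..1}" "t = (1 / m) * x - k / m" using t im by (metis (no_types, lifting) DiffD1 imageE)
      then show ?thesis using m by (simp add: u_def field_simps)
    qed
    ultimately have "u \<in> {0<..<1} - P" by auto
    then obtain a b where ab: "a < u" "u < b" "C1c {a..b} cu" using P(2) by blast
    have tpq: "p < t" "t < q" using t by auto
    show "speed A g \<delta> t = \<bar>m\<bar> * speed A g cu (m * t + k)"
    proof (rule speed_reparam[OF ab(3)])
      show "min (t - p) (q - t) > 0" using tpq by simp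
      show "\<delta> s = cu (m * s + k)" if "\<bar>s - t\<bar> < min (t - p) (q - t)" for s
        by (rule eq) (use that in \<open>auto simp: abs_less_iff\<close>)
    qed (use ab in \<open>auto simp: u_def\<close>)
  qed
qed

lemma piecewise_reverse:
  assumes cu: "piecewise_C1_curve A cu"
  shows "piecewise_C1_curve A (reversepath cu)" "curve_length A g (reversepath cu) = curve_length A g cu"
proof -
  obtain P where P: "finite P" "\<And>a b. 0 \<le> a ==> a < b ==> b \<le> 1 ==> {a<..<b} \<inter> P = {} ==> C1c {a..b} cu"
    using piecewiseE[OF cu] by blast
  show "piecewise_C1_curve A (reversepath cu)"
  proof (rule piecewiseI[of _ "(\<lambda>x. 1 - x) ` P"])
    show "path (reversepath cu)" using cu by (simp add: piecewise_C1_curve_def)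
    show "finite ((\<lambda>x. 1 - x) ` P)" using P by simp
    fix a b :: real assume ab: "0 \<le> a" "a < b" "b \<le> 1" "{a<..<b} \<inter> (\<lambda>x. 1 - x) ` P = {}"
    have "1 - x \<in> {a<..<b} \<inter> (\<lambda>x. 1 - x) ` P" if "x \<in> {1 - b<..<1 - a} \<inter> P" for x using that by auto
    then have "{1 - b<..<1 - a} \<inter> P = {}" using ab(4) by blast
    then have "C1c {1 - b..1 - a} cu" using P(2) ab by auto
    then have "C1c {a..b} (\<lambda>t. cu ((- 1) * t + 1))"
      by (rule C1c_affine(1)) (use ab in \<open>auto intro: nontriv_Icc\<close>)
    then show "C1c {a..b} (reversepath cu)" by (simp add: reversepath_def)
  qed
  have "(speed A g (reversepath cu) has_integral curve_length A g cu) {0..1}"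
    by (rule length_reparam[OF cu, of "- 1" _ _ _ 1])
      (auto simp: reversepath_def image_iff intro!: bexI[where x = "1 - _"])
  then show "curve_length A g (reversepath cu) = curve_length A g cu"
    by (simp add: curve_length_def[of A g "reversepath cu"] integral_unique)
qed

lemma piecewise_join:
  assumes cu: "piecewise_C1_curve A cu" and \<delta>: "piecewise_C1_curve A \<delta>" and eq: "pathfinish cu = pathstart \<delta>"
  shows "piecewise_C1_curve A (cu +++ \<delta>)" "curve_length A g (cu +++ \<delta>) = curve_length A g cu + curve_length A g \<delta>"
proof -
  obtain P where P: "finite P" "\<And>a b. 0 \<le> a ==> a < b ==> b \<le> 1 ==> {a<..<b} \<inter> P = {} ==> C1c {a..b} cu"
    using piecewiseE[OF cu] by blast
  obtain Q where Q: "finite Q" "\<And>a b. 0 \<le> a ==> a < b ==> b \<le> 1 ==> {a<..<b} \<inter> Q = {} ==> C1c {a..b} \<delta>"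
    using piecewiseE[OF \<delta>] by blast
  let ?R = "(\<lambda>x. x / 2) ` P \<union> (\<lambda>x. (x + 1) / 2) ` Q \<union> {1/2}"
  show "piecewise_C1_curve A (cu +++ \<delta>)"
  proof (rule piecewiseI[of _ ?R])
    show "path (cu +++ \<delta>)" using cu \<delta> eq by (simp add: piecewise_C1_curve_def)
    show "finite ?R" using P Q by simp
    fix a b :: real assume ab: "0 \<le> a" "a < b" "b \<le> 1" "{a<..<b} \<inter> ?R = {}"
    then have "1/2 \<notin> {a<..<b}" by blast
    then consider "b \<le> 1/2" | "a \<ge> 1/2" by fastforce
    then show "C1c {a..b} (cu +++ \<delta>)"
    proof cases
      case 1
      have "x / 2 \<in> {a<..<b} \<inter> ?R" if "x \<in> {2 * a<..<2 * b} \<inter> P" for x using that by auto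
      then have "{2 * a<..<2 * b} \<inter> P = {}" using ab(4) by blast
      then have "C1c {2 * a..2 * b} cu" using P(2) ab 1 by auto
      then have "C1c {a..b} (\<lambda>t. cu (2 * t + 0))"
        by (rule C1c_affine(1)) (use ab in \<open>auto intro: nontriv_Icc\<close>)
      then show ?thesis
        by (rule C1c_cong) (use ab 1 in \<open>auto intro: nontriv_Icc simp: joinpaths_def\<close>)
    next
      case 2
      have "(x + 1) / 2 \<in> {a<..<b} \<inter> ?R" if "x \<in> {2 * a - 1<..<2 * b - 1} \<inter> Q" for x using that by auto
      then have "{2 * a - 1<..<2 * b - 1} \<inter> Q = {}" using ab(4) by blast
      then have "C1c {2 * a - 1..2 * b - 1} \<delta>" using Q(2) ab 2 by auto
      then have "C1c {a..b} (\<lambda>t. \<delta> (2 * t + (- 1)))"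
        by (rule C1c_affine(1)) (use ab in \<open>auto intro: nontriv_Icc\<close>)
      then show ?thesis
      proof (rule C1c_cong)
        show "\<delta> (2 * t + - 1) = (cu +++ \<delta>) t" if "t \<in> {a..b}" for t
        proof (cases "t = 1/2")
          case True
          show ?thesis unfolding True using eq by (simp add: joinpaths_def pathfinish_def pathstart_def)
        next
          case False
          then show ?thesis using that 2 by (auto simp: joinpaths_def)
        qed
      qed (use ab in \<open>auto intro: nontriv_Icc\<close>)
    qed
  qed
  have "(speed A g (cu +++ \<delta>) has_integral curve_length A g cu) {0..1/2}"
    by (rule length_reparam[OF cu, of 2 _ _ _ 0])
      (auto simp: joinpaths_def image_iff intro!: bexI[where x = "2 * _"])
  moreover have "(speed A g (cu +++ \<delta>) has_integral curve_length A g \<delta>) {1/2..1}"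
    by (rule length_reparam[OF \<delta>, of 2 _ _ _ "- 1"])
      (auto simp: joinpaths_def image_iff field_simps intro!: bexI[where x = "2 * _ - 1"])
  ultimately have "(speed A g (cu +++ \<delta>) has_integral curve_length A g cu + curve_length A g \<delta>) {0..1}"
    by (intro has_integral_combine[of 0 "1/2" 1]) auto
  then show "curve_length A g (cu +++ \<delta>) = curve_length A g cu + curve_length A g \<delta>"
    by (simp add: curve_length_def[of A g "cu +++ \<delta>"] integral_unique)
qed

lemma piecewise_isom:
  assumes cu: "piecewise_C1_curve A cu" and f: "local_isom f"
  shows "piecewise_C1_curve A (f \<circ> cu)" "curve_length A g (f \<circ> cu) = curve_length A g cu"
proof -
  have isom: "C1c {a..b} (f \<circ> cu)" if "C1c {a..b} cu" "a < b" for a b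
    by (rule C1c_isom[OF nontriv_Icc[OF that(2)] C1c_C1_at[OF that(1)] f])
  obtain P where P: "finite P" "\<And>a b. 0 \<le> a ==> a < b ==> b \<le> 1 ==> {a<..<b} \<inter> P = {} ==> C1c {a..b} cu"
    using piecewiseE[OF cu] by blast
  show "piecewise_C1_curve A (f \<circ> cu)"
  proof (rule piecewiseI[OF _ P(1)])
    show "path (f \<circ> cu)" using cu local_isom_cont[OF f]
      by (auto simp: piecewise_C1_curve_def intro: path_continuous_image continuous_on_subset)
  qed (use P isom in auto)
  obtain P where P: "finite P" "\<And>t. t \<in> {0<..<1} - P ==> \<exists>a b. 0 \<le> a \<and> a < t \<and> t < b \<and> b \<le> 1 \<and> C1c {a..b} cu"
    using piecewise_at[OF cu] by blast
  have "speed A g (f \<circ> cu) t = speed A g cu t" if t: "t \<in> {0<..<1} - P" for t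
  proof -
    obtain a b where ab: "a < t" "t < b" "C1c {a..b} cu" using P(2)[OF t] by blast
    obtain c where c: "c \<in> A" "cu t \<in> fst c" using chart_at by blast
    have I: "nontriv {a..b}" "t \<in> {a..b}" using ab by (auto intro: nontriv_Icc)
    show ?thesis
      unfolding speed_eq_spd[OF ab(1,2)] spd_isom[OF I(1) ab(3) f I(2) c] spd_chart[OF I(1) ab(3) I(2) c] ..
  qed
  then show "curve_length A g (f \<circ> cu) = curve_length A g cu"
    unfolding curve_length_def
    by (intro integral_spike[of "insert 0 (insert 1 P)"]) (use P in auto)
qed

section \<open>Comparison with the Euclidean norm and definiteness of the distance\<close>

text \<open>Extrema of the quadratic form on the compact product of K with the unit sphere, extended
  to all v by homogeneity.\<close>

lemma ip_bounds:
  assumes c: "c \<in> A" and K: "compact K" "K \<subseteq> cim c"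
  obtains m M where "m > 0" "M > 0" "\<And>x v. x \<in> K ==> m * norm v \<le> sqrt (ip (g c) x v v)"
    "\<And>x v. x \<in> K ==> sqrt (ip (g c) x v v) \<le> M * norm v"
proof (cases "K = {}")
  case True
  then show ?thesis using that[of 1 1] by auto
next
  case False
  interpret C: chart_metric "cim c" "g c" by (rule chart_metric[OF c])
  let ?S = "K \<times> sphere (0 :: real ^ 'n) 1"
  let ?q = "\<lambda>p. ip (g c) (fst p) (snd p) (snd p)"
  have S: "compact ?S" by (intro compact_Times K compact_sphere)
  have "axis i (1::real) \<in> sphere (0 :: real ^ 'n) 1" for i by simp
  then have ne: "?S \<noteq> {}" using False by blast
  have G: "continuous_on ?S (\<lambda>p. g c (fst p) $ i $ j)" for i j
  proof -
    have "continuous_on K (\<lambda>x. g c x $ i $ j)"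
      by (rule continuous_on_subset[OF _ K(2)]) (use C.Ck_G_entry[of 0 i j] in simp)
    then show ?thesis by (rule continuous_on_compose2) (auto intro!: continuous_intros)
  qed
  have "continuous_on ?S (\<lambda>p. \<Sum>i\<in>UNIV. snd p $ i * (\<Sum>j\<in>UNIV. g c (fst p) $ i $ j * snd p $ j))"
    by (intro continuous_intros G)
  then have cont: "continuous_on ?S ?q" by (simp add: ip_def inner_vec_def matrix_vector_mult_def)
  obtain p where p: "p \<in> ?S" "\<And>q. q \<in> ?S ==> ?q p \<le> ?q q" using continuous_attains_inf[OF S ne cont] by blast
  obtain r where r: "r \<in> ?S" "\<And>q. q \<in> ?S ==> ?q q \<le> ?q r" using continuous_attains_sup[OF S ne cont] by blast
  have pos: "?q p > 0" using p(1) K by (intro C.ip_pos) auto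
  have pr: "?q p \<le> ?q r" using r p by blast
  have sc: "sqrt (ip (g c) x v v) = sqrt (?q (x, v /\<^sub>R norm v)) * norm v" if "v \<noteq> 0" for x v
    using that by (simp add: ip_lin real_sqrt_mult field_simps real_sqrt_divide)
  have in1: "(x, v /\<^sub>R norm v) \<in> ?S" if "x \<in> K" "v \<noteq> 0" for x and v :: "real ^ 'n" using that by simp
  show ?thesis
  proof (rule that[of "sqrt (?q p)" "sqrt (?q r)"])
    show "sqrt (?q p) > 0" "sqrt (?q r) > 0" using pos pr by auto
    fix x v assume x: "x \<in> K"
    show "sqrt (?q p) * norm v \<le> sqrt (ip (g c) x v v)"
      using sc[of v x] p(2)[OF in1[OF x, of v]] by (cases "v = 0") (auto simp: ip_lin mult_right_mono)
    show "sqrt (ip (g c) x v v) \<le> sqrt (?q r) * norm v"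
      using sc[of v x] r(2)[OF in1[OF x, of v]] by (cases "v = 0") (auto simp: ip_lin mult_right_mono)
  qed
qed

text \<open>Up to its first exit from the coordinate ball the curve lies in the chart. Its
  coordinate in the direction a of the exit point grows by r, while the coordinate speed is at most
  1 / m times the Riemannian speed.\<close>

lemma exit_length:
  assumes c: "c \<in> A" and x0: "x0 \<in> cim c" and r: "r > 0" "cball x0 r \<subseteq> cim c"
    and m: "m > 0" "\<And>x v. x \<in> cball x0 r ==> m * norm v \<le> sqrt (ip (g c) x v v)"
    and cu: "piecewise_C1_curve A cu" "pathstart cu = cinv c x0" and z: "pathfinish cu \<notin> cinv c ` ball x0 r"
  shows "m * r \<le> curve_length A g cu"
proof -
  let ?N = "cinv c ` ball x0 r"
  have path: "continuous_on {0..1} cu" using cu by (simp add: piecewise_C1_curve_def path_def)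
  have Nopen: "open ?N"
  proof -
    have "?N = fst c \<inter> snd c -` ball x0 r"
    proof
      show "?N \<subseteq> fst c \<inter> snd c -` ball x0 r" using c r(2) ball_subset_cball[of x0 r] by fastforce
      show "fst c \<inter> snd c -` ball x0 r \<subseteq> ?N" using c by (auto intro!: image_eqI[where x = "snd c _"])
    qed
    then show ?thesis
      using continuous_on_open_vimage[OF open_dom[OF c]] homeomorphism_cont1[OF homeo[OF c]] open_ball by (metis Int_commute)
  qed
  have "compact (cinv c ` cball x0 r)"
    by (intro compact_continuous_image continuous_on_subset[OF homeomorphism_cont2[OF homeo[OF c]] r(2)] compact_cball)
  then have Kclosed: "closed (cinv c ` cball x0 r)" by (rule compact_imp_closed)
  \<comment> \<open>The first time outside the open coordinate ball is the infimum of this closed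
    set; there the curve lies on the closed ball by continuity, hence still in the chart.\<close>
  define Z where "Z = {0..1} \<inter> cu -` (- ?N)"
  have "closed Z" unfolding Z_def
    by (intro continuous_closed_preimage path) (use Nopen in auto)
  have Z1: "1 \<in> Z" using z by (simp add: Z_def pathfinish_def)
  define T where "T = Inf Z"
  have bdd: "bdd_below Z" unfolding Z_def by (intro bdd_belowI[of _ 0]) auto
  have TZ: "T \<in> Z" unfolding T_def by (intro closed_contains_Inf bdd \<open>closed Z\<close>) (use Z1 in auto)
  have T01: "0 \<le> T" "T \<le> 1" and TN: "cu T \<notin> ?N" using TZ by (auto simp: Z_def)
  have before: "cu s \<in> ?N" if "0 \<le> s" "s < T" for s
    using cInf_lower[OF _ bdd, of s] that T01 by (force simp: Z_def T_def)
  have cu0: "cu 0 = cinv c x0" using cu by (simp add: pathstart_def)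
  have "T \<noteq> 0" using TN cu0 r by auto
  then have T0: "T > 0" using T01 by simp
  have TK: "cu T \<in> cinv c ` cball x0 r"
  proof -
    have "T \<in> closure {0..<T}" using T0 by simp
    moreover have "continuous_on (closure {0..<T}) cu"
      using T0 T01 by (intro continuous_on_subset[OF path]) auto
    moreover have "cu ` {0..<T} \<subseteq> cinv c ` cball x0 r"
      using before ball_subset_cball[of x0 r] by fastforce
    ultimately show ?thesis
      using image_closure_subset[of "{0..<T}" cu, OF _ Kclosed] by blast
  qed
  have in_c: "cu s \<in> cinv c ` cball x0 r" if "0 \<le> s" "s \<le> T" for s
    using before[of s] TK that ball_subset_cball[of x0 r] by (cases "s = T") auto
  have dom: "cu s \<in> fst c" "snd c (cu s) \<in> cball x0 r" if s: "0 \<le> s" "s \<le> T" for s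
  proof -
    obtain y where "y \<in> cball x0 r" "cu s = cinv c y" using in_c[OF s] by blast
    then show "cu s \<in> fst c" "snd c (cu s) \<in> cball x0 r" using c r(2) by (auto simp: subset_eq simp del: mem_cball)
  qed
  have norm_T: "norm (snd c (cu T) - x0) = r"
  proof -
    have "norm (snd c (cu T) - x0) \<le> r" using dom[of T] T0 by (simp add: dist_norm norm_minus_commute)
    moreover have "\<not> norm (snd c (cu T) - x0) < r"
    proof
      assume "norm (snd c (cu T) - x0) < r"
      then have "snd c (cu T) \<in> ball x0 r" by (simp add: dist_norm norm_minus_commute)
      then have "cu T \<in> ?N" using dom[of T] T0 c by (metis cinv_left imageI order_refl less_imp_le)
      then show False using TN by blast
    qed
    ultimately show ?thesis by simp
  qed
  define a where "a = (1 / r) *\<^sub>R (snd c (cu T) - x0)"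
  have na: "norm a = 1" using norm_T r by (simp add: a_def)
  define h where "h t = a \<bullet> snd c (cu t)" for t
  have "h T - h 0 \<le> (1 / m) * curve_length A g cu"
  proof (rule length_lower_bound[OF cu(1), where h = h and a = 0 and b = T and K = "1 / m"])
    have "continuous_on {0..T} (\<lambda>t. snd c (cu t))"
      by (rule continuous_on_compose2[OF homeomorphism_cont1[OF homeo[OF c]] continuous_on_subset[OF path]]) (use dom T01 in auto)
    then show "continuous_on {0..T} h" unfolding h_def by (intro continuous_intros)
    fix t a' b' assume t: "t \<in> {0<..<T}" "0 \<le> a'" "a' < t" "t < b'" "b' \<le> 1" and C: "C1c {a'..b'} cu"
    have I: "nontriv {a'..b'}" "t \<in> {a'..b'}" using t by (auto intro: nontriv_Icc)
    have tc: "cu t \<in> fst c" "snd c (cu t) \<in> cball x0 r" using dom[of t] t by auto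
    let ?v = "vel c {a'..b'} cu t"
    have "((snd c \<circ> cu) has_vector_derivative ?v) (at t)"
      using C1cD(1)[OF C c I(2) tc(1)] t by (simp add: at_within_Icc_at)
    then have "(h has_real_derivative a \<bullet> ?v) (at t)"
      unfolding h_def has_real_derivative_iff_has_vector_derivative
      using bounded_linear.has_vector_derivative[OF bounded_linear_inner_right, of "snd c \<circ> cu" ?v "at t" a] by (simp add: o_def)
    moreover have "a \<bullet> ?v \<le> norm ?v" using norm_cauchy_schwarz[of a ?v] na by simp
    moreover have "norm ?v \<le> (1 / m) * spd {a'..b'} cu t"
      using m(2)[OF tc(2), of ?v] m(1) spd_chart[OF I(1) C I(2) c tc(1)] by (simp add: field_simps)
    ultimately show "\<exists>h'. (h has_real_derivative h') (at t) \<and> h' \<le> (1 / m) * spd {a'..b'} cu t"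
      using order_trans by blast
  qed (use T01 m in auto)
  moreover have "h T - h 0 = r"
  proof -
    have "h T - h 0 = a \<bullet> (snd c (cu T) - x0)" using cu0 c x0 by (simp add: h_def inner_diff_right)
    also have "\<dots> = (1 / r) * (norm (snd c (cu T) - x0))\<^sup>2" by (simp add: a_def power2_norm_eq_inner)
    finally show ?thesis using norm_T r by (simp add: power2_eq_square)
  qed
  ultimately show ?thesis using m by (simp add: field_simps)
qed

lemma chart_ball:
  assumes c: "c \<in> A" "p \<in> fst c" and W: "open W" "p \<in> W"
  obtains r where "r > 0" "cball (snd c p) r \<subseteq> cim c" "cinv c ` cball (snd c p) r \<subseteq> W"
proof -
  have "open (cim c \<inter> cinv c -` W)"
    using continuous_on_open_vimage[OF open_cim[OF c(1)]] homeomorphism_cont2[OF homeo[OF c(1)]] W(1) by (metis Int_commute)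
  moreover have "snd c p \<in> cim c \<inter> cinv c -` W" using c W by simp
  ultimately obtain r where "r > 0" "cball (snd c p) r \<subseteq> cim c \<inter> cinv c -` W"
    using open_contains_cball by blast
  then show ?thesis using that[of r] by blast
qed

end

locale riem_conn = riem_mfd A g
  for A :: "('m::{t2_space,second_countable_topology}, 'n::finite) chart set" and g :: "('m, 'n) metric_coeffs" +
  assumes conn: "connected (UNIV :: 'm set)"
begin

text \<open>Being joined by a curve is an equivalence relation with open classes, since coordinate
  segments fill coordinate balls; connectedness leaves one class.\<close>

lemma curve_exists: "\<exists>cu. piecewise_C1_curve A cu \<and> pathstart cu = p \<and> pathfinish cu = q"
proof (rule connected_equivalence_relation[OF conn, of p q "\<lambda>p q. \<exists>cu. piecewise_C1_curve A cu \<and> pathstart cu = p \<and> pathfinish cu = q"])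
  show "\<exists>cu. piecewise_C1_curve A cu \<and> pathstart cu = y \<and> pathfinish cu = x"
    if "\<exists>cu. piecewise_C1_curve A cu \<and> pathstart cu = x \<and> pathfinish cu = y" for x y
    using that piecewise_reverse(1) pathstart_reversepath pathfinish_reversepath by metis
  show "\<exists>cu. piecewise_C1_curve A cu \<and> pathstart cu = x \<and> pathfinish cu = z"
    if "\<exists>cu. piecewise_C1_curve A cu \<and> pathstart cu = x \<and> pathfinish cu = y"
       "\<exists>cu. piecewise_C1_curve A cu \<and> pathstart cu = y \<and> pathfinish cu = z" for x y z
    using that piecewise_join(1) pathstart_join pathfinish_join by metis
  fix a :: 'm
  obtain c where c: "c \<in> A" "a \<in> fst c" using chart_at by blast
  obtain r where r: "r > 0" "cball (snd c a) r \<subseteq> cim c" using chart_ball[OF c open_UNIV UNIV_I] by metis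
  let ?T = "fst c \<inter> snd c -` ball (snd c a) r"
  have "open ?T" using continuous_on_open_vimage[OF open_dom[OF c(1)]] homeomorphism_cont1[OF homeo[OF c(1)]] open_ball by (metis Int_commute)
  moreover have "a \<in> ?T" using c r by simp
  moreover have "\<exists>cu. piecewise_C1_curve A cu \<and> pathstart cu = a \<and> pathfinish cu = x" if x: "x \<in> ?T" for x
  proof -
    let ?w = "snd c x - snd c a"
    have "snd c a + t *\<^sub>R ?w \<in> cim c" if "t \<in> {0..1}" for t
    proof -
      have "norm (t *\<^sub>R ?w) \<le> 1 * norm ?w" using that unfolding norm_scaleR by (intro mult_right_mono) auto
      then have "snd c a + t *\<^sub>R ?w \<in> cball (snd c a) r" using x by (simp add: dist_norm norm_minus_commute)
      then show ?thesis using r by blast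
    qed
    then have "C1c {0..1} (\<lambda>t. cinv c (snd c a + t *\<^sub>R ?w))"
      by (intro segment_C1(1)[OF c(1)] nontriv_Icc) auto
    from C1c_piecewise(1)[OF this] show ?thesis using c x
      by (intro exI[of _ "\<lambda>t. cinv c (snd c a + t *\<^sub>R ?w)"]) (simp add: pathstart_def pathfinish_def)
  qed
  ultimately show "\<exists>T. openin (top_of_set UNIV) T \<and> a \<in> T \<and> (\<forall>x\<in>T. \<exists>cu. piecewise_C1_curve A cu \<and> pathstart cu = a \<and> pathfinish cu = x)"
    by (metis open_openin subtopology_UNIV)
qed auto

abbreviation "d \<equiv> rdist A g"

lemma rdist_nonneg: "d p q \<ge> 0"
  by (rule rdist_nonneg_ex[OF curve_exists])

lemma rdist_ge:
  assumes "\<And>cu. piecewise_C1_curve A cu ==> pathstart cu = p ==> pathfinish cu = q ==> K \<le> curve_length A g cu"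
  shows "K \<le> d p q"
proof -
  have "\<exists>l. l \<in> {curve_length A g cu | cu. piecewise_C1_curve A cu \<and> pathstart cu = p \<and> pathfinish cu = q}"
    using curve_exists[of p q] by blast
  then show ?thesis unfolding rdist_def by (intro cInf_greatest) (use assms in auto)
qed

lemma rdist_sym: "d p q = d q p"
proof -
  have "d q p \<le> d p q" for p q
  proof (rule rdist_ge)
    fix cu assume "piecewise_C1_curve A cu" "pathstart cu = p" "pathfinish cu = q"
    then show "d q p \<le> curve_length A g cu"
      using rdist_le_length[OF piecewise_reverse(1)[of cu], of q p] piecewise_reverse(2)[of cu] by simp
  qed
  then show ?thesis by (meson antisym)
qed

lemma rdist_triangle: "d p r \<le> d p q + d q r"
proof -
  have "d p r - curve_length A g \<delta> \<le> d p q" if "piecewise_C1_curve A \<delta>" "pathstart \<delta> = q" "pathfinish \<delta> = r" for \<delta>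
  proof (rule rdist_ge)
    fix cu assume "piecewise_C1_curve A cu" "pathstart cu = p" "pathfinish cu = q"
    then show "d p r - curve_length A g \<delta> \<le> curve_length A g cu"
      using rdist_le_length[OF piecewise_join(1)[of cu \<delta>], of p r] piecewise_join(2)[of cu \<delta>] that by simp
  qed
  then have "d p r - d p q \<le> d q r" by (intro rdist_ge) (simp add: algebra_simps)
  then show ?thesis by simp
qed

lemma rdist_isom: "local_isom f ==> d (f p) (f q) \<le> d p q"
proof (rule rdist_ge)
  fix cu assume f: "local_isom f" and cu: "piecewise_C1_curve A cu" "pathstart cu = p" "pathfinish cu = q"
  then show "d (f p) (f q) \<le> curve_length A g cu"
    using rdist_le_length[OF piecewise_isom(1)[OF cu(1) f], of "f p" "f q"] piecewise_isom(2)[OF cu(1) f]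
    by (simp add: pathstart_compose pathfinish_compose)
qed

text \<open>Links the distance to the topology: a curve leaving a coordinate ball is long. It yields
  definiteness of the distance, places nearly convergent sequences in a chart, and supplies the
  compact set to which proper discontinuity is applied.\<close>

lemma small_ball:
  assumes W: "open W" "q \<in> W"
  obtains \<rho> K where "\<rho> > 0" "compact K" "K \<subseteq> W" "\<And>z. d q z < \<rho> ==> z \<in> K"
proof -
  obtain c where c: "c \<in> A" "q \<in> fst c" using chart_at by blast
  obtain r where r: "r > 0" "cball (snd c q) r \<subseteq> cim c" "cinv c ` cball (snd c q) r \<subseteq> W" using chart_ball[OF c W] by blast
  obtain m M where m: "m > 0" "\<And>x v. x \<in> cball (snd c q) r ==> m * norm v \<le> sqrt (ip (g c) x v v)"
    using ip_bounds[OF c(1) compact_cball r(2)] by metis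
  show ?thesis
  proof (rule that[of "m * r" "cinv c ` cball (snd c q) r"])
    show "m * r > 0" using m r by simp
    show "compact (cinv c ` cball (snd c q) r)"
      by (intro compact_continuous_image continuous_on_subset[OF homeomorphism_cont2[OF homeo[OF c(1)]] r(2)] compact_cball)
    show "cinv c ` cball (snd c q) r \<subseteq> W" by (rule r(3))
    fix z assume z: "d q z < m * r"
    show "z \<in> cinv c ` cball (snd c q) r"
    proof (rule ccontr)
      assume n: "z \<notin> cinv c ` cball (snd c q) r"
      have "m * r \<le> d q z"
      proof (rule rdist_ge)
        fix cu assume cu: "piecewise_C1_curve A cu" "pathstart cu = q" "pathfinish cu = z"
        show "m * r \<le> curve_length A g cu"
          by (rule exit_length[OF c(1) in_cim[OF c(2)] r(1,2) m cu(1)]) (use cu c n ball_subset_cball[of "snd c q" r] in auto)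
      qed
      then show False using z by simp
    qed
  qed
qed

lemma rdist_refl [simp]: "d p p = 0"
proof -
  obtain c where c: "c \<in> A" "p \<in> fst c" using chart_at by blast
  have C: "C1c {0..1} (\<lambda>t. cinv c (snd c p + t *\<^sub>R 0))"
    by (rule segment_C1(1)[OF c(1)]) (use c in \<open>auto intro: nontriv_Icc\<close>)
  have v: "vel c {0..1} (\<lambda>t. cinv c (snd c p + t *\<^sub>R 0)) t = 0" if "t \<in> {0..1}" for t
    by (rule segment_C1(2)[OF c(1)]) (use c that in \<open>auto intro: nontriv_Icc\<close>)
  have "spd {0..1} (\<lambda>t. cinv c (snd c p + t *\<^sub>R 0)) t \<le> 0" if "t \<in> {0..1}" for t
    using spd_chart[OF nontriv_Icc C that c(1)] v[OF that] c by (simp add: ip_lin)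
  from rdist_le_C1[OF C _ this] have "d p p \<le> 0" using c by simp
  then show ?thesis using rdist_nonneg[of p p] by simp
qed

lemma rdist_eq_0: "d p q = 0 \<longleftrightarrow> p = q"
proof
  assume 0: "d p q = 0"
  show "p = q"
  proof (rule ccontr)
    assume "p \<noteq> q"
    then have "open (- {q})" "p \<in> - {q}" by auto
    from small_ball[OF this] show False using 0 by (metis ComplD insertI1 subsetD)
  qed
qed simp

lemma metric_space: "Metric_space UNIV d"
  by (rule Metric_space.intro) (auto simp: rdist_nonneg rdist_eq_0 rdist_triangle intro: rdist_sym)

end

section \<open>Completeness and global geodesics\<close>

text \<open>A finite subcover leaves only finitely many local existence times, whose minimum is
  positive.\<close>

lemma uniform_flow:
  fixes X :: "'a::euclidean_space => 'a" and DX :: "'a => 'a \<Rightarrow>\<^sub>L 'a"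
  assumes U: "open U" and X: "\<And>y. y \<in> U ==> (X has_derivative blinfun_apply (DX y)) (at y)"
    and DX: "continuous_on U DX" and K: "compact K" "K \<subseteq> U"
  obtains \<epsilon> where "\<epsilon> > 0" "\<And>y. y \<in> K ==> \<exists>z. z 0 = y \<and> (\<forall>t. \<bar>t\<bar> < \<epsilon> \<longrightarrow> z t \<in> U \<and> (z has_vector_derivative X (z t)) (at t))"
proof -
  let ?P = "\<lambda>y \<epsilon>. \<exists>z. z 0 = y \<and> (\<forall>t. \<bar>t\<bar> < \<epsilon> \<longrightarrow> z t \<in> U \<and> (z has_vector_derivative X (z t)) (at t))"
  have "\<forall>y0\<in>K. \<exists>\<delta>>0. \<exists>\<epsilon>>0. \<forall>y\<in>ball y0 \<delta>. ?P y \<epsilon>"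
  proof
    fix y0 assume "y0 \<in> K"
    then have "y0 \<in> U" using K by blast
    show "\<exists>\<delta>>0. \<exists>\<epsilon>>0. \<forall>y\<in>ball y0 \<delta>. ?P y \<epsilon>"
      by (rule local_flow[OF U \<open>y0 \<in> U\<close> X DX]) blast+
  qed
  then obtain \<delta> \<epsilon> where de: "\<And>y0. y0 \<in> K ==> \<delta> y0 > 0 \<and> \<epsilon> y0 > 0 \<and> (\<forall>y\<in>ball y0 (\<delta> y0). ?P y (\<epsilon> y0))"
    by metis
  have "K \<subseteq> (\<Union>y\<in>K. ball y (\<delta> y))" using de by force
  then obtain C where C: "C \<subseteq> K" "finite C" "K \<subseteq> (\<Union>y\<in>C. ball y (\<delta> y))"
    using compactE_image[OF K(1), of K "\<lambda>y. ball y (\<delta> y)"] by auto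
  show ?thesis
  proof (cases "C = {}")
    case True
    then show ?thesis using C that[of 1] by auto
  next
    case False
    show ?thesis
    proof (rule that[of "Min (\<epsilon> ` C)"])
      show "Min (\<epsilon> ` C) > 0" using False C de by (subst Min_gr_iff) auto
      fix y assume "y \<in> K"
      then obtain y0 where y0: "y0 \<in> C" "y \<in> ball y0 (\<delta> y0)" using C by blast
      then obtain z where "z 0 = y" "\<And>t. \<bar>t\<bar> < \<epsilon> y0 ==> z t \<in> U \<and> (z has_vector_derivative X (z t)) (at t)"
        using de C by blast
      moreover have "Min (\<epsilon> ` C) \<le> \<epsilon> y0" using y0 C by auto
      ultimately show "?P y (Min (\<epsilon> ` C))" by (intro exI[of _ z]) auto
    qed
  qed
qed

context riem_mfd
begin

lemma geo_C1c:
  assumes "geo_on I cu"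
  shows "C1c I cu"
  using assms has_vector_derivative_continuous unfolding geo_on_def C1c_def by blast

lemma vel_subset:
  assumes "C1c I cu" "J \<subseteq> I" "nontriv J" "t \<in> J" "c \<in> A" "cu t \<in> fst c"
  shows "vel c J cu t = vel c I cu t"
  by (rule vel_eqI[OF assms(3,4) has_vector_derivative_within_subset[OF C1cD(1)[OF assms(1,5) _ assms(6)] assms(2)]])
    (use assms in auto)

lemma spd_subset:
  assumes "C1c I cu" "J \<subseteq> I" "nontriv J" "nontriv I" "t \<in> J"
  shows "spd J cu t = spd I cu t"
proof -
  obtain c where c: "c \<in> A" "cu t \<in> fst c" using chart_at by blast
  show ?thesis
    using spd_chart[OF assms(3) C1c_subset[OF assms(1-3)] assms(5) c] spd_chart[OF assms(4,1) _ c]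
      vel_subset[OF assms(1-3,5) c] assms by auto
qed

lemma geo_on_subset:
  assumes "geo_on I cu" "J \<subseteq> I" "nontriv J"
  shows "geo_on J cu"
proof (rule geo_onI[OF assms(3)])
  fix t assume "t \<in> J"
  then have "geo_at I cu t" using geo_on_geo_at assms by blast
  then obtain c v e where c: "c \<in> A" "e > 0" and h: "\<And>s. s \<in> I \<inter> ball t e ==> cu s \<in> fst c \<and>
     ((snd c \<circ> cu) has_vector_derivative v s) (at s within I) \<and>
     (v has_vector_derivative - Gam (g c) (snd c (cu s)) (v s) (v s)) (at s within I)"
    unfolding geo_at_def by blast
  have "cu s \<in> fst c \<and> ((snd c \<circ> cu) has_vector_derivative v s) (at s within J) \<and>
     (v has_vector_derivative - Gam (g c) (snd c (cu s)) (v s) (v s)) (at s within J)" if "s \<in> J \<inter> ball t e" for s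
    using h[of s] that assms(2) has_vector_derivative_within_subset[of _ _ s I J] by auto
  then show "geo_at J cu t" unfolding geo_at_def using c by blast
qed

lemma geo_on_local:
  assumes I: "open I"
    and loc: "\<And>t. t \<in> I ==> \<exists>K \<zeta>. open K \<and> t \<in> K \<and> K \<subseteq> I \<and> geo_on K \<zeta> \<and> (\<forall>s\<in>K. cu s = \<zeta> s)"
  shows "geo_on I cu"
proof (rule geo_onI[OF nontriv_open[OF I]])
  fix t assume "t \<in> I"
  then obtain K \<zeta> where K: "open K" "t \<in> K" "K \<subseteq> I" "geo_on K \<zeta>" and eq: "\<And>s. s \<in> K ==> cu s = \<zeta> s" using loc by metis
  obtain c where c: "c \<in> A" "\<zeta> t \<in> fst c" using chart_at by blast
  obtain e where e: "e > 0" "\<And>s. s \<in> K \<inter> ball t e ==> \<zeta> s \<in> fst c"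
    using chart_nbhd[OF geo_on_cont[OF K(4)] K(2) c(2) open_dom[OF c(1)]] by blast
  obtain e' where e': "e' > 0" "ball t e' \<subseteq> K" using K(1,2) open_contains_ball by blast
  have "cu s \<in> fst c \<and> ((snd c \<circ> cu) has_vector_derivative vel c K \<zeta> s) (at s within I) \<and>
     (vel c K \<zeta> has_vector_derivative - Gam (g c) (snd c (cu s)) (vel c K \<zeta> s) (vel c K \<zeta> s)) (at s within I)"
    if "s \<in> I \<inter> ball t (min e e')" for s
  proof -
    have sK: "s \<in> K" and sc: "\<zeta> s \<in> fst c" using that e e' by auto
    note d = geo_onD[OF K(4) c(1) sK sc, unfolded at_within_open[OF sK K(1)]]
    have "((snd c \<circ> cu) has_vector_derivative vel c K \<zeta> s) (at s)"
      by (rule has_vector_derivative_transform_within_open[OF d(1) K(1) sK]) (simp add: eq)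
    then show ?thesis using sc d(2) eq[OF sK] by (auto intro: has_vector_derivative_at_within)
  qed
  then show "geo_at I cu t" unfolding geo_at_def
    using c e(1) e'(1) by (intro bexI[of _ c] exI[of _ "vel c K \<zeta>"] exI[of _ "min e e'"]) auto
qed

lemma geo_affine:
  assumes cu: "geo_on I cu" and J: "nontriv J" "\<And>t. t \<in> J ==> m * t + k \<in> I"
  shows "geo_on J (\<lambda>t. cu (m * t + k))"
    "t \<in> J ==> c \<in> A ==> cu (m * t + k) \<in> fst c ==> vel c J (\<lambda>t. cu (m * t + k)) t = m *\<^sub>R vel c I cu (m * t + k)"
proof -
  let ?\<phi> = "\<lambda>t. m * t + k"
  have chain: "((\<lambda>t. f (?\<phi> t)) has_vector_derivative m *\<^sub>R v) (at t within J)"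
    if "t \<in> J" "(f has_vector_derivative v) (at (?\<phi> t) within I)" for f :: "real => real ^ 'n" and v t
  proof -
    have "(?\<phi> has_vector_derivative m) (at t within J)" by (auto intro!: derivative_eq_intros)
    moreover have "(f has_vector_derivative v) (at (?\<phi> t) within ?\<phi> ` J)"
      by (rule has_vector_derivative_within_subset[OF that(2)]) (use J in auto)
    ultimately show ?thesis using vector_diff_chain_within[of ?\<phi> m t J f] by (simp add: o_def)
  qed
  have d: "((snd c \<circ> (\<lambda>t. cu (?\<phi> t))) has_vector_derivative m *\<^sub>R vel c I cu (?\<phi> t)) (at t within J)"
    if "t \<in> J" "c \<in> A" "cu (?\<phi> t) \<in> fst c" for t c
    using chain[OF that(1) geo_onD(1)[OF cu that(2) J(2)[OF that(1)] that(3)]] by (simp add: o_def)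
  have d2: "((\<lambda>t. m *\<^sub>R vel c I cu (?\<phi> t)) has_vector_derivative
      - Gam (g c) (snd c (cu (?\<phi> t))) (m *\<^sub>R vel c I cu (?\<phi> t)) (m *\<^sub>R vel c I cu (?\<phi> t))) (at t within J)"
    if "t \<in> J" "c \<in> A" "cu (?\<phi> t) \<in> fst c" for t c
    using bounded_linear.has_vector_derivative[OF bounded_linear_scaleR_right
        chain[OF that(1) geo_onD(2)[OF cu that(2) J(2)[OF that(1)] that(3)]], of m]
    by (simp add: Gam_lin)
  have cont: "continuous_on J (\<lambda>t. cu (?\<phi> t))"
    by (rule continuous_on_compose2[OF geo_on_cont[OF cu]]) (auto intro!: continuous_intros J)
  show "geo_on J (\<lambda>t. cu (?\<phi> t))"
  proof (rule geo_onI[OF J(1)])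
    fix t assume t: "t \<in> J"
    obtain c where c: "c \<in> A" "cu (?\<phi> t) \<in> fst c" using chart_at by blast
    obtain e where e: "e > 0" "\<And>s. s \<in> J \<inter> ball t e ==> cu (?\<phi> s) \<in> fst c"
      using chart_nbhd[OF cont t c(2) open_dom[OF c(1)]] by blast
    show "geo_at J (\<lambda>t. cu (?\<phi> t)) t" unfolding geo_at_def
      by (rule bexI[OF _ c(1)], rule exI[of _ "\<lambda>t. m *\<^sub>R vel c I cu (?\<phi> t)"], rule exI[of _ e])
        (use e d d2 c in auto)
  qed
  show "t \<in> J ==> c \<in> A ==> cu (?\<phi> t) \<in> fst c ==> vel c J (\<lambda>t. cu (?\<phi> t)) t = m *\<^sub>R vel c I cu (?\<phi> t)"
    by (rule vel_eqI[OF J(1) _ d])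
qed

lemma geo_spd_const:
  assumes "convex I" "nontriv I" "geo_on I cu" "s \<in> I" "t \<in> I"
  shows "spd I cu t = spd I cu s"
proof -
  obtain c where c: "c \<in> A" "cu s \<in> fst c" using chart_at by blast
  obtain e where e: "e \<in> A" "cu t \<in> fst e" using chart_at by blast
  show ?thesis
    using spd_chart[OF assms(2) geo_C1c[OF assms(3)] assms(4) c] spd_chart[OF assms(2) geo_C1c[OF assms(3)] assms(5) e]
      speed_const[OF assms(1-4) c assms(5) e] by simp
qed

lemma solution_geo:
  assumes c: "c \<in> A"
    and z: "\<And>t. \<bar>t\<bar> < \<epsilon> ==> z t \<in> cim c \<times> UNIV \<and> (z has_vector_derivative chart_metric.geo_field (g c) (z t)) (at t)"
  shows "geo_on {t0 - \<epsilon><..<t0 + \<epsilon>} (\<lambda>t. cinv c (fst (z (t - t0))))"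
    "\<And>t. t \<in> {t0 - \<epsilon><..<t0 + \<epsilon>} ==> vel c {t0 - \<epsilon><..<t0 + \<epsilon>} (\<lambda>t. cinv c (fst (z (t - t0)))) t = snd (z (t - t0))"
proof -
  interpret C: chart_metric "cim c" "g c" by (rule chart_metric[OF c])
  let ?I = "{t0 - \<epsilon><..<t0 + \<epsilon>}" and ?cu = "\<lambda>t. cinv c (fst (z (t - t0)))"
  have I: "nontriv ?I" by (rule nontriv_open) simp
  have shift: "\<bar>t - t0\<bar> < \<epsilon>" if "t \<in> ?I" for t using that by (auto simp: abs_less_iff)
  have zc: "fst (z (t - t0)) \<in> cim c" if "t \<in> ?I" for t using z[OF shift[OF that]] by auto
  have dz: "((\<lambda>t. z (t - t0)) has_vector_derivative (snd (z (t - t0)), - Gam (g c) (fst (z (t - t0))) (snd (z (t - t0))) (snd (z (t - t0))))) (at t within ?I)"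
    if "t \<in> ?I" for t
  proof -
    have "((\<lambda>t. t - t0) has_vector_derivative 1) (at t)" by (auto intro!: derivative_eq_intros)
    from vector_diff_chain_at[OF this, of z] z[OF shift[OF that]]
    have "((\<lambda>t. z (t - t0)) has_vector_derivative C.geo_field (z (t - t0))) (at t)" by (simp add: o_def)
    then show ?thesis by (auto simp: C.geo_field_def intro: has_vector_derivative_at_within)
  qed
  have d1: "((\<lambda>t. fst (z (t - t0))) has_vector_derivative snd (z (t - t0))) (at t within ?I)"
    and d2: "((\<lambda>t. snd (z (t - t0))) has_vector_derivative - Gam (g c) (fst (z (t - t0))) (snd (z (t - t0))) (snd (z (t - t0)))) (at t within ?I)"
    if "t \<in> ?I" for t
    using bounded_linear.has_vector_derivative[OF bounded_linear_fst dz[OF that]]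
      bounded_linear.has_vector_derivative[OF bounded_linear_snd dz[OF that]] by auto
  have d: "((snd c \<circ> ?cu) has_vector_derivative snd (z (t - t0))) (at t within ?I)" if "t \<in> ?I" for t
    by (rule has_vector_derivative_transform[OF that _ d1[OF that]]) (use zc c in simp)
  show "geo_on ?I ?cu"
  proof (rule geo_onI[OF I], unfold geo_at_def, rule bexI[OF _ c], rule exI[of _ "\<lambda>t. snd (z (t - t0))"], rule exI[of _ 1], intro conjI ballI)
    fix t s assume s: "s \<in> ?I \<inter> ball t 1"
    then have s': "s \<in> ?I" by blast
    show "?cu s \<in> fst c" using zc[OF s'] c by simp
    show "((snd c \<circ> ?cu) has_vector_derivative snd (z (s - t0))) (at s within ?I)" by (rule d[OF s'])
    show "((\<lambda>t. snd (z (t - t0))) has_vector_derivative - Gam (g c) (snd c (?cu s)) (snd (z (s - t0))) (snd (z (s - t0)))) (at s within ?I)"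
      using d2[OF s'] zc[OF s'] c by simp
  qed simp
  show "\<And>t. t \<in> ?I ==> vel c ?I ?cu t = snd (z (t - t0))" by (rule vel_eqI[OF I _ d])
qed

lemma geo_glue:
  assumes I: "convex I" "open I" "geo_on I cu" and J: "convex J" "open J" "geo_on J \<delta>"
    and s: "s \<in> I" "s \<in> J" "cu s = \<delta> s" "c \<in> A" "cu s \<in> fst c" "vel c I cu s = vel c J \<delta> s"
  shows "geo_on (I \<union> J) (\<lambda>t. if t \<in> I then cu t else \<delta> t)" "\<And>t. t \<in> I \<inter> J ==> cu t = \<delta> t"
proof -
  have n: "nontriv (I \<inter> J)" "nontriv (I \<union> J)" using I J by (auto intro: nontriv_open)
  show eq: "cu t = \<delta> t" if "t \<in> I \<inter> J" for t
  proof (rule geo_unique[of "I \<inter> J" cu \<delta> s c t])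
    show "convex (I \<inter> J)" using I J convex_Int by blast
    show "geo_on (I \<inter> J) cu" "geo_on (I \<inter> J) \<delta>"
      using geo_on_subset[OF I(3) _ n(1)] geo_on_subset[OF J(3) _ n(1)] by auto
    have "vel c (I \<inter> J) cu s = vel c I cu s" by (rule vel_subset[OF geo_C1c[OF I(3)] _ n(1)]) (use s in auto)
    moreover have "vel c (I \<inter> J) \<delta> s = vel c J \<delta> s" by (rule vel_subset[OF geo_C1c[OF J(3)] _ n(1)]) (use s in auto)
    ultimately show "vel c (I \<inter> J) cu s = vel c (I \<inter> J) \<delta> s" using s by simp
  qed (use s n that in auto)
  have op: "open (I \<union> J)" using I J by blast
  show "geo_on (I \<union> J) (\<lambda>t. if t \<in> I then cu t else \<delta> t)"
  proof (rule geo_on_local[OF op])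
    fix t assume t: "t \<in> I \<union> J"
    show "\<exists>K \<zeta>. open K \<and> t \<in> K \<and> K \<subseteq> I \<union> J \<and> geo_on K \<zeta> \<and> (\<forall>s\<in>K. (if s \<in> I then cu s else \<delta> s) = \<zeta> s)"
    proof (cases "t \<in> I")
      case True
      then show ?thesis using I by (intro exI[of _ I] exI[of _ cu]) auto
    next
      case False
      then show ?thesis using t J eq by (intro exI[of _ J] exI[of _ \<delta>]) auto
    qed
  qed
qed

end

locale riem_complete = riem_conn A g
  for A :: "('m::{t2_space,second_countable_topology}, 'n::finite) chart set" and g :: "('m, 'n) metric_coeffs" +
  assumes complete: "complete_riemannian A g"
begin

lemma geo_rdist:
  assumes I: "convex I" "nontriv I" and cu: "geo_on I cu" and s: "s \<in> I" "t \<in> I" "r \<in> I"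
  shows "d (cu s) (cu t) \<le> spd I cu r * \<bar>s - t\<bar>"
proof -
  have *: "d (cu s) (cu t) \<le> spd I cu r * (t - s)" if "s < t" "s \<in> I" "t \<in> I" for s t
  proof (rule rdist_le_C1[OF _ that(1)])
    have sub: "{s..t} \<subseteq> I" using I(1) that closed_segment_subset[of s I t] by (simp add: closed_segment_eq_real_ivl)
    then show "C1c {s..t} cu" by (intro C1c_subset[OF geo_C1c[OF cu]] nontriv_Icc that)
    fix q assume "q \<in> {s..t}"
    then show "spd {s..t} cu q \<le> spd I cu r"
      using spd_subset[OF geo_C1c[OF cu] sub nontriv_Icc[OF that(1)] I(2)] geo_spd_const[OF I cu s(3)] sub by auto
  qed
  show ?thesis
    using *[of s t] *[of t s] s rdist_sym[of "cu s" "cu t"] by (cases s t rule: linorder_cases) auto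
qed

text \<open>From metric to geodesic completeness. Bounded speed makes the points cu (\<tau> k) a
  Cauchy sequence with a limit q. States near q of the given speed lie in a compact set and share an
  existence time \<epsilon>; restarting less than \<epsilon> / 2 before b leads past b.\<close>

lemma geo_extend_right:
  assumes ab: "a < b" and cu: "geo_on {a<..<b} cu"
  shows "\<exists>\<epsilon>>0. \<exists>\<delta>. geo_on {a<..<b + \<epsilon>} \<delta> \<and> (\<forall>t\<in>{a<..<b}. \<delta> t = cu t)"
proof -
  interpret M: Metric_space UNIV d by (rule metric_space)
  let ?I = "{a<..<b}"
  have I: "convex ?I" "nontriv ?I" by (auto intro: nontriv_open)
  define r where "r = (a + b) / 2"
  have r: "r \<in> ?I" using ab by (simp add: r_def)
  define \<sigma> where "\<sigma> = spd ?I cu r"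
  have \<sigma>: "\<sigma> \<ge> 0" unfolding \<sigma>_def by (rule spd_nonneg[OF geo_C1c[OF cu] I(2) r])
  define \<tau> where "\<tau> k = b - (b - a) / (real k + 2)" for k :: nat
  have \<tau>: "\<tau> k \<in> ?I" for k
  proof -
    have "(b - a) / (real k + 2) < (b - a) / 1" using ab by (intro divide_strict_left_mono) auto
    moreover have "(b - a) / (real k + 2) > 0" using ab by simp
    ultimately show ?thesis by (simp add: \<tau>_def)
  qed
  have \<tau>lim: "\<tau> \<longlonglongrightarrow> b"
  proof -
    have "(\<lambda>k. b - (b - a) * inverse (real (k + 2))) \<longlonglongrightarrow> b - (b - a) * 0"
      by (intro tendsto_intros LIMSEQ_ignore_initial_segment[OF lim_inverse_n])
    then show ?thesis by (simp add: \<tau>_def[abs_def] divide_inverse add.commute)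
  qed
  have "M.MCauchy (\<lambda>k. cu (\<tau> k))"
    unfolding M.MCauchy_def
  proof (intro conjI allI impI)
    fix e :: real assume e: "e > 0"
    have "Cauchy \<tau>" using \<tau>lim LIMSEQ_imp_Cauchy by blast
    moreover have "e / (\<sigma> + 1) > 0" using e \<sigma> by simp
    ultimately obtain N where N: "\<And>m n. m \<ge> N ==> n \<ge> N ==> dist (\<tau> m) (\<tau> n) < e / (\<sigma> + 1)"
      unfolding Cauchy_def by metis
    have "d (cu (\<tau> m)) (cu (\<tau> n)) < e" if "N \<le> m" "N \<le> n" for m n
    proof -
      have "d (cu (\<tau> m)) (cu (\<tau> n)) \<le> \<sigma> * \<bar>\<tau> m - \<tau> n\<bar>"
        unfolding \<sigma>_def by (rule geo_rdist[OF I cu \<tau> \<tau> r])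
      also have "\<dots> \<le> (\<sigma> + 1) * \<bar>\<tau> m - \<tau> n\<bar>" by (simp add: algebra_simps)
      also have "\<dots> < (\<sigma> + 1) * (e / (\<sigma> + 1))"
        using N[OF that] \<sigma> by (intro mult_strict_left_mono) (auto simp: dist_real_def)
      finally show ?thesis using \<sigma> by simp
    qed
    then show "\<exists>N. \<forall>n n'. N \<le> n \<longrightarrow> N \<le> n' \<longrightarrow> d (cu (\<tau> n)) (cu (\<tau> n')) < e" by blast
  qed simp
  then obtain q where "limitin M.mtopology (\<lambda>k. cu (\<tau> k)) q sequentially"
    using complete unfolding complete_riemannian_def M.mcomplete_def by blast
  then have lim: "\<And>e. e > 0 ==> \<forall>\<^sub>F k in sequentially. d (cu (\<tau> k)) q < e"
    unfolding M.limitin_metric by auto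
  obtain c where c: "c \<in> A" "q \<in> fst c" using chart_at by blast
  interpret C: chart_metric "cim c" "g c" by (rule chart_metric[OF c(1)])
  obtain R where R: "R > 0" "cball (snd c q) R \<subseteq> cim c" using chart_ball[OF c open_UNIV UNIV_I] by metis
  obtain m M where m: "m > 0" "\<And>x v. x \<in> cball (snd c q) R ==> m * norm v \<le> sqrt (ip (g c) x v v)"
    using ip_bounds[OF c(1) compact_cball R(2)] by metis
  \<comment> \<open>The lower bound m for the metric converts the Riemannian speed \<sigma> into a
    bound on the coordinate norm of the velocity.\<close>
  let ?K = "cball (snd c q) R \<times> cball (0 :: real ^ 'n) (\<sigma> / m)"
  have "?K \<subseteq> cim c \<times> UNIV" "compact ?K" using R by (auto intro!: compact_Times)
  then obtain \<epsilon> where \<epsilon>: "\<epsilon> > 0" "\<And>y. y \<in> ?K ==> \<exists>z. z 0 = y \<and> (\<forall>t. \<bar>t\<bar> < \<epsilon> \<longrightarrow> z t \<in> cim c \<times> UNIV \<and> (z has_vector_derivative C.geo_field (z t)) (at t))"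
    using uniform_flow[OF open_Times[OF C.D open_UNIV] C.has_derivative_geo_field C.continuous_geo_field_deriv] by metis
  have "open (fst c \<inter> snd c -` ball (snd c q) R)" 
    using continuous_on_open_vimage[OF open_dom[OF c(1)]] homeomorphism_cont1[OF homeo[OF c(1)]] open_ball by (metis Int_commute)
  moreover have "q \<in> fst c \<inter> snd c -` ball (snd c q) R" using c R by simp
  ultimately obtain \<rho> K where \<rho>: "\<rho> > 0" "K \<subseteq> fst c \<inter> snd c -` ball (snd c q) R" "\<And>z. d q z < \<rho> ==> z \<in> K"
    using small_ball by metis
  have "\<forall>\<^sub>F k in sequentially. d (cu (\<tau> k)) q < \<rho>" "\<forall>\<^sub>F k in sequentially. \<tau> k > b - \<epsilon> / 2"
    using lim[OF \<rho>(1)] order_tendstoD(1)[OF \<tau>lim, of "b - \<epsilon> / 2"] \<epsilon> by auto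
  then have "\<forall>\<^sub>F k in sequentially. d (cu (\<tau> k)) q < \<rho> \<and> \<tau> k > b - \<epsilon> / 2" by eventually_elim simp
  then obtain k where k: "d (cu (\<tau> k)) q < \<rho>" "\<tau> k > b - \<epsilon> / 2" using eventually_happens'[OF sequentially_bot] by blast
  define t1 where "t1 = \<tau> k"
  have t1: "t1 \<in> ?I" using \<tau> by (simp add: t1_def)
  have p1: "cu t1 \<in> fst c" "snd c (cu t1) \<in> ball (snd c q) R"
    using \<rho>(2) \<rho>(3)[of "cu t1"] k(1) rdist_sym by (auto simp: t1_def)
  let ?v = "vel c ?I cu t1"
  have "sqrt (ip (g c) (snd c (cu t1)) ?v ?v) = \<sigma>"
    using spd_chart[OF I(2) geo_C1c[OF cu] t1 c(1) p1(1)] geo_spd_const[OF I cu r t1] by (simp add: \<sigma>_def)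
  then have "norm ?v \<le> \<sigma> / m" using m(2)[of "snd c (cu t1)" ?v] p1 m(1) by (simp add: field_simps)
  then have "(snd c (cu t1), ?v) \<in> ?K" using p1 by simp
  then obtain z where z: "z 0 = (snd c (cu t1), ?v)"
    "\<And>t. \<bar>t\<bar> < \<epsilon> ==> z t \<in> cim c \<times> UNIV \<and> (z has_vector_derivative C.geo_field (z t)) (at t)" using \<epsilon>(2) by metis
  let ?J = "{t1 - \<epsilon><..<t1 + \<epsilon>}" and ?\<delta> = "\<lambda>t. cinv c (fst (z (t - t1)))"
  have \<delta>: "geo_on ?J ?\<delta>" by (rule solution_geo(1)[OF c(1) z(2)])
  have "vel c ?J ?\<delta> t1 = snd (z (t1 - t1))"
    by (rule solution_geo(2)[OF c(1), where \<epsilon> = \<epsilon> and z = z]) (use z(2) \<epsilon>(1) in auto)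
  then have v\<delta>: "vel c ?J ?\<delta> t1 = ?v" using z(1) by simp
  have "geo_on (?I \<union> ?J) (\<lambda>t. if t \<in> ?I then cu t else ?\<delta> t)"
    by (rule geo_glue(1)[OF _ _ cu _ _ \<delta> t1 _ _ c(1) p1(1)])
      (use \<epsilon>(1) z(1) v\<delta> c p1 in auto)
  moreover have "{a<..<b + \<epsilon> / 2} \<subseteq> ?I \<union> ?J" using t1 k(2) \<epsilon>(1) by (auto simp: t1_def)
  ultimately have "geo_on {a<..<b + \<epsilon> / 2} (\<lambda>t. if t \<in> ?I then cu t else ?\<delta> t)"
    by (rule geo_on_subset) (auto intro: nontriv_open)
  then show ?thesis using \<epsilon>(1) by (intro exI[of _ "\<epsilon> / 2"] conjI exI[of _ "\<lambda>t. if t \<in> ?I then cu t else ?\<delta> t"]) auto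
qed

lemma geo_extend:
  assumes T: "T > 0" and cu: "geo_on {-T<..<T} cu"
  shows "\<exists>T'>T. \<exists>\<delta>. geo_on {-T'<..<T'} \<delta> \<and> (\<forall>t\<in>{-T<..<T}. \<delta> t = cu t)"
proof -
  obtain e1 \<delta> where e1: "e1 > 0" "geo_on {-T<..<T + e1} \<delta>" "\<And>t. t \<in> {-T<..<T} ==> \<delta> t = cu t"
    using geo_extend_right[OF _ cu] T by auto
  \<comment> \<open>Reflecting time turns the left end into a right end; a second reflection
    restores the orientation.\<close>
  have "geo_on {-(T + e1)<..<T} (\<lambda>t. \<delta> ((- 1) * t + 0))"
    by (rule geo_affine(1)[OF e1(2)]) (auto intro: nontriv_open)
  then obtain e2 \<eta> where e2: "e2 > 0" "geo_on {-(T + e1)<..<T + e2} \<eta>" "\<And>t. t \<in> {-(T + e1)<..<T} ==> \<eta> t = \<delta> (- t)"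
    using geo_extend_right[of "-(T + e1)" T "\<lambda>t. \<delta> ((- 1) * t + 0)"] T e1(1) by auto
  define e where "e = min e1 e2"
  have e: "e > 0" using e1 e2 by (simp add: e_def)
  have "geo_on {-(T + e)<..<T + e} (\<lambda>t. \<eta> ((- 1) * t + 0))"
    by (rule geo_affine(1)[OF e2(2)]) (auto intro: nontriv_open simp: e_def)
  moreover have "\<eta> ((- 1) * t + 0) = cu t" if "t \<in> {-T<..<T}" for t
    using that e2(3)[of "- t"] e1(3)[of t] e1(1) by auto
  ultimately show ?thesis using e by (intro exI[of _ "T + e"] conjI exI[of _ "\<lambda>t. \<eta> ((- 1) * t + 0)"]) auto
qed

definition geo_init :: "('m, 'n) chart => 'm => real ^ 'n => real => (real => 'm) => bool"
  where "geo_init c p v T cu \<longleftrightarrow> geo_on {-T<..<T} cu \<and> cu 0 = p \<and> vel c {-T<..<T} cu 0 = v"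

lemma geo_init_unique:
  assumes c: "c \<in> A" "p \<in> fst c" and T: "0 < T" "T \<le> T'" and cu: "geo_init c p v T cu" and \<delta>: "geo_init c p v T' \<delta>" and t: "\<bar>t\<bar> < T"
  shows "cu t = \<delta> t"
proof (rule geo_unique[of "{-T<..<T}" cu \<delta> 0 c t])
  have n: "nontriv {-T<..<T}" by (auto intro: nontriv_open)
  have sub: "{-T<..<T} \<subseteq> {-T'<..<T'}" using T by auto
  have "geo_on {-T'<..<T'} \<delta>" using \<delta> by (simp add: geo_init_def)
  then show "geo_on {-T<..<T} \<delta>" by (rule geo_on_subset[OF _ sub n])
  have "vel c {-T<..<T} \<delta> 0 = vel c {-T'<..<T'} \<delta> 0"
    by (rule vel_subset[OF geo_C1c _ n _ c(1)]) (use \<delta> T c in \<open>auto simp: geo_init_def\<close>)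
  then show "vel c {-T<..<T} cu 0 = vel c {-T<..<T} \<delta> 0" using cu \<delta> by (simp add: geo_init_def)
qed (use assms in \<open>auto simp: geo_init_def abs_less_iff intro: nontriv_open\<close>)

text \<open>Solutions with the same initial data agree where both exist, so the diagonal t -> cu t
  t, which at each t uses a solution still existing there, is again a solution.\<close>

lemma geo_init_glue:
  assumes c: "c \<in> A" "p \<in> fst c" and \<tau>: "\<And>t. t \<in> I ==> \<bar>t\<bar> < \<tau> t" "\<And>t. t \<in> I ==> geo_init c p v (\<tau> t) (cu t)" and I: "open I" "0 \<in> I"
  shows "geo_on I (\<lambda>t. cu t t)" "cu 0 0 = p" "vel c I (\<lambda>t. cu t t) 0 = v"
proof -
  have n: "nontriv I" by (rule nontriv_open[OF I(1)])
  have eq: "cu s s = cu t s" if "t \<in> I" "s \<in> I" "\<bar>s\<bar> < \<tau> t" for s t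
  proof (cases "\<tau> s \<le> \<tau> t")
    case True
    show ?thesis by (rule geo_init_unique[OF c _ True \<tau>(2)[OF that(2)] \<tau>(2)[OF that(1)] \<tau>(1)[OF that(2)]]) (use \<tau>(1)[OF that(2)] in linarith)
  next
    case False
    then show ?thesis by (intro geo_init_unique[OF c _ _ \<tau>(2)[OF that(1)] \<tau>(2)[OF that(2)] that(3), symmetric]) (use \<tau>(1)[OF that(1)] in linarith)+
  qed
  let ?J = "\<lambda>t. {-\<tau> t<..<\<tau> t}"
  have loc: "open (I \<inter> ?J t)" "t \<in> I \<inter> ?J t" "geo_on (?J t) (cu t)" "\<forall>s\<in>I \<inter> ?J t. cu s s = cu t s" if "t \<in> I" for t
    using I \<tau>[OF that] eq[OF that] that by (auto simp: geo_init_def abs_less_iff)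
  have sub: "geo_on (I \<inter> ?J t) (cu t)" if "t \<in> I" for t
    by (rule geo_on_subset[OF loc(3)[OF that] Int_lower2 nontriv_open[OF loc(1)[OF that]]])
  show geo: "geo_on I (\<lambda>t. cu t t)"
  proof (rule geo_on_local[OF I(1)])
    fix t assume "t \<in> I"
    with loc[OF this] sub[OF this] show "\<exists>K \<zeta>. open K \<and> t \<in> K \<and> K \<subseteq> I \<and> geo_on K \<zeta> \<and> (\<forall>s\<in>K. cu s s = \<zeta> s)"
      by (intro exI[of _ "I \<inter> ?J t"] exI[of _ "cu t"] conjI Int_lower1)
  qed
  show p: "cu 0 0 = p" using \<tau>(2)[OF I(2)] by (simp add: geo_init_def)
  note n0 = nontriv_open[OF loc(1)[OF I(2)]]
  have "vel c I (\<lambda>t. cu t t) 0 = vel c (I \<inter> ?J 0) (\<lambda>t. cu t t) 0"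
    by (rule vel_subset[OF geo_C1c[OF geo] Int_lower1 n0 loc(2)[OF I(2)] c(1), symmetric]) (simp add: p c)
  also have "\<dots> = vel c (I \<inter> ?J 0) (cu 0) 0"
    by (rule vel_cong) (use loc[OF I(2)] in blast)+
  also have "\<dots> = vel c (?J 0) (cu 0) 0"
    by (rule vel_subset[OF geo_C1c[OF loc(3)[OF I(2)]] Int_lower2 n0 loc(2)[OF I(2)] c(1)]) (simp add: p c)
  also have "\<dots> = v" using \<tau>(2)[OF I(2)] by (simp add: geo_init_def)
  finally show "vel c I (\<lambda>t. cu t t) 0 = v" .
qed

text \<open>If existence times were bounded, gluing would give a solution on the open interval up to
  their supremum, and \<open>geo_extend\<close> would prolong it beyond.\<close>

theorem geo_exists:
  assumes c: "c \<in> A" "p \<in> fst c"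
  shows "\<exists>cu. geo_on UNIV cu \<and> cu 0 = p \<and> vel c UNIV cu 0 = v"
proof -
  interpret C: chart_metric "cim c" "g c" by (rule chart_metric[OF c(1)])
  define S where "S = {T. T > 0 \<and> (\<exists>cu. geo_init c p v T cu)}"
  have down: "T \<in> S" if T': "T' \<in> S" "0 < T" "T \<le> T'" for T T'
  proof -
    obtain cu where cu: "geo_init c p v T' cu" using T'(1) by (auto simp: S_def)
    have n: "nontriv {-T<..<T}" by (auto intro: nontriv_open)
    have sub: "{-T<..<T} \<subseteq> {-T'<..<T'}" using T' by auto
    have "geo_on {-T'<..<T'} cu" using cu by (simp add: geo_init_def)
    then have "geo_on {-T<..<T} cu" by (rule geo_on_subset[OF _ sub n])
    moreover have "vel c {-T<..<T} cu 0 = vel c {-T'<..<T'} cu 0"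
      by (rule vel_subset[OF geo_C1c _ n _ c(1)]) (use cu T' c in \<open>auto simp: geo_init_def\<close>)
    ultimately have "geo_init c p v T cu" using cu by (simp add: geo_init_def)
    then show ?thesis using T' by (auto simp: S_def)
  qed
  obtain \<epsilon> where \<epsilon>: "\<epsilon> > 0" "\<And>y. y \<in> {(snd c p, v)} ==> \<exists>z. z 0 = y \<and> (\<forall>t. \<bar>t\<bar> < \<epsilon> \<longrightarrow> z t \<in> cim c \<times> UNIV \<and> (z has_vector_derivative C.geo_field (z t)) (at t))"
    by (rule uniform_flow[OF open_Times[OF C.D open_UNIV] C.has_derivative_geo_field C.continuous_geo_field_deriv, of "{(snd c p, v)}"])
      (use c in auto)
  then obtain z where z: "z 0 = (snd c p, v)"
    "\<And>t. \<bar>t\<bar> < \<epsilon> ==> z t \<in> cim c \<times> UNIV \<and> (z has_vector_derivative C.geo_field (z t)) (at t)" by blast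
  have "geo_init c p v \<epsilon> (\<lambda>t. cinv c (fst (z (t - 0))))"
    using solution_geo(1)[of c \<epsilon> z 0] solution_geo(2)[of c \<epsilon> z 0 0]
      z c \<epsilon>(1) by (simp add: geo_init_def)
  then have ne: "\<epsilon> \<in> S" using \<epsilon> by (auto simp: S_def)
  have all: "T \<in> S" if T: "T > 0" for T
  proof (rule ccontr)
    assume nT: "T \<notin> S"
    then have ub: "s < T" if "s \<in> S" for s using down[OF that T] by force
    then have bdd: "bdd_above S" by (meson bdd_aboveI less_imp_le)
    define T0 where "T0 = Sup S"
    have T0: "T0 > 0" using cSup_upper[OF ne bdd] \<epsilon>(1) by (simp add: T0_def)
    have less: "s \<in> S" if "0 < s" "s < T0" for s
    proof -
      obtain s' where s': "s' \<in> S" "s < s'" using less_cSup_iff[of S s] ne bdd \<open>s < T0\<close> by (auto simp: T0_def)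
      show ?thesis by (rule down[OF s'(1) \<open>0 < s\<close>]) (use s'(2) in simp)
    qed
    \<comment> \<open>The midpoint between |t| and \<open>T0\<close> is an admissible existence time
      that still exceeds |t|.\<close>
    define \<tau> where "\<tau> t = (\<bar>t\<bar> + T0) / 2" for t
    have \<tau>: "\<bar>t\<bar> < \<tau> t" "\<tau> t < T0" "0 < \<tau> t" if "t \<in> {-T0<..<T0}" for t using that T0 by (auto simp: \<tau>_def)
    then have "\<forall>t\<in>{-T0<..<T0}. \<exists>cu. geo_init c p v (\<tau> t) cu" using less by (auto simp: S_def)
    then obtain cu where cu: "\<And>t. t \<in> {-T0<..<T0} ==> geo_init c p v (\<tau> t) (cu t)" by metis
    have gi: "geo_on {-T0<..<T0} (\<lambda>t. cu t t)" "cu 0 0 = p" "vel c {-T0<..<T0} (\<lambda>t. cu t t) 0 = v"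
    proof -
      have o: "open {-T0<..<T0}" "0 \<in> {-T0<..<T0}" using T0 by auto
      show "geo_on {-T0<..<T0} (\<lambda>t. cu t t)" by (rule geo_init_glue(1)[OF c \<tau>(1) cu o])
      show "cu 0 0 = p" by (rule geo_init_glue(2)[OF c \<tau>(1) cu o])
      show "vel c {-T0<..<T0} (\<lambda>t. cu t t) 0 = v" by (rule geo_init_glue(3)[OF c \<tau>(1) cu o])
    qed
    obtain T' \<delta> where T': "T' > T0" "geo_on {-T'<..<T'} \<delta>" "\<And>t. t \<in> {-T0<..<T0} ==> \<delta> t = cu t t"
      using geo_extend[OF T0 gi(1)] by blast
    have n: "nontriv {-T0<..<T0}" by (auto intro: nontriv_open)
    have "\<delta> 0 = p" using T'(3)[of 0] gi(2) T0 by simp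
    moreover have "vel c {-T0<..<T0} \<delta> 0 = vel c {-T'<..<T'} \<delta> 0"
      by (rule vel_subset[OF geo_C1c[OF T'(2)] _ n _ c(1)]) (use T' T0 c \<open>\<delta> 0 = p\<close> in auto)
    moreover have "vel c {-T0<..<T0} \<delta> 0 = v"
      using vel_cong[of "{-T0<..<T0}" \<delta> "\<lambda>t. cu t t" 0 c] T'(3) gi(3) T0 by simp
    ultimately have "geo_init c p v T' \<delta>" using T' by (simp add: geo_init_def)
    then have "T' \<in> S" using T' T0 by (auto simp: S_def)
    then have "T' \<le> T0" unfolding T0_def by (rule cSup_upper[OF _ bdd])
    then show False using T' by simp
  qed
  have "\<forall>t. \<exists>cu. geo_init c p v (\<bar>t\<bar> + 1) cu" using all by (auto simp: S_def)
  then obtain cu where cu: "\<And>t. geo_init c p v (\<bar>t\<bar> + 1) (cu t)" by metis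
  have "geo_on UNIV (\<lambda>t. cu t t)" "cu 0 0 = p" "vel c UNIV (\<lambda>t. cu t t) 0 = v"
    using geo_init_glue[OF c, of UNIV "\<lambda>t. \<bar>t\<bar> + 1" v cu] cu by auto
  then show ?thesis by (intro exI[of _ "\<lambda>t. cu t t"] conjI)
qed

end

section \<open>The exponential map and its derivative\<close>

lemma strict_deriv_C1':
  fixes f :: "'a::euclidean_space => 'b::real_normed_vector"
  assumes U: "open U" "x \<in> U" and f: "\<And>y. y \<in> U ==> (f has_derivative f' y) (at y)"
    and c: "\<And>h. isCont (\<lambda>y. f' y h) x"
  shows "strict_deriv f (f' x) x"
proof (rule strict_deriv_C1[OF U f])
  fix e :: real assume e: "e > 0"
  define e' where "e' = e / real DIM('a)"
  have e': "e' > 0" using e by (simp add: e'_def)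
  have "\<forall>b\<in>Basis. \<exists>d>0. \<forall>y. dist y x < d \<longrightarrow> dist (f' y b) (f' x b) < e'"
    using c e' unfolding continuous_at_eps_delta by blast
  then obtain d where d: "\<And>b. b \<in> Basis ==> d b > 0 \<and> (\<forall>y. dist y x < d b \<longrightarrow> dist (f' y b) (f' x b) < e')" by metis
  define D where "D = Min (d ` (Basis :: 'a set))"
  have D: "D > 0" unfolding D_def using d by (subst Min_gr_iff) auto
  have "norm (f' y h - f' x h) \<le> e * norm h" if y: "y \<in> ball x D" "y \<in> U" for y h
  proof -
    interpret y: bounded_linear "f' y" using f[OF y(2)] has_derivative_bounded_linear by blast
    interpret x: bounded_linear "f' x" using f[OF U(2)] has_derivative_bounded_linear by blast
    have "f' y h - f' x h = (\<Sum>b\<in>Basis. (h \<bullet> b) *\<^sub>R (f' y b - f' x b))"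
    proof -
      have "f' y h = (\<Sum>b\<in>Basis. (h \<bullet> b) *\<^sub>R f' y b)" "f' x h = (\<Sum>b\<in>Basis. (h \<bullet> b) *\<^sub>R f' x b)"
        by (subst (1) euclidean_representation[of h, symmetric], simp only: y.sum y.scaleR x.sum x.scaleR)+
      then show ?thesis by (simp add: scaleR_diff_right sum_subtractf)
    qed
    also have "norm \<dots> \<le> (\<Sum>b\<in>(Basis :: 'a set). norm h * e')"
    proof (rule sum_norm_le)
      fix b :: 'a assume b: "b \<in> Basis"
      have "D \<le> d b" unfolding D_def using b by (intro Min_le) auto
      then have "dist y x < d b" using y(1) by (simp add: dist_commute)
      then have "norm (f' y b - f' x b) \<le> e'" using d[OF b] by (auto simp: dist_norm less_imp_le)
      then show "norm ((h \<bullet> b) *\<^sub>R (f' y b - f' x b)) \<le> norm h * e'"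
        using Basis_le_norm[OF b, of h] by (auto intro: mult_mono)
    qed
    also have "\<dots> = e * norm h" by (simp add: e'_def)
    finally show ?thesis .
  qed
  then show "\<exists>d>0. \<forall>y\<in>ball x d. y \<in> U \<longrightarrow> (\<forall>h. norm (f' y h - f' x h) \<le> e * norm h)" using D by blast
qed

context riem_mfd
begin

text \<open>A chart chosen at every point. With \<open>gp\<close> and \<open>FR\<close> it
  identifies the tangent space at p isometrically with \<open>real ^ 'n\<close>; the choices at
  different points are unrelated.\<close>

definition bc :: "'m => ('m, 'n) chart" where "bc p = (SOME c. c \<in> A \<and> p \<in> fst c)"

lemma bc: "bc p \<in> A" "p \<in> fst (bc p)"
  using some_chart[of p] by (auto simp: bc_def)

definition gp :: "'m => real ^ 'n => real ^ 'n => real" where "gp p = ip (g (bc p)) (snd (bc p) p)"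

lemma frame_exists: "\<exists>B :: real ^ 'n ^ 'n. \<forall>v w. gp p (B *v v) (B *v w) = v \<bullet> w"
proof -
  interpret C: chart_metric "cim (bc p)" "g (bc p)" by (rule chart_metric[OF bc(1)])
  let ?S = "g (bc p) (snd (bc p) p)"
  have x: "snd (bc p) p \<in> cim (bc p)" using bc by simp
  have frames: "a \<bullet> (?S *v a) = 1 ==> \<exists>f. f k = a \<and> (\<forall>i j. f i \<bullet> (?S *v f j) = (if i = j then 1 else 0))" for a and k :: 'n
    by (rule orthonormal_frame_exists) (use C.G_sym[OF x] C.G_pos[OF x] in auto)
  obtain k :: 'n where "k = k" by simp
  let ?u = "axis k (1::real)"
  have u: "?u \<noteq> 0" by (simp add: axis_eq_0_iff)
  then have pos: "?u \<bullet> (?S *v ?u) > 0" using C.G_pos[OF x] by blast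
  define a where "a = (1 / sqrt (?u \<bullet> (?S *v ?u))) *\<^sub>R ?u"
  have a: "a \<bullet> (?S *v a) = 1"
    using pos by (simp add: a_def matrix_vector_mult_scaleR)
  obtain f where "f k = a \<and> (\<forall>i j. f i \<bullet> (?S *v f j) = (if i = j then 1 else 0))"
    using frames[OF a, of k] ..
  then have f: "\<And>i j. f i \<bullet> (?S *v f j) = (if i = j then 1 else 0)" by blast
  define B where "B = (\<chi> i j. f j $ i)"
  have B: "transpose B ** ?S ** B = mat 1" unfolding B_def by (rule frame_matrix[OF f])
  have "gp p (B *v v) (B *v w) = v \<bullet> w" for v w
  proof -
    have "gp p (B *v v) (B *v w) = (B *v v) \<bullet> (?S *v (B *v w))" by (simp add: gp_def ip_def)
    also have "\<dots> = v \<bullet> (transpose B *v (?S *v (B *v w)))"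
      by (metis dot_lmul_matrix inner_commute transpose_matrix_vector transpose_transpose)
    also have "\<dots> = v \<bullet> ((transpose B ** ?S ** B) *v w)" by (simp add: matrix_vector_mul_assoc matrix_mul_assoc)
    finally show ?thesis by (simp add: B)
  qed
  then show ?thesis by blast
qed

definition FR :: "'m => real ^ 'n ^ 'n" where "FR p = (SOME B. \<forall>v w. gp p (B *v v) (B *v w) = v \<bullet> w)"

lemma FR: "gp p (FR p *v v) (FR p *v w) = v \<bullet> w"
  using someI_ex[OF frame_exists[of p]] by (simp add: FR_def)

lemma FR_inj: "FR p *v v = FR p *v w ==> v = w"
proof -
  assume "FR p *v v = FR p *v w"
  then have "FR p *v (v - w) = 0" by (simp add: matrix_vector_mult_diff_distrib)
  then have "(v - w) \<bullet> (v - w) = 0" using FR[of p "v - w" "v - w"] by (simp add: gp_def ip_lin)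
  then show ?thesis by simp
qed

lemma FR_surj: "\<exists>v. FR p *v v = w"
proof -
  have "inj ((*v) (FR p))" using FR_inj by (auto simp: inj_def)
  then have "surj ((*v) (FR p))" using linear_injective_imp_surjective[OF matrix_vector_mul_linear] by blast
  then show ?thesis by (metis surjD)
qed

end

context riem_complete
begin

text \<open>The geodesic from p whose initial velocity has coordinates v in the frame
  \<open>FR p\<close>. Accordingly \<open>F p\<close> is the exponential map at p, defined on
  \<open>real ^ 'n\<close>.\<close>

definition E :: "'m => real ^ 'n => real => 'm"
  where "E p v = (SOME cu. geo_on UNIV cu \<and> cu 0 = p \<and> vel (bc p) UNIV cu 0 = FR p *v v)"

definition F :: "'m => real ^ 'n => 'm" where "F p v = E p v 1"

lemma E: "geo_on UNIV (E p v)" "E p v 0 = p" "vel (bc p) UNIV (E p v) 0 = FR p *v v"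
  using someI_ex[OF geo_exists[OF bc, of p "FR p *v v"]] by (auto simp: E_def)

lemma E_unique:
  assumes "geo_on UNIV cu" "cu 0 = p" "vel (bc p) UNIV cu 0 = FR p *v v"
  shows "cu = E p v"
proof
  fix t
  show "cu t = E p v t"
    by (rule geo_unique[of UNIV _ _ 0 "bc p"]) (use assms E[of p v] bc[of p] nontriv_UNIV in auto)
qed

lemma E_scale: "E p (s *\<^sub>R v) t = E p v (s * t)"
proof -
  have "(\<lambda>t. E p v (s * t + 0)) = E p (s *\<^sub>R v)"
  proof (rule E_unique)
    show "geo_on UNIV (\<lambda>t. E p v (s * t + 0))" by (rule geo_affine(1)[OF E(1) nontriv_UNIV]) simp
    have "vel (bc p) UNIV (\<lambda>t. E p v (s * t + 0)) 0 = s *\<^sub>R vel (bc p) UNIV (E p v) (s * 0 + 0)"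
      by (rule geo_affine(2)[OF E(1) nontriv_UNIV]) (use E bc in auto)
    then show "vel (bc p) UNIV (\<lambda>t. E p v (s * t + 0)) 0 = FR p *v s *\<^sub>R v"
      by (simp add: E matrix_vector_mult_scaleR)
  qed (simp add: E)
  then show ?thesis by (metis add.right_neutral)
qed

lemma E_F: "E p v t = F p (t *\<^sub>R v)"
  by (simp add: F_def E_scale)

lemma F_0: "F p 0 = p"
  using E_F[of p 0 0] E(2) by simp

lemma full_geodesic:
  assumes "geo_on UNIV cu"
  obtains v where "cu = E (cu 0) v"
proof -
  obtain v where "FR (cu 0) *v v = vel (bc (cu 0)) UNIV cu 0" using FR_surj by blast
  then show ?thesis using E_unique[OF assms refl, of v] that by simp
qed

lemma E_spd: "spd UNIV (E p v) t = norm v"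
proof -
  have "spd UNIV (E p v) t = spd UNIV (E p v) 0"
    by (rule geo_spd_const[OF convex_UNIV nontriv_UNIV E(1)]) auto
  also have "\<dots> = sqrt (gp p (FR p *v v) (FR p *v v))"
    using spd_chart[OF nontriv_UNIV geo_C1c[OF E(1)] UNIV_I, of "bc p" p v 0] E[of p v] bc[of p] by (simp add: gp_def)
  finally show ?thesis by (simp add: FR norm_eq_sqrt_inner)
qed

lemma E_shift: obtains u where "norm u = norm v" "\<And>t. E p v (s + t) = E (E p v s) u t"
proof -
  have g: "geo_on UNIV (\<lambda>t. E p v (1 * t + s))" by (rule geo_affine(1)[OF E(1) nontriv_UNIV]) simp
  obtain u where u: "(\<lambda>t. E p v (1 * t + s)) = E (E p v s) u" using full_geodesic[OF g] by auto
  have "spd UNIV (\<lambda>t. E p v (1 * t + s)) 0 = \<bar>1\<bar> * spd UNIV (E p v) (1 * 0 + s)"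
    by (rule C1c_affine(2)[OF geo_C1c[OF E(1)] nontriv_UNIV _ nontriv_UNIV]) auto
  then have "norm u = norm v" unfolding u E_spd by simp
  then show ?thesis using that[of u] u by (metis add.commute mult_1)
qed

lemma E_rdist: "d (E p v s) (E p v t) \<le> norm v * \<bar>s - t\<bar>"
  using geo_rdist[OF convex_UNIV nontriv_UNIV E(1), of s t 0] by (simp add: E_spd)

lemma F_rdist: "d p (F p v) \<le> norm v"
  using E_rdist[of p v 0 1] by (simp add: E F_def)

text \<open>Position and velocity at time t as a function of the initial vector. The derivative
  \<open>Dst\<close> in that vector consists of a Jacobi field and its coordinate
  derivative.\<close>

definition st :: "'m => ('m, 'n) chart => real => real ^ 'n => (real ^ 'n) \<times> (real ^ 'n)"
  where "st p c t v = (snd c (E p v t), vel c UNIV (E p v) t)"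

definition Dst :: "'m => ('m, 'n) chart => real ^ 'n => real => real ^ 'n => (real ^ 'n) \<times> (real ^ 'n)"
  where "Dst p c v0 t = frechet_derivative (st p c t) (at v0)"

lemma Dst_eqI: "strict_deriv (st p c t) D v0 ==> Dst p c v0 t = D"
  unfolding Dst_def using strict_deriv_has_derivative frechet_derivative_at by metis

lemma E_continuous: "continuous_on UNIV (E p v)"
  by (rule geo_on_cont[OF E(1)])

lemma st_ode:
  assumes c: "c \<in> A" "E p v t \<in> fst c"
  shows "((\<lambda>t. st p c t v) has_vector_derivative chart_metric.geo_field (g c) (st p c t v)) (at t)"
proof -
  interpret C: chart_metric "cim c" "g c" by (rule chart_metric[OF c(1)])
  show ?thesis
    using has_vector_derivative_Pair[OF geo_onD[OF E(1) c(1) UNIV_I c(2)]]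
    by (simp add: st_def C.geo_field_def o_def)
qed

lemma st_flow:
  assumes c: "c \<in> A" "E p v s \<in> fst c"
    and z: "z 0 = st p c s v" "\<And>t. \<bar>t\<bar> < \<epsilon> ==> z t \<in> cim c \<times> UNIV \<and> (z has_vector_derivative chart_metric.geo_field (g c) (z t)) (at t)"
    and s': "\<bar>s' - s\<bar> < \<epsilon>"
  shows "E p v s' \<in> fst c" "st p c s' v = z (s' - s)"
proof -
  let ?J = "{s - \<epsilon><..<s + \<epsilon>}" and ?\<delta> = "\<lambda>t. cinv c (fst (z (t - s)))"
  have n: "nontriv ?J" by (auto intro: nontriv_open)
  have e: "\<epsilon> > 0" using s' by auto
  have sJ: "s \<in> ?J" "s' \<in> ?J" using e s' by (auto simp: abs_less_iff)
  have \<delta>: "geo_on ?J ?\<delta>" by (rule solution_geo(1)[OF c(1) z(2)])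
  have v\<delta>: "vel c ?J ?\<delta> t = snd (z (t - s))" if "t \<in> ?J" for t
    by (rule solution_geo(2)[OF c(1) z(2) that])
  have EJ: "geo_on ?J (E p v)" by (rule geo_on_subset[OF E(1) _ n]) auto
  have vE: "vel c ?J (E p v) t = vel c UNIV (E p v) t" if "t \<in> ?J" "E p v t \<in> fst c" for t
    by (rule vel_subset[OF geo_C1c[OF E(1)] _ n that(1) c(1) that(2)]) auto
  have eq: "E p v t = ?\<delta> t" if "t \<in> ?J" for t
  proof (rule geo_unique[OF _ n EJ \<delta> sJ(1) _ c])
    show "E p v s = ?\<delta> s" using z(1) c by (simp add: st_def)
    show "vel c ?J (E p v) s = vel c ?J ?\<delta> s" using vE[OF sJ(1) c(2)] v\<delta>[OF sJ(1)] z(1) by (simp add: st_def)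
  qed (use that in auto)
  have zc: "fst (z (s' - s)) \<in> cim c" using z(2)[OF s'] by auto
  show E': "E p v s' \<in> fst c" using eq[OF sJ(2)] zc c by simp
  have "vel c ?J (E p v) s' = vel c ?J ?\<delta> s'" by (rule vel_cong[OF eq sJ(2)])
  then show "st p c s' v = z (s' - s)"
    using eq[OF sJ(2)] vE[OF sJ(2) E'] v\<delta>[OF sJ(2)] zc c(1) by (simp add: st_def prod_eq_iff)
qed

text \<open>The second clause makes the coordinates in c meaningful for all nearby initial
  vectors.\<close>

definition regular :: "'m => ('m, 'n) chart => real ^ 'n => real => bool"
  where "regular p c v0 t \<longleftrightarrow> strict_deriv (st p c t) (Dst p c v0 t) v0 \<and> (\<forall>\<^sub>F v in nhds v0. E p v t \<in> fst c)"

lemma regularI: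
  assumes "strict_deriv (st p c t) D v0" "\<forall>\<^sub>F v in nhds v0. E p v t \<in> fst c"
  shows "regular p c v0 t"
  using assms Dst_eqI[OF assms(1)] by (simp add: regular_def)

text \<open>Within a chart the states at nearby times differ by the local flow. Composing with this
  strictly differentiable map moves regularity from s to s', and the derivative inherits the
  variational equation.\<close>

lemma regular_local:
  assumes c: "c \<in> A" "E p v0 t0 \<in> fst c"
  obtains e where "e > 0" "\<And>s. \<bar>s - t0\<bar> < e ==> E p v0 s \<in> fst c"
    "\<And>s s'. \<bar>s - t0\<bar> < e ==> \<bar>s' - t0\<bar> < e ==> regular p c v0 s ==> regular p c v0 s'"
    "\<And>s s' w. \<bar>s - t0\<bar> < e ==> \<bar>s' - t0\<bar> < e ==> regular p c v0 s ==>
       ((\<lambda>t. Dst p c v0 t w) has_vector_derivative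
         blinfun_apply (chart_metric.geo_field_deriv (g c) (st p c s' v0)) (Dst p c v0 s' w)) (at s')"
proof -
  interpret C: chart_metric "cim c" "g c" by (rule chart_metric[OF c(1)])
  let ?U = "cim c \<times> (UNIV :: (real ^ 'n) set)"
  let ?y0 = "st p c t0 v0"
  have U: "open ?U" "?y0 \<in> ?U" using C.D c by (auto intro: open_Times simp: st_def)
  obtain \<delta> \<epsilon> :: real and \<Phi> W where de: "\<delta> > 0" "\<epsilon> > 0"
    and \<Phi>0: "\<And>y. y \<in> ball ?y0 \<delta> ==> \<Phi> y 0 = y"
    and \<Phi>: "\<And>y t. y \<in> ball ?y0 \<delta> ==> \<bar>t\<bar> < \<epsilon> ==> \<Phi> y t \<in> ?U \<and> (\<Phi> y has_vector_derivative C.geo_field (\<Phi> y t)) (at t)"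
    and W0: "\<And>y h. y \<in> ball ?y0 \<delta> ==> W y 0 h = h"
    and W: "\<And>y t h. y \<in> ball ?y0 \<delta> ==> \<bar>t\<bar> < \<epsilon> ==>
       ((\<lambda>t. W y t h) has_vector_derivative blinfun_apply (C.geo_field_deriv (\<Phi> y t)) (W y t h)) (at t)"
    and sd: "\<And>y t. y \<in> ball ?y0 \<delta> ==> \<bar>t\<bar> < \<epsilon> ==> strict_deriv (\<lambda>y. \<Phi> y t) (W y t) y"
    by (rule local_flow[OF U C.has_derivative_geo_field C.continuous_geo_field_deriv]) (assumption, rule that)
  have "isCont (\<lambda>t. st p c t v0) t0" using st_ode[OF c] has_vector_derivative_continuous by blast
  then obtain e1 where e1: "e1 > 0" "\<And>s. dist s t0 < e1 ==> dist (st p c s v0) ?y0 < \<delta>"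
    unfolding continuous_at_eps_delta using de(1) by metis
  obtain e2 where e2: "e2 > 0" "\<And>s. s \<in> UNIV \<inter> ball t0 e2 ==> E p v0 s \<in> fst c"
    using chart_nbhd[OF E_continuous UNIV_I c(2) open_dom[OF c(1)]] by metis
  define e where "e = min (min e1 e2) (\<epsilon> / 2)"
  have e: "e > 0" using e1 e2 de by (simp add: e_def)
  have inb: "st p c s v0 \<in> ball ?y0 \<delta>" "E p v0 s \<in> fst c" if "\<bar>s - t0\<bar> < e" for s
    using e1(2)[of s] e2(2)[of s] that by (auto simp: e_def dist_real_def dist_commute abs_minus_commute)
  have diff: "\<bar>s' - s\<bar> < \<epsilon>" if "\<bar>s - t0\<bar> < e" "\<bar>s' - t0\<bar> < e" for s s'
    using that unfolding e_def by linarith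
  have step: "regular p c v0 s' \<and> Dst p c v0 s' = (\<lambda>w. W (st p c s v0) (s' - s) (Dst p c v0 s w))"
    if s: "\<bar>s - t0\<bar> < e" "\<bar>s' - t0\<bar> < e" and r: "regular p c v0 s" for s s'
  proof -
    have D: "strict_deriv (st p c s) (Dst p c v0 s) v0" and ev: "\<forall>\<^sub>F v in nhds v0. E p v s \<in> fst c"
      using r by (auto simp: regular_def)
    have "\<forall>\<^sub>F v in nhds v0. st p c s v \<in> ball ?y0 \<delta>"
    proof -
      have "\<forall>\<^sub>F v in at v0. st p c s v \<in> ball ?y0 \<delta>"
        by (rule topological_tendstoD[OF strict_deriv_continuous[OF D, unfolded isCont_def] open_ball inb(1)[OF s(1)]])
      then show ?thesis using inb(1)[OF s(1)] unfolding eventually_nhds_conv_at by blast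
    qed
    from this ev have ev': "\<forall>\<^sub>F v in nhds v0. E p v s' \<in> fst c \<and> st p c s' v = \<Phi> (st p c s v) (s' - s)"
    proof eventually_elim
      case (elim v)
      then show ?case
        using st_flow[OF c(1) elim(2) \<Phi>0[OF elim(1)] \<Phi>[OF elim(1)] diff[OF s]] by blast
    qed
    have sdc: "strict_deriv (\<lambda>v. \<Phi> (st p c s v) (s' - s)) (\<lambda>w. W (st p c s v0) (s' - s) (Dst p c v0 s w)) v0"
      by (rule strict_deriv_compose[OF D sd[OF inb(1)[OF s(1)] diff[OF s]]])
    obtain S where S: "open S" "v0 \<in> S" "\<And>v. v \<in> S ==> E p v s' \<in> fst c \<and> st p c s' v = \<Phi> (st p c s v) (s' - s)"
      using ev' unfolding eventually_nhds by blast
    have *: "strict_deriv (st p c s') (\<lambda>w. W (st p c s v0) (s' - s) (Dst p c v0 s w)) v0"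
      by (rule strict_deriv_cong[OF sdc S(1,2)]) (use S(3) in simp)
    have "\<forall>\<^sub>F v in nhds v0. E p v s' \<in> fst c" using ev' by eventually_elim simp
    from regularI[OF * this] Dst_eqI[OF *] show ?thesis by simp
  qed
  show ?thesis
  proof (rule that[OF e inb(2)])
    fix s s' w assume s: "\<bar>s - t0\<bar> < e" "\<bar>s' - t0\<bar> < e" and r: "regular p c v0 s"
    show "regular p c v0 s'" using step[OF s r] by blast
    let ?y = "st p c s v0"
    have "((\<lambda>t. W ?y t (Dst p c v0 s w)) has_vector_derivative
       blinfun_apply (C.geo_field_deriv (\<Phi> ?y (s' - s))) (W ?y (s' - s) (Dst p c v0 s w))) (at (s' - s))"
      by (rule W[OF inb(1)[OF s(1)] diff[OF s]])
    moreover have "((\<lambda>t. t - s) has_vector_derivative 1) (at s')" by (auto intro!: derivative_eq_intros)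
    ultimately have "((\<lambda>t. W ?y (t - s) (Dst p c v0 s w)) has_vector_derivative
       blinfun_apply (C.geo_field_deriv (\<Phi> ?y (s' - s))) (W ?y (s' - s) (Dst p c v0 s w))) (at s')"
      using vector_diff_chain_at[of "\<lambda>t. t - s" 1 s' "\<lambda>t. W ?y t (Dst p c v0 s w)"] by (simp add: o_def)
    moreover have "\<Phi> ?y (s' - s) = st p c s' v0"
      using st_flow(2)[OF c(1) inb(2)[OF s(1)] \<Phi>0[OF inb(1)[OF s(1)]] \<Phi>[OF inb(1)[OF s(1)]] diff[OF s]] by simp
    moreover have "W ?y (s' - s) (Dst p c v0 s w) = Dst p c v0 s' w" using step[OF s r] by simp
    ultimately have *: "((\<lambda>t. W ?y (t - s) (Dst p c v0 s w)) has_vector_derivative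
       blinfun_apply (C.geo_field_deriv (st p c s' v0)) (Dst p c v0 s' w)) (at s')" by simp
    show "((\<lambda>t. Dst p c v0 t w) has_vector_derivative
       blinfun_apply (C.geo_field_deriv (st p c s' v0)) (Dst p c v0 s' w)) (at s')"
    proof (rule has_vector_derivative_transform_within_open[OF *])
      show "s' \<in> ball t0 e" using s(2) by (simp add: dist_real_def abs_minus_commute)
      show "W ?y (t - s) (Dst p c v0 s w) = Dst p c v0 t w" if "t \<in> ball t0 e" for t
        using step[OF s(1) _ r, of t] that by (simp add: dist_real_def abs_minus_commute)
    qed simp
  qed
qed

text \<open>Change of charts on the tangent bundle; in its derivative \<open>dttr\<close> the term
  with \<open>d2tr\<close> comes from differentiating the Jacobian.\<close>

definition ttr :: "('m, 'n) chart => ('m, 'n) chart => (real ^ 'n) \<times> (real ^ 'n) => (real ^ 'n) \<times> (real ^ 'n)"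
  where "ttr c e y = (coord_rep c e id (fst y), dtr c e id (fst y) (snd y))"

definition dttr :: "('m, 'n) chart => ('m, 'n) chart => (real ^ 'n) \<times> (real ^ 'n) => (real ^ 'n) \<times> (real ^ 'n) => (real ^ 'n) \<times> (real ^ 'n)"
  where "dttr c e y h = (dtr c e id (fst y) (fst h), d2tr c e id (fst y) (fst h) (snd y) + dtr c e id (fst y) (snd h))"

lemma strict_deriv_ttr:
  assumes c: "c \<in> A" and e: "e \<in> A" and x: "fst y \<in> tdom c e id"
  shows "strict_deriv (ttr c e) (dttr c e y) y"
proof (rule strict_deriv_C1'[where U = "tdom c e id \<times> UNIV"])
  show "open (tdom c e id \<times> (UNIV :: (real ^ 'n) set))" by (intro open_Times open_tdom[OF c e local_isom_id] open_UNIV)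
  show "y \<in> tdom c e id \<times> UNIV" using x by (auto simp: mem_Times_iff)
  have fs: "(fst has_derivative fst) (at z)" "(snd has_derivative snd) (at z)" for z :: "(real ^ 'n) \<times> (real ^ 'n)"
    by (auto intro: bounded_linear_imp_has_derivative bounded_linear_fst bounded_linear_snd)
  fix z assume "z \<in> tdom c e id \<times> (UNIV :: (real ^ 'n) set)"
  then have z: "fst z \<in> tdom c e id" by auto
  show "(ttr c e has_derivative dttr c e z) (at z)"
    unfolding ttr_def[abs_def] dttr_def[abs_def]
    by (intro has_derivative_Pair has_derivative_dtr[OF c e local_isom_id fs(1) z fs(2)]
        has_derivative_compose[OF fs(1) has_derivative_tr[OF c e local_isom_id z]])
next
  fix h :: "(real ^ 'n) \<times> (real ^ 'n)"
  have op: "open (tdom c e id)" by (rule open_tdom[OF c e local_isom_id])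
  have "isCont (partial_deriv i (coord_rep c e id)) (fst y)" "isCont (partial_deriv j (partial_deriv i (coord_rep c e id))) (fst y)" for i j
    using continuous_partial_tr[OF c e local_isom_id] op x continuous_on_eq_continuous_at by blast+
  then have cc: "isCont (\<lambda>z. partial_deriv i (coord_rep c e id) (fst z)) y" "isCont (\<lambda>z. partial_deriv j (partial_deriv i (coord_rep c e id)) (fst z)) y" for i j
    by (auto intro: isCont_o2[OF isCont_fst[OF continuous_ident]])
  show "isCont (\<lambda>y. dttr c e y h) y"
    unfolding dttr_def dtr_def d2tr_def
    by (intro continuous_Pair continuous_add continuous_sum continuous_scaleR cc continuous_const continuous_component continuous_snd continuous_ident)
qed

lemma regular_chart:
  assumes c: "c \<in> A" "E p v0 t \<in> fst c" and e: "e \<in> A" "E p v0 t \<in> fst e" and r: "regular p c v0 t"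
  shows "regular p e v0 t" "Dst p e v0 t = (\<lambda>w. dttr c e (st p c t v0) (Dst p c v0 t w))"
proof -
  have D: "strict_deriv (st p c t) (Dst p c v0 t) v0" and ev: "\<forall>\<^sub>F v in nhds v0. E p v t \<in> fst c"
    using r by (auto simp: regular_def)
  have x: "fst (st p c t v0) \<in> tdom c e id"
    using tdom_chart[OF c(1) e(1) local_isom_id c(2)] e(2) by (simp add: st_def)
  have "isCont (\<lambda>v. fst (st p c t v)) v0" using strict_deriv_continuous[OF D] by (rule isCont_fst)
  then have "\<forall>\<^sub>F v in nhds v0. fst (st p c t v) \<in> tdom c e id"
    using open_tdom[OF c(1) e(1) local_isom_id] x unfolding isCont_def
    by (simp add: eventually_nhds_conv_at tendsto_def)
  with ev have ev': "\<forall>\<^sub>F v in nhds v0. E p v t \<in> fst e \<and> ttr c e (st p c t v) = st p e t v"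
  proof eventually_elim
    case (elim v)
    have "snd c (E p v t) \<in> tdom c e id" using elim(2) by (simp add: st_def)
    then have v: "E p v t \<in> fst e" using tdom_iff[OF c(1) e(1) local_isom_id] elim(1) c(1) by simp
    then show ?case
      using vel_tr[OF nontriv_UNIV E(1) c(1) e(1) local_isom_id UNIV_I elim(1)] tr_chart[OF c(1) e(1) local_isom_id elim(1)]
      by (simp add: ttr_def st_def)
  qed
  obtain S where S: "open S" "v0 \<in> S" "\<And>v. v \<in> S ==> E p v t \<in> fst e \<and> ttr c e (st p c t v) = st p e t v"
    using ev' unfolding eventually_nhds by blast
  have *: "strict_deriv (st p e t) (\<lambda>w. dttr c e (st p c t v0) (Dst p c v0 t w)) v0"
    by (rule strict_deriv_cong[OF strict_deriv_compose[OF D strict_deriv_ttr[OF c(1) e(1) x]] S(1,2)]) (use S(3) in simp)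
  have "\<forall>\<^sub>F v in nhds v0. E p v t \<in> fst e" using ev' by eventually_elim simp
  from regularI[OF * this] show "regular p e v0 t" .
  show "Dst p e v0 t = (\<lambda>w. dttr c e (st p c t v0) (Dst p c v0 t w))" by (rule Dst_eqI[OF *])
qed

lemma regular_0: "regular p (bc p) v0 0" "Dst p (bc p) v0 0 w = (0, FR p *v w)"
proof -
  have st0: "st p (bc p) 0 = (\<lambda>v. (snd (bc p) p, FR p *v v))" by (simp add: st_def E fun_eq_iff)
  have *: "strict_deriv (st p (bc p) 0) (\<lambda>w. (0, FR p *v w)) v0"
    unfolding st0 by (intro strict_deriv_Pair strict_deriv_const strict_deriv_linear matrix_vector_mul_bounded_linear)
  show "regular p (bc p) v0 0" by (rule regularI[OF *]) (simp add: E bc)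
  show "Dst p (bc p) v0 0 w = (0, FR p *v w)" using Dst_eqI[OF *] by simp
qed

text \<open>At time 0 the state is affine in the initial vector, and regularity spreads along the
  geodesic chart by chart; no flow for long times has to be constructed.\<close>

theorem regular:
  assumes "c \<in> A" "E p v0 t \<in> fst c"
  shows "regular p c v0 t"
proof -
  let ?P = "\<lambda>t. \<forall>c\<in>A. E p v0 t \<in> fst c \<longrightarrow> regular p c v0 t"
  have "?P t"
  proof (rule interval_induction[of UNIV 0 t ?P])
    show "?P 0" using regular_chart(1)[OF bc(1) _ _ _ regular_0(1)] E bc by auto
    fix t0 :: real
    obtain c where c: "c \<in> A" "E p v0 t0 \<in> fst c" using chart_at by blast
    obtain e where e: "e > 0" "\<And>s. \<bar>s - t0\<bar> < e ==> E p v0 s \<in> fst c"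
      "\<And>s s'. \<bar>s - t0\<bar> < e ==> \<bar>s' - t0\<bar> < e ==> regular p c v0 s ==> regular p c v0 s'"
      using regular_local[OF c] by metis
    have "?P y" if xy: "x \<in> UNIV \<inter> ball t0 e" "y \<in> UNIV \<inter> ball t0 e" "?P x" for x y
    proof -
      have xy': "\<bar>x - t0\<bar> < e" "\<bar>y - t0\<bar> < e" using xy by (auto simp: dist_real_def abs_minus_commute)
      have "regular p c v0 x" using xy(3) c(1) e(2)[OF xy'(1)] by blast
      then have "regular p c v0 y" by (rule e(3)[OF xy'])
      then show ?thesis using regular_chart(1)[OF c(1) e(2)[OF xy'(2)]] by blast
    qed
    then show "\<exists>e>0. \<forall>x\<in>UNIV \<inter> ball t0 e. \<forall>y\<in>UNIV \<inter> ball t0 e. ?P x \<longrightarrow> ?P y" using e(1) by blast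
  qed auto
  then show ?thesis using assms by blast
qed

lemma Dst_ode:
  assumes c: "c \<in> A" "E p v0 t \<in> fst c"
  shows "((\<lambda>t. Dst p c v0 t w) has_vector_derivative
      blinfun_apply (chart_metric.geo_field_deriv (g c) (st p c t v0)) (Dst p c v0 t w)) (at t)"
proof -
  obtain e where e: "e > 0" "\<And>s s' w. \<bar>s - t\<bar> < e ==> \<bar>s' - t\<bar> < e ==> regular p c v0 s ==>
       ((\<lambda>t. Dst p c v0 t w) has_vector_derivative
         blinfun_apply (chart_metric.geo_field_deriv (g c) (st p c s' v0)) (Dst p c v0 s' w)) (at s')"
    using regular_local[OF c] by metis
  show ?thesis by (rule e(2)[OF _ _ regular[OF c]]) (use e(1) in auto)
qed

end

section \<open>Jacobi fields\<close>

text \<open>The inequality \<phi> \<le> t \<phi>' says that \<phi>(t) / t is nondecreasing, and its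
  limit at 0 is \<phi>'(0).\<close>

lemma star_derivative_bound:
  fixes \<phi> :: "real => real"
  assumes d: "\<And>t. (\<phi> has_real_derivative \<phi>' t) (at t)" and 0: "\<phi> 0 = 0"
    and ge: "\<And>t. 0 < t ==> t \<le> T ==> \<phi> t \<le> t * \<phi>' t" and t: "0 \<le> t" "t \<le> T"
  shows "t * \<phi>' 0 \<le> \<phi> t"
proof (cases "t = 0")
  case False
  then have t0: "t > 0" using t by simp
  have mono: "\<phi> s / s \<le> \<phi> t / t" if s: "0 < s" "s \<le> t" for s
  proof (rule DERIV_nonneg_imp_nondecreasing[OF s(2)])
    fix x assume x: "s \<le> x" "x \<le> t"
    then have x0: "x > 0" "x \<le> T" using s t by auto
    have "((\<lambda>x. \<phi> x / x) has_real_derivative (\<phi>' x * x - \<phi> x * 1) / (x * x)) (at x)"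
      by (rule DERIV_divide[OF d DERIV_ident]) (use x0 in simp)
    moreover have "(\<phi>' x * x - \<phi> x * 1) / (x * x) \<ge> 0" using ge[OF x0] x0 by (simp add: mult.commute)
    ultimately show "\<exists>y. ((\<lambda>x. \<phi> x / x) has_real_derivative y) (at x) \<and> 0 \<le> y" by blast
  qed
  have "(\<lambda>s. \<phi> s / s) \<midarrow>0\<rightarrow> \<phi>' 0" using d[of 0] 0 by (simp add: DERIV_def)
  then have lim: "((\<lambda>s. \<phi> s / s) \<longlongrightarrow> \<phi>' 0) (at_right 0)" by (rule tendsto_within_subset) simp
  have "\<forall>\<^sub>F s in at_right 0. \<phi> s / s \<le> \<phi> t / t"
    unfolding eventually_at_right_field using mono t0 by (intro exI[of _ t]) auto
  then have "\<phi>' 0 \<le> \<phi> t / t"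
    using tendsto_upperbound[OF lim] by simp
  then show ?thesis using t0 by (simp add: field_simps)
qed (use 0 in simp)

text \<open>Here \<open>f\<close>, \<open>h\<close> and \<open>k\<close> stand for \<open>\<langle>J, J\<rangle>\<close>, \<open>\<langle>J, DJ\<rangle>\<close> and \<open>\<langle>DJ, DJ\<rangle>\<close> along a Jacobi field \<open>J\<close> with \<open>J(0) = 0\<close>;
  nonpositive curvature enters as \<open>h' \<ge> k\<close>.\<close>

lemma jacobi_estimates:
  fixes f h k :: "real => real"
  assumes f: "\<And>t. (f has_real_derivative 2 * h t) (at t)"
    and h: "\<And>t. (h has_real_derivative h' t) (at t)" "\<And>t. k t \<le> h' t"
    and cs: "\<And>a b t. 0 \<le> a\<^sup>2 * k t + 2 * (a * b) * h t + b\<^sup>2 * f t"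
    and init: "f 0 = 0" "h 0 = 0"
  shows "k 0 \<le> f 1"
    and "[|\<And>t. (k has_real_derivative k' t) (at t); \<And>t. k' t \<le> \<kappa> * R * (k t + R\<^sup>2 * f t); 1 \<le> R; 0 \<le> \<kappa>|]
      ==> f 1 \<le> k 0 * exp ((\<kappa> + 1) * R)"
proof -
  \<comment> \<open>For t > 0, B \<ge> 0 says that |J|^2 / t^2 is nondecreasing.\<close>
  define B where "B t = t * h t - f t" for t
  have B': "(B has_real_derivative t * h' t - h t) (at t)" for t
    unfolding B_def[abs_def] by (auto intro!: derivative_eq_intros f h(1))
  have B: "0 \<le> B t" if "0 \<le> t" for t
  proof -
    have "t * (0 * h' 0 - h 0) \<le> B t"
    proof (rule star_derivative_bound[OF B' _ _ that order_refl])
      fix s :: real assume s: "0 < s" "s \<le> t"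
      have "s\<^sup>2 * k s \<le> s\<^sup>2 * h' s" using h(2) by (simp add: mult_left_mono)
      \<comment> \<open>The instance of \<open>cs\<close> is |s DJ - J|^2 \<ge> 0.\<close>
      then show "B s \<le> s * (s * h' s - h s)"
        using cs[of s s "-1"] by (simp add: B_def algebra_simps power2_eq_square)
    qed (simp add: B_def init)
    then show ?thesis by (simp add: init)
  qed
  have A: "t * k 0 \<le> h t" if "0 \<le> t" for t
  proof -
    have "t * h' 0 \<le> h t"
    proof (rule star_derivative_bound[OF h(1) init(2) _ that order_refl])
      fix s :: real assume s: "0 < s" "s \<le> t"
      have "s\<^sup>2 * k s \<le> s\<^sup>2 * h' s" using h(2) by (simp add: mult_left_mono)
      moreover have "2 * (s * h s) \<le> f s + s\<^sup>2 * k s" using cs[of s s "-1"] by simp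
      moreover have "f s \<le> s * h s" using B[of s] s by (simp add: B_def)
      ultimately have "s * h s \<le> s\<^sup>2 * h' s" by linarith
      then have "s * h s \<le> s * (s * h' s)" by (simp add: power2_eq_square mult.assoc)
      then show "h s \<le> s * h' s" using s by (simp only: mult_le_cancel_left_pos)
    qed
    then show ?thesis using mult_left_mono[OF h(2)[of 0] that] by simp
  qed
  \<comment> \<open>Comparison with flat space, where |J(t)|^2 would be t^2 |DJ(0)|^2: the
    difference is nondecreasing because h \<ge> t k(0).\<close>
  have "f 0 - 0\<^sup>2 * k 0 \<le> f 1 - 1\<^sup>2 * k 0"
  proof (rule DERIV_nonneg_imp_nondecreasing[of 0 1 "\<lambda>t. f t - t\<^sup>2 * k 0"])
    fix t :: real assume t: "0 \<le> t" "t \<le> 1"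
    have "((\<lambda>t. f t - t\<^sup>2 * k 0) has_real_derivative 2 * h t - 2 * t * k 0) (at t)"
      by (auto intro!: derivative_eq_intros f)
    moreover have "0 \<le> 2 * h t - 2 * t * k 0" using A[OF t(1)] by simp
    ultimately show "\<exists>y. ((\<lambda>t. f t - t\<^sup>2 * k 0) has_real_derivative y) (at t) \<and> 0 \<le> y" by blast
  qed simp
  then show "k 0 \<le> f 1" by (simp add: init)
  assume k: "\<And>t. (k has_real_derivative k' t) (at t)" "\<And>t. k' t \<le> \<kappa> * R * (k t + R\<^sup>2 * f t)" and R: "1 \<le> R" "0 \<le> \<kappa>"
  \<comment> \<open>Energy with weight R^2, suited to geodesics of speed at most R: it bounds the
    curvature term at rate \<kappa> R and the term 2 R^2 h at rate R, whence C.\<close>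
  define e where "e t = k t + R\<^sup>2 * f t" for t
  define C where "C = (\<kappa> + 1) * R"
  have e': "(e has_real_derivative k' t + R\<^sup>2 * (2 * h t)) (at t)" for t
    unfolding e_def[abs_def] by (auto intro!: derivative_eq_intros f k(1))
  have le: "k' t + R\<^sup>2 * (2 * h t) \<le> C * e t" for t
  proof -
    have "2 * R * h t \<le> e t" using cs[of 1 t "- R"] by (simp add: e_def)
    then have "R * (2 * R * h t) \<le> R * e t" using R by (intro mult_left_mono) auto
    moreover have "k' t \<le> \<kappa> * R * e t" using k(2) by (simp add: e_def)
    ultimately show ?thesis by (simp add: C_def algebra_simps power2_eq_square)
  qed
  have "- (e 0 * exp (- C * 0)) \<le> - (e 1 * exp (- C * 1))"
  proof (rule DERIV_nonneg_imp_nondecreasing[of 0 1 "\<lambda>t. - (e t * exp (- C * t))"])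
    fix t :: real
    have "((\<lambda>t. - (e t * exp (- C * t))) has_real_derivative (C * e t - (k' t + R\<^sup>2 * (2 * h t))) * exp (- C * t)) (at t)"
      by (auto intro!: derivative_eq_intros e' simp: algebra_simps)
    moreover have "0 \<le> (C * e t - (k' t + R\<^sup>2 * (2 * h t))) * exp (- C * t)" using le[of t] by simp
    ultimately show "\<exists>y. ((\<lambda>t. - (e t * exp (- C * t))) has_real_derivative y) (at t) \<and> 0 \<le> y" by blast
  qed simp
  then have "e 1 \<le> k 0 * exp C" by (simp add: e_def init exp_minus field_simps)
  moreover have "f 1 \<le> e 1"
  proof -
    have "k 1 \<ge> 0" "f 1 \<ge> 0" using cs[of 1 1 0] cs[of 0 1 1] by simp_all
    moreover have "R\<^sup>2 \<ge> 1" using R by simp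
    ultimately show ?thesis using mult_right_mono[of 1 "R\<^sup>2" "f 1"] by (simp add: e_def)
  qed
  ultimately show "f 1 \<le> k 0 * exp ((\<kappa> + 1) * R)" by (simp add: C_def)
qed

context chart_metric
begin

text \<open>\<open>Y\<close> solves the linearized geodesic equation along X. \<open>DJ\<close> is
  the covariant derivative of J, and the step \<open>cov\<close> is the Jacobi equation, its second
  covariant derivative being - R(J,u)u, obtained by sorting \<open>Gam\<close> and
  \<open>dGam\<close> terms.\<close>

lemma jacobi_derivatives:
  assumes X: "(X has_vector_derivative geo_field (X t)) (at t)" and x: "fst (X t) \<in> D"
    and Y: "(Y has_vector_derivative blinfun_apply (geo_field_deriv (X t)) (Y t)) (at t)"
  defines "J \<equiv> \<lambda>t. fst (Y t)" and "DJ \<equiv> \<lambda>t. snd (Y t) + Gam G (fst (X t)) (snd (X t)) (fst (Y t))"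
    and "Rm \<equiv> \<lambda>t. curvature G (fst (X t)) (fst (Y t)) (snd (X t)) (snd (X t))"
  shows "((\<lambda>t. ip G (fst (X t)) (J t) (J t)) has_real_derivative 2 * ip G (fst (X t)) (J t) (DJ t)) (at t)"
    "((\<lambda>t. ip G (fst (X t)) (J t) (DJ t)) has_real_derivative
       ip G (fst (X t)) (DJ t) (DJ t) - ip G (fst (X t)) (J t) (Rm t)) (at t)"
    "((\<lambda>t. ip G (fst (X t)) (DJ t) (DJ t)) has_real_derivative - 2 * ip G (fst (X t)) (DJ t) (Rm t)) (at t)"
proof -
  define u where "u = snd (X t)"
  define y where "y = fst (X t)"
  have y: "y \<in> D" using x by (simp add: y_def)
  have X1: "((\<lambda>t. fst (X t)) has_vector_derivative u) (at t)" "((\<lambda>t. snd (X t)) has_vector_derivative - Gam G y u u) (at t)"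
    using bounded_linear.has_vector_derivative[OF bounded_linear_fst X] bounded_linear.has_vector_derivative[OF bounded_linear_snd X]
    by (simp_all add: geo_field_def u_def y_def)
  define K where "K = snd (Y t)"
  define K' where "K' = - (dGam G y (J t) u u + Gam G y K u + Gam G y u K)"
  have Y1: "(J has_vector_derivative K) (at t)" "((\<lambda>t. snd (Y t)) has_vector_derivative K') (at t)"
    using bounded_linear.has_vector_derivative[OF bounded_linear_fst Y] bounded_linear.has_vector_derivative[OF bounded_linear_snd Y]
    by (simp_all add: geo_field_deriv_apply[OF x] J_def K_def K'_def u_def y_def)
  define D' where "D' = K' + (dGam G y u u (J t) + Gam G y (- Gam G y u u) (J t) + Gam G y u K)"
  have DJ: "(DJ has_vector_derivative D') (at t)"
    unfolding DJ_def D'_def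
    using has_vector_derivative_add[OF Y1(2) has_vector_derivative_Gam[OF X1(1) x X1(2) Y1(1)]]
    by (simp add: J_def u_def y_def)
  have DJt: "DJ t = K + Gam G y u (J t)" by (simp add: DJ_def K_def J_def u_def y_def)
  have cov: "D' + Gam G y u (DJ t) = - Rm t"
  proof -
    have "Gam G y K u = Gam G y u K" "Gam G y (Gam G y u u) (J t) = Gam G y (J t) (Gam G y u u)"
      "Gam G y (J t) u = Gam G y u (J t)" "dGam G y u u (J t) = dGam G y u (J t) u"
      using Gam_sym[OF y] dGam_sym[OF y] by blast+
    moreover have "fst (Y t) = J t" by (simp add: J_def)
    ultimately show ?thesis
      unfolding D'_def K'_def DJt Rm_def curvature_Gam
      by (simp add: u_def[symmetric] y_def[symmetric] Gam_lin Gam_lin' algebra_simps)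
  qed
  have der: "((\<lambda>t. ip G (fst (X t)) (a t) (b t)) has_real_derivative
      ip G y (a' + Gam G y u (a t)) (b t) + ip G y (a t) (b' + Gam G y u (b t))) (at t)"
    if "(a has_vector_derivative a') (at t)" "(b has_vector_derivative b') (at t)" for a b a' b'
    using has_vector_derivative_ip[OF X1(1) x that]
    by (simp add: has_real_derivative_iff_has_vector_derivative dmet_Gam[OF y] y_def[symmetric] ip_lin algebra_simps)
  have s: "ip G y a b = ip G y b a" for a b by (rule ip_sym[OF y])
  have J': "K + Gam G y u (J t) = DJ t" by (simp add: DJt)
  show "((\<lambda>t. ip G (fst (X t)) (J t) (J t)) has_real_derivative 2 * ip G (fst (X t)) (J t) (DJ t)) (at t)"
    using der[OF Y1(1) Y1(1)] s[of "DJ t" "J t"] unfolding J' y_def[symmetric] by simp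
  show "((\<lambda>t. ip G (fst (X t)) (J t) (DJ t)) has_real_derivative
       ip G (fst (X t)) (DJ t) (DJ t) - ip G (fst (X t)) (J t) (Rm t)) (at t)"
    using der[OF Y1(1) DJ] unfolding J' cov y_def[symmetric] by (simp add: ip_lin)
  show "((\<lambda>t. ip G (fst (X t)) (DJ t) (DJ t)) has_real_derivative - 2 * ip G (fst (X t)) (DJ t) (Rm t)) (at t)"
    using der[OF DJ DJ] s[of "Rm t" "DJ t"] unfolding cov y_def[symmetric] by (simp add: ip_lin)
qed

lemma ip_square: "x \<in> D ==> 0 \<le> a\<^sup>2 * ip G x v v + 2 * (a * b) * ip G x w v + b\<^sup>2 * ip G x w w"
  using ip_nonneg[of x "a *\<^sub>R v + b *\<^sub>R w"] ip_sym[of x v w] by (simp add: ip_lin algebra_simps power2_eq_square)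

end

context riem_complete
begin

definition Jac :: "'m => ('m, 'n) chart => real ^ 'n => real ^ 'n => real => real ^ 'n"
  where "Jac p c v w t = fst (Dst p c v t w)"

definition DJac :: "'m => ('m, 'n) chart => real ^ 'n => real ^ 'n => real => real ^ 'n"
  where "DJac p c v w t = snd (Dst p c v t w) + Gam (g c) (fst (st p c t v)) (snd (st p c t v)) (fst (Dst p c v t w))"

text \<open>The second component of \<open>Dst\<close> does not transform like a vector; the
  \<open>Gam\<close> term in \<open>DJac\<close> absorbs the second derivatives of the change of
  charts.\<close>

lemma Jac_chart:
  assumes c: "c \<in> A" "E p v t \<in> fst c" and e: "e \<in> A" "E p v t \<in> fst e"
  shows "Jac p e v w t = dtr c e id (snd c (E p v t)) (Jac p c v w t)"
    "DJac p e v w t = dtr c e id (snd c (E p v t)) (DJac p c v w t)"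
proof -
  let ?x = "snd c (E p v t)" and ?u = "vel c UNIV (E p v) t"
  have x: "?x \<in> tdom c e id" using tdom_chart[OF c(1) e(1) local_isom_id c(2)] e(2) by simp
  have D: "Dst p e v t w = dttr c e (st p c t v) (Dst p c v t w)"
    using regular_chart(2)[OF c e regular[OF c]] by simp
  show "Jac p e v w t = dtr c e id ?x (Jac p c v w t)"
    by (simp add: Jac_def D dttr_def st_def)
  have ve: "vel e UNIV (E p v) t = dtr c e id ?x ?u"
    using vel_tr[OF nontriv_UNIV E(1) c(1) e(1) local_isom_id UNIV_I c(2)] e(2) by simp
  have xe: "snd e (E p v t) = coord_rep c e id ?x" using tr_chart[OF c(1) e(1) local_isom_id c(2)] by simp
  have "d2tr c e id ?x ?u (fst (Dst p c v t w)) = d2tr c e id ?x (fst (Dst p c v t w)) ?u"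
    by (rule d2tr_sym[OF c(1) e(1) local_isom_id x])
  then show "DJac p e v w t = dtr c e id ?x (DJac p c v w t)"
    unfolding DJac_def D by (simp add: dttr_def st_def ve xe dtr_lin tr_Gam[OF c(1) e(1) local_isom_id x])
qed

text \<open>With \<open>Jh\<close> and \<open>Jk\<close>, the inner products of J and DJ as
  functions on all of \<open>real\<close>, each evaluated in the chart chosen at the current point
  so that no chart has to contain the whole geodesic.\<close>

definition Jf :: "'m => real ^ 'n => real ^ 'n => real => real"
  where "Jf p v w t = gp (E p v t) (Jac p (bc (E p v t)) v w t) (Jac p (bc (E p v t)) v w t)"

definition Jh :: "'m => real ^ 'n => real ^ 'n => real => real"
  where "Jh p v w t = gp (E p v t) (Jac p (bc (E p v t)) v w t) (DJac p (bc (E p v t)) v w t)"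

definition Jk :: "'m => real ^ 'n => real ^ 'n => real => real"
  where "Jk p v w t = gp (E p v t) (DJac p (bc (E p v t)) v w t) (DJac p (bc (E p v t)) v w t)"

lemma J_chart:
  assumes e: "e \<in> A" "E p v t \<in> fst e"
  shows "Jf p v w t = ip (g e) (snd e (E p v t)) (Jac p e v w t) (Jac p e v w t)"
    "Jh p v w t = ip (g e) (snd e (E p v t)) (Jac p e v w t) (DJac p e v w t)"
    "Jk p v w t = ip (g e) (snd e (E p v t)) (DJac p e v w t) (DJac p e v w t)"
proof -
  let ?c = "bc (E p v t)"
  have x: "snd ?c (E p v t) \<in> tdom ?c e id" using tdom_chart[OF bc(1) e(1) local_isom_id bc(2)] e(2) by simp
  have "gp (E p v t) a b = ip (g e) (snd e (E p v t)) (dtr ?c e id (snd ?c (E p v t)) a) (dtr ?c e id (snd ?c (E p v t)) b)" for a b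
    using tr_metric[OF bc(1) e(1) local_isom_id x] tr_chart[OF bc(1) e(1) local_isom_id bc(2)] by (simp add: gp_def)
  then show "Jf p v w t = ip (g e) (snd e (E p v t)) (Jac p e v w t) (Jac p e v w t)"
    "Jh p v w t = ip (g e) (snd e (E p v t)) (Jac p e v w t) (DJac p e v w t)"
    "Jk p v w t = ip (g e) (snd e (E p v t)) (DJac p e v w t) (DJac p e v w t)"
    by (simp_all add: Jf_def Jh_def Jk_def Jac_chart[OF bc e])
qed

lemma J_init: "Jf p v w 0 = 0" "Jh p v w 0 = 0" "Jk p v w 0 = (norm w)\<^sup>2"
proof -
  have J: "Jac p (bc p) v w 0 = 0" "DJac p (bc p) v w 0 = FR p *v w"
    by (simp_all add: Jac_def DJac_def regular_0 Gam_lin')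
  show "Jf p v w 0 = 0" "Jh p v w 0 = 0" "Jk p v w 0 = (norm w)\<^sup>2"
    unfolding Jf_def Jh_def Jk_def E(2) J FR by (simp_all add: gp_def ip_lin power2_norm_eq_inner)
qed

lemma J_cs: "0 \<le> a\<^sup>2 * Jk p v w t + 2 * (a * b) * Jh p v w t + b\<^sup>2 * Jf p v w t"
proof -
  obtain c where c: "c \<in> A" "E p v t \<in> fst c" using chart_at by blast
  interpret C: chart_metric "cim c" "g c" by (rule chart_metric[OF c(1)])
  show ?thesis unfolding J_chart[OF c] by (rule C.ip_square) (use c in simp)
qed

lemma J_derivatives:
  fixes w :: "real ^ 'n"
  assumes c: "c \<in> A" "E p v t \<in> fst c"
  defines "Rm \<equiv> curvature (g c) (snd c (E p v t)) (Jac p c v w t) (vel c UNIV (E p v) t) (vel c UNIV (E p v) t)"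
  shows "(Jf p v w has_real_derivative 2 * Jh p v w t) (at t)"
    "(Jh p v w has_real_derivative Jk p v w t - ip (g c) (snd c (E p v t)) (Jac p c v w t) Rm) (at t)"
    "(Jk p v w has_real_derivative - 2 * ip (g c) (snd c (E p v t)) (DJac p c v w t) Rm) (at t)"
proof -
  interpret C: chart_metric "cim c" "g c" by (rule chart_metric[OF c(1)])
  obtain e where e: "e > 0" "\<And>s. s \<in> UNIV \<inter> ball t e ==> E p v s \<in> fst c"
    using chart_nbhd[OF E_continuous UNIV_I c(2) open_dom[OF c(1)]] by metis
  have x: "fst (st p c t v) \<in> cim c" using c by (simp add: st_def)
  have o: "open (ball t e)" "t \<in> ball t e" using e(1) by auto
  have *: "(h has_real_derivative D) (at t)"
    if "(h' has_real_derivative D) (at t)" "\<And>s. E p v s \<in> fst c ==> h' s = h s" for h' h D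
    using has_field_derivative_transform_within_open[OF that(1) o] that(2) e(2) by auto
  note J = C.jacobi_derivatives[OF st_ode[OF c] x Dst_ode[OF c], of w]
  show "(Jf p v w has_real_derivative 2 * Jh p v w t) (at t)"
    unfolding J_chart[OF c] by (rule *) (use J(1) J_chart[OF c(1)] in \<open>simp_all add: Jac_def DJac_def st_def\<close>)
  show "(Jh p v w has_real_derivative Jk p v w t - ip (g c) (snd c (E p v t)) (Jac p c v w t) Rm) (at t)"
    unfolding J_chart[OF c] by (rule *) (use J(2) J_chart[OF c(1)] in \<open>simp_all add: Jac_def DJac_def st_def Rm_def\<close>)
  show "(Jk p v w has_real_derivative - 2 * ip (g c) (snd c (E p v t)) (DJac p c v w t) Rm) (at t)"
    unfolding J_chart[OF c] by (rule *) (use J(3) J_chart[OF c(1)] in \<open>simp_all add: Jac_def DJac_def st_def Rm_def\<close>)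
qed

lemma vel_E_norm:
  assumes c: "c \<in> A" "E p v t \<in> fst c"
  shows "ip (g c) (snd c (E p v t)) (vel c UNIV (E p v) t) (vel c UNIV (E p v) t) = (norm v)\<^sup>2"
proof -
  interpret C: chart_metric "cim c" "g c" by (rule chart_metric[OF c(1)])
  have "norm v = sqrt (ip (g c) (snd c (E p v t)) (vel c UNIV (E p v) t) (vel c UNIV (E p v) t))"
    using spd_chart[OF nontriv_UNIV geo_C1c[OF E(1)] UNIV_I c] E_spd by metis
  then show ?thesis using C.ip_nonneg c(2) by simp
qed

end

locale hadamard = riem_complete A g
  for A :: "('m::{t2_space,second_countable_topology}, 'n::finite) chart set" and g :: "('m, 'n) metric_coeffs" +
  fixes \<kappa> :: real
  assumes simply_conn: "simply_connected (UNIV :: 'm set)" and npc: "nonpositively_curved A g"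
    and ric: "ricci_bounded_below A g (- \<kappa>)" and \<kappa>: "\<kappa> > 0"
begin

text \<open>The lower bound comes from <J, R(J,u)u> \<le> 0, the upper one from the bound on the
  operator R(.,u)u that the Ricci hypothesis provides.\<close>

lemma Jf_bounds:
  shows "(norm w)\<^sup>2 \<le> Jf p v w 1"
    and "norm v \<le> R ==> 1 \<le> R ==> Jf p v w 1 \<le> (norm w)\<^sup>2 * exp ((\<kappa> + 1) * R)"
proof -
  have ex: "\<exists>h' k'. (Jf p v w has_real_derivative 2 * Jh p v w t) (at t) \<and>
      (Jh p v w has_real_derivative h') (at t) \<and> Jk p v w t \<le> h' \<and> (Jk p v w has_real_derivative k') (at t) \<and>
      (\<forall>R. norm v \<le> R \<longrightarrow> 1 \<le> R \<longrightarrow> k' \<le> \<kappa> * R * (Jk p v w t + R\<^sup>2 * Jf p v w t))" for t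
  proof -
    obtain c where c: "c \<in> A" "E p v t \<in> fst c" using chart_at by blast
    interpret C: chart_metric "cim c" "g c" by (rule chart_metric[OF c(1)])
    let ?x = "snd c (E p v t)" and ?u = "vel c UNIV (E p v) t" and ?J = "Jac p c v w t" and ?D = "DJac p c v w t"
    let ?Rm = "curvature (g c) ?x ?J ?u ?u"
    have x: "?x \<in> cim c" using c by simp
    have sec: "sectional_curvature (g c) ?x a b \<le> 0" if "a \<noteq> b" "independent {a, b}" for a b
      using npc c x that unfolding nonpositively_curved_def cim_def by blast
    have rc: "ricci (g c) ?x ?u ?u \<ge> - \<kappa> * ip (g c) ?x ?u ?u"
      using ric c x unfolding ricci_bounded_below_def cim_def ip_def by blast
    have "ip (g c) ?x ?J ?Rm \<le> 0" using C.R_nonpos[OF x sec, where u = ?u and a = ?J] C.ip_sym[OF x] by simp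
    moreover have "- 2 * ip (g c) ?x ?D ?Rm \<le> \<kappa> * R * (Jk p v w t + R\<^sup>2 * Jf p v w t)" if R: "norm v \<le> R" "1 \<le> R" for R
    proof -
      have "ip (g c) ?x ?Rm ?Rm \<le> (\<kappa> * (norm v)\<^sup>2)\<^sup>2 * ip (g c) ?x ?J ?J"
        using C.R_bound[OF x sec rc, where a = ?J] by (simp add: vel_E_norm[OF c])
      also have "\<dots> \<le> (\<kappa> * R\<^sup>2)\<^sup>2 * ip (g c) ?x ?J ?J"
        using \<kappa> R C.ip_nonneg[OF x] by (intro mult_right_mono power_mono mult_left_mono) auto
      finally have m: "ip (g c) ?x ?Rm ?Rm \<le> (\<kappa> * R\<^sup>2)\<^sup>2 * ip (g c) ?x ?J ?J" .
      have kR: "\<kappa> * R > 0" using \<kappa> R by simp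
      \<comment> \<open>Expanding |\<kappa> R DJ + R(J,u)u|^2 \<ge> 0 bounds the mixed term; the
        factor \<kappa> R balances the two squares to match the energy with weight R^2.\<close>
      have "0 \<le> (\<kappa> * R)\<^sup>2 * ip (g c) ?x ?D ?D + 2 * (\<kappa> * R * 1) * ip (g c) ?x ?Rm ?D + 1\<^sup>2 * ip (g c) ?x ?Rm ?Rm"
        by (rule C.ip_square[OF x])
      then have "(\<kappa> * R) * (- 2 * ip (g c) ?x ?D ?Rm) \<le> (\<kappa> * R)\<^sup>2 * ip (g c) ?x ?D ?D + (\<kappa> * R\<^sup>2)\<^sup>2 * ip (g c) ?x ?J ?J"
        using m C.ip_sym[OF x, of ?Rm ?D] by simp
      also have "\<dots> = (\<kappa> * R) * (\<kappa> * R * (Jk p v w t + R\<^sup>2 * Jf p v w t))"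
        by (simp add: J_chart[OF c] power2_eq_square algebra_simps)
      finally show ?thesis using kR by (simp only: mult_le_cancel_left_pos)
    qed
    ultimately show ?thesis
      by (intro exI) (rule conjI, rule J_derivatives(1)[OF c], rule conjI, rule J_derivatives(2)[OF c], rule conjI, simp,
          rule conjI, rule J_derivatives(3)[OF c], blast)
  qed
  obtain h' k' where hk: "\<And>t. (Jf p v w has_real_derivative 2 * Jh p v w t) (at t)"
      "\<And>t. (Jh p v w has_real_derivative h' t) (at t)" "\<And>t. Jk p v w t \<le> h' t" "\<And>t. (Jk p v w has_real_derivative k' t) (at t)"
      "\<And>R t. norm v \<le> R ==> 1 \<le> R ==> k' t \<le> \<kappa> * R * (Jk p v w t + R\<^sup>2 * Jf p v w t)"
  proof -
    from ex have "\<forall>t. \<exists>h' k'. (Jf p v w has_real_derivative 2 * Jh p v w t) (at t) \<and>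
      (Jh p v w has_real_derivative h') (at t) \<and> Jk p v w t \<le> h' \<and> (Jk p v w has_real_derivative k') (at t) \<and>
      (\<forall>R. norm v \<le> R \<longrightarrow> 1 \<le> R \<longrightarrow> k' \<le> \<kappa> * R * (Jk p v w t + R\<^sup>2 * Jf p v w t))" by blast
    from this[THEN choice] obtain h' where "\<forall>t. \<exists>k'. (Jf p v w has_real_derivative 2 * Jh p v w t) (at t) \<and>
      (Jh p v w has_real_derivative h' t) (at t) \<and> Jk p v w t \<le> h' t \<and> (Jk p v w has_real_derivative k') (at t) \<and>
      (\<forall>R. norm v \<le> R \<longrightarrow> 1 \<le> R \<longrightarrow> k' \<le> \<kappa> * R * (Jk p v w t + R\<^sup>2 * Jf p v w t))" by blast
    from choice[OF this] show thesis using that by blast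
  qed
  note est = jacobi_estimates[OF hk(1-3) J_cs J_init(1,2)]
  show "(norm w)\<^sup>2 \<le> Jf p v w 1" using est(1) by (simp add: J_init)
  show "Jf p v w 1 \<le> (norm w)\<^sup>2 * exp ((\<kappa> + 1) * R)" if "norm v \<le> R" "1 \<le> R"
    using est(2)[OF hk(4) hk(5)[OF that] that(2)] \<kappa> by (simp add: J_init)
qed

text \<open>The derivative of the exponential map in direction w is the value at time 1 of the
  Jacobi field with J(0) = 0 and DJ(0) = w. The exponent is halved because \<open>Jf\<close> bounds
  the squared norm.\<close>

theorem F_derivative:
  assumes c: "c \<in> A" "F p v \<in> fst c"
  shows "strict_deriv (\<lambda>v. snd c (F p v)) (\<lambda>w. Jac p c v w 1) v"
    "norm w \<le> sqrt (ip (g c) (snd c (F p v)) (Jac p c v w 1) (Jac p c v w 1))"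
    "norm v \<le> R ==> 1 \<le> R ==>
      sqrt (ip (g c) (snd c (F p v)) (Jac p c v w 1) (Jac p c v w 1)) \<le> exp ((\<kappa> + 1) * R / 2) * norm w"
    "\<forall>\<^sub>F v' in nhds v. F p v' \<in> fst c"
proof -
  have c1: "E p v 1 \<in> fst c" using c by (simp add: F_def)
  have r: "strict_deriv (st p c 1) (Dst p c v 1) v" "\<forall>\<^sub>F v' in nhds v. E p v' 1 \<in> fst c"
    using regular[OF c(1) c1] by (auto simp: regular_def)
  have "strict_deriv (\<lambda>v. fst (st p c 1 v)) (\<lambda>w. fst (Dst p c v 1 w)) v"
    by (rule strict_deriv_compose[OF r(1) strict_deriv_linear[OF bounded_linear_fst]])
  then show "strict_deriv (\<lambda>v. snd c (F p v)) (\<lambda>w. Jac p c v w 1) v"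
    by (simp add: st_def F_def Jac_def[abs_def])
  have *: "ip (g c) (snd c (F p v)) (Jac p c v w 1) (Jac p c v w 1) = Jf p v w 1"
    by (simp add: J_chart[OF c(1) c1] F_def)
  show "norm w \<le> sqrt (ip (g c) (snd c (F p v)) (Jac p c v w 1) (Jac p c v w 1))"
    unfolding * using Jf_bounds(1) by (rule real_le_rsqrt)
  have "(exp ((\<kappa> + 1) * R / 2))\<^sup>2 = exp ((\<kappa> + 1) * R)" by (simp add: power2_eq_square flip: exp_add)
  then show "sqrt (ip (g c) (snd c (F p v)) (Jac p c v w 1) (Jac p c v w 1)) \<le> exp ((\<kappa> + 1) * R / 2) * norm w"
    if "norm v \<le> R" "1 \<le> R"
    unfolding * using Jf_bounds(2)[OF that, of p w] by (intro real_le_lsqrt) (auto simp: power_mult_distrib mult.commute)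
  show "\<forall>\<^sub>F v' in nhds v. F p v' \<in> fst c" using r(2) by (simp add: F_def)
qed

end

section \<open>Lifting through local homeomorphisms\<close>

locale local_homeo =
  fixes F :: "'a::euclidean_space => 'm::t2_space"
  assumes F_cont: "continuous_on UNIV F"
    and F_local: "\<And>v. \<exists>V \<psi>. open V \<and> v \<in> V \<and> open (F ` V) \<and> (\<forall>x\<in>V. \<psi> (F x) = x) \<and> continuous_on (F ` V) \<psi>"
begin

lemma F_local_obtain:
  obtains V \<psi> where "open V" "v \<in> V" "open (F ` V)" "\<And>x. x \<in> V ==> \<psi> (F x) = x" "continuous_on (F ` V) \<psi>"
  using F_local[of v] by metis

lemma lift_unique:
  assumes T: "connected T" and f: "continuous_on T f" and h: "continuous_on T h"
    and eq: "\<And>t. t \<in> T ==> F (f t) = F (h t)" and a: "a \<in> T" "f a = h a" and b: "b \<in> T"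
  shows "f b = h b"
proof (rule connected_induction_simple[OF T a(1) b, of "\<lambda>t. f t = h t"])
  show "f a = h a" by (rule a(2))
  fix t assume t: "t \<in> T"
  have op: "openin (top_of_set T) (T \<inter> f -` U \<inter> (T \<inter> h -` W))" if "open U" "open W" for U W
    by (intro openin_Int continuous_openin_preimage_gen f h that)
  show "\<exists>S. openin (top_of_set T) S \<and> t \<in> S \<and> (\<forall>x\<in>S. \<forall>y\<in>S. f x = h x \<longrightarrow> f y = h y)"
  proof (cases "f t = h t")
    case True
    obtain V \<psi> where V: "open V" "f t \<in> V" "\<And>x. x \<in> V ==> \<psi> (F x) = x" using F_local_obtain[of "f t"] by metis
    have "f y = h y" if "y \<in> T \<inter> f -` V \<inter> (T \<inter> h -` V)" for y
    proof -
      have "f y = \<psi> (F (f y))" "h y = \<psi> (F (h y))" using V(3) that by auto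
      then show ?thesis using eq that by auto
    qed
    then show ?thesis using op[OF V(1) V(1)] V(2) t True
      by (intro exI[of _ "T \<inter> f -` V \<inter> (T \<inter> h -` V)"]) auto
  next
    case False
    then obtain U W where UW: "open U" "open W" "f t \<in> U" "h t \<in> W" "U \<inter> W = {}" using hausdorff by metis
    have "f y \<noteq> h y" if "y \<in> T \<inter> f -` U \<inter> (T \<inter> h -` W)" for y using that UW(5) by auto
    then show ?thesis using op[OF UW(1,2)] UW(3,4) t
      by (intro exI[of _ "T \<inter> f -` U \<inter> (T \<inter> h -` W)"]) auto
  qed
qed

definition lift :: "(real => 'm) => 'a => real => (real => 'a) => bool"
  where "lift cu v s \<sigma> \<longleftrightarrow> continuous_on {0..s} \<sigma> \<and> \<sigma> 0 = v \<and> (\<forall>t\<in>{0..s}. F (\<sigma> t) = cu t)"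

lemma lift_mono: "lift cu v s' \<sigma> ==> s \<le> s' ==> lift cu v s \<sigma>"
  by (auto simp: lift_def intro: continuous_on_subset)

lemma lift_extend:
  assumes \<sigma>: "lift cu v s \<sigma>" and s: "0 \<le> s" "s \<le> s'" and \<tau>: "continuous_on {s..s'} \<tau>" "\<tau> s = \<sigma> s"
    and F: "\<And>t. t \<in> {s..s'} ==> F (\<tau> t) = cu t"
  shows "\<exists>\<sigma>'. lift cu v s' \<sigma>'"
proof -
  let ?\<sigma> = "\<lambda>t. if t \<le> s then \<sigma> t else \<tau> t"
  have "continuous_on ({0..s} \<union> {s..s'}) ?\<sigma>"
    by (rule continuous_on_cases) (use \<sigma> \<tau> in \<open>auto simp: lift_def\<close>)
  moreover have "{0..s} \<union> {s..s'} = {0..s'}" using s by auto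
  ultimately have "lift cu v s' ?\<sigma>" using \<sigma> s F by (auto simp: lift_def)
  then show ?thesis by blast
qed

text \<open>Radial segments are lifted one by one; continuity in (x, s) jointly is known at s = 0
  and continued to s = 1. Near a given parameter the lifts equal a local inverse of F applied to the
  base, because lifts over a connected interval are determined by one value.\<close>

lemma star_lift:
  fixes S :: "'e::real_normed_vector set"
  assumes S: "\<And>x t. x \<in> S ==> t \<in> {0..1} ==> t *\<^sub>R x \<in> S" and h: "continuous_on S h"
    and cu: "\<And>x. x \<in> S ==> continuous_on {0..1} (cu x)" "\<And>x. x \<in> S ==> cu x 0 = v0"
      "\<And>x t. x \<in> S ==> t \<in> {0..1} ==> F (cu x t) = h (t *\<^sub>R x)"
  shows "continuous_on S (\<lambda>x. cu x (1::real))"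
  unfolding continuous_on_eq_continuous_within
proof
  fix x assume x: "x \<in> S"
  define Z where "Z = S \<times> {0..1::real}"
  define \<Phi> where "\<Phi> z = cu (fst z) (snd z)" for z
  define H where "H z = h (snd z *\<^sub>R fst z)" for z
  have H: "continuous_on Z H" unfolding H_def[abs_def]
    by (rule continuous_on_compose2[OF h]) (auto simp: Z_def S intro!: continuous_intros)
  have FP: "F (\<Phi> z) = H z" if "z \<in> Z" for z using that cu(3) by (auto simp: Z_def \<Phi>_def H_def)
  \<comment> \<open>\<open>s1\<close> is a parameter at which the neighbouring lifts are known to
    lie in V; from there they are given by \<psi> on the whole interval around
    \<open>s0\<close>.\<close>
  have key: "\<exists>e>0. \<forall>s1\<in>{0..1} \<inter> ball s0 e. cu x s1 \<in> V \<and> (\<forall>\<delta>'>0. (\<forall>x'\<in>S. dist x' x < \<delta>' \<longrightarrow> cu x' s1 \<in> V) \<longrightarrow>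
    (\<forall>s\<in>{0..1} \<inter> ball s0 e. continuous (at (x, s) within Z) \<Phi>))"
    if s0: "s0 \<in> {0..1}" and V: "open V" "cu x s0 \<in> V" "open (F ` V)" "\<forall>y\<in>V. \<psi> (F y) = y" "continuous_on (F ` V) \<psi>"
    for s0 V \<psi>
  proof -
    have z0: "(x, s0) \<in> Z" using x s0 by (simp add: Z_def)
    have H0: "H (x, s0) \<in> F ` V" using FP[OF z0] V(2) by (force simp: \<Phi>_def)
    obtain d1 where d1: "d1 > 0" "\<And>z. z \<in> Z ==> dist z (x, s0) < d1 ==> H z \<in> F ` V"
      by (rule nearby[OF H z0 V(3) H0]) (rule that)
    obtain d2 where d2: "d2 > 0" "\<And>t. t \<in> {0..1} ==> dist t s0 < d2 ==> cu x t \<in> V"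
      by (rule nearby[OF cu(1)[OF x] s0 V(1,2)]) (rule that)
    define \<delta> where "\<delta> = min (d1 / 2) d2"
    have \<delta>: "\<delta> > 0" using d1 d2 by (simp add: \<delta>_def)
    let ?I = "{0..1} \<inter> ball s0 \<delta>"
    have I: "connected ?I" by (intro convex_connected convex_Int) auto
    have HV: "H (x', t) \<in> F ` V" if "x' \<in> S" "dist x' x < \<delta>" "t \<in> ?I" for x' t
    proof (rule d1(2))
      have "dist (x', t) (x, s0) \<le> dist x' x + dist t s0"
        unfolding dist_Pair_Pair by (rule sqrt_sum_squares_le_sum) auto
      then show "dist (x', t) (x, s0) < d1" using that by (simp add: \<delta>_def dist_commute)
    qed (use that in \<open>simp add: Z_def\<close>)
    have "continuous (at (x, s) within Z) \<Phi>"
      if \<delta>': "\<delta>' > 0" "\<forall>x'\<in>S. dist x' x < \<delta>' \<longrightarrow> cu x' s1 \<in> V" and s1: "s1 \<in> ?I" and s: "s \<in> ?I" for \<delta>' s s1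
    proof -
      have eq: "\<psi> (H (x', t)) = \<Phi> (x', t)" if x': "x' \<in> S" "dist x' x < \<delta>" "dist x' x < \<delta>'" and t: "t \<in> ?I" for x' t
      proof -
        have c: "continuous_on ?I (\<lambda>t. \<psi> (H (x', t)))"
          by (rule continuous_on_compose2[OF V(5) continuous_on_compose2[OF H]])
            (use HV x' in \<open>auto intro!: continuous_intros simp: Z_def\<close>)
        have FH: "F (cu x' t) = H (x', t)" if "t \<in> ?I" for t using cu(3)[OF x'(1), of t] that by (simp add: H_def)
        show ?thesis unfolding \<Phi>_def fst_conv snd_conv
        proof (rule lift_unique[OF I c _ _ s1 _ t])
          show "continuous_on ?I (cu x')" by (rule continuous_on_subset[OF cu(1)[OF x'(1)]]) auto
          show "F (\<psi> (H (x', t))) = F (cu x' t)" if t: "t \<in> ?I" for t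
            using HV[OF x'(1,2) t] V(4) FH[OF t] by force
          show "\<psi> (H (x', s1)) = cu x' s1" using bspec[OF V(4), of "cu x' s1"] \<delta>'(2) x' FH[OF s1] by simp
        qed
      qed
      have zs: "(x, s) \<in> Z" using x s by (simp add: Z_def)
      have "continuous (at (x, s) within Z) H" using H zs unfolding continuous_on_eq_continuous_within by blast
      moreover have "isCont \<psi> (H (x, s))"
        using V(3,5) HV[OF x _ s] \<delta> continuous_on_eq_continuous_at by fastforce
      ultimately have cc: "continuous (at (x, s) within Z) (\<lambda>z. \<psi> (H z))"
        by (rule continuous_within_compose3[rotated])
      show ?thesis
      proof (rule continuous_transform_within[OF cc _ zs])
        show "0 < min (min \<delta> \<delta>') (\<delta> - dist s s0)" using \<delta> \<delta>'(1) s by (simp add: dist_commute)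
        fix z assume z: "z \<in> Z" "dist z (x, s) < min (min \<delta> \<delta>') (\<delta> - dist s s0)"
        have "dist (fst z) x \<le> dist z (x, s)" "dist (snd z) s \<le> dist z (x, s)"
          using dist_fst_le[of z "(x, s)"] dist_snd_le[of z "(x, s)"] by auto
        moreover from this z(2) have "dist s0 (snd z) < \<delta>"
          using dist_triangle[of s0 "snd z" s] by (simp add: dist_commute)
        ultimately have "\<psi> (H (fst z, snd z)) = \<Phi> (fst z, snd z)" using z by (intro eq) (auto simp: Z_def)
        then show "\<psi> (H z) = \<Phi> z" by simp
      qed
    qed
    moreover have "cu x s \<in> V" if "s \<in> ?I" for s using d2(2)[of s] that by (simp add: \<delta>_def dist_commute)
    ultimately show ?thesis using \<delta> by blast
  qed
  have "continuous (at (x, 1) within Z) \<Phi>"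
  proof (rule interval_induction[of "{0..1::real}" 0 1 "\<lambda>s. continuous (at (x, s) within Z) \<Phi>"])
      obtain V \<psi> where V: "open V" "cu x 0 \<in> V" "open (F ` V)" "\<forall>y\<in>V. \<psi> (F y) = y" "continuous_on (F ` V) \<psi>"
        using F_local[of "cu x 0"] by (elim exE conjE) (rule that)
      have z: "(0::real) \<in> {0..1}" by simp
      from key[OF z V] obtain e where e: "e > 0" and k: "\<forall>s1\<in>{0..1} \<inter> ball 0 e. cu x s1 \<in> V \<and> (\<forall>\<delta>'>0. (\<forall>x'\<in>S. dist x' x < \<delta>' \<longrightarrow> cu x' s1 \<in> V) \<longrightarrow>
        (\<forall>s\<in>{0..1} \<inter> ball 0 e. continuous (at (x, s) within Z) \<Phi>))" by (elim exE conjE)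
      have "0 \<in> {0..1} \<inter> ball (0::real) e" using e by simp
      moreover have "\<forall>x'\<in>S. dist x' x < 1 \<longrightarrow> cu x' 0 \<in> V" using V(2) cu(2) x by simp
      ultimately show "continuous (at (x, 0) within Z) \<Phi>" using k zero_less_one by blast
    next
      fix s0 :: real assume s0: "s0 \<in> {0..1}"
      obtain V \<psi> where V: "open V" "cu x s0 \<in> V" "open (F ` V)" "\<forall>y\<in>V. \<psi> (F y) = y" "continuous_on (F ` V) \<psi>"
        using F_local[of "cu x s0"] by (elim exE conjE) (rule that)
      from key[OF s0 V] obtain e where e: "e > 0" and k: "\<forall>s1\<in>{0..1} \<inter> ball s0 e. cu x s1 \<in> V \<and> (\<forall>\<delta>'>0. (\<forall>x'\<in>S. dist x' x < \<delta>' \<longrightarrow> cu x' s1 \<in> V) \<longrightarrow>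
        (\<forall>s\<in>{0..1} \<inter> ball s0 e. continuous (at (x, s) within Z) \<Phi>))" by (elim exE conjE)
      have "continuous (at (x, s2) within Z) \<Phi>"
        if s: "s1 \<in> {0..1} \<inter> ball s0 e" "s2 \<in> {0..1} \<inter> ball s0 e" and P: "continuous (at (x, s1) within Z) \<Phi>" for s1 s2
      proof -
        have "\<Phi> (x, s1) \<in> V" using k s(1) by (simp add: \<Phi>_def)
        then have "\<forall>\<^sub>F z in at (x, s1) within Z. \<Phi> z \<in> V"
          using P V(1) unfolding continuous_within tendsto_def by blast
        then obtain \<delta>' where \<delta>': "\<delta>' > 0" "\<And>z. z \<in> Z ==> z \<noteq> (x, s1) ==> dist z (x, s1) < \<delta>' ==> \<Phi> z \<in> V"
          unfolding eventually_at by blast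
        have "cu x' s1 \<in> V" if "x' \<in> S" "dist x' x < \<delta>'" for x'
          using \<delta>'(2)[of "(x', s1)"] that s(1) \<open>\<Phi> (x, s1) \<in> V\<close> by (cases "x' = x") (auto simp: Z_def \<Phi>_def dist_Pair_Pair)
        then show ?thesis using k s \<delta>'(1) by blast
      qed
      then show "\<exists>e>0. \<forall>s1\<in>{0..1} \<inter> ball s0 e. \<forall>s2\<in>{0..1} \<inter> ball s0 e.
        continuous (at (x, s1) within Z) \<Phi> \<longrightarrow> continuous (at (x, s2) within Z) \<Phi>" using e by blast
  qed auto
  then have lim: "(\<Phi> \<longlongrightarrow> \<Phi> (x, 1)) (at (x, 1) within Z)" by (simp add: continuous_within)
  have l1: "((\<lambda>y. (y, 1::real)) \<longlongrightarrow> (x, 1)) (at x within S)" by (intro tendsto_intros)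
  have l2: "\<forall>\<^sub>F y in at x within S. (y, 1) \<in> Z \<and> (y, 1::real) \<noteq> (x, 1)"
    unfolding eventually_at by (intro exI[of _ 1]) (auto simp: Z_def)
  have "filterlim (\<lambda>y. (y, 1)) (at (x, 1) within Z) (at x within S)"
    unfolding filterlim_at using l1 l2 by blast
  from filterlim_compose[OF lim this] have "continuous (at x within S) (\<lambda>x. \<Phi> (x, 1))" by (simp add: continuous_within)
  then show "continuous (at x within S) (\<lambda>x. cu x 1)" by (simp add: \<Phi>_def)
qed

end

text \<open>A weak covering property: over B a section passes through every preimage. Paths can be
  lifted with it, and for the exponential map it is obtained by lifting coordinate segments.\<close>

locale local_homeo_sections = local_homeo F for F :: "'a::euclidean_space => 'm::t2_space" +
  assumes sections: "\<And>q. \<exists>B. open B \<and> q \<in> B \<and> (\<forall>v. F v \<in> B \<longrightarrow>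
     (\<exists>\<sigma>. continuous_on B \<sigma> \<and> \<sigma> (F v) = v \<and> (\<forall>z\<in>B. F (\<sigma> z) = z)))"
begin

lemma path_lift:
  assumes cu: "continuous_on {0..1::real} cu" and v: "F v = cu 0"
  obtains \<sigma> where "continuous_on {0..1} \<sigma>" "\<sigma> 0 = v" "\<And>t. t \<in> {0..1} ==> F (\<sigma> t) = cu t"
proof -
  have "\<exists>\<sigma>. lift cu v 1 \<sigma>"
  proof (rule interval_induction[of "{0..1::real}" 0 1 "\<lambda>s. \<exists>\<sigma>. lift cu v s \<sigma>"])
    show "\<exists>\<sigma>. lift cu v 0 \<sigma>" using v by (intro exI[of _ "\<lambda>_. v"]) (auto simp: lift_def)
    fix s0 :: real assume s0: "s0 \<in> {0..1}"
    obtain B where B: "open B" "cu s0 \<in> B" "\<And>v. F v \<in> B ==>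
       \<exists>\<sigma>. continuous_on B \<sigma> \<and> \<sigma> (F v) = v \<and> (\<forall>z\<in>B. F (\<sigma> z) = z)" using sections[of "cu s0"] by blast
    obtain e where e: "e > 0" "\<And>t. t \<in> {0..1} ==> dist t s0 < e ==> cu t \<in> B"
      by (rule nearby[OF cu s0 B(1,2)]) (rule that)
    have "\<exists>\<sigma>. lift cu v y \<sigma>" if xy: "x \<in> {0..1} \<inter> ball s0 e" "y \<in> {0..1} \<inter> ball s0 e" and \<sigma>: "lift cu v x \<sigma>" for x y \<sigma>
    proof (cases "y \<le> x")
      case True
      then show ?thesis using lift_mono[OF \<sigma>] by blast
    next
      case False
      have inB: "cu t \<in> B" if "t \<in> {x..y}" for t
      proof (rule e(2))
        show "t \<in> {0..1}" using that xy by auto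
        show "dist t s0 < e" using that xy by (auto simp: dist_real_def abs_less_iff)
      qed
      have Fx: "F (\<sigma> x) = cu x" using \<sigma> xy by (simp add: lift_def)
      then obtain \<tau> where \<tau>: "continuous_on B \<tau>" "\<tau> (cu x) = \<sigma> x" "\<And>z. z \<in> B ==> F (\<tau> z) = z"
        using B(3)[of "\<sigma> x"] inB[of x] False by auto
      have "continuous_on {x..y} (\<lambda>t. \<tau> (cu t))"
        by (rule continuous_on_compose2[OF \<tau>(1) continuous_on_subset[OF cu]]) (use xy inB in auto)
      from lift_extend[OF \<sigma> _ _ this] show ?thesis using \<tau>(2,3) inB xy False by auto
    qed
    then show "\<exists>e>0. \<forall>x\<in>{0..1} \<inter> ball s0 e. \<forall>y\<in>{0..1} \<inter> ball s0 e. (\<exists>\<sigma>. lift cu v x \<sigma>) \<longrightarrow> (\<exists>\<sigma>. lift cu v y \<sigma>)"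
      using e(1) by blast
  qed auto
  then show thesis using that unfolding lift_def by blast
qed

text \<open>The image is open since F is a local homeomorphism, and closed since a neighbourhood
  with sections that meets the image is contained in it.\<close>

lemma range_eq:
  assumes "connected (UNIV :: 'm set)"
  shows "range F = UNIV"
proof -
  have "openin (top_of_set UNIV) (range F)"
  proof (simp, subst open_subopen, intro ballI)
    fix y assume "y \<in> range F"
    then obtain v where v: "y = F v" by blast
    obtain V where "open (F ` V)" "v \<in> V" using F_local_obtain[of v] by metis
    then show "\<exists>T. open T \<and> y \<in> T \<and> T \<subseteq> range F" using v by blast
  qed
  moreover have "closedin (top_of_set UNIV) (range F)"
  proof (simp add: closed_def, subst open_subopen, intro ballI)
    fix q assume q: "q \<in> - range F"
    obtain B where B: "open B" "q \<in> B" "\<And>v. F v \<in> B ==>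
       \<exists>\<sigma>. continuous_on B \<sigma> \<and> \<sigma> (F v) = v \<and> (\<forall>z\<in>B. F (\<sigma> z) = z)" using sections[of q] by blast
    have "B \<subseteq> - range F"
    proof
      fix z assume "z \<in> B"
      show "z \<in> - range F"
      proof
        assume "z \<in> range F"
        then obtain \<sigma> where "\<forall>z\<in>B. F (\<sigma> z) = z" using B(3) \<open>z \<in> B\<close> by blast
        then show False using B(2) q by (metis ComplD rangeI)
      qed
    qed
    then show "\<exists>T. open T \<and> q \<in> T \<and> T \<subseteq> - range F" using B by blast
  qed
  ultimately show ?thesis using assms unfolding connected_clopen by blast
qed

text \<open>The segment from v1 to v2 maps to a loop, which is freely homotopic to a constant. In
  the lifted square one edge is the segment and the opposite one is constant; the two other edges
  lie over the same curve and share an end point, so they agree at the other end.\<close>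

theorem inj_F:
  assumes "simply_connected (UNIV :: 'm set)"
  shows "inj F"
proof (rule injI)
  fix v1 v2 assume v: "F v1 = F v2"
  define p where "p t = F (v1 + t *\<^sub>R (v2 - v1))" for t
  have p: "continuous_on {0..1} p" unfolding p_def[abs_def]
    by (rule continuous_on_compose2[OF F_cont]) (auto intro!: continuous_intros)
  have "homotopic_loops UNIV p (\<lambda>_. F v1)"
    using assms p v unfolding simply_connected_def
    by (elim allE[of _ p] allE[of _ "\<lambda>_. F v1"] impE) (auto simp: path_def pathstart_def pathfinish_def p_def[of 0] p_def[of 1])
  then obtain H where H: "continuous_on ({0..1::real} \<times> {0..1::real}) H" "\<And>t. t \<in> {0..1} ==> H (0, t) = p t"
      "\<And>t. t \<in> {0..1} ==> H (1, t) = F v1" "\<And>s. s \<in> {0..1} ==> H (s, 0) = H (s, 1)"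
    unfolding homotopic_loops by (auto simp: pathstart_def pathfinish_def)
  let ?S = "{0..1::real} \<times> {0..1::real}"
  have S: "t *\<^sub>R x \<in> ?S" if "x \<in> ?S" "t \<in> {0..1}" for x t
    using that by (auto simp: mem_Times_iff mult_le_one)
  have "\<exists>\<sigma>. continuous_on {0..1} \<sigma> \<and> \<sigma> 0 = v1 \<and> (\<forall>t\<in>{0..1}. F (\<sigma> t) = H (t *\<^sub>R x))" if x: "x \<in> ?S" for x
  proof -
    have c: "continuous_on {0..1} (\<lambda>t. H (t *\<^sub>R x))"
      by (rule continuous_on_compose2[OF H(1)]) (intro continuous_intros image_subsetI S[OF x])+
    have "(0, 0) = (0 :: real \<times> real)" by (simp add: zero_prod_def)
    then have "F v1 = H (0 *\<^sub>R x)" using H(2)[of 0] by (simp add: p_def)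
    from path_lift[OF c this] show ?thesis by metis
  qed
  then obtain cu where cu: "\<And>x. x \<in> ?S ==> continuous_on {0..1} (cu x)" "\<And>x. x \<in> ?S ==> cu x 0 = v1"
      "\<And>x t. x \<in> ?S ==> t \<in> {0..1} ==> F (cu x t) = H (t *\<^sub>R x)" by metis
  define G where "G x = cu x (1::real)" for x
  have G: "continuous_on ?S G" unfolding G_def[abs_def] by (rule star_lift[OF S H(1) cu])
  have FG: "F (G x) = H x" if "x \<in> ?S" for x using cu(3)[OF that, of 1] by (simp add: G_def)
  have edge: "continuous_on {0..1} (\<lambda>t. G (t, b))" "continuous_on {0..1} (\<lambda>t. G (b, t))" if "b \<in> {0..1}" for b
    by (rule continuous_on_compose2[OF G], use that in \<open>auto intro!: continuous_intros\<close>)+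
  have c01: "connected {0..1::real}" by simp
  have G00: "G (0, 0) = v1"
  proof -
    have z: "(0, 0) = (0 :: real \<times> real)" by (simp add: zero_prod_def)
    have "cu (0, 0) 1 = v1"
      by (rule lift_unique[OF c01 cu(1) continuous_on_const _ _ cu(2)])
        (use cu(3)[of "(0, 0)"] H(2)[of 0] in \<open>auto simp: p_def\<close>)
    then show ?thesis by (simp add: G_def)
  qed
  have "G (0, 1) = v1 + 1 *\<^sub>R (v2 - v1)"
    by (rule lift_unique[OF c01 edge(2), where a = 0 and h = "\<lambda>t. v1 + t *\<^sub>R (v2 - v1)"])
      (use FG H(2) G00 in \<open>auto intro!: continuous_intros simp: p_def\<close>)
  moreover have G1: "G (1, 1) = G (1, 0)"
    by (rule lift_unique[OF c01 edge(2), where a = 0 and h = "\<lambda>_. G (1, 0)"])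
      (use FG H(3) in auto)
  moreover have "G (0, 1) = G (0, 0)"
    by (rule lift_unique[OF c01 edge(1) edge(1), where a = 1])
      (use FG H(4) G1 in auto)
  ultimately show "v1 = v2" using G00 by simp
qed

end

section \<open>The Cartan--Hadamard theorem\<close>

context hadamard
begin

lemma F_isCont: "isCont (F p) v"
proof -
  obtain c where c: "c \<in> A" "F p v \<in> fst c" using chart_at by blast
  note \<xi> = F_derivative(1,4)[OF c]
  have "isCont (\<lambda>v. cinv c (snd c (F p v))) v"
    by (rule isCont_o2[OF strict_deriv_continuous[OF \<xi>(1)] cont_cinv[OF c(1) in_cim[OF c(2)]]])
  moreover have "\<forall>\<^sub>F v' in nhds v. cinv c (snd c (F p v')) = F p v'"
    using \<xi>(2) by eventually_elim (simp add: c(1))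
  ultimately show ?thesis using isCont_cong by fast
qed

text \<open>Inverse function theorem at a point of strict differentiability: a derivative bounded
  below makes the map injective nearby, and invariance of domain makes it open. The estimate for
  \<psi>' is the no-shrinking property read backwards.\<close>

lemma F_chart_inverse:
  assumes c: "c \<in> A" "F p v \<in> fst c"
  obtains V \<psi> \<psi>' where "open V" "v \<in> V" "F p ` V \<subseteq> fst c" "open ((\<lambda>v. snd c (F p v)) ` V)"
    "\<And>x. x \<in> V ==> \<psi> (snd c (F p x)) = x" "continuous_on ((\<lambda>v. snd c (F p v)) ` V) \<psi>"
    "(\<psi> has_derivative \<psi>') (at (snd c (F p v)))" "\<And>w. norm (\<psi>' w) \<le> sqrt (ip (g c) (snd c (F p v)) w w)"
proof -
  let ?\<phi> = "\<lambda>v. snd c (F p v)"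
  define \<xi> where "\<xi> w = Jac p c v w 1" for w
  note \<xi> = F_derivative(1,2)[OF c, folded \<xi>_def]
  have "compact {?\<phi> v}" "{?\<phi> v} \<subseteq> cim c" using c by auto
  from ip_bounds[OF c(1) this] obtain M where M: "M > 0" "\<And>w. sqrt (ip (g c) (?\<phi> v) w w) \<le> M * norm w"
    by (metis insertI1)
  have low: "norm w \<le> M * norm (\<xi> w)" for w using \<xi>(2)[of w] M(2)[of "\<xi> w"] by linarith
  interpret x: bounded_linear \<xi> by (rule strict_deriv_bounded_linear[OF \<xi>(1)])
  have "inj \<xi>"
  proof (rule injI)
    fix a b assume "\<xi> a = \<xi> b"
    then show "a = b" using low[of "a - b"] by (simp add: x.diff)
  qed
  then obtain \<xi>' where \<xi>': "linear \<xi>'" "\<And>w. \<xi>' (\<xi> w) = w" "\<And>w. \<xi> (\<xi>' w) = w"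
    using linear_injective_isomorphism[of \<xi>] x.linear_axioms by blast
  \<comment> \<open>1 / (2 M) is half of the lower bound 1 / M for \<xi>, so distinct points near v
    keep distinct images.\<close>
  obtain d where d: "d > 0" "\<And>y z. y \<in> ball v d ==> z \<in> ball v d ==> norm (?\<phi> y - ?\<phi> z - \<xi> (y - z)) \<le> 1 / (2 * M) * norm (y - z)"
    using strict_derivD[OF \<xi>(1), of "1 / (2 * M)"] M(1) by auto
  have FU: "continuous_on UNIV (F p)" using F_isCont by (simp add: continuous_at_imp_continuous_on)
  obtain d' where d': "d' > 0" "\<And>v'. v' \<in> UNIV ==> dist v' v < d' ==> F p v' \<in> fst c"
    by (rule nearby[OF FU UNIV_I open_dom[OF c(1)] c(2)]) (rule that)
  define V where "V = ball v (min d d')"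
  have V: "open V" "v \<in> V" using d d' by (auto simp: V_def)
  have Vc: "F p v' \<in> fst c" if "v' \<in> V" for v'
    using that d'(2)[of v'] by (auto simp: V_def dist_commute)
  have inj: "inj_on ?\<phi> V"
  proof (rule inj_onI)
    fix y z assume yz: "y \<in> V" "z \<in> V" "?\<phi> y = ?\<phi> z"
    have "norm (y - z) \<le> M * norm (\<xi> (y - z))" by (rule low)
    also have "\<dots> \<le> M * (1 / (2 * M) * norm (y - z))"
      using d(2)[of y z] yz M(1) by (intro mult_left_mono) (auto simp: V_def)
    finally show "y = z" using M(1) by simp
  qed
  have cont: "continuous_on V ?\<phi>"
  proof (rule continuous_at_imp_continuous_on, intro ballI)
    fix v' assume "v' \<in> V"
    then show "isCont ?\<phi> v'" using isCont_o2[OF F_isCont cont_chart[OF c(1) Vc]] by blast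
  qed
  have op: "open (?\<phi> ` V)" by (rule invariance_of_domain[OF cont V(1) inj])
  define \<psi> where "\<psi> = inv_into V ?\<phi>"
  have \<psi>: "\<psi> (?\<phi> x) = x" if "x \<in> V" for x unfolding \<psi>_def using inv_into_f_f[OF inj that] by simp
  have c\<psi>: "continuous_on (?\<phi> ` V) \<psi>" by (rule continuous_on_inverse_open[OF V(1) cont _ \<psi>]) simp_all
  have "(\<psi> has_derivative \<xi>') (at (?\<phi> v))"
  proof (rule has_derivative_inverse_basic)
    show "(?\<phi> has_derivative \<xi>) (at (\<psi> (?\<phi> v)))"
      unfolding \<psi>[OF V(2)] by (rule strict_deriv_has_derivative[OF \<xi>(1)])
    show "isCont \<psi> (?\<phi> v)" using c\<psi> op V(2) continuous_on_eq_continuous_at by blast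
    show "\<xi>' \<circ> \<xi> = id" using \<xi>'(2) by (simp add: fun_eq_iff)
    show "?\<phi> (\<psi> z) = z" if "z \<in> ?\<phi> ` V" for z using that \<psi> by auto
  qed (use op V \<xi>'(1) in \<open>auto simp: linear_conv_bounded_linear\<close>)
  moreover have "norm (\<xi>' w) \<le> sqrt (ip (g c) (?\<phi> v) w w)" for w using \<xi>(2)[of "\<xi>' w"] by (simp add: \<xi>')
  ultimately show thesis using that[OF V _ op \<psi> c\<psi>] Vc by blast
qed

lemma F_local_homeo: "local_homeo (F p)"
proof
  show "continuous_on UNIV (F p)" using F_isCont by (simp add: continuous_at_imp_continuous_on)
  fix v
  obtain c where c: "c \<in> A" "F p v \<in> fst c" using chart_at by blast
  let ?\<phi> = "\<lambda>v. snd c (F p v)"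
  obtain V \<psi> \<psi>' where V: "open V" "v \<in> V" "F p ` V \<subseteq> fst c" "open (?\<phi> ` V)"
    "\<And>x. x \<in> V ==> \<psi> (?\<phi> x) = x" "continuous_on (?\<phi> ` V) \<psi>"
    by (rule F_chart_inverse[OF c]) (rule that)
  have im: "F p ` V = fst c \<inter> snd c -` (?\<phi> ` V)"
  proof (intro equalityI subsetI)
    fix q assume "q \<in> fst c \<inter> snd c -` (?\<phi> ` V)"
    then obtain x where x: "x \<in> V" "q \<in> fst c" "snd c q = snd c (F p x)" by auto
    then have "q = F p x" using cinv_left[OF c(1) x(2)] cinv_left[OF c(1), of "F p x"] V(3) by auto
    then show "q \<in> F p ` V" using x(1) by blast
  qed (use V(3) in auto)
  have cc: "continuous_on (fst c) (snd c)"
    using cont_chart[OF c(1)] by (simp add: continuous_at_imp_continuous_on)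
  have "open (F p ` V)" unfolding im by (rule continuous_open_preimage[OF cc open_dom[OF c(1)] V(4)])
  moreover have "continuous_on (F p ` V) (\<lambda>q. \<psi> (snd c q))"
    by (rule continuous_on_compose2[OF V(6) continuous_on_subset[OF cc V(3)]]) auto
  ultimately show "\<exists>V \<psi>. open V \<and> v \<in> V \<and> open (F p ` V) \<and> (\<forall>x\<in>V. \<psi> (F p x) = x) \<and> continuous_on (F p ` V) \<psi>"
    using V(1,2,5) by (intro exI[of _ V] exI[of _ "\<lambda>q. \<psi> (snd c q)"] conjI ballI)
qed

text \<open>As \<open>F p\<close> does not shrink tangent vectors, lifts through \<open>F p\<close> have speed at most that of the curve.\<close>

lemma lift_derivative:
  fixes \<sigma> :: "real => real ^ 'n"
  assumes t: "t \<in> I" "continuous (at t within I) \<sigma>" and c: "c \<in> A" "F p (\<sigma> t) \<in> fst c"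
    and w: "((\<lambda>s. snd c (F p (\<sigma> s))) has_vector_derivative w) (at t within I)"
  obtains \<zeta> where "(\<sigma> has_vector_derivative \<zeta>) (at t within I)" "norm \<zeta> \<le> sqrt (ip (g c) (snd c (F p (\<sigma> t))) w w)"
proof -
  obtain V \<psi> \<psi>' where V: "open V" "\<sigma> t \<in> V" "\<And>x. x \<in> V ==> \<psi> (snd c (F p x)) = x"
    and \<psi>: "(\<psi> has_derivative \<psi>') (at (snd c (F p (\<sigma> t))))" "\<And>w. norm (\<psi>' w) \<le> sqrt (ip (g c) (snd c (F p (\<sigma> t))) w w)"
    by (rule F_chart_inverse[OF c]) (rule that)
  have "((\<lambda>s. \<psi> (snd c (F p (\<sigma> s)))) has_vector_derivative \<psi>' w) (at t within I)"
    by (rule has_vector_derivative_compose_linear[OF \<psi>(1) w])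
  moreover have "\<forall>\<^sub>F s in at t within I. \<psi> (snd c (F p (\<sigma> s))) = \<sigma> s"
  proof -
    have "\<forall>\<^sub>F s in at t within I. \<sigma> s \<in> V" using t(2) V(1,2) unfolding continuous_within tendsto_def by blast
    then show ?thesis by eventually_elim (rule V(3))
  qed
  ultimately have "(\<sigma> has_vector_derivative \<psi>' w) (at t within I)"
    by (rule has_vector_derivative_transform_eventually) (use V t in auto)
  then show thesis using that \<psi>(2) by blast
qed

text \<open>The lift has speed at most B, so it is Lipschitz and extends to the supremum
  \<open>s1\<close> of the parameters reached; a local inverse of F p then carries it further unless
  \<open>s1\<close> = 1.\<close>

lemma segment_lift:
  assumes c: "c \<in> A" and seg: "\<And>t. t \<in> {0..1} ==> x + t *\<^sub>R y \<in> K" and K: "K \<subseteq> cim c" "compact K"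
    and v: "F p v = cinv c x"
  obtains \<sigma> where "continuous_on {0..1} \<sigma>" "\<sigma> 0 = v" "\<And>t. t \<in> {0..1} ==> F p (\<sigma> t) = cinv c (x + t *\<^sub>R y)"
proof -
  interpret L: local_homeo "F p" by (rule F_local_homeo)
  define h where "h t = cinv c (x + t *\<^sub>R y)" for t
  have cim: "x + t *\<^sub>R y \<in> cim c" if "t \<in> {0..1}" for t using seg[OF that] K by blast
  have h: "continuous_on {0..1} h"
    unfolding h_def[abs_def]
    by (rule continuous_on_compose2[where s = "{0..1}" and t = "cim c"])
      (use cim cont_cinv[OF c] in \<open>auto intro!: continuous_intros continuous_at_imp_continuous_on\<close>)
  obtain M where M: "M > 0" "\<And>x v. x \<in> K ==> sqrt (ip (g c) x v v) \<le> M * norm v"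
    using ip_bounds[OF c K(2,1)] by metis
  define B where "B = M * norm y"
  have B0: "B \<ge> 0" using M by (simp add: B_def)
  have lip: "norm (\<sigma> a - \<sigma> b) \<le> B * \<bar>a - b\<bar>" if \<sigma>: "L.lift h v s \<sigma>" and s: "s \<le> 1" and ab: "a \<in> {0..s}" "b \<in> {0..s}" for s \<sigma> a b
  proof -
    have "\<exists>\<zeta>. (\<sigma> has_vector_derivative \<zeta>) (at t within {0..s}) \<and> norm \<zeta> \<le> B" if t: "t \<in> {0..s}" for t
    proof -
      have t1: "t \<in> {0..1}" and Ft: "F p (\<sigma> t) = h t" using t s \<sigma> by (auto simp: L.lift_def)
      have hc: "h t \<in> fst c" "snd c (h t) = x + t *\<^sub>R y" using cim[OF t1] c by (simp_all add: h_def)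
      have "((\<lambda>s. x + s *\<^sub>R y) has_vector_derivative y) (at t within {0..s})" by (auto intro!: derivative_eq_intros)
      then have w: "((\<lambda>s. snd c (F p (\<sigma> s))) has_vector_derivative y) (at t within {0..s})"
        by (rule has_vector_derivative_transform[OF t, rotated])
          (use \<sigma> s cim c in \<open>simp add: L.lift_def h_def\<close>)
      have "continuous (at t within {0..s}) \<sigma>"
        using \<sigma> t unfolding L.lift_def continuous_on_eq_continuous_within by blast
      from lift_derivative[OF t this c _ w] obtain \<zeta>
        where "(\<sigma> has_vector_derivative \<zeta>) (at t within {0..s})" "norm \<zeta> \<le> sqrt (ip (g c) (snd c (h t)) y y)"
        using hc(1) unfolding Ft by blast
      then show ?thesis using M(2)[OF seg[OF t1], of y] hc(2) by (auto simp: B_def)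
    qed
    then obtain \<zeta> where \<zeta>: "\<And>t. t \<in> {0..s} ==> (\<sigma> has_vector_derivative \<zeta> t) (at t within {0..s})"
      "\<And>t. t \<in> {0..s} ==> norm (\<zeta> t) \<le> B" by metis
    have "norm (\<sigma> a - \<sigma> b) \<le> B * norm (a - b)"
    proof (rule differentiable_bound[where S = "{0..s}" and f' = "\<lambda>t h. h *\<^sub>R \<zeta> t"])
      show "onorm (\<lambda>h. h *\<^sub>R \<zeta> t) \<le> B" if "t \<in> {0..s}" for t
        by (rule onorm_bound) (use \<zeta>(2)[OF that] B0 in \<open>simp_all add: mult.commute[of B] mult_left_mono\<close>)
    qed (use \<zeta>(1) ab in \<open>auto simp: has_vector_derivative_def\<close>)
    then show ?thesis by simp
  qed
  note mono = L.lift_mono[of h v]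
  have uniq: "\<sigma> t = \<sigma>' t" if "L.lift h v s \<sigma>" "L.lift h v s' \<sigma>'" "0 \<le> t" "t \<le> s" "t \<le> s'" for s s' \<sigma> \<sigma>' t
    by (rule L.lift_unique[of "{0..t}" \<sigma> \<sigma>' 0 t])
      (use that mono[OF that(1,4)] mono[OF that(2,5)] in \<open>auto simp: L.lift_def\<close>)
  define T where "T = {s \<in> {0..1}. \<exists>\<sigma>. L.lift h v s \<sigma>}"
  have T0: "0 \<in> T" unfolding T_def using v by (auto simp: L.lift_def h_def intro!: exI[of _ "\<lambda>_. v"])
  define s1 where "s1 = Sup T"
  have bdd: "bdd_above T" by (intro bdd_aboveI[of _ 1]) (simp add: T_def)
  have "s1 \<le> 1" unfolding s1_def
  proof (rule cSup_least)
    show "T \<noteq> {}" using T0 by blast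
  qed (simp add: T_def)
  then have s1: "0 \<le> s1" "s1 \<le> 1" using cSup_upper[OF T0 bdd] by (simp_all add: s1_def)
  have below: "\<exists>\<sigma>. L.lift h v s \<sigma>" if "s < s1" for s
  proof -
    have "T \<noteq> {}" using T0 by blast
    from less_cSupD[OF this that[unfolded s1_def]] obtain s' where s': "s' \<in> T" "s < s'" by blast
    then obtain \<sigma> where "L.lift h v s' \<sigma>" unfolding T_def by blast
    then show ?thesis using mono[of s' \<sigma> s] s'(2) by auto
  qed
  have "\<exists>\<sigma>. L.lift h v s1 \<sigma>"
  proof (cases "s1 = 0")
    case True
    then show ?thesis using T0 by (simp add: T_def)
  next
    case False
    then have s10: "s1 > 0" using s1 by simp
    obtain \<Sigma> where \<Sigma>: "\<And>s. s < s1 ==> L.lift h v s (\<Sigma> s)" using below by metis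
    define \<tau> where "\<tau> t = \<Sigma> t t" for t
    have \<tau>: "\<tau> t = \<Sigma> s t" if "0 \<le> t" "t \<le> s" "s < s1" for s t
      unfolding \<tau>_def by (rule uniq[OF \<Sigma> \<Sigma>]) (use that in auto)
    have lt: "norm (\<tau> a - \<tau> b) \<le> B * \<bar>a - b\<bar>" if ab: "a \<in> {0..<s1}" "b \<in> {0..<s1}" for a b
    proof -
      have m: "max a b < s1" using ab by auto
      have "norm (\<Sigma> (max a b) a - \<Sigma> (max a b) b) \<le> B * \<bar>a - b\<bar>"
        by (rule lip[OF \<Sigma>[OF m]]) (use ab s1 in auto)
      then show ?thesis using \<tau>[of a "max a b"] \<tau>[of b "max a b"] ab m by simp
    qed
    have "B-lipschitz_on {0..<s1} \<tau>"
      by (rule lipschitz_onI) (use lt B0 in \<open>auto simp: dist_norm\<close>)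
    then have "uniformly_continuous_on {0..<s1} \<tau>" by (rule lipschitz_on_uniformly_continuous)
    then obtain G where G: "uniformly_continuous_on (closure {0..<s1}) G" "\<And>t. t \<in> {0..<s1} ==> \<tau> t = G t"
      by (rule uniformly_continuous_on_extension_on_closure) (rule that)
    have cl: "closure {0..<s1} = {0..s1}" using s10 by simp
    have Gc: "continuous_on {0..s1} G" using G(1) unfolding cl by (rule uniformly_continuous_imp_continuous)
    have FG: "F p (G t) = h t" if "t \<in> {0..<s1}" for t
    proof -
      have "F p (\<Sigma> t t) = h t" using \<Sigma>[of t] that by (simp add: L.lift_def)
      then show ?thesis using G(2)[OF that] by (simp add: \<tau>_def)
    qed
    have "F p (G s1) = h s1"
    proof -
      have "\<not> trivial_limit (at s1 within {0..<s1})"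
      proof -
        have "s1 \<in> closure {0..<s1} - {0..<s1}" using s10 unfolding cl by simp
        then show ?thesis by (simp add: trivial_limit_within closure_def)
      qed
      moreover have "((\<lambda>t. F p (G t)) \<longlongrightarrow> F p (G s1)) (at s1 within {0..<s1})"
      proof -
        have "(G \<longlongrightarrow> G s1) (at s1 within {0..<s1})"
          by (rule tendsto_within_subset[of _ _ _ "{0..s1}"]) (use Gc s10 in \<open>auto simp: continuous_on_def\<close>)
        then show ?thesis by (rule isCont_tendsto_compose[OF F_isCont])
      qed
      moreover have "((\<lambda>t. F p (G t)) \<longlongrightarrow> h s1) (at s1 within {0..<s1})"
      proof (rule Lim_transform_eventually)
        show "(h \<longlongrightarrow> h s1) (at s1 within {0..<s1})"
          by (rule tendsto_within_subset[of _ _ _ "{0..1}"]) (use h s1 in \<open>auto simp: continuous_on_def\<close>)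
        show "\<forall>\<^sub>F t in at s1 within {0..<s1}. h t = F p (G t)"
          unfolding eventually_at_filter using FG by (auto intro: always_eventually)
      qed
      ultimately show ?thesis by (rule tendsto_unique)
    qed
    moreover have "G 0 = v" using G(2)[of 0] \<Sigma>[of 0] s10 by (auto simp: \<tau>_def L.lift_def)
    ultimately have "L.lift h v s1 G" using Gc FG unfolding L.lift_def
      by (metis atLeastAtMost_iff atLeastLessThan_iff order_le_less)
    then show ?thesis by blast
  qed
  then obtain G where G: "L.lift h v s1 G" by blast
  have "s1 = 1"
  proof (rule ccontr)
    assume "s1 \<noteq> 1"
    then have s11: "s1 < 1" using s1 by simp
    obtain V \<psi> where V: "open V" "G s1 \<in> V" "open (F p ` V)" "\<And>x. x \<in> V ==> \<psi> (F p x) = x" "continuous_on (F p ` V) \<psi>"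
      by (rule L.F_local_obtain[of "G s1"]) (rule that)
    have Gs: "F p (G s1) = h s1" using G s1 by (simp add: L.lift_def)
    have s1I: "s1 \<in> {0..1}" using s1 by simp
    have hV: "h s1 \<in> F p ` V" using imageI[OF V(2), of "F p"] Gs by simp
    obtain e where e: "e > 0" "\<And>t. t \<in> {0..1} ==> dist t s1 < e ==> h t \<in> F p ` V"
      by (rule nearby[OF h s1I V(3) hV]) (rule that)
    define s2 where "s2 = min 1 (s1 + e / 2)"
    have s2: "s1 < s2" "s2 \<le> 1" "s2 - s1 < e" using s11 e(1) by (auto simp: s2_def min_def)
    have hV: "h t \<in> F p ` V" if "t \<in> {s1..s2}" for t using that e(2)[of t] s1 s2 by (auto simp: dist_real_def)
    have "continuous_on {s1..s2} (\<lambda>t. \<psi> (h t))"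
      by (rule continuous_on_compose2[OF V(5) continuous_on_subset[OF h]]) (use hV s1 s2 in auto)
    from L.lift_extend[OF G s1(1) _ this] have "\<exists>\<sigma>. L.lift h v s2 \<sigma>"
      using V(4)[OF V(2)] Gs s2 V(4) hV by force
    then have "s2 \<in> T" using s1 s2 by (auto simp: T_def intro: exI)
    then show False using cSup_upper[OF _ bdd, of s2] s2 by (simp add: s1_def)
  qed
  then show thesis using G that[of G] by (simp add: L.lift_def h_def)
qed

text \<open>Over a coordinate ball the section through v lifts the coordinate segments issuing from
  the image of v; by \<open>star_lift\<close> the end points depend continuously on the target. The
  ball is chosen before v.\<close>

lemma F_sections: "local_homeo_sections (F p)"
proof (intro local_homeo_sections.intro local_homeo_sections_axioms.intro F_local_homeo)
  interpret L: local_homeo "F p" by (rule F_local_homeo)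
  fix q
  obtain c where c: "c \<in> A" "q \<in> fst c" using chart_at by blast
  obtain r where r: "r > 0" "cball (snd c q) r \<subseteq> cim c"
    using chart_ball[OF c open_UNIV UNIV_I] by metis
  let ?b = "ball (snd c q) r"
  define B where "B = fst c \<inter> snd c -` ?b"
  have cc: "continuous_on (fst c) (snd c)"
    using cont_chart[OF c(1)] by (simp add: continuous_at_imp_continuous_on)
  have "open B" unfolding B_def by (rule continuous_open_preimage[OF cc open_dom[OF c(1)] open_ball])
  moreover have "q \<in> B" using c r by (simp add: B_def)
  moreover have "\<exists>\<sigma>. continuous_on B \<sigma> \<and> \<sigma> (F p v) = v \<and> (\<forall>z\<in>B. F p (\<sigma> z) = z)" if v: "F p v \<in> B" for v
  proof -
    define x where "x = snd c (F p v)"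
    have x: "x \<in> ?b" "cinv c x = F p v" using v c by (auto simp: B_def x_def)
    define S where "S = {y. x + y \<in> ?b}"
    have S: "t *\<^sub>R y \<in> S" if "y \<in> S" "t \<in> {0..1}" for y t
    proof -
      have "(1 - t) *\<^sub>R x + t *\<^sub>R (x + y) \<in> ?b"
        using convexD[OF convex_ball x(1), of "x + y" "1 - t" t] that by (simp add: S_def)
      then show ?thesis by (simp add: S_def algebra_simps)
    qed
    have Sc: "x + y \<in> cim c" if "y \<in> S" for y using that r by (auto simp: S_def)
    have h: "continuous_on S (\<lambda>y. cinv c (x + y))"
      by (rule continuous_on_compose2[where s = S and t = "cim c"])
        (use Sc cont_cinv[OF c(1)] in \<open>auto intro!: continuous_intros continuous_at_imp_continuous_on\<close>)
    have "\<exists>\<sigma>. continuous_on {0..1} \<sigma> \<and> \<sigma> 0 = v \<and> (\<forall>t\<in>{0..1}. F p (\<sigma> t) = cinv c (x + t *\<^sub>R y))" if y: "y \<in> S" for y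
    proof -
      have seg: "x + t *\<^sub>R y \<in> cball (snd c q) r" if "t \<in> {0..1}" for t using S[OF y that] by (simp add: S_def)
      obtain \<sigma> where "continuous_on {0..1} \<sigma>" "\<sigma> 0 = v" "\<And>t. t \<in> {0..1} ==> F p (\<sigma> t) = cinv c (x + t *\<^sub>R y)"
        by (rule segment_lift[OF c(1) seg r(2) compact_cball x(2)[symmetric]]) (assumption, rule that)
      then show ?thesis by (intro exI[of _ \<sigma>] conjI ballI)
    qed
    then obtain cu where cu: "\<And>y. y \<in> S ==> continuous_on {0..1} (cu y)" "\<And>y. y \<in> S ==> cu y 0 = v"
        "\<And>y t. y \<in> S ==> t \<in> {0..1} ==> F p (cu y t) = cinv c (x + t *\<^sub>R y)" by metis
    have G: "continuous_on S (\<lambda>y. cu y 1)" by (rule L.star_lift[OF S h cu])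
    have S0: "0 \<in> S" using x(1) by (simp add: S_def)
    have "cu 0 1 = v"
      by (rule L.lift_unique[OF _ cu(1)[OF S0] continuous_on_const _ _ cu(2)[OF S0]]) (use cu(3)[OF S0] x(2) in auto)
    moreover have "continuous_on B (\<lambda>z. cu (snd c z - x) 1)"
    proof (rule continuous_on_compose2[OF G])
      show "continuous_on B (\<lambda>z. snd c z - x)"
        by (intro continuous_intros continuous_on_subset[OF cc]) (auto simp: B_def)
    qed (auto simp: S_def B_def)
    moreover have "F p (cu (snd c z - x) 1) = z" if "z \<in> B" for z
      using cu(3)[of "snd c z - x" 1] that c(1) by (simp add: S_def B_def)
    ultimately show ?thesis by (intro exI[of _ "\<lambda>z. cu (snd c z - x) 1"]) (simp add: x_def)
  qed
  ultimately show "\<exists>B. open B \<and> q \<in> B \<and> (\<forall>v. F p v \<in> B \<longrightarrow>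
     (\<exists>\<sigma>. continuous_on B \<sigma> \<and> \<sigma> (F p v) = v \<and> (\<forall>z\<in>B. F p (\<sigma> z) = z)))" by blast
qed

theorem F_bij: "bij (F p)"
proof -
  interpret L: local_homeo_sections "F p" by (rule F_sections)
  show ?thesis using L.range_eq[OF conn] L.inj_F[OF simply_conn] by (simp add: bij_def)
qed

text \<open>The logarithm at p, inverse of the exponential map.\<close>

definition L :: "'m => 'm => real ^ 'n" where "L p = inv_into UNIV (F p)"

lemma L [simp]: "L p (F p v) = v" "F p (L p q) = q"
  using F_bij[of p] by (auto simp: L_def bij_def surj_f_inv_f)

lemma L_cont: "continuous_on UNIV (L p)"
proof (rule continuous_at_imp_continuous_on, intro ballI)
  fix q
  interpret L: local_homeo "F p" by (rule F_local_homeo)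
  obtain V \<psi> where V: "open V" "L p q \<in> V" "open (F p ` V)" "\<And>x. x \<in> V ==> \<psi> (F p x) = x" "continuous_on (F p ` V) \<psi>"
    by (rule L.F_local_obtain[of "L p q"]) (rule that)
  have q: "q \<in> F p ` V" using imageI[OF V(2), of "F p"] by simp
  have "continuous_on (F p ` V) (L p)" using V(5) by (rule continuous_on_eq) (use V(4) in auto)
  then show "isCont (L p) q" using V(3) q continuous_on_eq_continuous_at by blast
qed

text \<open>The lift of any curve by \<open>L p\<close> is no longer than the curve, and the
  coordinate of the lift in the direction a grows by |u - v|.\<close>

theorem F_expands: "norm (u - v) \<le> d (F p u) (F p v)"
proof (cases "u = v")
  case False
  define a where "a = (v - u) /\<^sub>R norm (v - u)"
  have "a \<bullet> v - a \<bullet> u = ((v - u) \<bullet> (v - u)) / norm (v - u)"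
    by (simp add: a_def inner_diff_right divide_inverse algebra_simps)
  also have "\<dots> = norm (u - v)" by (simp add: dot_square_norm power2_eq_square norm_minus_commute)
  finally have a: "norm a = 1" "a \<bullet> v - a \<bullet> u = norm (u - v)" using False by (simp_all add: a_def)
  show ?thesis
  proof (rule rdist_ge)
    fix cu assume cu: "piecewise_C1_curve A cu" "pathstart cu = F p u" "pathfinish cu = F p v"
    let ?h = "\<lambda>t. a \<bullet> L p (cu t)"
    have ccu: "continuous_on {0..1} cu" using cu(1) by (simp add: piecewise_C1_curve_def path_def)
    have Lg: "continuous_on {0..1} (\<lambda>t. L p (cu t))" by (rule continuous_on_compose2[OF L_cont ccu]) simp
    have "?h 1 - ?h 0 \<le> 1 * curve_length A g cu"
    proof (rule length_lower_bound[OF cu(1), where a = 0 and b = 1 and h = ?h and K = 1])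
      show "continuous_on {0..1} ?h" by (intro continuous_intros Lg)
      fix t a' b' :: real assume t: "t \<in> {0<..<1}" "0 \<le> a'" "a' < t" "t < b'" "b' \<le> 1" and C: "C1c {a'..b'} cu"
      have I: "nontriv {a'..b'}" "t \<in> {a'..b'}" using t nontriv_Icc by auto
      obtain c where c: "c \<in> A" "cu t \<in> fst c" using chart_at by blast
      have w: "((\<lambda>s. snd c (F p (L p (cu s)))) has_vector_derivative vel c {a'..b'} cu t) (at t within {a'..b'})"
        using C1cD(1)[OF C c(1) I(2) c(2)] by (simp add: o_def)
      have cL: "continuous (at t within {a'..b'}) (\<lambda>s. L p (cu s))"
        using continuous_on_subset[OF Lg, of "{a'..b'}"] t I(2) by (auto simp: continuous_on_eq_continuous_within)
      obtain \<zeta> where \<zeta>: "((\<lambda>s. L p (cu s)) has_vector_derivative \<zeta>) (at t within {a'..b'})"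
        "norm \<zeta> \<le> sqrt (ip (g c) (snd c (cu t)) (vel c {a'..b'} cu t) (vel c {a'..b'} cu t))"
        using lift_derivative[OF I(2) cL c(1) _ w] c(2) by auto
      have "at t within {a'..b'} = at t" using t by (intro at_within_Icc_at)
      then have "(?h has_real_derivative a \<bullet> \<zeta>) (at t)"
        using bounded_linear.has_vector_derivative[OF bounded_linear_inner_right \<zeta>(1), of a]
        by (simp add: has_real_derivative_iff_has_vector_derivative)
      moreover have "a \<bullet> \<zeta> \<le> 1 * spd {a'..b'} cu t"
        using norm_cauchy_schwarz[of a \<zeta>] \<zeta>(2) spd_chart[OF I(1) C I(2) c] a(1) by simp
      ultimately show "\<exists>h'. (?h has_real_derivative h') (at t) \<and> h' \<le> 1 * spd {a'..b'} cu t" by blast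
    qed auto
    then show "norm (u - v) \<le> curve_length A g cu"
      using cu(2,3) a(2) by (simp add: pathstart_def pathfinish_def)
  qed
qed (simp add: rdist_nonneg)

lemma rdist_F: "d p (F p v) = norm v"
  using F_rdist[of p v] F_expands[of 0 v p] by (simp add: F_0)

lemma E_rdist_eq: "d (E p v s) (E p v t) = norm v * \<bar>s - t\<bar>"
proof -
  obtain u where u: "norm u = norm v" "\<And>t. E p v (s + t) = E (E p v s) u t" using E_shift by metis
  have "E p v t = F (E p v s) ((t - s) *\<^sub>R u)" using u(2)[of "t - s"] by (simp add: E_F)
  then show ?thesis using u(1) by (simp add: rdist_F abs_minus_commute)
qed

end

section \<open>Lipschitz bound for the exponential map on balls\<close>

text \<open>Increments from y along short multiples of w are compared with f' and with the
  derivative D at y. This provides the continuous velocity of t -> F p (u + t w) that a C^1 curve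
  requires.\<close>

lemma strict_deriv_near:
  fixes f :: "'a::real_normed_vector => 'b::real_normed_vector"
  assumes f: "strict_deriv f f' x" and e: "e > 0"
  obtains r where "r > 0" "\<And>y D w. y \<in> ball x r ==> (f has_derivative D) (at y) ==> norm (D w - f' w) \<le> e * norm w"
proof -
  obtain r where r: "r > 0" "\<And>y z. y \<in> ball x r ==> z \<in> ball x r ==> norm (f y - f z - f' (y - z)) \<le> e * norm (y - z)"
    using strict_derivD[OF f e] by metis
  interpret f': bounded_linear f' by (rule strict_deriv_bounded_linear[OF f])
  have "norm (D w - f' w) \<le> e * norm w" if y: "y \<in> ball x r" and D: "(f has_derivative D) (at y)" for y D w
  proof (cases "w = 0")
    case False
    interpret D: bounded_linear D by (rule has_derivative_bounded_linear[OF D])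
    have "norm (D w - f' w) \<le> (e + \<epsilon>) * norm w" if \<epsilon>: "\<epsilon> > 0" for \<epsilon>
    proof -
      obtain \<delta> where \<delta>: "\<delta> > 0" "\<And>z. norm (z - y) < \<delta> ==> norm (f z - f y - D (z - y)) \<le> \<epsilon> * norm (z - y)"
        using D \<epsilon> unfolding has_derivative_within_alt by (metis UNIV_I)
      define m where "m = min \<delta> (r - dist x y)"
      have m: "m > 0" using \<delta> y by (simp add: m_def)
      define k where "k = m / (2 * norm w)"
      have k: "k > 0" using m False by (simp add: k_def)
      define z where "z = y + k *\<^sub>R w"
      have zy: "norm (z - y) = m / 2" using False m by (simp add: z_def k_def)
      have zr: "z \<in> ball x r"
        using zy m dist_triangle[of x z y] by (simp add: dist_norm[of z y] dist_commute[of y z] m_def min_def split: if_splits)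
      have "k *\<^sub>R (D w - f' w) = (f z - f y - f' (z - y)) - (f z - f y - D (z - y))"
        by (simp add: z_def D.scaleR f'.scaleR scaleR_diff_right)
      then have "norm (k *\<^sub>R (D w - f' w)) \<le> norm (f z - f y - f' (z - y)) + norm (f z - f y - D (z - y))"
        using norm_triangle_ineq4 by metis
      also have "\<dots> \<le> e * norm (z - y) + \<epsilon> * norm (z - y)"
      proof (intro add_mono r(2)[OF zr y] \<delta>(2))
        have "m \<le> \<delta>" by (simp add: m_def)
        then show "norm (z - y) < \<delta>" using zy m by linarith
      qed
      also have "\<dots> = k * ((e + \<epsilon>) * norm w)" using k by (simp add: z_def algebra_simps)
      finally show ?thesis using k by (simp add: mult_le_cancel_left_pos)
    qed
    then have "norm (D w - f' w) \<le> e * norm w + \<epsilon>" if "\<epsilon> > 0" for \<epsilon>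
      using False that by (metis (no_types) distrib_right divide_pos_pos nonzero_eq_divide_eq norm_eq_zero zero_less_norm_iff)
    then show ?thesis by (rule field_le_epsilon)
  qed (use linear_simps(3)[OF has_derivative_bounded_linear[OF D]] f'.zero in simp)
  then show thesis using that r(1) by blast
qed

context hadamard
begin

text \<open>The segment from u to v stays in the ball of radius R; its image is a C^1 curve with
  velocity given by Jacobi fields, whose size bounds its length.\<close>

theorem F_lipschitz:
  assumes R: "1 \<le> R" "norm u \<le> R" "norm v \<le> R"
  shows "d (F p u) (F p v) \<le> exp ((\<kappa> + 1) * R / 2) * norm (u - v)"
proof -
  define w where "w = v - u"
  let ?cu = "\<lambda>t. F p (u + t *\<^sub>R w)"
  have nR: "norm (u + t *\<^sub>R w) \<le> R" if "t \<in> {0..1}" for t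
  proof -
    have "u + t *\<^sub>R w = (1 - t) *\<^sub>R u + t *\<^sub>R v" by (simp add: w_def algebra_simps)
    also have "norm \<dots> \<le> (1 - t) * norm u + t * norm v" using that norm_triangle_ineq[of "(1 - t) *\<^sub>R u" "t *\<^sub>R v"] by simp
    also have "\<dots> \<le> R" using that R by (intro convex_bound_le) auto
    finally show ?thesis .
  qed
  have lin: "((\<lambda>t. u + t *\<^sub>R w) has_vector_derivative w) (at s within I)" for s I by (auto intro!: derivative_eq_intros)
  have cl: "isCont (\<lambda>t. u + t *\<^sub>R w) s" for s by (intro continuous_intros)
  have cg: "isCont ?cu s" for s by (rule isCont_o2[OF cl F_isCont])
  let ?\<xi> = "\<lambda>c s. Jac p c (u + s *\<^sub>R w) w 1"
  have der: "((snd c \<circ> ?cu) has_vector_derivative ?\<xi> c s) (at s within {0..1})" if "c \<in> A" "?cu s \<in> fst c" for c s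
    unfolding o_def by (rule has_vector_derivative_compose_linear[OF strict_deriv_has_derivative[OF F_derivative(1)[OF that]] lin])
  have cont: "isCont (?\<xi> c) s" if c: "c \<in> A" "?cu s \<in> fst c" for c s
    unfolding isCont_def
  proof (rule tendstoI)
    fix \<epsilon> :: real assume \<epsilon>: "\<epsilon> > 0"
    have nw: "norm w + 1 > 0" by (simp add: add_nonneg_pos)
    define \<epsilon>' where "\<epsilon>' = \<epsilon> / (norm w + 1)"
    have \<epsilon>': "\<epsilon>' > 0" "\<epsilon>' * norm w < \<epsilon>" using \<epsilon> nw by (simp_all add: \<epsilon>'_def field_simps)
    obtain r where r: "r > 0" "\<And>y D w'. y \<in> ball (u + s *\<^sub>R w) r ==> ((\<lambda>v. snd c (F p v)) has_derivative D) (at y) ==>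
        norm (D w' - Jac p c (u + s *\<^sub>R w) w' 1) \<le> \<epsilon>' * norm w'"
      using strict_deriv_near[OF F_derivative(1)[OF c] \<epsilon>'(1)] by metis
    have "\<forall>\<^sub>F s' in at s. u + s' *\<^sub>R w \<in> ball (u + s *\<^sub>R w) r"
      by (rule topological_tendstoD[OF cl[unfolded isCont_def]]) (use r(1) in auto)
    moreover have "\<forall>\<^sub>F s' in at s. ?cu s' \<in> fst c"
      by (rule topological_tendstoD[OF cg[unfolded isCont_def] open_dom[OF c(1)] c(2)])
    ultimately show "\<forall>\<^sub>F s' in at s. dist (?\<xi> c s') (?\<xi> c s) < \<epsilon>"
    proof eventually_elim
      case (elim s')
      show ?case
        using r(2)[OF elim(1) strict_deriv_has_derivative[OF F_derivative(1)[OF c(1) elim(2)]], of w] \<epsilon>'(2)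
        by (simp add: dist_norm)
    qed
  qed
  have n: "nontriv {0..1}" by (rule nontriv_Icc) simp
  have C: "C1c {0..1} ?cu"
  proof (rule C1cI[OF n])
    fix t :: real assume t: "t \<in> {0..1}"
    obtain c where c: "c \<in> A" "?cu t \<in> fst c" using chart_at by blast
    have "continuous_on {0..1} ?cu" using cg by (simp add: continuous_at_imp_continuous_on)
    from chart_nbhd[OF this t c(2) open_dom[OF c(1)]]
    obtain e where "e > 0" "\<And>s. s \<in> {0..1} \<inter> ball t e ==> ?cu s \<in> fst c" by blast
    then show "C1_at {0..1} ?cu t" unfolding C1_at_def using der cont c(1)
      by (intro bexI[OF _ c(1)] exI[of _ "?\<xi> c"] exI[of _ e]) (auto intro!: continuous_at_imp_continuous_at_within cont[OF c(1)])
  qed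
  have "d (?cu 0) (?cu 1) \<le> (exp ((\<kappa> + 1) * R / 2) * norm w) * (1 - 0)"
  proof (rule rdist_le_C1[OF C])
    fix t :: real assume t: "t \<in> {0..1}"
    obtain c where c: "c \<in> A" "?cu t \<in> fst c" using chart_at by blast
    show "spd {0..1} ?cu t \<le> exp ((\<kappa> + 1) * R / 2) * norm w"
      unfolding spd_chart[OF n C t c] vel_eqI[OF n t der[OF c]] by (rule F_derivative(3)[OF c nR[OF t] R(1)])
  qed simp
  then show ?thesis by (simp add: w_def norm_minus_commute)
qed

end

section \<open>Comparison geometry and Busemann functions\<close>

context hadamard
begin

text \<open>The CAT(0) inequality. From the intermediate point q, with w = \<open>L q x\<close>, the
  expanding exponential map gives d(x, y)^2 \<ge> |w - t u|^2 at both ends y; in the convex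
  combination the terms with the product of w and u cancel.\<close>

lemma stewart:
  assumes l: "0 \<le> l" "l \<le> 1"
  shows "(d x (E p v ((1 - l) * a + l * b)))\<^sup>2
    \<le> (1 - l) * (d x (E p v a))\<^sup>2 + l * (d x (E p v b))\<^sup>2 - l * (1 - l) * ((b - a) * norm v)\<^sup>2"
proof -
  define s where "s = (1 - l) * a + l * b"
  define q where "q = E p v s"
  obtain u where u: "norm u = norm v" "\<And>t. E p v (s + t) = E q u t" using E_shift unfolding q_def by metis
  define w where "w = L q x"
  have dq: "d x q = norm w" using rdist_F[of q w] by (simp add: w_def rdist_sym)
  have ge: "(norm w)\<^sup>2 - 2 * t * (w \<bullet> u) + t\<^sup>2 * (norm v)\<^sup>2 \<le> (d x (E p v (s + t)))\<^sup>2" for t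
  proof -
    have "norm (w - t *\<^sub>R u) \<le> d x (E p v (s + t))"
      using F_expands[of w "t *\<^sub>R u" q] by (simp only: u(2)[of t] E_F[of q u t] w_def L(2))
    then have "(norm (w - t *\<^sub>R u))\<^sup>2 \<le> (d x (E p v (s + t)))\<^sup>2" by (intro power_mono) auto
    moreover have "(norm (w - t *\<^sub>R u))\<^sup>2 = (norm w)\<^sup>2 - 2 * t * (w \<bullet> u) + t\<^sup>2 * (norm u)\<^sup>2"
      unfolding power2_norm_eq_inner by (simp add: inner_diff inner_commute algebra_simps power2_eq_square)
    ultimately show ?thesis using u(1) by simp
  qed
  have "s + - l * (b - a) = a" "s + (1 - l) * (b - a) = b" by (simp_all add: s_def algebra_simps)
  then have "(1 - l) * ((norm w)\<^sup>2 - 2 * (- l * (b - a)) * (w \<bullet> u) + (- l * (b - a))\<^sup>2 * (norm v)\<^sup>2)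
      + l * ((norm w)\<^sup>2 - 2 * ((1 - l) * (b - a)) * (w \<bullet> u) + ((1 - l) * (b - a))\<^sup>2 * (norm v)\<^sup>2)
      \<le> (1 - l) * (d x (E p v a))\<^sup>2 + l * (d x (E p v b))\<^sup>2"
    using ge[of "- l * (b - a)"] ge[of "(1 - l) * (b - a)"] l
    by (intro add_mono mult_left_mono) simp_all
  moreover have "(1 - l) * ((norm w)\<^sup>2 - 2 * (- l * (b - a)) * (w \<bullet> u) + (- l * (b - a))\<^sup>2 * (norm v)\<^sup>2)
      + l * ((norm w)\<^sup>2 - 2 * ((1 - l) * (b - a)) * (w \<bullet> u) + ((1 - l) * (b - a))\<^sup>2 * (norm v)\<^sup>2)
      = (norm w)\<^sup>2 + l * (1 - l) * ((b - a) * norm v)\<^sup>2"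
    by (simp add: power2_eq_square algebra_simps)
  ultimately show ?thesis unfolding s_def[symmetric] q_def[symmetric] dq by simp
qed

lemma stewart_F:
  assumes "0 \<le> l" "l \<le> 1"
  shows "(d x (F p (l *\<^sub>R v)))\<^sup>2 \<le> (1 - l) * (d x p)\<^sup>2 + l * (d x (F p v))\<^sup>2 - l * (1 - l) * (norm v)\<^sup>2"
  using stewart[OF assms, of x p v 0 1] by (simp add: E_F F_0)

text \<open>The two end distances differ by at most |v|, which makes the correction term in
  \<open>stewart_F\<close> large enough to complete the square.\<close>

lemma dist_convex:
  assumes l: "0 \<le> l" "l \<le> 1"
  shows "d x (F p (l *\<^sub>R v)) \<le> (1 - l) * d x p + l * d x (F p v)"
proof (rule power2_le_imp_le)
  have "\<bar>d x p - d x (F p v)\<bar> \<le> norm v"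
    using rdist_triangle[of x "F p v" p] rdist_triangle[of x p "F p v"] rdist_F[of p v] rdist_sym[of p "F p v"] by linarith
  then have "(d x p - d x (F p v))\<^sup>2 \<le> (norm v)\<^sup>2" by (simp add: abs_le_square_iff[symmetric])
  then have "l * (1 - l) * (d x p - d x (F p v))\<^sup>2 \<le> l * (1 - l) * (norm v)\<^sup>2"
    using l by (intro mult_left_mono) auto
  then show "(d x (F p (l *\<^sub>R v)))\<^sup>2 \<le> ((1 - l) * d x p + l * d x (F p v))\<^sup>2"
    using stewart_F[OF l, of x p v] by (simp add: power2_eq_square algebra_simps)
  show "0 \<le> (1 - l) * d x p + l * d x (F p v)" using l rdist_nonneg by simp
qed

text \<open>The CAT(0) inequality twice, first from the point at l u to the side towards w, then
  from the end w to the side towards u; the norms of u and w cancel.\<close>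

lemma thin:
  assumes l: "0 \<le> l" "l \<le> 1"
  shows "d (F p (l *\<^sub>R u)) (F p (l *\<^sub>R w)) \<le> l * d (F p u) (F p w)"
proof (rule power2_le_imp_le)
  have 1: "(d (F p (l *\<^sub>R u)) (F p (l *\<^sub>R w)))\<^sup>2 \<le> (1 - l) * (l * norm u)\<^sup>2 + l * (d (F p (l *\<^sub>R u)) (F p w))\<^sup>2 - l * (1 - l) * (norm w)\<^sup>2"
    using stewart_F[OF l, of "F p (l *\<^sub>R u)" p w] rdist_F[of p "l *\<^sub>R u"] l by (simp add: rdist_sym)
  have "(d (F p w) (F p (l *\<^sub>R u)))\<^sup>2 \<le> (1 - l) * (norm w)\<^sup>2 + l * (d (F p w) (F p u))\<^sup>2 - l * (1 - l) * (norm u)\<^sup>2"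
    using stewart_F[OF l, of "F p w" p u] rdist_F[of p w] by (simp add: rdist_sym)
  then have "l * (d (F p (l *\<^sub>R u)) (F p w))\<^sup>2 \<le> l * ((1 - l) * (norm w)\<^sup>2 + l * (d (F p u) (F p w))\<^sup>2 - l * (1 - l) * (norm u)\<^sup>2)"
    using l by (intro mult_left_mono) (simp_all add: rdist_sym)
  with 1 show "(d (F p (l *\<^sub>R u)) (F p (l *\<^sub>R w)))\<^sup>2 \<le> (l * d (F p u) (F p w))\<^sup>2"
    by (simp add: power2_eq_square algebra_simps)
  show "0 \<le> l * d (F p u) (F p w)" using l rdist_nonneg by simp
qed

lemma F_reverse: "F p (l *\<^sub>R L p q) = F q ((1 - l) *\<^sub>R L q p)"
proof -
  define v where "v = L p q"
  have q: "E p v 1 = q" by (simp add: v_def E_F)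
  obtain u where u: "\<And>t. E p v (1 + t) = E q u t" using E_shift[of v p 1] unfolding q by metis
  have "E q u (- 1) = p" using u[of "- 1"] E(2) by simp
  then have "L q p = - u" using L(1)[of q "- u"] by (simp add: E_F)
  then show ?thesis using u[of "l - 1"] by (simp add: E_F v_def algebra_simps)
qed

text \<open>The geodesic from p to q' is a diagonal shared by two triangles, one thin at p and one
  thin at q'.\<close>

lemma quad:
  assumes l: "0 \<le> l" "l \<le> 1"
  shows "d (F p (l *\<^sub>R L p q)) (F p' (l *\<^sub>R L p' q')) \<le> (1 - l) * d p p' + l * d q q'"
proof -
  have "d (F p (l *\<^sub>R L p q)) (F p (l *\<^sub>R L p q')) \<le> l * d q q'" using thin[OF l, of p "L p q" "L p q'"] by simp
  moreover have "d (F p (l *\<^sub>R L p q')) (F p' (l *\<^sub>R L p' q')) \<le> (1 - l) * d p p'"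
    using thin[of "1 - l" q' "L q' p" "L q' p'"] l by (simp add: F_reverse[of _ _ q'])
  ultimately show ?thesis using rdist_triangle[of "F p (l *\<^sub>R L p q)" "F p' (l *\<^sub>R L p' q')" "F p (l *\<^sub>R L p q')"] by linarith
qed

lemma isom_E:
  assumes f: "local_isom f"
  shows "f (E p v t) = E (f p) (L (f p) (f (F p v))) t"
proof -
  have "geo_on UNIV (f \<circ> E p v)" by (rule geo_on_isom[OF nontriv_UNIV _ f]) (rule geo_on_geo_at[OF E(1)])
  then obtain w where w: "f \<circ> E p v = E (f p) w" using full_geodesic[of "f \<circ> E p v"] by (auto simp: E)
  have "f (F p v) = F (f p) w" using fun_cong[OF w, of 1] by (simp add: E_F)
  then have "w = L (f p) (f (F p v))" by simp
  then show ?thesis using fun_cong[OF w, of t] by simp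
qed

lemma isom_F: "local_isom f ==> f (F p (t *\<^sub>R L p q)) = F (f p) (t *\<^sub>R L (f p) (f q))"
  using isom_E[of f p "L p q" t] by (simp add: E_F)

text \<open>The first estimate is the triangle inequality. The second is the CAT(0) inequality at
  ratio t / T; its error does not involve T and so gives a uniform rate of convergence along all
  rays from p.\<close>

lemma ray_monotone:
  assumes v: "norm v = 1" and t: "0 < t" "t \<le> T"
  shows "d x (F p (T *\<^sub>R v)) - T \<le> d x (F p (t *\<^sub>R v)) - t"
    and "d x (F p (t *\<^sub>R v)) - t - (d x p)\<^sup>2 / t \<le> d x (F p (T *\<^sub>R v)) - T"
proof -
  have "d (F p (t *\<^sub>R v)) (F p (T *\<^sub>R v)) = T - t" using E_rdist_eq[of p v t T] v t by (simp add: E_F)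
  then show 1: "d x (F p (T *\<^sub>R v)) - T \<le> d x (F p (t *\<^sub>R v)) - t"
    using rdist_triangle[of x "F p (T *\<^sub>R v)" "F p (t *\<^sub>R v)"] by linarith
  define D where "D = d x p"
  define \<beta> where "\<beta> = d x (F p (T *\<^sub>R v)) - T"
  define \<alpha> where "\<alpha> = d x (F p (t *\<^sub>R v)) - t"
  have T: "T > 0" using t by simp
  have dT: "d p (F p (T *\<^sub>R v)) = T" using v T by (simp add: rdist_F)
  have "\<bar>\<beta>\<bar> \<le> D"
    using rdist_triangle[of x "F p (T *\<^sub>R v)" p] rdist_triangle[of p "F p (T *\<^sub>R v)" x] rdist_sym[of x p] dT
    by (simp add: \<beta>_def D_def)
  then have \<beta>2: "\<beta>\<^sup>2 \<le> D\<^sup>2" by (metis abs_ge_zero abs_le_square_iff abs_of_nonneg order_trans)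
  have l: "0 \<le> t / T" "t / T \<le> 1" using t by auto
  have "(t + \<alpha>)\<^sup>2 \<le> (1 - t / T) * D\<^sup>2 + (t / T) * (T + \<beta>)\<^sup>2 - t / T * (1 - t / T) * T\<^sup>2"
    using stewart_F[OF l, of x p "T *\<^sub>R v"] T v by (simp add: D_def \<alpha>_def \<beta>_def)
  also have "\<dots> = (1 - t / T) * D\<^sup>2 + (t / T) * \<beta>\<^sup>2 + 2 * t * \<beta> + t\<^sup>2"
    using T by (simp add: power2_eq_square field_simps)
  also have "\<dots> \<le> D\<^sup>2 + D\<^sup>2 + 2 * t * \<beta> + t\<^sup>2"
  proof -
    have "(1 - t / T) * D\<^sup>2 \<le> 1 * D\<^sup>2" "(t / T) * \<beta>\<^sup>2 \<le> 1 * D\<^sup>2"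
      using l \<beta>2 by (intro mult_mono; simp)+
    then show ?thesis by simp
  qed
  finally have "2 * t * \<alpha> + \<alpha>\<^sup>2 \<le> 2 * D\<^sup>2 + 2 * t * \<beta>" by (simp add: power2_eq_square algebra_simps)
  then have "t * \<alpha> \<le> D\<^sup>2 + t * \<beta>" using zero_le_power2[of \<alpha>] by linarith
  then have "\<alpha> - D\<^sup>2 / t \<le> \<beta>" using t by (simp add: field_simps)
  then show "d x (F p (t *\<^sub>R v)) - t - (d x p)\<^sup>2 / t \<le> d x (F p (T *\<^sub>R v)) - T" by (simp add: \<alpha>_def \<beta>_def D_def)
qed

section \<open>Busemann functions\<close>

text \<open>The Busemann function of the ray from p in direction v. As the expression is
  nonincreasing in t, the infimum is its limit; the infimum form gives upper bounds at every t
  directly.\<close>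

definition bus :: "'m => real ^ 'n => 'm => real"
  where "bus p v x = (INF t\<in>{0<..}. d x (F p (t *\<^sub>R v)) - t)"

lemma bus_bounds:
  assumes v: "norm v = 1" and t: "0 < t"
  shows "bus p v x \<le> d x (F p (t *\<^sub>R v)) - t"
    and "d x (F p (t *\<^sub>R v)) - t - (d x p)\<^sup>2 / t \<le> bus p v x"
proof -
  have "bdd_below ((\<lambda>t. d x (F p (t *\<^sub>R v)) - t) ` {0<..})"
  proof (rule bdd_belowI2)
    fix t :: real assume "t \<in> {0<..}"
    then show "- d x p \<le> d x (F p (t *\<^sub>R v)) - t"
      using rdist_triangle[of p "F p (t *\<^sub>R v)" x] rdist_F[of p "t *\<^sub>R v"] rdist_sym[of x p] v by simp
  qed
  then show "bus p v x \<le> d x (F p (t *\<^sub>R v)) - t" unfolding bus_def using t by (intro cINF_lower) auto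
  show "d x (F p (t *\<^sub>R v)) - t - (d x p)\<^sup>2 / t \<le> bus p v x" unfolding bus_def
  proof (rule cINF_greatest)
    fix T :: real assume T: "T \<in> {0<..}"
    show "d x (F p (t *\<^sub>R v)) - t - (d x p)\<^sup>2 / t \<le> d x (F p (T *\<^sub>R v)) - T"
    proof (cases "t \<le> T")
      case True
      then show ?thesis by (rule ray_monotone(2)[OF v t])
    next
      case False
      have "(d x p)\<^sup>2 / t \<ge> 0" using t by simp
      moreover have "d x (F p (t *\<^sub>R v)) - t \<le> d x (F p (T *\<^sub>R v)) - T"
        using False T by (intro ray_monotone(1)[OF v]) auto
      ultimately show ?thesis by linarith
    qed
  qed auto
qed

lemma bus_limit:
  assumes v: "norm v = 1"
  shows "((\<lambda>t. d x (F p (t *\<^sub>R v)) - t) \<longlongrightarrow> bus p v x) at_top"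
proof (rule tendsto_sandwich)
  show "\<forall>\<^sub>F t in at_top. bus p v x \<le> d x (F p (t *\<^sub>R v)) - t"
    using eventually_gt_at_top[of 0] by eventually_elim (rule bus_bounds(1)[OF v])
  show "\<forall>\<^sub>F t in at_top. d x (F p (t *\<^sub>R v)) - t \<le> bus p v x + (d x p)\<^sup>2 / t"
    using eventually_gt_at_top[of 0]
  proof eventually_elim
    case (elim t)
    then show ?case using bus_bounds(2)[OF v elim, of x p] by linarith
  qed
  have "((\<lambda>t. (d x p)\<^sup>2 / t) \<longlongrightarrow> 0) at_top"
    by (rule tendsto_divide_0[OF tendsto_const filterlim_at_top_imp_at_infinity[OF filterlim_ident]])
  then show "((\<lambda>t. bus p v x + (d x p)\<^sup>2 / t) \<longlongrightarrow> bus p v x) at_top"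
    using tendsto_add[OF tendsto_const[of "bus p v x"]] by fastforce
qed simp

lemma bus_base: "norm v = 1 ==> bus p v p = 0"
  using bus_bounds[of v 1 p p] rdist_F[of p v] by simp

lemma bus_lipschitz:
  assumes v: "norm v = 1"
  shows "bus p v x \<le> bus p v y + d x y"
proof (rule tendsto_le[OF _ tendsto_add[OF bus_limit[OF v, where x = y] tendsto_const] bus_limit[OF v, where x = x]])
  show "\<forall>\<^sub>F t in at_top. d x (F p (t *\<^sub>R v)) - t \<le> d y (F p (t *\<^sub>R v)) - t + d x y"
    using rdist_triangle[of x _ y] by (intro always_eventually allI) (simp add: algebra_simps)
qed simp

lemma bus_convex:
  assumes v: "norm v = 1" and l: "0 \<le> l" "l \<le> 1"
  shows "bus p v (F q (l *\<^sub>R u)) \<le> (1 - l) * bus p v q + l * bus p v (F q u)"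
proof (rule tendsto_le[OF _ tendsto_add[OF tendsto_mult_left[OF bus_limit[OF v]] tendsto_mult_left[OF bus_limit[OF v]]] bus_limit[OF v]])
  show "\<forall>\<^sub>F t in at_top. d (F q (l *\<^sub>R u)) (F p (t *\<^sub>R v)) - t
      \<le> (1 - l) * (d q (F p (t *\<^sub>R v)) - t) + l * (d (F q u) (F p (t *\<^sub>R v)) - t)"
  proof (intro always_eventually allI)
    fix t
    show "d (F q (l *\<^sub>R u)) (F p (t *\<^sub>R v)) - t
      \<le> (1 - l) * (d q (F p (t *\<^sub>R v)) - t) + l * (d (F q u) (F p (t *\<^sub>R v)) - t)"
      using dist_convex[OF l, of "F p (t *\<^sub>R v)" q u] by (simp add: rdist_sym[of "F p (t *\<^sub>R v)"] algebra_simps)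
  qed
qed simp

lemma F_tendsto:
  assumes "(u \<longlongrightarrow> v) G"
  shows "((\<lambda>k. d (F p (u k)) (F p v)) \<longlongrightarrow> 0) G"
proof (rule tendsto_sandwich[of "\<lambda>_. 0"])
  define R where "R = norm v + 1"
  have R: "1 \<le> R" "norm v \<le> R" by (auto simp: R_def)
  have "\<forall>\<^sub>F k in G. dist (u k) v < 1" using assms by (rule tendstoD) simp
  then show "\<forall>\<^sub>F k in G. d (F p (u k)) (F p v) \<le> exp ((\<kappa> + 1) * R / 2) * norm (u k - v)"
  proof eventually_elim
    case (elim k)
    have "norm (u k) \<le> R" using elim norm_triangle_sub[of "u k" v] by (simp add: R_def dist_norm)
    then show ?case by (rule F_lipschitz[OF R(1) _ R(2)])
  qed
  have "((\<lambda>k. norm (u k - v)) \<longlongrightarrow> norm (v - v)) G" by (intro tendsto_intros assms)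
  then show "((\<lambda>k. exp ((\<kappa> + 1) * R / 2) * norm (u k - v)) \<longlongrightarrow> 0) G"
    using tendsto_mult_right_zero by fastforce
  show "\<forall>\<^sub>F k in G. 0 \<le> d (F p (u k)) (F p v)" using rdist_nonneg by (intro always_eventually allI)
  show "((\<lambda>k. 0) \<longlongrightarrow> 0) G" by simp
qed

text \<open>Points escaping to infinity whose directions from p converge to v compute the Busemann
  function of v. They are compared with the ray at one fixed radius t, where convergence of
  directions applies, at an error of d(x,p)^2 / t.\<close>

theorem bus_sequence:
  fixes y :: "nat => 'm"
  assumes v: "norm v = 1" and T: "filterlim (\<lambda>k. d p (y k)) at_top sequentially"
    and dir: "(\<lambda>k. (1 / d p (y k)) *\<^sub>R L p (y k)) \<longlonglongrightarrow> v"
  shows "(\<lambda>k. d x (y k) - d p (y k)) \<longlonglongrightarrow> bus p v x"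
proof (rule tendstoI)
  fix e :: real assume e: "e > 0"
  define D where "D = (d x p)\<^sup>2"
  \<comment> \<open>Large enough that D / t < e / 3; the summand 1 keeps t positive when D =
    0.\<close>
  define t where "t = 3 * D / e + 1"
  have D: "D \<ge> 0" by (simp add: D_def)
  have t: "t > 0" using D e by (simp add: t_def add_nonneg_pos)
  have Dt: "D / t < e / 3" using t e D by (simp add: t_def field_simps)
  define u where "u k = (1 / d p (y k)) *\<^sub>R L p (y k)" for k
  have "((\<lambda>k. t *\<^sub>R u k) \<longlongrightarrow> t *\<^sub>R v) sequentially" unfolding u_def by (intro tendsto_intros dir)
  then have "\<forall>\<^sub>F k in sequentially. dist (d (F p (t *\<^sub>R u k)) (F p (t *\<^sub>R v))) 0 < e / 3"
    by (intro tendstoD[OF F_tendsto]) (use e in auto)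
  moreover have "\<forall>\<^sub>F k in sequentially. t \<le> d p (y k)" using T by (simp add: filterlim_at_top)
  ultimately show "\<forall>\<^sub>F k in sequentially. dist (d x (y k) - d p (y k)) (bus p v x) < e"
  proof eventually_elim
    case (elim k)
    have dk: "d p (y k) > 0" using elim(2) t by linarith
    have nL: "norm (L p (y k)) = d p (y k)" using rdist_F[of p "L p (y k)"] by simp
    then have nu: "norm (u k) = 1" using dk by (simp add: u_def)
    have yk: "y k = F p (d p (y k) *\<^sub>R u k)" using dk by (simp add: u_def)
    have 1: "d x (y k) - d p (y k) \<le> d x (F p (t *\<^sub>R u k)) - t"
      "d x (F p (t *\<^sub>R u k)) - t - D / t \<le> d x (y k) - d p (y k)"
      using ray_monotone[OF nu t elim(2), of x p] unfolding yk[symmetric] D_def by auto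
    have 2: "\<bar>d x (F p (t *\<^sub>R u k)) - d x (F p (t *\<^sub>R v))\<bar> < e / 3"
      using elim(1) rdist_triangle[of x "F p (t *\<^sub>R u k)" "F p (t *\<^sub>R v)"] rdist_triangle[of x "F p (t *\<^sub>R v)" "F p (t *\<^sub>R u k)"]
        rdist_sym[of "F p (t *\<^sub>R u k)" "F p (t *\<^sub>R v)"] rdist_nonneg[of "F p (t *\<^sub>R u k)" "F p (t *\<^sub>R v)"]
      unfolding dist_real_def by linarith
    show ?case
      using 1 2 Dt bus_bounds[OF v t, where x = x and p = p] unfolding D_def[symmetric] dist_real_def by linarith
  qed
qed

text \<open>Logarithms do not increase distances, so points at bounded distance from the ray have
  directions converging to v. Asymptotic rays with other starting points thus compute the same
  function, normalized at p.\<close>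

lemma bus_asymptotic:
  fixes y :: "nat => 'm"
  assumes v: "norm v = 1" and C: "\<And>k. d (F p (real k *\<^sub>R v)) (y k) \<le> C"
  shows "(\<lambda>k. d x (y k) - d p (y k)) \<longlonglongrightarrow> bus p v x"
proof (rule bus_sequence[OF v])
  define T where "T k = d p (y k)" for k
  have nL: "norm (L p (y k)) = T k" for k using rdist_F[of p "L p (y k)"] by (simp add: T_def)
  have near: "norm (real k *\<^sub>R v - L p (y k)) \<le> C" for k
    using F_expands[of "real k *\<^sub>R v" "L p (y k)" p] C[of k] by simp
  have Tk: "\<bar>T k - real k\<bar> \<le> C" for k
    using norm_triangle_ineq3[of "L p (y k)" "real k *\<^sub>R v"] near[of k] v by (simp add: nL norm_minus_commute)
  have C0: "C \<ge> 0" using near[of 0] norm_ge_zero order_trans by blast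
  have lim: "filterlim (\<lambda>k. real k - C) at_top sequentially" by real_asymp
  show T: "filterlim (\<lambda>k. d p (y k)) at_top sequentially"
  proof (rule filterlim_at_top_mono[OF lim], intro always_eventually allI)
    show "real k - C \<le> d p (y k)" for k using Tk[of k] unfolding T_def by linarith
  qed
  have "((\<lambda>k. (1 / T k) *\<^sub>R L p (y k) - v) \<longlongrightarrow> 0) sequentially"
  proof (rule Lim_null_comparison)
    show "\<forall>\<^sub>F k in sequentially. norm ((1 / T k) *\<^sub>R L p (y k) - v) \<le> 2 * C / T k"
    proof -
      have "\<forall>\<^sub>F k in sequentially. T k > 0" using T unfolding T_def filterlim_at_top_dense by blast
      then show ?thesis
      proof eventually_elim
        case (elim k)
        have "T k *\<^sub>R ((1 / T k) *\<^sub>R L p (y k) - v) = (L p (y k) - real k *\<^sub>R v) + (real k - T k) *\<^sub>R v"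
          using elim by (simp add: algebra_simps)
        then have "norm (T k *\<^sub>R ((1 / T k) *\<^sub>R L p (y k) - v)) \<le> norm (L p (y k) - real k *\<^sub>R v) + norm ((real k - T k) *\<^sub>R v)"
          using norm_triangle_ineq by metis
        also have "\<dots> \<le> C + C" using near[of k] Tk[of k] v by (intro add_mono) (auto simp: norm_minus_commute)
        finally have "T k * norm ((1 / T k) *\<^sub>R L p (y k) - v) \<le> 2 * C" using elim by simp
        then show ?case using elim by (simp add: pos_le_divide_eq mult.commute)
      qed
    qed
    show "((\<lambda>k. 2 * C / T k) \<longlongrightarrow> 0) sequentially"
      by (rule tendsto_divide_0[OF tendsto_const filterlim_at_top_imp_at_infinity[OF T[folded T_def]]])
  qed
  then show "(\<lambda>k. (1 / d p (y k)) *\<^sub>R L p (y k)) \<longlonglongrightarrow> v"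
    by (simp add: LIM_zero_iff T_def)
qed

end

section \<open>Rays and the boundary at infinity\<close>

context riem_mfd
begin

lemma unit_geodesic_Gam:
  "unit_geodesic_on A g I cu \<longleftrightarrow> continuous_on I cu \<and> (\<forall>c\<in>A. \<exists>v. \<forall>t\<in>I. cu t \<in> fst c \<longrightarrow>
    ((snd c \<circ> cu) has_vector_derivative v t) (at t within I) \<and>
    (v has_vector_derivative - Gam (g c) (snd c (cu t)) (v t) (v t)) (at t within I) \<and> ip (g c) (snd c (cu t)) (v t) (v t) = 1)"
proof -
  have "(\<chi> k. - (\<Sum>i\<in>UNIV. \<Sum>j\<in>UNIV. christoffel G k i j x * v $ i * v $ j)) = - Gam G x v v"
    for G :: "real ^ 'n => real ^ 'n ^ 'n" and x v by (simp add: Gam_def vec_eq_iff)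
  then show ?thesis unfolding unit_geodesic_on_def ip_def by simp
qed

lemma unit_geodesic_iff:
  assumes I: "nontriv I"
  shows "unit_geodesic_on A g I cu \<longleftrightarrow> geo_on I cu \<and>
    (\<forall>c\<in>A. \<forall>t\<in>I. cu t \<in> fst c \<longrightarrow> ip (g c) (snd c (cu t)) (vel c I cu t) (vel c I cu t) = 1)"
proof
  assume u: "unit_geodesic_on A g I cu"
  then have cont: "continuous_on I cu" by (simp add: unit_geodesic_on_def)
  note ex = bspec[OF conjunct2[OF u[unfolded unit_geodesic_Gam]]]
  have "geo_on I cu"
  proof (rule geo_onI[OF I])
    fix t assume t: "t \<in> I"
    obtain c where c: "c \<in> A" "cu t \<in> fst c" using chart_at by blast
    obtain e where e: "e > 0" "\<And>s. s \<in> I \<inter> ball t e ==> cu s \<in> fst c"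
      using chart_nbhd[OF cont t c(2) open_dom[OF c(1)]] by blast
    obtain v where v: "\<And>t. t \<in> I ==> cu t \<in> fst c ==> ((snd c \<circ> cu) has_vector_derivative v t) (at t within I) \<and>
      (v has_vector_derivative - Gam (g c) (snd c (cu t)) (v t) (v t)) (at t within I)"
      using ex[OF c(1)] by blast
    show "geo_at I cu t" unfolding geo_at_def
      by (intro bexI[OF _ c(1)] exI[of _ v] exI[of _ e] conjI e(1) ballI) (use e(2) v in auto)
  qed
  moreover have "ip (g c) (snd c (cu t)) (vel c I cu t) (vel c I cu t) = 1" if h: "c \<in> A" "t \<in> I" "cu t \<in> fst c" for c t
  proof -
    obtain v where "((snd c \<circ> cu) has_vector_derivative v t) (at t within I)" "ip (g c) (snd c (cu t)) (v t) (v t) = 1"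
      using ex[OF h(1)] h by blast
    then show ?thesis using vel_eqI[OF I h(2)] by metis
  qed
  ultimately show "geo_on I cu \<and>
    (\<forall>c\<in>A. \<forall>t\<in>I. cu t \<in> fst c \<longrightarrow> ip (g c) (snd c (cu t)) (vel c I cu t) (vel c I cu t) = 1)" by blast
next
  assume h: "geo_on I cu \<and>
    (\<forall>c\<in>A. \<forall>t\<in>I. cu t \<in> fst c \<longrightarrow> ip (g c) (snd c (cu t)) (vel c I cu t) (vel c I cu t) = 1)"
  then show "unit_geodesic_on A g I cu"
    unfolding unit_geodesic_Gam geo_on_def by blast
qed

lemma unit_geodesic_isom:
  assumes I: "nontriv I" and cu: "unit_geodesic_on A g I cu" and f: "local_isom f"
  shows "unit_geodesic_on A g I (f \<circ> cu)"
  unfolding unit_geodesic_iff[OF I]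
proof (intro conjI ballI impI)
  have geo: "geo_on I cu" using cu unit_geodesic_iff[OF I] by blast
  show "geo_on I (f \<circ> cu)" by (rule geo_on_isom[OF I geo_on_geo_at[OF geo] f])
  fix e t assume e: "e \<in> A" "t \<in> I" "(f \<circ> cu) t \<in> fst e"
  obtain c where c: "c \<in> A" "cu t \<in> fst c" using chart_at by blast
  have e': "f (cu t) \<in> fst e" using e by simp
  have "ip (g c) (snd c (cu t)) (vel c I cu t) (vel c I cu t) = 1" using cu unit_geodesic_iff[OF I] c e(2) by blast
  then show "ip (g e) (snd e ((f \<circ> cu) t)) (vel e I (f \<circ> cu) t) (vel e I (f \<circ> cu) t) = 1"
    unfolding vel_tr[OF I geo c(1) e(1) f e(2) c(2) e'] comp_apply tr_chart[OF c(1) e(1) f c(2), symmetric]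
      tr_metric[OF c(1) e(1) f tdom_chart[OF c(1) e(1) f c(2) e'], symmetric] .
qed

end

context hadamard
begin

lemma unit_geodesic_E:
  assumes I: "nontriv I" "0 \<in> I" "convex I" and cu: "unit_geodesic_on A g I cu"
  obtains w where "norm w = 1" "\<And>t. t \<in> I ==> cu t = F (cu 0) (t *\<^sub>R w)"
proof -
  define p where "p = cu 0"
  have geo: "geo_on I cu" and one: "ip (g (bc p)) (snd (bc p) p) (vel (bc p) I cu 0) (vel (bc p) I cu 0) = 1"
    using cu unit_geodesic_iff[OF I(1)] I(2) bc[of p] unfolding p_def by auto
  obtain w where w: "FR p *v w = vel (bc p) I cu 0" using FR_surj by blast
  have "w \<bullet> w = 1" using FR[of p w w] one by (simp add: w gp_def)
  then have n: "norm w = 1" by (simp add: norm_eq_sqrt_inner)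
  have EI: "geo_on I (E p w)" by (rule geo_on_subset[OF E(1) _ I(1)]) simp
  have v: "vel (bc p) I (E p w) 0 = vel (bc p) UNIV (E p w) 0"
    by (rule vel_subset[OF geo_C1c[OF E(1)] _ I(1,2) bc(1)]) (use bc E in auto)
  have "cu t = F p (t *\<^sub>R w)" if "t \<in> I" for t
    using geo_unique[OF I(3,1) geo EI I(2) _ bc(1)[of p] _ _ that] v w bc(2)[of p] by (simp add: E p_def E_F[symmetric])
  then show thesis using that n by (simp add: p_def)
qed

abbreviation ray :: "(real => 'm) => bool" where "ray \<equiv> unit_geodesic_on A g {0..}"

lemma ray_F:
  assumes v: "norm v = 1"
  shows "ray (\<lambda>t. F p (t *\<^sub>R v))"
proof -
  have "ray (E p v)"
    unfolding unit_geodesic_iff[OF nontriv_ray]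
  proof (intro conjI ballI impI)
    show "geo_on {0..} (E p v)" by (rule geo_on_subset[OF E(1) _ nontriv_ray]) simp
    fix c t assume c: "c \<in> A" "t \<in> {0::real..}" "E p v t \<in> fst c"
    have "vel c {0..} (E p v) t = vel c UNIV (E p v) t"
      by (rule vel_subset[OF geo_C1c[OF E(1)] _ nontriv_ray c(2,1,3)]) simp
    then show "ip (g c) (snd c (E p v t)) (vel c {0..} (E p v) t) (vel c {0..} (E p v) t) = 1"
      using vel_E_norm[OF c(1,3)] v by simp
  qed
  moreover have "E p v = (\<lambda>t. F p (t *\<^sub>R v))" by (simp add: E_F fun_eq_iff)
  ultimately show ?thesis by simp
qed

lemma ray_obtain:
  assumes "ray cu"
  obtains w where "norm w = 1" "\<And>t. t \<ge> 0 ==> cu t = F (cu 0) (t *\<^sub>R w)"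
  using unit_geodesic_E[OF nontriv_ray _ _ assms] by auto

lemma asymptotic_iff:
  "(cu, \<delta>) \<in> asymptotic A g \<longleftrightarrow> ray cu \<and> ray \<delta> \<and> (\<exists>C. \<forall>t\<ge>0. d (cu t) (\<delta> t) \<le> C)"
  by (simp add: asymptotic_def)

lemma asymptotic_equiv: "equiv {cu. ray cu} (asymptotic A g)"
proof (rule equivI)
  show "asymptotic A g \<subseteq> {cu. ray cu} \<times> {cu. ray cu}" by (auto simp: asymptotic_iff)
  show "refl_on {cu. ray cu} (asymptotic A g)" by (rule refl_onI) (auto simp: asymptotic_iff)
  show "sym (asymptotic A g)" by (rule symI) (auto simp: asymptotic_iff rdist_sym)
  show "trans (asymptotic A g)"
  proof (rule transI)
    fix a b c assume ab: "(a, b) \<in> asymptotic A g" and bc: "(b, c) \<in> asymptotic A g"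
    from ab obtain C where C: "ray a" "\<And>t. t \<ge> 0 ==> d (a t) (b t) \<le> C" unfolding asymptotic_iff by blast
    from bc obtain C' where C': "ray c" "\<And>t. t \<ge> 0 ==> d (b t) (c t) \<le> C'" unfolding asymptotic_iff by blast
    have "d (a t) (c t) \<le> C + C'" if "t \<ge> 0" for t
      using rdist_triangle[of "a t" "c t" "b t"] C(2)[OF that] C'(2)[OF that] by linarith
    then show "(a, c) \<in> asymptotic A g" unfolding asymptotic_iff using C(1) C'(1) by blast
  qed
qed

text \<open>Boundary points seen from p, indexed by unit vectors. Different unit vectors at p give
  different points, and every boundary point is of this form for some p, the start of a representing
  ray.\<close>

definition cls :: "'m => real ^ 'n => (real => 'm) set"
  where "cls p v = asymptotic A g `` {\<lambda>t. F p (t *\<^sub>R v)}"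

lemma cls_boundary: "norm v = 1 ==> cls p v \<in> boundary_at_infinity A g"
  unfolding cls_def boundary_at_infinity_def by (rule quotientI) (simp add: ray_F)

lemma boundary_cls:
  assumes "\<xi> \<in> boundary_at_infinity A g"
  obtains p v where "norm v = 1" "\<xi> = cls p v"
proof -
  obtain cu where cu: "ray cu" "\<xi> = asymptotic A g `` {cu}"
    using assms unfolding boundary_at_infinity_def by (auto elim: quotientE)
  obtain w where w: "norm w = 1" "\<And>t. t \<ge> 0 ==> cu t = F (cu 0) (t *\<^sub>R w)" using ray_obtain[OF cu(1)] by blast
  have "d (cu t) (F (cu 0) (t *\<^sub>R w)) \<le> 0" if "t \<ge> 0" for t using w(2)[OF that] by simp
  then have "(cu, \<lambda>t. F (cu 0) (t *\<^sub>R w)) \<in> asymptotic A g"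
    unfolding asymptotic_iff using cu(1) ray_F[OF w(1)] by blast
  then have "\<xi> = cls (cu 0) w" unfolding cu(2) cls_def by (rule equiv_class_eq[OF asymptotic_equiv])
  then show thesis using that w(1) by blast
qed

lemma cls_eqD:
  assumes v: "norm v = 1" "norm w = 1" and eq: "cls p v = asymptotic A g `` {cu}"
  obtains C where "ray cu" "\<And>t. t \<ge> 0 ==> d (cu t) (F p (t *\<^sub>R v)) \<le> C"
proof -
  have "(\<lambda>t. F p (t *\<^sub>R v)) \<in> cls p v"
    unfolding cls_def by (rule equiv_class_self[OF asymptotic_equiv]) (simp add: ray_F v)
  then have "(cu, \<lambda>t. F p (t *\<^sub>R v)) \<in> asymptotic A g" unfolding eq by simp
  then show thesis using that unfolding asymptotic_iff by blast
qed

text \<open>Since the exponential map expands distances, rays with different directions at p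
  separate at least linearly.\<close>

lemma cls_inj:
  assumes v: "norm v = 1" "norm w = 1" and eq: "cls p v = cls p w"
  shows "v = w"
proof (rule ccontr)
  assume "v \<noteq> w"
  then have n: "norm (w - v) > 0" by simp
  obtain C where C: "\<And>t. t \<ge> 0 ==> d (F p (t *\<^sub>R w)) (F p (t *\<^sub>R v)) \<le> C"
    using cls_eqD[OF v eq[unfolded cls_def[of p w]]] by metis
  have le: "t * norm (w - v) \<le> C" if "t \<ge> 0" for t
  proof -
    have "norm (t *\<^sub>R w - t *\<^sub>R v) \<le> C" using F_expands[of "t *\<^sub>R w" "t *\<^sub>R v" p] C[OF that] by linarith
    then show ?thesis using that by (simp flip: scaleR_diff_right)
  qed
  have "C \<ge> 0" using le[of 0] by simp
  then have "C + 1 \<le> C" using le[of "(C + 1) / norm (w - v)"] n by simp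
  then show False by simp
qed

text \<open>An isometry maps asymptotic rays to asymptotic rays, so the union in
  \<open>boundary_map\<close> is over equal classes and a single representative decides.\<close>

lemma cls_fix_iff:
  assumes v: "norm v = 1" and f: "local_isom f"
  shows "cls p v \<in> Fix A g f \<longleftrightarrow> (\<exists>C. \<forall>t\<ge>0. d (F p (t *\<^sub>R v)) (f (F p (t *\<^sub>R v))) \<le> C)"
proof -
  let ?c = "\<lambda>t. F p (t *\<^sub>R v)"
  have c: "ray ?c" by (rule ray_F[OF v])
  have fray: "ray (f \<circ> cu)" if "ray cu" for cu by (rule unit_geodesic_isom[OF nontriv_ray that f])
  have cin: "?c \<in> cls p v" unfolding cls_def by (rule equiv_class_self[OF asymptotic_equiv]) (simp add: c)
  have map: "boundary_map A g f (cls p v) = asymptotic A g `` {f \<circ> ?c}"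
  proof -
    have eq: "asymptotic A g `` {f \<circ> cu} = asymptotic A g `` {f \<circ> ?c}" if "cu \<in> cls p v" for cu
    proof (rule equiv_class_eq[OF asymptotic_equiv])
      obtain C where C: "ray cu" "\<And>t. t \<ge> 0 ==> d (?c t) (cu t) \<le> C" using \<open>cu \<in> cls p v\<close> unfolding cls_def Image_singleton_iff asymptotic_iff by blast
      have "d ((f \<circ> cu) t) ((f \<circ> ?c) t) \<le> C" if "t \<ge> 0" for t
        using rdist_isom[OF f, of "cu t" "?c t"] C(2)[OF that] by (simp add: rdist_sym)
      then show "(f \<circ> cu, f \<circ> ?c) \<in> asymptotic A g" unfolding asymptotic_iff using fray C(1) c by blast
    qed
    have "boundary_map A g f (cls p v) = (\<Union>cu\<in>cls p v. asymptotic A g `` {f \<circ> cu})"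
      unfolding boundary_map_def by blast
    also have "\<dots> = asymptotic A g `` {f \<circ> ?c}" by (rule UN_constant_eq[OF cin ballI[OF eq]])
    finally show ?thesis .
  qed
  have "cls p v \<in> Fix A g f \<longleftrightarrow> asymptotic A g `` {f \<circ> ?c} = cls p v"
    using cls_boundary[OF v, of p] by (simp only: Fix_def mem_Collect_eq map) blast
  also have "\<dots> \<longleftrightarrow> (f \<circ> ?c, ?c) \<in> asymptotic A g"
    unfolding cls_def using eq_equiv_class_iff[OF asymptotic_equiv, of "f \<circ> ?c" ?c] fray[OF c] c by simp
  also have "\<dots> \<longleftrightarrow> (\<exists>C. \<forall>t\<ge>0. d (?c t) (f (?c t)) \<le> C)"
    unfolding asymptotic_iff using fray[OF c] c by (simp add: rdist_sym)
  finally show ?thesis .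
qed

text \<open>The image of the ray stays at bounded distance from the ray, hence computes the same
  Busemann function; moving f to the other argument of the distance shifts the normalization from p
  to f p.\<close>

lemma bus_shift:
  assumes v: "norm v = 1" and f: "local_isom f" "\<And>x y. d (f x) (f y) = d x y" and fx: "cls p v \<in> Fix A g f"
  shows "bus p v (f x) = bus p v x + bus p v (f p)"
proof -
  obtain C where C: "\<And>t. t \<ge> 0 ==> d (F p (t *\<^sub>R v)) (f (F p (t *\<^sub>R v))) \<le> C"
    using fx cls_fix_iff[OF v f(1)] by blast
  let ?y = "\<lambda>k::nat. F p (real k *\<^sub>R v)"
  have lim: "(\<lambda>k. d x (f (?y k)) - d p (f (?y k))) \<longlonglongrightarrow> bus p v x" for x
    by (rule bus_asymptotic[OF v]) (rule C, simp)
  have "(\<lambda>k. d x (?y k) - d p (?y k)) \<longlonglongrightarrow> bus p v x"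
    by (rule bus_asymptotic[OF v, where C = 0]) simp
  from tendsto_add[OF this lim[of "f p"]]
  have "(\<lambda>k. d (f x) (f (?y k)) - d p (f (?y k))) \<longlonglongrightarrow> bus p v x + bus p v (f p)"
    by (simp add: f(2))
  with lim[of "f x"] show ?thesis by (rule LIMSEQ_unique)
qed

text \<open>Visibility provides a line from the class of v to that of w. Backwards along it the
  Busemann function of w grows at unit rate, and the ray towards v remains at bounded distance from
  it.\<close>

lemma bus_unbounded:
  assumes vis: "visibility_manifold A g" and v: "norm v = 1" "norm w = 1" "v \<noteq> w"
    and M: "\<And>t. t \<ge> 0 ==> bus p w (F p (t *\<^sub>R v)) \<le> M"
  shows False
proof -
  have "cls p v \<noteq> cls p w" using cls_inj[OF v(1,2)] v(3) by blast
  then obtain cu where cu: "geodesic_line A g cu" "end_point A g (\<lambda>t. cu (- t)) = cls p v" "end_point A g cu = cls p w"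
    using vis cls_boundary[OF v(1), of p] cls_boundary[OF v(2), of p] unfolding visibility_manifold_def by metis
  obtain u where u: "norm u = 1" "\<And>t. cu t = F (cu 0) (t *\<^sub>R u)"
    using unit_geodesic_E[OF nontriv_UNIV _ _ cu(1)] by auto
  obtain C where C: "\<And>t. t \<ge> 0 ==> d (cu (- t)) (F p (t *\<^sub>R v)) \<le> C"
    using cls_eqD[OF v(1,1), of p "\<lambda>t. cu (- t)"] cu(2) unfolding end_point_def by metis
  obtain C' where C': "\<And>t. t \<ge> 0 ==> d (cu t) (F p (t *\<^sub>R w)) \<le> C'"
    using cls_eqD[OF v(2,2), of p cu] cu(3) unfolding end_point_def by metis
  have dg: "d (cu s) (cu t) = \<bar>s - t\<bar>" for s t using E_rdist_eq[of "cu 0" u s t] u(1) u(2)[of s] u(2)[of t] by (simp only: E_F mult_1)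
  \<comment> \<open>On the line cu (- t) and cu k have distance exactly t + k, whereas d p (cu k)
    exceeds k by at most d p (cu 0).\<close>
  have low: "t - d p (cu 0) \<le> bus p w (cu (- t))" if "t \<ge> 0" for t
  proof (rule LIMSEQ_le_const)
    show "(\<lambda>k. d (cu (- t)) (cu (real k)) - d p (cu (real k))) \<longlonglongrightarrow> bus p w (cu (- t))"
      by (rule bus_asymptotic[OF v(2), where C = C']) (use C' in \<open>simp add: rdist_sym\<close>)
    have "t - d p (cu 0) \<le> d (cu (- t)) (cu (real k)) - d p (cu (real k))" for k
      using rdist_triangle[of p "cu (real k)" "cu 0"] that by (simp add: dg)
    then show "\<exists>N. \<forall>k\<ge>N. t - d p (cu 0) \<le> d (cu (- t)) (cu (real k)) - d p (cu (real k))" by blast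
  qed
  have "t - d p (cu 0) \<le> M + C" if "t \<ge> 0" for t
    using low[OF that] bus_lipschitz[OF v(2), of p "cu (- t)" "F p (t *\<^sub>R v)"] M[OF that] C[OF that] by linarith
  from this[of "\<bar>M + C\<bar> + d p (cu 0) + 1"] show False using rdist_nonneg[of p "cu 0"] by (simp add: add_nonneg_nonneg)
qed

end

section \<open>Growth of the orbit\<close>

text \<open>Packing: the balls of radius \<delta> / 2 about the points are disjoint and lie in the
  ball of radius R + \<delta> / 2. The volume of the unit ball cancels, and a factor 2^N clears the
  halves.\<close>

lemma separated_card:
  fixes X :: "(real ^ 'n) set"
  assumes X: "finite X" "\<And>x. x \<in> X ==> norm x \<le> R" and \<delta>: "\<delta> > 0"
    and sep: "\<And>x y. x \<in> X ==> y \<in> X ==> x \<noteq> y ==> \<delta> \<le> norm (x - y)" and R: "R \<ge> 0"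
  shows "real (card X) * \<delta> ^ CARD('n) \<le> (2 * R + \<delta>) ^ CARD('n)"
proof -
  let ?N = "CARD('n)" and ?B = "\<lambda>x :: real ^ 'n. ball x (\<delta> / 2)"
  define V where "V = unit_ball_vol (real ?N)"
  have V: "V > 0" unfolding V_def by (rule unit_ball_vol_pos) simp
  have vol: "measure lborel (ball x r :: (real ^ 'n) set) = V * r ^ ?N" if "r \<ge> 0" for x r
    using content_ball[OF that, of x] by (simp add: V_def)
  have fm: "ball x r \<in> fmeasurable lborel" for x :: "real ^ 'n" and r
    using emeasure_bounded_finite[OF bounded_ball] by (intro fmeasurableI) (simp_all add: top_unique less_top)
  have "disjnt (?B x) (?B y)" if "x \<in> X" "y \<in> X" "x \<noteq> y" for x y
  proof -
    have "False" if "z \<in> ?B x" "z \<in> ?B y" for z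
    proof -
      have "dist x y < \<delta>" using dist_triangle[of x y z] that by (simp add: dist_commute)
      then show False using sep[OF \<open>x \<in> X\<close> \<open>y \<in> X\<close> \<open>x \<noteq> y\<close>] by (simp add: dist_norm)
    qed
    then show ?thesis unfolding disjnt_iff by blast
  qed
  then have "measure lborel (\<Union>x\<in>X. ?B x) = (\<Sum>x\<in>X. measure lborel (?B x))"
    by (intro measure_UNION' X(1)) (auto simp: pairwise_def fm)
  also have "\<dots> = real (card X) * (V * (\<delta> / 2) ^ ?N)" using \<delta> by (simp add: vol)
  finally have "real (card X) * (V * (\<delta> / 2) ^ ?N) = measure lborel (\<Union>x\<in>X. ?B x)" ..
  also have "\<dots> \<le> measure lborel (ball 0 (R + \<delta> / 2) :: (real ^ 'n) set)"
  proof (rule measure_mono_fmeasurable)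
    show "(\<Union>x\<in>X. ?B x) \<subseteq> ball 0 (R + \<delta> / 2)"
    proof
      fix z assume "z \<in> (\<Union>x\<in>X. ?B x)"
      then obtain x where x: "x \<in> X" "dist x z < \<delta> / 2" by auto
      have "norm z \<le> norm x + dist x z" using norm_triangle_sub[of z x] by (simp add: dist_norm norm_minus_commute)
      then show "z \<in> ball 0 (R + \<delta> / 2)" using x X(2)[OF x(1)] by simp
    qed
    show "(\<Union>x\<in>X. ?B x) \<in> sets lborel" using X(1) by (intro sets.finite_UN) auto
    show "(ball 0 (R + \<delta> / 2) :: (real ^ 'n) set) \<in> fmeasurable lborel" by (rule fm)
  qed
  also have "\<dots> = V * (R + \<delta> / 2) ^ ?N" using R \<delta> by (intro vol) simp
  finally have "V * (real (card X) * (\<delta> / 2) ^ ?N) \<le> V * (R + \<delta> / 2) ^ ?N" by (simp add: algebra_simps)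
  then have "real (card X) * (\<delta> / 2) ^ ?N \<le> (R + \<delta> / 2) ^ ?N" using V by simp
  then have "2 ^ ?N * (real (card X) * (\<delta> / 2) ^ ?N) \<le> 2 ^ ?N * (R + \<delta> / 2) ^ ?N" by (intro mult_left_mono) auto
  moreover have "2 ^ ?N * (real (card X) * (\<delta> / 2) ^ ?N) = real (card X) * \<delta> ^ ?N" by (simp add: power_divide)
  moreover have "2 ^ ?N * (R + \<delta> / 2) ^ ?N = (2 * R + \<delta>) ^ ?N"
    by (simp add: algebra_simps flip: power_mult_distrib)
  ultimately show ?thesis by simp
qed

text \<open>If all late increments were below e / 2, the sequence would grow at rate at most e / 2,
  yet it exceeds e k for arbitrarily large k.\<close>

lemma not_sublinear_jumps:
  fixes a :: "nat => real"
  assumes a: "\<And>k. 0 \<le> a k" and n: "\<not> (\<lambda>k. a k / real k) \<longlonglongrightarrow> 0"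
  obtains e where "e > 0" "infinite {k. e \<le> a (Suc k) - a k}"
proof -
  obtain e where e: "e > 0" "\<exists>\<^sub>F k in sequentially. e \<le> a k / real k"
  proof -
    from n obtain e where e: "e > 0" "\<not> (\<forall>\<^sub>F k in sequentially. dist (a k / real k) 0 < e)" unfolding tendsto_iff by blast
    have "\<exists>\<^sub>F k in sequentially. e \<le> a k / real k"
      using e(2) unfolding frequently_def by (rule contrapos_nn) (auto elim!: eventually_mono simp: a abs_of_nonneg)
    then show thesis using that e(1) by blast
  qed
  show thesis
  proof (rule that[of "e / 2"])
    show "e / 2 > 0" using e by simp
    show "infinite {k. e / 2 \<le> a (Suc k) - a k}"
    proof
      assume "finite {k. e / 2 \<le> a (Suc k) - a k}"
      then obtain N where N: "\<And>k. k > N ==> a (Suc k) - a k < e / 2"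
        unfolding finite_nat_set_iff_bounded_le by (metis (mono_tags, lifting) mem_Collect_eq not_le)
      have up: "a (Suc N + j) \<le> a (Suc N) + real j * (e / 2)" for j
      proof (induction j)
        case (Suc j)
        have "real (Suc j) * (e / 2) = real j * (e / 2) + e / 2" by (simp add: algebra_simps)
        moreover have "a (Suc N + Suc j) - a (Suc N + j) < e / 2" using N[of "Suc N + j"] by simp
        ultimately show ?case using Suc by linarith
      qed simp
      \<comment> \<open>Beyond 2 a (Suc N) / e the initial value is less than e k / 2, and the two
        growth rates collide.\<close>
      define M where "M = nat \<lceil>2 * a (Suc N) / e\<rceil> + Suc N + 1"
      from e(2) obtain k where k: "k \<ge> M" "e \<le> a k / real k" unfolding frequently_sequentially by blast
      have kN: "k \<ge> Suc N" "k > 0" using k(1) by (auto simp: M_def)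
      have "2 * a (Suc N) / e < real k" using k(1) unfolding M_def by linarith
      then have "2 * a (Suc N) < e * real k" using e(1) by (simp add: field_simps)
      moreover have "e * real k \<le> a k" using k(2) kN by (simp add: field_simps)
      moreover have "a k \<le> a (Suc N) + real (k - Suc N) * (e / 2)" using up[of "k - Suc N"] kN by simp
      moreover have "real (k - Suc N) * (e / 2) \<le> real k * (e / 2)" using e(1) by (intro mult_right_mono) auto
      ultimately show False by (simp add: mult.commute)
    qed
  qed
qed

lemma sublinear_ge:
  assumes "(\<lambda>k. a k / real k) \<longlonglongrightarrow> 0" and "\<And>k. real k * c \<le> a k"
  shows "c \<le> 0"
proof (rule LIMSEQ_le_const[OF assms(1)])
  show "\<exists>N. \<forall>k\<ge>N. c \<le> a k / real k"
    using assms(2) by (intro exI[of _ 1]) (auto simp: pos_le_divide_eq mult.commute)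
qed

section \<open>Groups with a common unique fixed point at infinity\<close>

text \<open>The base point p is a start of a ray to the common fixed point and \<omega> its
  direction there; the orbit and all Busemann functions are taken from this p.\<close>

locale parabolic_action = hadamard A g \<kappa> + G: group \<Gamma>
  for A :: "('m::{t2_space,second_countable_topology}, 'n::finite) chart set" and g :: "('m, 'n) metric_coeffs"
    and \<kappa> :: real and \<Gamma> :: "('g, 'r) monoid_scheme" (structure) +
  fixes \<phi> :: "'g => 'm => 'm" and p :: 'm and \<omega> :: "real ^ 'n"
  assumes vis: "visibility_manifold A g"
    and action: "isometric_action A g \<Gamma> \<phi>" and free: "free_action \<Gamma> \<phi>" and pd: "properly_discontinuous_action \<Gamma> \<phi>"
    and \<omega>: "norm \<omega> = 1" and parabolic: "\<And>a. a \<in> carrier \<Gamma> ==> a \<noteq> \<one> ==> Fix A g (\<phi> a) = {cls p \<omega>}"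
begin

lemma act_mult: "a \<in> carrier \<Gamma> ==> b \<in> carrier \<Gamma> ==> \<phi> (a \<otimes> b) x = \<phi> a (\<phi> b x)"
  using action group_action.composition_rule[of \<Gamma> UNIV \<phi> x a b] by (simp add: isometric_action_def)

lemma act_one: "\<phi> \<one> x = x"
  using action fun_cong[OF group_action.id_eq_one[of \<Gamma> UNIV \<phi>], of x] by (simp add: isometric_action_def)

lemma act_inv: "a \<in> carrier \<Gamma> ==> \<phi> (inv a) (\<phi> a x) = x" "a \<in> carrier \<Gamma> ==> \<phi> a (\<phi> (inv a) x) = x"
  by (simp_all add: act_mult[symmetric] act_one)

lemma act_isom: "a \<in> carrier \<Gamma> ==> local_isom (\<phi> a)"
  using action by (simp add: isometric_action_def riemannian_isometry_def local_isom_def)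

lemma act_dist: "a \<in> carrier \<Gamma> ==> d (\<phi> a x) (\<phi> a y) = d x y"
  using rdist_isom[OF act_isom, of a x y] rdist_isom[OF act_isom, of "inv a" "\<phi> a x" "\<phi> a y"] by (simp add: act_inv)

definition disp :: "'g => real" where "disp a = d p (\<phi> a p)"

lemma disp_nonneg: "disp a \<ge> 0" by (simp add: disp_def rdist_nonneg)

lemma disp_inv: "a \<in> carrier \<Gamma> ==> disp (inv a) = disp a"
  using act_dist[of a p "\<phi> (inv a) p"] by (simp add: disp_def act_inv rdist_sym)

text \<open>For the maximizer \<psi> k = s b at a jump, d(s p, \<psi> p) = disp b is smaller than
  d(p, \<psi> p) by at least e. One s serves infinitely many jumps by pigeonhole, and compactness of
  the sphere gives a limit direction, whose Busemann function inherits the inequality. The sets W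
  are left general to cover both powers of one element and word balls.\<close>

lemma record_sequence:
  assumes W: "\<And>k. finite (W k)" "\<And>k. W k \<noteq> {}" "\<And>k. W k \<subseteq> carrier \<Gamma>" "\<And>k. W k \<subseteq> W (Suc k)"
    and S: "finite S" "S \<subseteq> carrier \<Gamma>"
    and step: "\<And>k a. a \<in> W (Suc k) ==> a \<in> W k \<or> (\<exists>s\<in>S. \<exists>b\<in>W k. a = s \<otimes> b)"
    and n: "\<not> (\<lambda>k. Max (disp ` W k) / real k) \<longlonglongrightarrow> 0"
  obtains s v e \<psi> where "s \<in> S" "norm v = 1" "e > 0" "\<And>i. \<psi> i \<in> (\<Union>k. W k)"
    "filterlim (\<lambda>i::nat. d p (\<phi> (\<psi> i) p)) at_top sequentially"
    "(\<lambda>i. (1 / d p (\<phi> (\<psi> i) p)) *\<^sub>R L p (\<phi> (\<psi> i) p)) \<longlonglongrightarrow> v"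
    "bus p v (\<phi> s p) \<le> - e"
proof -
  define M where "M k = Max (disp ` W k)" for k
  have M_ge: "disp a \<le> M k" if "a \<in> W k" for a k unfolding M_def using W(1) that by (intro Max_ge) auto
  have M_in: "\<exists>a\<in>W k. disp a = M k" for k
  proof -
    have "M k \<in> disp ` W k" unfolding M_def using W(1,2) by (intro Max_in) auto
    then show ?thesis by auto
  qed
  have M0: "0 \<le> M k" for k using M_in[of k] disp_nonneg by metis
  have M_mono: "M j \<le> M k" if "j \<le> k" for j k
  proof (rule lift_Suc_mono_le[OF _ that])
    fix i
    obtain a where "a \<in> W i" "disp a = M i" using M_in by blast
    then show "M i \<le> M (Suc i)" using M_ge[of a "Suc i"] W(4) by auto
  qed
  have n': "\<not> (\<lambda>k. M k / real k) \<longlonglongrightarrow> 0" using n by (simp add: M_def)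
  obtain e where e: "e > 0" "infinite {k. e \<le> M (Suc k) - M k}"
    by (rule not_sublinear_jumps[OF M0 n'])
  have "\<exists>\<psi>. \<forall>k. \<psi> k \<in> W (Suc k) \<and> disp (\<psi> k) = M (Suc k)" using M_in by (intro choice) blast
  then obtain \<psi> where \<psi>: "\<And>k. \<psi> k \<in> W (Suc k)" "\<And>k. disp (\<psi> k) = M (Suc k)" by blast
  have ex: "\<exists>s\<in>S. d (\<phi> s p) (\<phi> (\<psi> k) p) - d p (\<phi> (\<psi> k) p) \<le> - e" if k: "e \<le> M (Suc k) - M k" for k
  proof -
    have "\<psi> k \<notin> W k" using M_ge[of "\<psi> k" k] \<psi>(2)[of k] k e(1) by auto
    then obtain s b where s: "s \<in> S" "b \<in> W k" "\<psi> k = s \<otimes> b" using step[OF \<psi>(1)] by blast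
    have "d (\<phi> s p) (\<phi> (\<psi> k) p) = disp b"
      using s S(2) W(3)[of k] by (simp add: disp_def act_mult act_dist subset_iff)
    then show ?thesis using s(1) M_ge[OF s(2)] k \<psi>(2)[of k] by (auto simp: disp_def intro!: bexI[of _ s])
  qed
  obtain s where s: "s \<in> S" "infinite {k \<in> {k. e \<le> M (Suc k) - M k}. d (\<phi> s p) (\<phi> (\<psi> k) p) - d p (\<phi> (\<psi> k) p) \<le> - e}"
    using pigeonhole_infinite_rel[OF e(2) S(1), of "\<lambda>k s. d (\<phi> s p) (\<phi> (\<psi> k) p) - d p (\<phi> (\<psi> k) p) \<le> - e"] ex by blast
  define J where "J = {k \<in> {k. e \<le> M (Suc k) - M k}. d (\<phi> s p) (\<phi> (\<psi> k) p) - d p (\<phi> (\<psi> k) p) \<le> - e}"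
  have J: "infinite J" using s(2) by (simp add: J_def)
  define K where "K i = enumerate J i" for i
  have KJ: "K i \<in> J" and Kmono: "K i < K (Suc i)" for i
    unfolding K_def using enumerate_in_set[OF J] enumerate_step[OF J] by auto
  have MK: "e \<le> M (Suc (K i)) - M (K i)" and sK: "d (\<phi> s p) (\<phi> (\<psi> (K i)) p) - d p (\<phi> (\<psi> (K i)) p) \<le> - e" for i
    using KJ[of i] by (auto simp: J_def)
  define T where "T i = d p (\<phi> (\<psi> (K i)) p)" for i
  have TM: "T i = M (Suc (K i))" for i using \<psi>(2)[of "K i"] by (simp add: T_def disp_def)
  \<comment> \<open>The maxima never decrease and gain at least e at every selected jump, so the
    displacements tend to infinity.\<close>
  have T_ge: "real (Suc i) * e \<le> T i" for i
  proof (induction i)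
    case 0
    then show ?case using MK[of 0] M0[of "K 0"] by (simp add: TM)
  next
    case (Suc i)
    have "M (Suc (K i)) \<le> M (K (Suc i))" using Kmono[of i] by (intro M_mono) simp
    then show ?case using Suc MK[of "Suc i"] by (simp add: TM algebra_simps)
  qed
  have T_pos: "T i > 0" for i using T_ge[of i] e(1) by (meson less_le_trans mult_pos_pos of_nat_0_less_iff zero_less_Suc)
  have T_lim: "filterlim T at_top sequentially"
  proof (rule filterlim_at_top_mono)
    show "filterlim (\<lambda>i. real (Suc i) * e) at_top sequentially" using e(1) by real_asymp
    show "\<forall>\<^sub>F i in sequentially. real (Suc i) * e \<le> T i" using T_ge by (intro always_eventually allI)
  qed
  define u where "u i = (1 / T i) *\<^sub>R L p (\<phi> (\<psi> (K i)) p)" for i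
  have "u i \<in> sphere 0 1" for i
    using T_pos[of i] rdist_F[of p "L p (\<phi> (\<psi> (K i)) p)"] by (simp add: u_def T_def)
  then obtain v r where v: "v \<in> sphere 0 1" "strict_mono r" "(u \<circ> r) \<longlonglongrightarrow> v"
    using compact_sphere[of 0 1] unfolding compact_def by metis
  have r: "filterlim r sequentially sequentially" by (rule filterlim_subseq[OF v(2)])
  show thesis
  proof (rule that[of s v e "\<lambda>i. \<psi> (K (r i))"])
    show "s \<in> S" "e > 0" "norm v = 1" using s(1) e(1) v(1) by auto
    show "\<psi> (K (r i)) \<in> (\<Union>k. W k)" for i using \<psi>(1) by blast
    show lim: "filterlim (\<lambda>i. d p (\<phi> (\<psi> (K (r i))) p)) at_top sequentially"
      using filterlim_compose[OF T_lim r] by (simp add: T_def)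
    show dir: "(\<lambda>i. (1 / d p (\<phi> (\<psi> (K (r i))) p)) *\<^sub>R L p (\<phi> (\<psi> (K (r i))) p)) \<longlonglongrightarrow> v"
      using v(3) by (simp add: u_def T_def o_def)
    have "(\<lambda>i. d (\<phi> s p) (\<phi> (\<psi> (K (r i))) p) - d p (\<phi> (\<psi> (K (r i))) p)) \<longlonglongrightarrow> bus p v (\<phi> s p)"
      by (rule bus_sequence[OF _ lim dir]) (use v(1) in simp)
    then show "bus p v (\<phi> s p) \<le> - e" by (rule LIMSEQ_le_const2) (use sK in blast)
  qed
qed

text \<open>Points of the limit ray are approximated by points of the geodesics from p to y i, which
  lets convexity estimates along these geodesics pass to the ray.\<close>

lemma ray_approx:
  fixes y :: "nat => 'm"
  assumes T: "filterlim (\<lambda>i. d p (y i)) at_top sequentially"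
    and dir: "(\<lambda>i. (1 / d p (y i)) *\<^sub>R L p (y i)) \<longlonglongrightarrow> v" and t: "t \<ge> 0" and e: "e > 0"
  obtains i l where "0 \<le> l" "l \<le> 1" "d (F p (l *\<^sub>R L p (y i))) (F p (t *\<^sub>R v)) < e"
proof -
  have "((\<lambda>i. t *\<^sub>R ((1 / d p (y i)) *\<^sub>R L p (y i))) \<longlongrightarrow> t *\<^sub>R v) sequentially" by (intro tendsto_intros dir)
  then have "\<forall>\<^sub>F i in sequentially. dist (d (F p (t *\<^sub>R ((1 / d p (y i)) *\<^sub>R L p (y i)))) (F p (t *\<^sub>R v))) 0 < e"
    by (intro tendstoD[OF F_tendsto] e)
  moreover have "\<forall>\<^sub>F i in sequentially. t + 1 \<le> d p (y i)" using T by (simp add: filterlim_at_top)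
  ultimately have "\<forall>\<^sub>F i in sequentially. t + 1 \<le> d p (y i) \<and> d (F p ((t / d p (y i)) *\<^sub>R L p (y i))) (F p (t *\<^sub>R v)) < e"
    by eventually_elim (simp add: rdist_nonneg dist_real_def)
  then obtain i where i: "t + 1 \<le> d p (y i)" "d (F p ((t / d p (y i)) *\<^sub>R L p (y i))) (F p (t *\<^sub>R v)) < e"
    using eventually_happens' by (metis (no_types, lifting) sequentially_bot)
  show thesis by (rule that[OF _ _ i(2)]) (use i(1) t in \<open>auto simp: divide_le_eq_1\<close>)
qed

abbreviation cyc :: "'g => nat => 'g set"
  where "cyc s k \<equiv> (\<lambda>j. s [^] j) ` {..k}"

text \<open>The auxiliary fact \<open>key\<close> is stated for an arbitrary element because it is
  applied to s and to its inverse; the two conclusions exclude each other.\<close>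

lemma cyclic_displacement:
  assumes s: "s \<in> carrier \<Gamma>"
  shows "(\<lambda>k. Max (disp ` cyc s k) / real k) \<longlonglongrightarrow> 0"
proof (rule ccontr)
  assume n: "\<not> (\<lambda>k. Max (disp ` cyc s k) / real k) \<longlonglongrightarrow> 0"
  have key: "\<exists>e>0. bus p \<omega> (\<phi> s p) \<le> - e"
    if s: "s \<in> carrier \<Gamma>" and n: "\<not> (\<lambda>k. Max (disp ` cyc s k) / real k) \<longlonglongrightarrow> 0" for s
  proof -
    have step: "a \<in> cyc s k \<or> (\<exists>s'\<in>{s}. \<exists>b\<in>cyc s k. a = s' \<otimes> b)"
      if a: "a \<in> cyc s (Suc k)" for a k
    proof -
      obtain j where j: "j \<le> Suc k" "a = s [^] j" using a by blast
      show ?thesis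
      proof (cases "j = Suc k")
        case True
        then have "a = s \<otimes> s [^] k" using j G.nat_pow_Suc2[OF s] by simp
        then show ?thesis by auto
      qed (use j in auto)
    qed
    have W: "finite (cyc s k)" "cyc s k \<noteq> {}" "cyc s k \<subseteq> carrier \<Gamma>"
      "cyc s k \<subseteq> cyc s (Suc k)" for k :: nat
      using s by (auto simp: atMost_Suc)
    obtain s' v e \<psi> where h: "s' \<in> {s}" "norm v = 1" "e > 0" "\<And>i. \<psi> i \<in> (\<Union>k. cyc s k)"
      "filterlim (\<lambda>i::nat. d p (\<phi> (\<psi> i) p)) at_top sequentially"
      "(\<lambda>i. (1 / d p (\<phi> (\<psi> i) p)) *\<^sub>R L p (\<phi> (\<psi> i) p)) \<longlonglongrightarrow> v" "bus p v (\<phi> s' p) \<le> - e"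
      by (rule record_sequence[of "cyc s" "{s}", OF W _ _ step n]) (use s in simp, use s in simp, assumption, rule that)
    have s1: "s \<noteq> \<one>"
    proof
      assume "s = \<one>"
      then show False using h(1,3,7) bus_base[OF h(2)] by (simp add: act_one)
    qed
    have "d (F p (t *\<^sub>R v)) (\<phi> s (F p (t *\<^sub>R v))) \<le> disp s" if t: "t \<ge> 0" for t
    proof (rule field_le_epsilon)
      fix \<epsilon> :: real assume "\<epsilon> > 0"
      then have e2: "\<epsilon> / 2 > 0" by simp
      obtain i l where l: "0 \<le> l" "l \<le> 1" and c: "d (F p (l *\<^sub>R L p (\<phi> (\<psi> i) p))) (F p (t *\<^sub>R v)) < \<epsilon> / 2"
        using ray_approx[OF h(5,6) t e2] by metis
      let ?y = "\<phi> (\<psi> i) p" and ?c = "F p (l *\<^sub>R L p (\<phi> (\<psi> i) p))"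
      obtain j where j: "\<psi> i = s [^] (j::nat)" using h(4)[of i] by auto
      \<comment> \<open>Powers of s commute with s, so s moves every point of the cyclic orbit by
        exactly \<open>disp s\<close>.\<close>
      have "d ?y (\<phi> s ?y) = d (\<phi> (\<psi> i) p) (\<phi> (\<psi> i) (\<phi> s p))"
        using s by (simp add: j act_mult[symmetric] G.nat_pow_Suc2[symmetric])
      then have dy: "d ?y (\<phi> s ?y) = disp s" using s by (simp add: j act_dist disp_def)
      have "d ?c (\<phi> s ?c) \<le> (1 - l) * d p (\<phi> s p) + l * d ?y (\<phi> s ?y)"
        unfolding isom_F[OF act_isom[OF s]] by (rule quad[OF l])
      also have "\<dots> = disp s" unfolding dy by (simp add: disp_def algebra_simps)
      finally have "d ?c (\<phi> s ?c) \<le> disp s" .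
      then show "d (F p (t *\<^sub>R v)) (\<phi> s (F p (t *\<^sub>R v))) \<le> disp s + \<epsilon>"
        using c act_dist[OF s, of ?c "F p (t *\<^sub>R v)"] rdist_sym[of ?c "F p (t *\<^sub>R v)"]
          rdist_triangle[of "F p (t *\<^sub>R v)" "\<phi> s (F p (t *\<^sub>R v))" ?c] rdist_triangle[of ?c "\<phi> s (F p (t *\<^sub>R v))" "\<phi> s ?c"]
        by linarith
    qed
    then have "cls p v \<in> Fix A g (\<phi> s)" using cls_fix_iff[OF h(2) act_isom[OF s]] by blast
    then have "v = \<omega>" using parabolic[OF s s1] cls_inj[OF h(2) \<omega>] by simp
    then show ?thesis using h(1,3,7) by auto
  qed
  \<comment> \<open>A power of the inverse has the displacement of the same power of s, so the
    assumption passes to \<open>inv s\<close>.\<close>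
  have inv: "disp ` cyc (inv s) k = disp ` cyc s k" for k :: nat
    using s by (simp add: image_image G.nat_pow_inv disp_inv)
  obtain e1 where e1: "e1 > 0" "bus p \<omega> (\<phi> s p) \<le> - e1" using key[OF s n] by blast
  obtain e2 where e2: "e2 > 0" "bus p \<omega> (\<phi> (inv s) p) \<le> - e2" using key[of "inv s"] s n by (auto simp: inv)
  have "s \<noteq> \<one>" using e1 bus_base[OF \<omega>] by (auto simp: act_one)
  then have "cls p \<omega> \<in> Fix A g (\<phi> s)" using parabolic s by simp
  \<comment> \<open>At the point s^-1 p the shift formula reads 0 = b(s^-1 p) + b(s p), a sum of two
    negative numbers.\<close>
  from bus_shift[OF \<omega> act_isom[OF s] act_dist[OF s] this, of "\<phi> (inv s) p"]
  show False using e1 e2 s by (simp add: act_inv bus_base[OF \<omega>])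
qed

text \<open>By the shift formula the value at s^j p is j times the value at s p. A Busemann function
  is 1-Lipschitz and vanishes at p, so |j b(s p)| is at most the displacement of s^j, which is
  sublinear in j.\<close>

lemma bus_orbit:
  assumes s: "s \<in> carrier \<Gamma>"
  shows "bus p \<omega> (\<phi> s p) = 0"
proof (cases "s = \<one>")
  case True
  then show ?thesis by (simp add: act_one bus_base[OF \<omega>])
next
  case False
  then have "cls p \<omega> \<in> Fix A g (\<phi> s)" using parabolic s by simp
  note shift = bus_shift[OF \<omega> act_isom[OF s] act_dist[OF s] this]
  have pow: "bus p \<omega> (\<phi> (s [^] j) p) = real j * bus p \<omega> (\<phi> s p)" for j :: nat
  proof (induction j)
    case (Suc j)
    have "\<phi> (s [^] Suc j) p = \<phi> s (\<phi> (s [^] j) p)" using s unfolding G.nat_pow_Suc2[OF s] by (simp add: act_mult)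
    then show ?case using Suc shift[of "\<phi> (s [^] j) p"] by (simp add: algebra_simps)
  qed (simp add: act_one bus_base[OF \<omega>])
  have "real j * bus p \<omega> (\<phi> s p) \<le> disp (s [^] j)" "real j * (- bus p \<omega> (\<phi> s p)) \<le> disp (s [^] j)" for j :: nat
    using pow[of j] bus_lipschitz[OF \<omega>, of p "\<phi> (s [^] j) p" p] bus_lipschitz[OF \<omega>, of p p "\<phi> (s [^] j) p"]
      bus_base[OF \<omega>, of p] by (simp_all add: disp_def rdist_sym)
  moreover have "disp (s [^] k) \<le> Max (disp ` cyc s k)" for k :: nat by (intro Max_ge) auto
  ultimately have "real k * bus p \<omega> (\<phi> s p) \<le> Max (disp ` cyc s k)"
    "real k * (- bus p \<omega> (\<phi> s p)) \<le> Max (disp ` cyc s k)" for k :: nat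
    by (meson order_trans)+
  from sublinear_ge[OF cyclic_displacement[OF s] this(1)] sublinear_ge[OF cyclic_displacement[OF s] this(2)]
  show ?thesis by simp
qed

theorem displacement_sublinear:
  assumes W: "\<And>k. finite (W k)" "\<And>k. W k \<noteq> {}" "\<And>k. W k \<subseteq> carrier \<Gamma>" "\<And>k. W k \<subseteq> W (Suc k)"
    and S: "finite S" "S \<subseteq> carrier \<Gamma>"
    and step: "\<And>k a. a \<in> W (Suc k) ==> a \<in> W k \<or> (\<exists>s\<in>S. \<exists>b\<in>W k. a = s \<otimes> b)"
  shows "(\<lambda>k. Max (disp ` W k) / real k) \<longlonglongrightarrow> 0"
proof (rule ccontr)
  assume n: "\<not> (\<lambda>k. Max (disp ` W k) / real k) \<longlonglongrightarrow> 0"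
  obtain s v e \<psi> where h: "s \<in> S" "norm v = 1" "e > 0" "\<And>i. \<psi> i \<in> (\<Union>k. W k)"
    "filterlim (\<lambda>i::nat. d p (\<phi> (\<psi> i) p)) at_top sequentially"
    "(\<lambda>i. (1 / d p (\<phi> (\<psi> i) p)) *\<^sub>R L p (\<phi> (\<psi> i) p)) \<longlonglongrightarrow> v" "bus p v (\<phi> s p) \<le> - e"
    by (rule record_sequence[OF W S step n]) (assumption, rule that)
  \<comment> \<open>The Busemann function of v is negative at s p, that of \<omega> vanishes
    there.\<close>
  have "v \<noteq> \<omega>" using h(1,3,7) bus_orbit[of s] S(2) by auto
  moreover have "bus p \<omega> (F p (t *\<^sub>R v)) \<le> 0" if t: "t \<ge> 0" for t
  proof (rule field_le_epsilon)
    fix \<epsilon> :: real assume e: "\<epsilon> > 0"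
    obtain i l where l: "0 \<le> l" "l \<le> 1" and c: "d (F p (l *\<^sub>R L p (\<phi> (\<psi> i) p))) (F p (t *\<^sub>R v)) < \<epsilon>"
      using ray_approx[OF h(5,6) t e] by metis
    have "\<psi> i \<in> carrier \<Gamma>" using h(4) W(3) by blast
    \<comment> \<open>The function is convex along the geodesic from p to an orbit point and
      vanishes at both ends.\<close>
    then have "bus p \<omega> (F p (l *\<^sub>R L p (\<phi> (\<psi> i) p))) \<le> 0"
      using bus_convex[OF \<omega> l, of p p "L p (\<phi> (\<psi> i) p)"] by (simp add: bus_base[OF \<omega>] bus_orbit)
    then show "bus p \<omega> (F p (t *\<^sub>R v)) \<le> 0 + \<epsilon>"
      using bus_lipschitz[OF \<omega>, of p "F p (t *\<^sub>R v)" "F p (l *\<^sub>R L p (\<phi> (\<psi> i) p))"] c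
      by (simp add: rdist_sym)
  qed
  ultimately show False using bus_unbounded[OF vis h(2) \<omega>] by blast
qed

text \<open>Proper discontinuity leaves finitely many elements moving p by less than r, and freeness
  makes their displacements positive. Any pair reduces to this by translating with the inverse of
  a.\<close>

lemma orbit_separated:
  obtains \<rho> where "\<rho> > 0" "\<And>a b. a \<in> carrier \<Gamma> ==> b \<in> carrier \<Gamma> ==> a \<noteq> b ==> \<rho> \<le> d (\<phi> a p) (\<phi> b p)"
proof -
  obtain r K where K: "r > 0" "compact K" "\<And>z. d p z < r ==> z \<in> K" using small_ball[OF open_UNIV UNIV_I] by metis
  define B where "B = {a \<in> carrier \<Gamma>. \<phi> a ` K \<inter> K \<noteq> {}} - {\<one>}"
  have B: "finite B" using pd K(2) by (simp add: properly_discontinuous_action_def B_def)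
  have pos: "disp a > 0" if "a \<in> carrier \<Gamma>" "a \<noteq> \<one>" for a
  proof -
    have "stabilizer \<Gamma> \<phi> p = {\<one>}" using free by (simp add: free_action_def)
    then have "\<phi> a p \<noteq> p" using that by (auto simp: stabilizer_def)
    then have "disp a \<noteq> 0" unfolding disp_def using rdist_eq_0[of p "\<phi> a p"] by simp
    then show ?thesis using disp_nonneg[of a] by simp
  qed
  define \<rho> where "\<rho> = Min (insert r (disp ` B))"
  have \<rho>: "\<rho> > 0" unfolding \<rho>_def using B K(1) pos by (subst Min_gr_iff) (auto simp: B_def)
  have low: "\<rho> \<le> disp a" if a: "a \<in> carrier \<Gamma>" "a \<noteq> \<one>" for a
  proof (cases "disp a < r")
    case True
    have "p \<in> K" "\<phi> a p \<in> K" using K(1) K(3)[of p] K(3)[of "\<phi> a p"] True by (simp_all add: disp_def)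
    then have "a \<in> B" using a by (auto simp: B_def)
    then show ?thesis unfolding \<rho>_def using B by (intro Min_le) auto
  next
    case False
    have "\<rho> \<le> r" unfolding \<rho>_def using B by (intro Min_le) auto
    then show ?thesis using False by simp
  qed
  have "\<rho> \<le> d (\<phi> a p) (\<phi> b p)" if ab: "a \<in> carrier \<Gamma>" "b \<in> carrier \<Gamma>" "a \<noteq> b" for a b
  proof -
    have "inv a \<otimes> b \<noteq> \<one>" using ab by (metis G.inv_equality G.inv_inv G.inv_closed)
    then have "\<rho> \<le> disp (inv a \<otimes> b)" using ab by (intro low) auto
    also have "\<dots> = d (\<phi> a p) (\<phi> b p)"
      using act_dist[of a p "\<phi> (inv a) (\<phi> b p)"] ab by (simp add: disp_def act_mult act_inv)
    finally show ?thesis .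
  qed
  then show thesis using that \<rho> by blast
qed

text \<open>Logarithms of orbit points in the ball of radius R are separated by \<rho> exp (- \<mu>
  R), as F p has Lipschitz constant exp (\<mu> R) there. The logarithm of the packing bound is then
  at most affine in R.\<close>

lemma orbit_count:
  obtains c\<^sub>1 c\<^sub>2 where "\<And>X. finite X ==> X \<noteq> {} ==> X \<subseteq> carrier \<Gamma> ==> ln (real (card X)) \<le> c\<^sub>1 + c\<^sub>2 * Max (disp ` X)"
proof -
  obtain \<rho> where \<rho>: "\<rho> > 0" "\<And>a b. a \<in> carrier \<Gamma> ==> b \<in> carrier \<Gamma> ==> a \<noteq> b ==> \<rho> \<le> d (\<phi> a p) (\<phi> b p)"
    using orbit_separated by metis
  let ?N = "CARD('n)"
  define \<mu> where "\<mu> = (\<kappa> + 1) / 2"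
  have \<mu>: "\<mu> > 0" using \<kappa> by (simp add: \<mu>_def)
  have bound: "ln (real (card X)) \<le> real ?N * (2 * (M + 1) + \<rho> - ln \<rho> + \<mu> * (M + 1))"
    if X: "finite X" "X \<noteq> {}" "X \<subseteq> carrier \<Gamma>" and M: "M = Max (disp ` X)" for X M
  proof -
    have leM: "disp a \<le> M" if "a \<in> X" for a unfolding M using X(1) that by (intro Max_ge) auto
    have M0: "M \<ge> 0" using X(2) leM disp_nonneg by (metis all_not_in_conv order_trans)
    \<comment> \<open>The summand 1 secures R \<ge> 1, as \<open>F_lipschitz\<close>
      demands.\<close>
    define R where "R = M + 1"
    have R: "1 \<le> R" "0 \<le> R" using M0 by (auto simp: R_def)
    define \<delta> where "\<delta> = \<rho> * exp (- \<mu> * R)"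
    have \<delta>: "\<delta> > 0" "\<delta> \<le> \<rho>"
      using \<rho>(1) \<mu> R by (simp_all add: \<delta>_def mult_le_cancel_left1 zero_le_mult_iff)
    let ?f = "\<lambda>a. L p (\<phi> a p)"
    have nf: "norm (?f a) \<le> R" if "a \<in> X" for a
      using rdist_F[of p "?f a"] leM[OF that] by (simp add: disp_def R_def)
    have sep: "\<delta> \<le> norm (?f a - ?f b)" if ab: "a \<in> X" "b \<in> X" "a \<noteq> b" for a b
    proof -
      have "\<rho> \<le> d (\<phi> a p) (\<phi> b p)" using \<rho>(2) ab X(3) by blast
      also have "\<dots> \<le> exp ((\<kappa> + 1) * R / 2) * norm (?f a - ?f b)"
        using F_lipschitz[OF R(1) nf[OF ab(1)] nf[OF ab(2)], of p] by simp
      finally have "\<rho> \<le> exp (\<mu> * R) * norm (?f a - ?f b)" by (simp add: \<mu>_def)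
      then show ?thesis by (simp add: \<delta>_def exp_minus field_simps)
    qed
    have inj: "inj_on ?f X"
    proof (rule inj_onI)
      fix a b assume "a \<in> X" "b \<in> X" "?f a = ?f b"
      then show "a = b" using sep[of a b] \<delta>(1) by auto
    qed
    have "real (card (?f ` X)) * \<delta> ^ ?N \<le> (2 * R + \<delta>) ^ ?N"
      by (rule separated_card[OF _ _ \<delta>(1) _ R(2)]) (use X(1) nf sep in auto)
    then have cX: "real (card X) * \<delta> ^ ?N \<le> (2 * R + \<delta>) ^ ?N" by (simp add: card_image[OF inj])
    have c1: "real (card X) > 0" using X by (simp add: card_gt_0_iff)
    have "ln (real (card X)) + real ?N * ln \<delta> = ln (real (card X) * \<delta> ^ ?N)"
      using c1 \<delta>(1) by (simp add: ln_mult ln_realpow)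
    also have "\<dots> \<le> ln ((2 * R + \<delta>) ^ ?N)" using cX c1 \<delta>(1) R by (intro ln_mono) auto
    also have "\<dots> = real ?N * ln (2 * R + \<delta>)" using \<delta>(1) R by (simp add: ln_realpow)
    also have "\<dots> \<le> real ?N * (2 * R + \<rho>)"
    proof (rule mult_left_mono)
      have "ln (2 * R + \<delta>) \<le> 2 * R + \<delta>" using ln_le_minus_one[of "2 * R + \<delta>"] \<delta>(1) R by simp
      then show "ln (2 * R + \<delta>) \<le> 2 * R + \<rho>" using \<delta>(2) by simp
    qed simp
    finally have "ln (real (card X)) \<le> real ?N * (2 * R + \<rho> - ln \<delta>)" by (simp add: algebra_simps)
    moreover have "ln \<delta> = ln \<rho> - \<mu> * R" using \<rho>(1) by (simp add: \<delta>_def ln_mult)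
    ultimately show ?thesis by (simp add: R_def algebra_simps)
  qed
  show thesis
  proof (rule that)
    fix X :: "'g set" assume X: "finite X" "X \<noteq> {}" "X \<subseteq> carrier \<Gamma>"
    show "ln (real (card X)) \<le> real ?N * (2 + \<rho> - ln \<rho> + \<mu>) + real ?N * (2 + \<mu>) * Max (disp ` X)"
      using bound[OF X refl] by (simp add: algebra_simps)
  qed
qed

section \<open>Words and the growth function\<close>

text \<open>Explicit words of length at most k, from which the first letter can be split off to pass
  from k + 1 to k. These sets contain the word balls, so their size bounds the growth from
  above.\<close>

definition words :: "'g set => nat => 'g set"
  where "words S k = {foldr (\<otimes>) ws \<one> | ws. set ws \<subseteq> S \<and> length ws \<le> k}"

lemma word_closed: "S \<subseteq> carrier \<Gamma> ==> set ws \<subseteq> S ==> foldr (\<otimes>) ws \<one> \<in> carrier \<Gamma>"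
  by (induction ws) auto

lemma word_append:
  assumes "S \<subseteq> carrier \<Gamma>" "set us \<subseteq> S" "set ws \<subseteq> S"
  shows "foldr (\<otimes>) (us @ ws) \<one> = foldr (\<otimes>) us \<one> \<otimes> foldr (\<otimes>) ws \<one>"
  using assms(2)
proof (induction us)
  case Nil
  then show ?case using word_closed[OF assms(1,3)] by simp
next
  case (Cons u us)
  then have "u \<in> carrier \<Gamma>" "set us \<subseteq> S" using assms(1) by auto
  then show ?case using Cons word_closed[OF assms(1) \<open>set us \<subseteq> S\<close>] word_closed[OF assms(1,3)]
    by (simp add: G.m_assoc)
qed

text \<open>Symmetry of S makes the inverse rule of \<open>generate\<close> a one-letter word.
  Existence of a word guarantees that the \<open>LEAST\<close> in \<open>word_length\<close> is
  attained.\<close>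

lemma word_exists:
  assumes S: "finite_symmetric_generating_set \<Gamma> S" and a: "a \<in> carrier \<Gamma>"
  obtains ws where "set ws \<subseteq> S" "foldr (\<otimes>) ws \<one> = a"
proof -
  have S': "S \<subseteq> carrier \<Gamma>" "\<And>s. s \<in> S ==> inv s \<in> S" "a \<in> generate \<Gamma> S"
    using S a by (auto simp: finite_symmetric_generating_set_def)
  from S'(3) have "\<exists>ws. set ws \<subseteq> S \<and> foldr (\<otimes>) ws \<one> = a"
  proof induction
    case one
    show ?case by (intro exI[of _ "[]"]) simp
  next
    case (incl h)
    then show ?case using S'(1) by (intro exI[of _ "[h]"]) auto
  next
    case (inv h)
    then show ?case using S'(1,2) by (intro exI[of _ "[inv h]"]) auto
  next
    case (eng h1 h2)
    then obtain us ws where "set us \<subseteq> S" "foldr (\<otimes>) us \<one> = h1" "set ws \<subseteq> S" "foldr (\<otimes>) ws \<one> = h2" by blast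
    then show ?case using word_append[OF S'(1), of us ws] by (intro exI[of _ "us @ ws"]) auto
  qed
  then show thesis using that by blast
qed

lemma word_ball_subset:
  assumes S: "finite_symmetric_generating_set \<Gamma> S"
  shows "word_ball \<Gamma> S k \<subseteq> words S k"
proof
  fix a assume "a \<in> word_ball \<Gamma> S k"
  then have a: "a \<in> carrier \<Gamma>" "word_length \<Gamma> S a \<le> k" by (auto simp: word_ball_def)
  obtain ws where "set ws \<subseteq> S" "foldr (\<otimes>) ws \<one> = a" using word_exists[OF S a(1)] .
  then have "\<exists>k. \<exists>ws. set ws \<subseteq> S \<and> length ws = k \<and> foldr (\<otimes>) ws \<one> = a" by blast
  from LeastI_ex[OF this] obtain ws where "set ws \<subseteq> S" "length ws = word_length \<Gamma> S a" "foldr (\<otimes>) ws \<one> = a"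
    unfolding word_length_def by blast
  then show "a \<in> words S k" using a(2) unfolding words_def by auto
qed

theorem entropy_zero:
  assumes S: "finite_symmetric_generating_set \<Gamma> S"
  shows "has_algebraic_entropy \<Gamma> S 0"
proof -
  have S': "finite S" "S \<subseteq> carrier \<Gamma>" using S by (auto simp: finite_symmetric_generating_set_def)
  have fin: "finite (words S k)" for k
  proof -
    have "words S k = (\<lambda>ws. foldr (\<otimes>) ws \<one>) ` {ws. set ws \<subseteq> S \<and> length ws \<le> k}" by (auto simp: words_def)
    then show ?thesis using finite_lists_length_le[OF S'(1)] by simp
  qed
  have one: "\<one> \<in> words S k" for k unfolding words_def by (auto intro!: exI[of _ "[]"])
  have sub: "words S k \<subseteq> carrier \<Gamma>" for k using word_closed[OF S'(2)] by (auto simp: words_def)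
  have mono: "words S k \<subseteq> words S (Suc k)" for k by (auto simp: words_def)
  have step: "a \<in> words S k \<or> (\<exists>s\<in>S. \<exists>b\<in>words S k. a = s \<otimes> b)" if a: "a \<in> words S (Suc k)" for a k
  proof -
    obtain ws where ws: "set ws \<subseteq> S" "length ws \<le> Suc k" "a = foldr (\<otimes>) ws \<one>" using a unfolding words_def by blast
    show ?thesis
    proof (cases ws)
      case Nil
      then show ?thesis using ws one by simp
    next
      case (Cons s us)
      then have "foldr (\<otimes>) us \<one> \<in> words S k" "s \<in> S" "a = s \<otimes> foldr (\<otimes>) us \<one>" using ws by (auto simp: words_def)
      then show ?thesis by blast
    qed
  qed
  have lim: "(\<lambda>k. Max (disp ` words S k) / real k) \<longlonglongrightarrow> 0"
    by (rule displacement_sublinear[of "words S", OF fin _ sub mono S' step]) (use one in auto)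
  obtain c1 c2 where c: "\<And>X. finite X ==> X \<noteq> {} ==> X \<subseteq> carrier \<Gamma> ==> ln (real (card X)) \<le> c1 + c2 * Max (disp ` X)"
    using orbit_count by metis
  \<comment> \<open>A ball containing the unit has a nonnegative logarithm, the lower half of the
    sandwich.\<close>
  have one_ball: "\<one> \<in> word_ball \<Gamma> S k" for k
  proof -
    have "word_length \<Gamma> S \<one> = 0" unfolding word_length_def by (rule Least_eq_0) (auto intro: exI[of _ "[]"])
    then show ?thesis by (simp add: word_ball_def)
  qed
  have ball: "finite (word_ball \<Gamma> S k)" "card (word_ball \<Gamma> S k) \<ge> 1" "card (word_ball \<Gamma> S k) \<le> card (words S k)" for k
  proof -
    show f: "finite (word_ball \<Gamma> S k)" using word_ball_subset[OF S] fin finite_subset by blast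
    show "card (word_ball \<Gamma> S k) \<ge> 1" using f one_ball[of k] by (simp add: card_gt_0_iff Suc_le_eq) blast
    show "card (word_ball \<Gamma> S k) \<le> card (words S k)" by (rule card_mono[OF fin word_ball_subset[OF S]])
  qed
  show ?thesis unfolding has_algebraic_entropy_def
  proof (rule tendsto_sandwich)
    show "\<forall>\<^sub>F k in sequentially. 0 \<le> ln (real (card (word_ball \<Gamma> S k))) / real k"
      using ball(2) by (intro always_eventually allI) (simp add: Suc_le_eq)
    show "\<forall>\<^sub>F k in sequentially. ln (real (card (word_ball \<Gamma> S k))) / real k
        \<le> c1 / real k + c2 * (Max (disp ` words S k) / real k)"
    \<comment> \<open>At k = 0 both sides are 0 by division by zero, so the inequality holds for
      every k.\<close>
    proof (intro always_eventually allI)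
      fix k
      have "ln (real (card (word_ball \<Gamma> S k))) \<le> ln (real (card (words S k)))"
        using ball(2,3)[of k] by (intro ln_mono) auto
      also have "\<dots> \<le> c1 + c2 * Max (disp ` words S k)" using c[OF fin _ sub] one by blast
      finally have "ln (real (card (word_ball \<Gamma> S k))) / real k \<le> (c1 + c2 * Max (disp ` words S k)) / real k"
        by (rule divide_right_mono) simp
      then show "ln (real (card (word_ball \<Gamma> S k))) / real k \<le> c1 / real k + c2 * (Max (disp ` words S k) / real k)"
        by (simp add: add_divide_distrib)
    qed
    have "(\<lambda>k. c1 / real k + c2 * (Max (disp ` words S k) / real k)) \<longlonglongrightarrow> 0 + c2 * 0"
      by (intro tendsto_intros lim lim_const_over_n)
    then show "(\<lambda>k. c1 / real k + c2 * (Max (disp ` words S k) / real k)) \<longlonglongrightarrow> 0" by simp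
  qed simp
qed

end

section \<open>Symmetric generating sets, connectedness and the conclusion\<close>

lemma symmetric_generating_set_exists:
  assumes "group \<Gamma>" "finitely_generated \<Gamma>"
  shows "\<exists>S. finite_symmetric_generating_set \<Gamma> S"
proof -
  interpret group \<Gamma> by (rule assms(1))
  obtain S where S: "finite S" "S \<subseteq> carrier \<Gamma>" "generate \<Gamma> S = carrier \<Gamma>"
    using assms(2) by (auto simp: finitely_generated_def)
  let ?T = "S \<union> (\<lambda>s. inv\<^bsub>\<Gamma>\<^esub> s) ` S"
  have T: "?T \<subseteq> carrier \<Gamma>" using S(2) by auto
  have "carrier \<Gamma> \<subseteq> generate \<Gamma> ?T" using mono_generate[of S ?T] S(3) by blast
  then have gen: "generate \<Gamma> ?T = carrier \<Gamma>" using generate_incl[OF T] by (rule subset_antisym[rotated])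
  have sym: "\<forall>s\<in>?T. inv\<^bsub>\<Gamma>\<^esub> s \<in> ?T" using S(2) by (auto simp: subset_iff)
  have "finite ?T" using S(1) by simp
  then have "finite_symmetric_generating_set \<Gamma> ?T"
    unfolding finite_symmetric_generating_set_def by (intro conjI T sym gen)
  then show ?thesis ..
qed

text \<open>\<open>simply_connected\<close> makes all loops freely homotopic, including constant
  loops at different points; the base point travels along a path during such a homotopy.\<close>

lemma simply_connected_UNIV_connected:
  assumes "simply_connected (UNIV :: 'm::topological_space set)"
  shows "connected (UNIV :: 'm set)"
proof -
  have "\<exists>h. continuous_on {0..1::real} h \<and> h 0 = a \<and> h 1 = b" for a b :: 'm
  proof -
    have "homotopic_loops UNIV (\<lambda>_. a) (\<lambda>_. b)"
      using assms unfolding simply_connected_def by (simp add: path_def pathstart_def pathfinish_def)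
    then obtain h where h: "continuous_on ({0..1::real} \<times> {0..1::real}) h" "h (0, 0) = a" "h (1, 0) = b"
      unfolding homotopic_loops by auto
    have "continuous_on {0..1} (\<lambda>s. h (s, 0))"
      by (rule continuous_on_compose2[OF h(1)]) (auto intro!: continuous_intros)
    then show ?thesis using h(2,3) by blast
  qed
  then have "path_connected (UNIV :: 'm set)"
    unfolding path_connected_def path_def pathstart_def pathfinish_def by blast
  then show ?thesis by (rule path_connected_imp_connected)
qed

theorem proposition1p5:
  fixes A :: "('m::{t2_space,second_countable_topology}, 'n::finite) chart set"
    and g :: "('m, 'n) metric_coeffs"
    and \<Gamma>\<^sub>0 :: "('g, 'r) monoid_scheme"
    and \<phi> :: "'g \<Rightarrow> 'm \<Rightarrow> 'm"
    and n :: nat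
  assumes "smooth_atlas A" and "riemannian_metric A g"
    and "CARD('n) = n" and "n \<ge> 2"
    and "complete_riemannian A g"
    and "simply_connected (UNIV :: 'm set)"
    and "nonpositively_curved A g"
    and "visibility_manifold A g"
    and "ricci_bounded_below A g (- (real n - 1))"
    and "group \<Gamma>\<^sub>0" and "finitely_generated \<Gamma>\<^sub>0"
    and "isometric_action A g \<Gamma>\<^sub>0 \<phi>"
    and "free_action \<Gamma>\<^sub>0 \<phi>"
    and "properly_discontinuous_action \<Gamma>\<^sub>0 \<phi>"
    and "\<exists>\<eta> \<in> boundary_at_infinity A g.
           \<forall>a \<in> carrier \<Gamma>\<^sub>0 - {\<one>\<^bsub>\<Gamma>\<^sub>0\<^esub>}. Fix A g (\<phi> a) = {\<eta>}"
  shows "algebraic_entropy_vanishes \<Gamma>\<^sub>0"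
proof -
  \<comment> \<open>The constant \<kappa> = n - 1 is positive because n \<ge> 2.\<close>
  interpret H: hadamard A g "real n - 1"
    by (intro hadamard.intro riem_complete.intro riem_conn.intro riem_mfd.intro riem_conn_axioms.intro
        riem_complete_axioms.intro hadamard_axioms.intro simply_connected_UNIV_connected) (use assms in auto)
  obtain \<eta> where \<eta>: "\<eta> \<in> boundary_at_infinity A g" "\<And>a. a \<in> carrier \<Gamma>\<^sub>0 - {\<one>\<^bsub>\<Gamma>\<^sub>0\<^esub>} ==> Fix A g (\<phi> a) = {\<eta>}"
    using assms(15) by blast
  \<comment> \<open>The base point of the orbit comes from \<eta>: it is the starting point of a ray
    that represents it.\<close>
  obtain p v where v: "norm v = 1" "\<eta> = H.cls p v" using H.boundary_cls[OF \<eta>(1)] .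
  have "parabolic_action A g (real n - 1) \<Gamma>\<^sub>0 \<phi> p v"
    by (intro parabolic_action.intro parabolic_action_axioms.intro H.hadamard_axioms) (use assms \<eta>(2) v in auto)
  then show ?thesis
    using parabolic_action.entropy_zero symmetric_generating_set_exists[OF assms(10,11)]
    unfolding algebraic_entropy_vanishes_def by blast
qed

end
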